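(* Let $\bar X$ be the complement of the standard ball $B\subset\mathbb C^2$ in $\mathbb P^2_{\mathbb C}$, and let $L$ be a trivial $\mathcal C^\infty$ complex line bundle on $\bar X$. Let $\Delta_L$ be the space of formally integrable Dolbeault operators on $L$; for $x\in\partial\bar X$ let $\Delta_L^x\subset\Delta_L$ be the subspace of those $\delta\in\Delta_L$ for which $L$ admits a formally $\delta$-holomorphic frame around $x$, and put $\Delta_L^{\mathrm{si}}:=\bigcap_{x\in\partial\bar X}\Delta_L^x$. Then: (1) The union $\bigcup_{x\in\partial\bar X}\Delta_L^x$ is a first Baire category subset of $\Delta_L$; in particular its subsets $\Delta_L^x$ (for $x\in\partial\bar X$) and $\Delta_L^{\mathrm{si}}$ have the same property. (2) For any $x\in\partial\bar X$, $\Delta_L^x$ is an infinite codimensional affine subspace of $\Delta_L$. (3) $\Delta_L^{\mathrm{si}}$ is a first Baire category, infinite codimensional, but dense affine subspace of $\Delta_L$.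
   Context: $B=\{z\in\mathbb C^2:\|z\|<1\}$ is regarded as a subset of $\mathbb P^2_{\mathbb C}$ via the standard embedding $\mathbb C^2\subset\mathbb P^2_{\mathbb C}$, so $\bar X=\mathbb P^2_{\mathbb C}\setminus B$ is a compact complex manifold with boundary $\partial\bar X=S^3$. All forms, sections and functions on (relatively) open subsets of $\bar X$ are smooth up to the boundary points contained in the subset. $A^{01}(\bar X)$ is the Fréchet space of smooth $(0,1)$-forms on $\bar X$ with its $\mathcal C^\infty$ topology, and $Z^{01}(\bar X)\subset A^{01}(\bar X)$ is the closed subspace of $\bar\partial$-closed forms. A Dolbeault operator on $L$ is a first order operator $\delta:\Gamma(\bar X,L)\to A^{01}(\bar X,L)$ with $\delta(\varphi\sigma)=\bar\partial\varphi\otimes\sigma+\varphi\,\delta\sigma$; it is formally integrable if $\delta^2=0$. Fixing a global smooth trivializing section $\sigma_0$ of $L$, the map $\delta\mapsto\alpha_\delta$, $\delta\sigma_0=\alpha_\delta\sigma_0$, identifies $\Delta_L$ with $Z^{01}(\bar X)$; this identification gives $\Delta_L$ its topology and its affine structure. A formally $\delta$-holomorphic frame around $x\in\partial\bar X$ is a nowhere vanishing smooth section $\sigma$ of $L$ over an open neighborhood of $x$ in $\bar X$ with $\delta\sigma=0$. First Baire category means meagre (countable union of nowhere dense sets). *)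

theory Defs
  imports "HOL-Analysis.Analysis" "HOL-Library.Function_Algebras"
begin

section \<open>The complement of the ball in the complex projective plane\<close>

definition proj_rel :: "complex^3 \<Rightarrow> complex^3 \<Rightarrow> bool" where
  "proj_rel u v \<longleftrightarrow> u \<noteq> 0 \<and> v \<noteq> 0 \<and> (\<exists>c. u = c *s v)"

lemma part_equivp_proj_rel: "part_equivp proj_rel"
proof (rule part_equivpI)
  show "\<exists>x. proj_rel x x"
  proof
    show "proj_rel (axis 1 1) (axis 1 1)"
      unfolding proj_rel_def by (metis axis_eq_0_iff vector_smult_lid zero_neq_one)
  qed
  show "symp proj_rel"
  proof (rule sympI)
    fix u v assume "proj_rel u v"
    then obtain c where c: "u \<noteq> 0" "v \<noteq> 0" "u = c *s v"
      by (auto simp: proj_rel_def)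
    then have "c \<noteq> 0" by auto
    then have "v = inverse c *s u"
      using c by (simp add: vector_smult_assoc)
    with c show "proj_rel v u"
      unfolding proj_rel_def by blast
  qed
  show "transp proj_rel"
    unfolding proj_rel_def by (rule transpI) (metis vector_smult_assoc)
qed

quotient_type cp2 = "complex^3" / partial: proj_rel
  by (rule part_equivp_proj_rel)

text \<open>The quotient topology from the punctured space. The representative \<open>0\<close> is outside the domain
  of the partial equivalence, so it has to be excluded by hand.\<close>

instantiation cp2 :: topological_space
begin

definition open_cp2_def: "open U \<longleftrightarrow> open {v. v \<noteq> 0 \<and> abs_cp2 v \<in> U}"

instance
proof
  show "open (UNIV :: cp2 set)"
    unfolding open_cp2_def by (simp add: open_Collect_neq)
  fix S T :: "cp2 set" assume "open S" "open T"
  moreover have "{v. v \<noteq> 0 \<and> abs_cp2 v \<in> S \<inter> T} =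
      {v. v \<noteq> 0 \<and> abs_cp2 v \<in> S} \<inter> {v. v \<noteq> 0 \<and> abs_cp2 v \<in> T}"
    by auto
  ultimately show "open (S \<inter> T)"
    unfolding open_cp2_def by (simp only: open_Int)
next
  fix K :: "cp2 set set" assume "\<forall>S\<in>K. open S"
  moreover have "{v. v \<noteq> 0 \<and> abs_cp2 v \<in> \<Union>K} = (\<Union>S\<in>K. {v. v \<noteq> 0 \<and> abs_cp2 v \<in> S})"
    by auto
  ultimately show "open (\<Union>K)"
    unfolding open_cp2_def by auto
qed

end

text \<open>The three standard affine charts, indexed by the homogeneous coordinate that is set to \<open>1\<close>;
  chart \<open>1\<close> is the standard embedding of the affine plane.\<close>

definition homog :: "3 \<Rightarrow> complex^2 \<Rightarrow> complex^3" where
  "homog i z = (if i = 1 then vector [1, z$1, z$2]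
                else if i = 2 then vector [z$1, 1, z$2]
                else vector [z$1, z$2, 1])"

definition affine_pt :: "3 \<Rightarrow> complex^2 \<Rightarrow> cp2" where
  "affine_pt i z = abs_cp2 (homog i z)"

definition affine_coord :: "3 \<Rightarrow> cp2 \<Rightarrow> complex^2" where
  "affine_coord i = inv (affine_pt i)"

definition cp2_ball :: "cp2 set" where
  "cp2_ball = affine_pt 1 ` ball 0 1"

lemma homog_nonzero: "homog i z \<noteq> 0"
  by (auto simp: homog_def vec_eq_iff forall_3)

lemma affine_pt_eq_iff: "affine_pt i z = affine_pt j w \<longleftrightarrow> (\<exists>c. homog i z = c *s homog j w)"
proof -
  have "proj_rel (homog k u) (homog k u)" for k u
    unfolding proj_rel_def using homog_nonzero vector_smult_lid by metis
  then have "affine_pt i z = affine_pt j w \<longleftrightarrow> proj_rel (homog i z) (homog j w)"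
    unfolding affine_pt_def using Quotient3_rel[OF Quotient3_cp2] by blast
  then show ?thesis
    by (simp add: proj_rel_def homog_nonzero)
qed

lemma affine_pt_2_0_notin_ball: "affine_pt 2 0 \<notin> cp2_ball"
  by (auto simp: cp2_ball_def affine_pt_eq_iff homog_def vec_eq_iff forall_3)

typedef xbar = "- cp2_ball"
  using affine_pt_2_0_notin_ball by blast

instantiation xbar :: topological_space
begin

definition open_xbar_def: "open U \<longleftrightarrow> (\<exists>V. open V \<and> U = Rep_xbar -` V)"

instance
proof
  show "open (UNIV :: xbar set)"
    unfolding open_xbar_def by (intro exI[of _ UNIV]) auto
  fix S T :: "xbar set" assume "open S" "open T"
  then obtain V W where "open V" "S = Rep_xbar -` V" "open W" "T = Rep_xbar -` W"
    unfolding open_xbar_def by blast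
  then show "open (S \<inter> T)"
    unfolding open_xbar_def by (intro exI[of _ "V \<inter> W"]) auto
next
  fix K :: "xbar set set" assume "\<forall>S\<in>K. open S"
  then obtain V where V: "\<And>S. S \<in> K \<Longrightarrow> open (V S) \<and> S = Rep_xbar -` V S"
    unfolding open_xbar_def by metis
  then show "open (\<Union>K)"
    unfolding open_xbar_def by (intro exI[of _ "\<Union>S\<in>K. V S"]) blast
qed

end

definition xbar_boundary :: "xbar set" where
  "xbar_boundary = {x. Rep_xbar x \<in> affine_pt 1 ` sphere 0 1}"

text \<open>Chart \<open>i\<close> of \<open>xbar\<close>: the coordinate domain \<open>xdom i\<close> (a closed domain with smooth boundary), its
  parametrization \<open>xpt i\<close>, its image \<open>chart_dom i\<close> and the coordinate map \<open>crd i\<close>. The maps \<open>xpt i\<close>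
  and \<open>crd i\<close> are meaningful on \<open>xdom i\<close> and \<open>chart_dom i\<close> only.\<close>

definition xdom :: "3 \<Rightarrow> (complex^2) set" where
  "xdom i = {z. affine_pt i z \<notin> cp2_ball}"

definition xpt :: "3 \<Rightarrow> complex^2 \<Rightarrow> xbar" where
  "xpt i z = Abs_xbar (affine_pt i z)"

definition chart_dom :: "3 \<Rightarrow> xbar set" where
  "chart_dom i = {x. Rep_xbar x \<in> range (affine_pt i)}"

definition crd :: "3 \<Rightarrow> xbar \<Rightarrow> complex^2" where
  "crd i x = affine_coord i (Rep_xbar x)"


section \<open>Smoothness up to the boundary\<close>

text \<open>Iterated directional derivatives relative to \<open>S\<close>. They are used for \<open>S = UNIV\<close> on an open set
  and for \<open>S = xdom i\<close>, where derivatives within \<open>S\<close> are unique also at boundary points.\<close>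

primrec iter_deriv :: "'a::real_normed_vector set \<Rightarrow> 'a list \<Rightarrow> ('a \<Rightarrow> 'b::real_normed_vector) \<Rightarrow> 'a \<Rightarrow> 'b"
  where
    "iter_deriv S [] f = f"
  | "iter_deriv S (v # vs) f = (\<lambda>x. frechet_derivative (iter_deriv S vs f) (at x within S) v)"

definition smooth_open :: "'a::real_normed_vector set \<Rightarrow> ('a \<Rightarrow> 'b::real_normed_vector) \<Rightarrow> bool" where
  "smooth_open W f \<longleftrightarrow> open W \<and> (\<forall>vs. \<forall>x\<in>W. iter_deriv UNIV vs f differentiable (at x))"

definition smooth_upto :: "'a::real_normed_vector set \<Rightarrow> ('a \<Rightarrow> 'b::real_normed_vector) \<Rightarrow> bool" where
  "smooth_upto S f \<longleftrightarrow>
     (\<forall>x\<in>S. \<exists>W g. x \<in> W \<and> smooth_open W g \<and> (\<forall>y\<in>S \<inter> W. f y = g y))"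

definition smooth_fun :: "xbar set \<Rightarrow> (xbar \<Rightarrow> complex) \<Rightarrow> bool" where
  "smooth_fun U f \<longleftrightarrow> (\<forall>i. smooth_upto {z \<in> xdom i. xpt i z \<in> U} (\<lambda>z. f (xpt i z)))"


section \<open>Smooth complex line bundles on \<open>xbar\<close>\<close>

text \<open>The fibres are one-dimensional subspaces of an arbitrary complex vector space (any family of
  fibres embeds in its direct sum); no topology of that space is used, the smooth structure is given by
  an atlas of local frames \<open>(U, e)\<close>.\<close>

record 'v line_bundle =
  lscale :: "complex \<Rightarrow> 'v \<Rightarrow> 'v"
  lfibre :: "xbar \<Rightarrow> 'v set"
  lframes :: "(xbar set \<times> (xbar \<Rightarrow> 'v)) set"

definition smooth_line_bundle :: "'v::ab_group_add line_bundle \<Rightarrow> bool" where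
  "smooth_line_bundle L \<longleftrightarrow>
     vector_space (lscale L) \<and>
     (\<forall>(U, e)\<in>lframes L. open U \<and>
        (\<forall>x\<in>U. e x \<noteq> 0 \<and> lfibre L x = range (\<lambda>c. lscale L c (e x)))) \<and>
     (\<forall>x. \<exists>(U, e)\<in>lframes L. x \<in> U) \<and>
     (\<forall>(U, e)\<in>lframes L. \<forall>(V, f)\<in>lframes L.
        \<exists>g. smooth_fun (U \<inter> V) g \<and> (\<forall>x\<in>U \<inter> V. f x = lscale L (g x) (e x)))"

definition smooth_section :: "'v::ab_group_add line_bundle \<Rightarrow> xbar set \<Rightarrow> (xbar \<Rightarrow> 'v) \<Rightarrow> bool" where
  "smooth_section L U s \<longleftrightarrow>
     (\<forall>x\<in>U. s x \<in> lfibre L x) \<and>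
     (\<forall>(V, e)\<in>lframes L.
        \<exists>g. smooth_fun (U \<inter> V) g \<and> (\<forall>x\<in>U \<inter> V. s x = lscale L (g x) (e x)))"

definition global_sections :: "'v::ab_group_add line_bundle \<Rightarrow> (xbar \<Rightarrow> 'v) set" where
  "global_sections L = {s. smooth_section L UNIV s}"

definition trivializing_section :: "'v::ab_group_add line_bundle \<Rightarrow> (xbar \<Rightarrow> 'v) \<Rightarrow> bool" where
  "trivializing_section L s \<longleftrightarrow> s \<in> global_sections L \<and> (\<forall>x. s x \<noteq> 0)"

definition product_bundle :: "complex line_bundle" where
  "product_bundle =
     \<lparr>lscale = (*), lfibre = (\<lambda>_. UNIV), lframes = {(UNIV, \<lambda>_. 1)}\<rparr>"


section \<open>Forms of type (0,1) and the Cauchy-Riemann operator\<close>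

text \<open>A form \<open>\<omega>\<close> is recorded by its values on tangent vectors in coordinates: \<open>\<omega> x i v\<close> is the value at
  \<open>x\<close> on the tangent vector whose coordinate vector in chart \<open>i\<close> is \<open>v\<close>. It is conjugate-linear in \<open>v\<close>
  and compatible with coordinate changes; the value is set to \<open>0\<close> if \<open>x\<close> is not in the chart.\<close>

type_synonym 'v form01 = "xbar \<Rightarrow> 3 \<Rightarrow> complex^2 \<Rightarrow> 'v"
type_synonym 'v form02 = "xbar \<Rightarrow> 3 \<Rightarrow> complex^2 \<Rightarrow> complex^2 \<Rightarrow> 'v"

definition A01 :: "'v::ab_group_add line_bundle \<Rightarrow> 'v form01 set" where
  "A01 L = {\<omega>.
     (\<forall>i. \<forall>x\<in>- chart_dom i. \<forall>v. \<omega> x i v = 0) \<and>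
     (\<forall>i. \<forall>x\<in>chart_dom i. \<forall>v w. \<omega> x i (v + w) = \<omega> x i v + \<omega> x i w) \<and>
     (\<forall>i. \<forall>x\<in>chart_dom i. \<forall>c v. \<omega> x i (c *s v) = lscale L (cnj c) (\<omega> x i v)) \<and>
     (\<forall>i j. \<forall>x\<in>chart_dom i \<inter> chart_dom j. \<forall>v.
        \<omega> x i v = \<omega> x j (frechet_derivative (affine_coord j \<circ> affine_pt i) (at (crd i x)) v)) \<and>
     (\<forall>i v. smooth_section L (chart_dom i) (\<lambda>x. \<omega> x i v))}"

abbreviation A01c :: "complex form01 set" where
  "A01c \<equiv> A01 product_bundle"

text \<open>The conjugate-linear part of the derivative, evaluated on \<open>v\<close>.\<close>

definition dbar_at :: "(complex^2) set \<Rightarrow> (complex^2 \<Rightarrow> complex) \<Rightarrow> complex^2 \<Rightarrow> complex^2 \<Rightarrow> complex" where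
  "dbar_at S f z v =
     (let D = frechet_derivative f (at z within S) in (D v + \<i> * D (\<i> *s v)) / 2)"

definition dbar_fun :: "(xbar \<Rightarrow> complex) \<Rightarrow> complex form01" where
  "dbar_fun f x i v =
     (if x \<in> chart_dom i then dbar_at (xdom i) (\<lambda>z. f (xpt i z)) (crd i x) v else 0)"

text \<open>In coordinates \<open>z\<^sub>1, z\<^sub>2\<close> with conjugates \<open>u\<^sub>1, u\<^sub>2\<close>, the form \<open>a du\<^sub>2\<close> is sent to
  \<open>(\<partial>a/\<partial>u\<^sub>1) du\<^sub>1 \<and> du\<^sub>2\<close>, where \<open>(\<alpha> \<and> \<beta>)(v, w) = \<alpha>(v) \<beta>(w) - \<alpha>(w) \<beta>(v)\<close>.\<close>

definition dbar_form :: "complex form01 \<Rightarrow> complex form02" where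
  "dbar_form \<alpha> x i v w =
     (if x \<in> chart_dom i then
        dbar_at (xdom i) (\<lambda>z. \<alpha> (xpt i z) i w) (crd i x) v -
        dbar_at (xdom i) (\<lambda>z. \<alpha> (xpt i z) i v) (crd i x) w
      else 0)"

definition Z01 :: "complex form01 set" where
  "Z01 = {\<alpha> \<in> A01c. dbar_form \<alpha> = 0}"

definition form_scale :: "complex \<Rightarrow> complex form01 \<Rightarrow> complex form01" where
  "form_scale c \<alpha> = (\<lambda>x i v. c * \<alpha> x i v)"

interpretation form_space: vector_space form_scale
  by unfold_locales (auto simp: form_scale_def fun_eq_iff algebra_simps)

text \<open>The \<open>C\<^sup>\<infinity>\<close> topology: uniform convergence of all coefficients with all their derivatives on compact
  subsets (including boundary points) of the coordinate domains.\<close>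

definition cinf_nbhd ::
    "3 \<Rightarrow> (complex^2) set \<Rightarrow> (complex^2) list \<Rightarrow> complex^2 \<Rightarrow> real \<Rightarrow> complex form01 \<Rightarrow> complex form01 set"
  where
  "cinf_nbhd i K vs v \<epsilon> \<alpha> = {\<beta> \<in> A01c. \<forall>z\<in>K.
     norm (iter_deriv (xdom i) vs (\<lambda>y. \<beta> (xpt i y) i v) z -
           iter_deriv (xdom i) vs (\<lambda>y. \<alpha> (xpt i y) i v) z) < \<epsilon>}"

definition A01_topology :: "complex form01 topology" where
  "A01_topology = topology_generated_by
     {cinf_nbhd i K vs v \<epsilon> \<alpha> | i K vs v \<epsilon> \<alpha>. compact K \<and> K \<subseteq> xdom i \<and> \<epsilon> > 0 \<and> \<alpha> \<in> A01c}"


section \<open>Dolbeault operators\<close>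

definition fun_section :: "'v line_bundle \<Rightarrow> (xbar \<Rightarrow> complex) \<Rightarrow> (xbar \<Rightarrow> 'v) \<Rightarrow> xbar \<Rightarrow> 'v" where
  "fun_section L f s = (\<lambda>x. lscale L (f x) (s x))"

definition fun_form :: "'v line_bundle \<Rightarrow> (xbar \<Rightarrow> complex) \<Rightarrow> 'v form01 \<Rightarrow> 'v form01" where
  "fun_form L f \<omega> = (\<lambda>x i v. lscale L (f x) (\<omega> x i v))"

definition tensor01 :: "'v line_bundle \<Rightarrow> complex form01 \<Rightarrow> (xbar \<Rightarrow> 'v) \<Rightarrow> 'v form01" where
  "tensor01 L \<alpha> s = (\<lambda>x i v. lscale L (\<alpha> x i v) (s x))"

definition tensor02 :: "'v line_bundle \<Rightarrow> complex form02 \<Rightarrow> (xbar \<Rightarrow> 'v) \<Rightarrow> 'v form02" where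
  "tensor02 L \<eta> s = (\<lambda>x i v w. lscale L (\<eta> x i v w) (s x))"

definition wedge :: "'v::ab_group_add line_bundle \<Rightarrow> complex form01 \<Rightarrow> 'v form01 \<Rightarrow> 'v form02" where
  "wedge L \<alpha> \<omega> =
     (\<lambda>x i v w. lscale L (\<alpha> x i v) (\<omega> x i w) - lscale L (\<alpha> x i w) (\<omega> x i v))"

text \<open>Additivity together with the Leibniz rule makes \<open>\<delta>\<close> a first order differential operator.
  Operators are extensional functions on the space of global sections, so that they are equal as soon as
  they agree on global sections.\<close>

definition dolbeault_operator ::
    "'v::ab_group_add line_bundle \<Rightarrow> ((xbar \<Rightarrow> 'v) \<Rightarrow> 'v form01) \<Rightarrow> bool" where
  "dolbeault_operator L \<delta> \<longleftrightarrow>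
     \<delta> \<in> global_sections L \<rightarrow>\<^sub>E A01 L \<and>
     (\<forall>s\<in>global_sections L. \<forall>t\<in>global_sections L. \<delta> (s + t) = \<delta> s + \<delta> t) \<and>
     (\<forall>f s. smooth_fun UNIV f \<longrightarrow> s \<in> global_sections L \<longrightarrow>
        \<delta> (fun_section L f s) = tensor01 L (dbar_fun f) s + fun_form L f (\<delta> s))"

text \<open>\<open>D\<close> is the induced operator on \<open>L\<close>-valued (0,1)-forms, through which \<open>\<delta>\<^sup>2\<close> is defined. It is
  determined by \<open>\<delta>\<close>, as these forms are finite sums of products \<open>\<alpha> \<otimes> s\<close>.\<close>

definition dolbeault_prolongation ::
    "'v::ab_group_add line_bundle \<Rightarrow> ((xbar \<Rightarrow> 'v) \<Rightarrow> 'v form01) \<Rightarrow> ('v form01 \<Rightarrow> 'v form02) \<Rightarrow> bool" where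
  "dolbeault_prolongation L \<delta> D \<longleftrightarrow>
     (\<forall>\<omega>\<in>A01 L. \<forall>\<omega>'\<in>A01 L. D (\<omega> + \<omega>') = D \<omega> + D \<omega>') \<and>
     (\<forall>\<alpha>\<in>A01c. \<forall>s\<in>global_sections L.
        D (tensor01 L \<alpha> s) = tensor02 L (dbar_form \<alpha>) s - wedge L \<alpha> (\<delta> s))"

definition formally_integrable ::
    "'v::ab_group_add line_bundle \<Rightarrow> ((xbar \<Rightarrow> 'v) \<Rightarrow> 'v form01) \<Rightarrow> bool" where
  "formally_integrable L \<delta> \<longleftrightarrow>
     (\<exists>D. dolbeault_prolongation L \<delta> D \<and> (\<forall>s\<in>global_sections L. D (\<delta> s) = 0))"

definition Delta :: "'v::ab_group_add line_bundle \<Rightarrow> ((xbar \<Rightarrow> 'v) \<Rightarrow> 'v form01) set" where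
  "Delta L = {\<delta>. dolbeault_operator L \<delta> \<and> formally_integrable L \<delta>}"

text \<open>A Dolbeault operator is local, hence acts on local sections: near any point of \<open>U\<close> a smooth
  section over \<open>U\<close> agrees with a global one, to which \<open>\<delta>\<close> can be applied.\<close>

definition vanishes_on ::
    "'v::ab_group_add line_bundle \<Rightarrow> ((xbar \<Rightarrow> 'v) \<Rightarrow> 'v form01) \<Rightarrow> xbar set \<Rightarrow> (xbar \<Rightarrow> 'v) \<Rightarrow> bool" where
  "vanishes_on L \<delta> U \<sigma> \<longleftrightarrow>
     (\<forall>y\<in>U. \<exists>V s. open V \<and> y \<in> V \<and> V \<subseteq> U \<and> s \<in> global_sections L \<and>
        (\<forall>x\<in>V. s x = \<sigma> x) \<and> (\<forall>x\<in>V. \<delta> s x = 0))"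

definition holomorphic_frame_around ::
    "'v::ab_group_add line_bundle \<Rightarrow> ((xbar \<Rightarrow> 'v) \<Rightarrow> 'v form01) \<Rightarrow> xbar \<Rightarrow> xbar set \<Rightarrow> (xbar \<Rightarrow> 'v) \<Rightarrow> bool"
  where
  "holomorphic_frame_around L \<delta> x U \<sigma> \<longleftrightarrow>
     open U \<and> x \<in> U \<and> smooth_section L U \<sigma> \<and> (\<forall>y\<in>U. \<sigma> y \<noteq> 0) \<and> vanishes_on L \<delta> U \<sigma>"

definition Delta_at :: "'v::ab_group_add line_bundle \<Rightarrow> xbar \<Rightarrow> ((xbar \<Rightarrow> 'v) \<Rightarrow> 'v form01) set" where
  "Delta_at L x = {\<delta> \<in> Delta L. \<exists>U \<sigma>. holomorphic_frame_around L \<delta> x U \<sigma>}"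

definition Delta_si :: "'v::ab_group_add line_bundle \<Rightarrow> ((xbar \<Rightarrow> 'v) \<Rightarrow> 'v form01) set" where
  "Delta_si L = (\<Inter>x\<in>xbar_boundary. Delta_at L x)"


section \<open>Topology and affine structure on the space of integrable operators\<close>

definition connection_form ::
    "'v::ab_group_add line_bundle \<Rightarrow> (xbar \<Rightarrow> 'v) \<Rightarrow> ((xbar \<Rightarrow> 'v) \<Rightarrow> 'v form01) \<Rightarrow> complex form01" where
  "connection_form L \<sigma>\<^sub>0 \<delta> = (THE \<alpha>. \<alpha> \<in> A01c \<and> \<delta> \<sigma>\<^sub>0 = tensor01 L \<alpha> \<sigma>\<^sub>0)"

definition Delta_topology ::
    "'v::ab_group_add line_bundle \<Rightarrow> (xbar \<Rightarrow> 'v) \<Rightarrow> ((xbar \<Rightarrow> 'v) \<Rightarrow> 'v form01) topology" where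
  "Delta_topology L \<sigma>\<^sub>0 =
     pullback_topology (Delta L) (connection_form L \<sigma>\<^sub>0) (subtopology A01_topology Z01)"

definition nowhere_dense_in :: "'a topology \<Rightarrow> 'a set \<Rightarrow> bool" where
  "nowhere_dense_in T S \<longleftrightarrow> S \<subseteq> topspace T \<and> T interior_of (T closure_of S) = {}"

definition first_category_in :: "'a topology \<Rightarrow> 'a set \<Rightarrow> bool" where
  "first_category_in T S \<longleftrightarrow> (\<exists>N :: nat \<Rightarrow> 'a set. (\<forall>n. nowhere_dense_in T (N n)) \<and> S = (\<Union>n. N n))"

definition dense_in :: "'a topology \<Rightarrow> 'a set \<Rightarrow> bool" where
  "dense_in T S \<longleftrightarrow> S \<subseteq> topspace T \<and> T closure_of S = topspace T"

text \<open>Complex affine subspaces (the library notion \<open>affine\<close> is over the reals).\<close>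

definition complex_affine :: "complex form01 set \<Rightarrow> bool" where
  "complex_affine A \<longleftrightarrow> A \<noteq> {} \<and>
     (\<forall>\<alpha>\<in>A. \<forall>\<beta>\<in>A. \<forall>c. form_scale c \<alpha> + form_scale (1 - c) \<beta> \<in> A)"

definition infinite_codim_in :: "complex form01 set \<Rightarrow> complex form01 set \<Rightarrow> bool" where
  "infinite_codim_in Z A \<longleftrightarrow>
     \<not> (\<exists>F. finite F \<and> F \<subseteq> Z \<and>
          Z \<subseteq> {\<alpha> - \<beta> + \<gamma> | \<alpha> \<beta> \<gamma>. \<alpha> \<in> A \<and> \<beta> \<in> A \<and> \<gamma> \<in> form_space.span F})"

definition Delta_affine_subspace ::
    "'v::ab_group_add line_bundle \<Rightarrow> (xbar \<Rightarrow> 'v) \<Rightarrow> ((xbar \<Rightarrow> 'v) \<Rightarrow> 'v form01) set \<Rightarrow> bool" where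
  "Delta_affine_subspace L \<sigma>\<^sub>0 M \<longleftrightarrow>
     M \<subseteq> Delta L \<and> connection_form L \<sigma>\<^sub>0 ` M \<subseteq> Z01 \<and>
     complex_affine (connection_form L \<sigma>\<^sub>0 ` M)"

definition Delta_infinite_codim ::
    "'v::ab_group_add line_bundle \<Rightarrow> (xbar \<Rightarrow> 'v) \<Rightarrow> ((xbar \<Rightarrow> 'v) \<Rightarrow> 'v form01) set \<Rightarrow> bool" where
  "Delta_infinite_codim L \<sigma>\<^sub>0 M \<longleftrightarrow> infinite_codim_in Z01 (connection_form L \<sigma>\<^sub>0 ` M)"

end

theory Submission
  imports Defs "HOL-Complex_Analysis.Cauchy_Integral_Formula"
begin

text \<open>Via \<open>\<delta> \<mapsto> \<alpha>\<^sub>\<delta>\<close> the space of operators becomes \<open>Z01\<close>, and a holomorphic frame around a boundary point \<open>x\<close>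
  exists iff \<open>\<alpha>\<close> is exact near \<open>x\<close>: a primitive \<open>u\<close> gives the frame \<open>exp (- u) \<sigma>\<^sub>0\<close>, and a frame \<open>f \<sigma>\<^sub>0\<close> gives the
  primitive \<open>- Ln f\<close>. Forms exact near \<open>x\<close> make up a linear subspace.

  Let \<open>w, w'\<close> be the unitary coordinates for which \<open>x\<close> is the point \<open>(1, 0)\<close>. Near \<open>x\<close> lies a bidisc whose
  boundary is outside of the ball, except for the part over the left edge \<open>Re w = 1 - \<eta>\<close> of its first factor. The
  functional \<open>\<Lambda>\<^sub>t\<close> integrates \<open>exp (t (w - 1)) \<alpha> \<and> dw \<and> dw'\<close> over the boundary without this part. If \<open>\<alpha>\<close> is exact near
  the bidisc, Stokes' theorem moves the integral to the left edge, so that \<open>\<Lambda>\<^sub>t \<alpha> = O (exp (- t \<eta>))\<close> as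
  \<open>t \<rightarrow> \<infinity>\<close>. For a Bochner-Martinelli form with pole \<open>p\<close> on the segment from \<open>0\<close> to \<open>x\<close>, the residue at the pole
  contributes \<open>- 4 \<pi>\<^sup>2 exp (- t (1 - \<bar>p\<bar>))\<close>, which is larger if \<open>1 - \<bar>p\<bar> < \<eta>\<close>. A rapidly convergent superposition of
  such forms, with poles tending to \<open>x\<close> and positive coefficients, is therefore not exact near \<open>x\<close>. This shows that
  the closed sets \<open>{\<alpha>. \<bar>\<Lambda>\<^sub>t \<alpha>\<bar> \<le> M exp (- t \<eta>) for all t}\<close> have empty interior; countably many of them cover all forms
  which are exact near some point, since it suffices to consider a dense sequence of \<open>x\<close>. Coefficient sequences
  \<open>1 / (k + 1)\<^sup>j\<close> give forms that are linearly independent modulo the forms exact near \<open>x\<close>.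

  Density: pulling back \<open>\<alpha>\<close> by the dilation \<open>z \<mapsto> r z\<close>, \<open>r > 1\<close>, gives a form that is closed on a neighbourhood of
  the boundary, hence locally exact by the Dolbeault lemma, and that tends to \<open>\<alpha>\<close> as \<open>r \<rightarrow> 1\<close>.\<close>

section \<open>Calculus of smooth functions\<close>

text \<open>No single Bochner-Martinelli form is an obstruction: its pole lies inside the ball, so
  it extends as a closed form across the sphere and is exact near every boundary point. Only poles
  accumulating at \<open>x\<close> can prevent exactness, and such forms blow up. The weights
  therefore become stricter with the index: the k-th one controls k derivatives on the ball of
  radius k. Cancellation between infinitely many poles is excluded by a common sign, since
  \<open>exp (t (w - 1))\<close> is positive on the segment that carries the poles.

  This function is chosen because \<open>Re w = 1\<close> is the real tangent hyperplane of the
  sphere at \<open>x\<close>: it decays on the side of the face that has to be left out. Exactness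
  near a point is not a closed condition, as density shows, but a decay estimate with fixed rate and
  constant is, because for each \<open>t\<close> it involves the coefficients on a compact set only.

  The forms must also extend over the line at infinity; the Bochner-Martinelli form does so, being
  homogeneous once a factor \<open>Z$1\<close> squared is included.\<close>

primrec Ck :: "nat \<Rightarrow> 'a::real_normed_vector set \<Rightarrow> ('a \<Rightarrow> 'b::real_normed_vector) \<Rightarrow> bool" where
  "Ck 0 W f \<longleftrightarrow> True"
| "Ck (Suc k) W f \<longleftrightarrow> (\<forall>x\<in>W. f differentiable (at x)) \<and>
     (\<forall>v. Ck k W (\<lambda>x. frechet_derivative f (at x) v))"

lemma iter_deriv_append: "iter_deriv S (us @ vs) f = iter_deriv S us (iter_deriv S vs f)"
  by (induction us) auto

lemma iter_deriv_snoc: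
  "iter_deriv S (vs @ [v]) f = iter_deriv S vs (\<lambda>x. frechet_derivative f (at x within S) v)"
  by (simp add: iter_deriv_append)

text \<open>The two recursions run in opposite directions: \<open>iter_deriv\<close> adds the
  outermost derivative at the head of the list, whereas \<open>Ck\<close> starts with the innermost
  one. The list is therefore split at its last element. The form of \<open>Ck\<close> is the one
  that suits inductions over products and compositions.\<close>

lemma Ck_iff_iter_deriv:
  "Ck k W f \<longleftrightarrow> (\<forall>vs. length vs < k \<longrightarrow> (\<forall>x\<in>W. iter_deriv UNIV vs f differentiable (at x)))"
proof (induction k arbitrary: f)
  case (Suc k)
  have "(\<forall>vs. length vs < Suc k \<longrightarrow> (\<forall>x\<in>W. iter_deriv UNIV vs f differentiable (at x))) \<longleftrightarrow>
    (\<forall>x\<in>W. f differentiable (at x)) \<and>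
    (\<forall>v vs. length vs < k \<longrightarrow> (\<forall>x\<in>W. iter_deriv UNIV (vs @ [v]) f differentiable (at x)))"
    (is "?L \<longleftrightarrow> ?A \<and> ?B")
  proof
    assume L: ?L
    have ?A using L[rule_format, of "[]"] by simp
    moreover have ?B using L[rule_format, of "_ @ [_]"] by simp
    ultimately show "?A \<and> ?B" ..
  next
    assume AB: "?A \<and> ?B"
    show ?L
    proof (intro allI impI)
      fix vs :: "'a list" assume "length vs < Suc k"
      then show "\<forall>x\<in>W. iter_deriv UNIV vs f differentiable (at x)"
        using AB by (cases vs rule: rev_cases) auto
    qed
  qed
  then show ?case
    unfolding iter_deriv_snoc by (simp add: Suc.IH)
qed simp

lemma smooth_open_iff_Ck: "smooth_open W f \<longleftrightarrow> open W \<and> (\<forall>k. Ck k W f)"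
  unfolding smooth_open_def Ck_iff_iter_deriv by (meson lessI)

lemma Ck_Suc_imp: "Ck (Suc k) W f \<Longrightarrow> Ck k W f"
  unfolding Ck_iff_iter_deriv by auto

lemma Ck_subset: "Ck k W f \<Longrightarrow> W' \<subseteq> W \<Longrightarrow> Ck k W' f"
  unfolding Ck_iff_iter_deriv by blast

lemma frechet_derivative_cong_open:
  assumes "open W" "x \<in> W" "\<And>y. y \<in> W \<Longrightarrow> f y = g y"
  shows "frechet_derivative f (at x) = frechet_derivative g (at x)"
proof -
  have "(f has_derivative D) (at x) \<longleftrightarrow> (g has_derivative D) (at x)" for D
    using assms by (metis has_derivative_transform_within_open)
  then show ?thesis unfolding frechet_derivative_def by simp
qed

lemma differentiable_cong_open:
  assumes "open W" "x \<in> W" "\<And>y. y \<in> W \<Longrightarrow> f y = g y"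
  shows "f differentiable (at x) \<longleftrightarrow> g differentiable (at x)"
  using assms by (metis differentiable_def has_derivative_transform_within_open)

lemma Ck_cong:
  assumes "open W" "\<And>y. y \<in> W \<Longrightarrow> f y = g y"
  shows "Ck k W f \<longleftrightarrow> Ck k W g"
  using assms(2)
proof (induction k arbitrary: f g)
  case (Suc k)
  have "Ck k W (\<lambda>x. frechet_derivative f (at x) v) \<longleftrightarrow> Ck k W (\<lambda>x. frechet_derivative g (at x) v)" for v
    by (rule Suc.IH) (metis frechet_derivative_cong_open[OF assms(1)] Suc.prems)
  then show ?case
    using differentiable_cong_open[OF assms(1)] Suc.prems by (metis Ck.simps(2))
qed simp

lemma frechet_derivative_eqI: "(f has_derivative D) (at x) \<Longrightarrow> frechet_derivative f (at x) = D"
  by (rule frechet_derivative_at[symmetric])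

lemma Ck_SucI:
  assumes "open W" "\<And>x. x \<in> W \<Longrightarrow> (f has_derivative D x) (at x)" "\<And>v. Ck k W (\<lambda>x. D x v)"
  shows "Ck (Suc k) W f"
proof -
  have "Ck k W (\<lambda>x. frechet_derivative f (at x) v)" for v
    using assms(3)[of v] by (subst Ck_cong[OF assms(1)]) (auto simp: frechet_derivative_eqI[OF assms(2)])
  then show ?thesis using assms(2) by (auto simp: differentiable_def)
qed

lemma Ck_SucD:
  assumes "Ck (Suc k) W f" "x \<in> W"
  shows "(f has_derivative frechet_derivative f (at x)) (at x)"
  using assms frechet_derivative_works by auto

lemma Ck_const: "open W \<Longrightarrow> Ck k W (\<lambda>x. c)"
proof (induction k arbitrary: c)
  case (Suc k)
  then show ?case by (intro Ck_SucI[where D="\<lambda>x v. 0"]) auto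
qed simp

lemma Ck_bounded_linear:
  assumes "open W" "bounded_linear h" shows "Ck k W h"
proof (cases k)
  case (Suc n)
  show ?thesis
    unfolding Suc by (rule Ck_SucI[where D="\<lambda>x. h"])
      (use assms in \<open>auto intro!: Ck_const bounded_linear_imp_has_derivative\<close>)
qed simp

lemma Ck_add:
  assumes "open W" shows "Ck k W f \<Longrightarrow> Ck k W g \<Longrightarrow> Ck k W (\<lambda>x. f x + g x)"
proof (induction k arbitrary: f g)
  case (Suc k)
  show ?case
    by (rule Ck_SucI[OF assms has_derivative_add[OF Ck_SucD[OF Suc.prems(1)] Ck_SucD[OF Suc.prems(2)]]])
      (use Suc in auto)
qed simp

lemma Ck_linear_compose:
  assumes "open W" "bounded_linear h" shows "Ck k W f \<Longrightarrow> Ck k W (\<lambda>x. h (f x))"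
proof (induction k arbitrary: f)
  case (Suc k)
  show ?case
    by (rule Ck_SucI[OF assms(1) bounded_linear.has_derivative[OF assms(2) Ck_SucD[OF Suc.prems(1)]]])
      (use Suc in auto)
qed simp

lemma Ck_bilinear:
  assumes "open W" "bounded_bilinear B"
  shows "Ck k W f \<Longrightarrow> Ck k W g \<Longrightarrow> Ck k W (\<lambda>x. B (f x) (g x))"
proof (induction k arbitrary: f g)
  case (Suc k)
  show ?case
    by (rule Ck_SucI[OF assms(1) bounded_bilinear.FDERIV[OF assms(2) Ck_SucD[OF Suc.prems(1)] Ck_SucD[OF Suc.prems(2)]]])
      (use Suc Ck_Suc_imp[OF Suc.prems(1)] Ck_Suc_imp[OF Suc.prems(2)] in \<open>auto intro!: Ck_add assms\<close>)
qed simp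

lemma Ck_sum:
  assumes "open W" "\<And>i. i \<in> I \<Longrightarrow> Ck k W (f i)" shows "Ck k W (\<lambda>x. \<Sum>i\<in>I. f i x)"
  using assms(2) by (induction I rule: infinite_finite_induct) (auto intro: Ck_const Ck_add assms(1))

lemma linear_eq_sum_Basis:
  fixes D :: "'a::euclidean_space \<Rightarrow> 'b::real_normed_vector"
  assumes "linear D" shows "D v = (\<Sum>b\<in>Basis. (v \<bullet> b) *\<^sub>R D b)"
proof -
  have "D v = D (\<Sum>b\<in>Basis. (v \<bullet> b) *\<^sub>R b)" by (simp add: euclidean_representation)
  then show ?thesis by (simp add: linear_sum[OF assms] linear_cmul[OF assms])
qed

text \<open>The chain rule contains a derivative of \<open>f\<close> in a direction that depends on
  \<open>x\<close>. Expanding this direction in the basis gives a finite sum of products, in which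
  \<open>f\<close> is differentiated in fixed directions only, so that the induction hypothesis
  applies.\<close>

lemma Ck_compose:
  fixes f :: "'b::euclidean_space \<Rightarrow> 'c::real_normed_vector" and g :: "'a::real_normed_vector \<Rightarrow> 'b"
  assumes "open W" "open V" "g ` W \<subseteq> V"
  shows "Ck k V f \<Longrightarrow> Ck k W g \<Longrightarrow> Ck k W (\<lambda>x. f (g x))"
proof (induction k arbitrary: f)
  case (Suc k)
  define D where "D x v = (\<Sum>b\<in>Basis. (frechet_derivative g (at x) v \<bullet> b) *\<^sub>R frechet_derivative f (at (g x)) b)" for x v
  have f: "(f has_derivative frechet_derivative f (at (g x))) (at (g x))" if "x \<in> W" for x
    using Ck_SucD[OF Suc.prems(1)] that assms(3) by auto
  have "((\<lambda>x. f (g x)) has_derivative D x) (at x)" if "x \<in> W" for x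
  proof -
    have "((\<lambda>x. f (g x)) has_derivative (\<lambda>v. frechet_derivative f (at (g x)) (frechet_derivative g (at x) v))) (at x)"
      by (rule has_derivative_compose[OF Ck_SucD[OF Suc.prems(2)] f]) (use that in auto)
    also have "(\<lambda>v. frechet_derivative f (at (g x)) (frechet_derivative g (at x) v)) = D x"
      unfolding D_def using linear_eq_sum_Basis[OF has_derivative_linear[OF f[OF that]]] by blast
    finally show ?thesis .
  qed
  moreover have "Ck k W (\<lambda>x. D x v)" for v
    unfolding D_def
    by (intro Ck_sum assms Ck_bilinear[OF _ bounded_bilinear_scaleR]
      Ck_linear_compose[OF _ bounded_linear_inner_left] Suc.IH)
      (use Suc.prems Ck_Suc_imp[OF Suc.prems(2)] in auto)
  ultimately show ?case by (intro Ck_SucI assms)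
qed simp

lemma smooth_openD: "smooth_open W f \<Longrightarrow> open W" "smooth_open W f \<Longrightarrow> x \<in> W \<Longrightarrow> f differentiable (at x)"
  unfolding smooth_open_def by (auto dest!: spec[of _ "[]"])

lemma smooth_open_has_derivative:
  "smooth_open W f \<Longrightarrow> x \<in> W \<Longrightarrow> (f has_derivative frechet_derivative f (at x)) (at x)"
  using smooth_openD(2) frechet_derivative_works by blast

lemma smooth_open_deriv:
  "smooth_open W f \<Longrightarrow> smooth_open W (\<lambda>x. frechet_derivative f (at x) v)"
  unfolding smooth_open_iff_Ck using Ck.simps(2) by blast

lemma smooth_open_iter_deriv: "smooth_open W f \<Longrightarrow> smooth_open W (iter_deriv UNIV vs f)"
  by (induction vs) (auto intro: smooth_open_deriv)

lemma smooth_open_continuous: "smooth_open W f \<Longrightarrow> continuous_on W f"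
  by (intro continuous_at_imp_continuous_on ballI differentiable_imp_continuous_within)
    (auto dest: smooth_openD)

lemma smooth_open_subset: "smooth_open W f \<Longrightarrow> open W' \<Longrightarrow> W' \<subseteq> W \<Longrightarrow> smooth_open W' f"
  unfolding smooth_open_def by blast

lemma smooth_open_cong: "(\<And>x. x \<in> W \<Longrightarrow> f x = g x) \<Longrightarrow> smooth_open W f \<longleftrightarrow> smooth_open W g"
  unfolding smooth_open_iff_Ck using Ck_cong by metis

lemma smooth_open_locally:
  assumes "open W" "\<And>x. x \<in> W \<Longrightarrow> \<exists>V. x \<in> V \<and> smooth_open V f"
  shows "smooth_open W f"
  using assms unfolding smooth_open_def by metis

named_theorems smooth_intros

lemma smooth_open_const[smooth_intros]: "open W \<Longrightarrow> smooth_open W (\<lambda>x. c)"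
  by (simp add: smooth_open_iff_Ck Ck_const)

lemma smooth_open_bounded_linear: "open W \<Longrightarrow> bounded_linear h \<Longrightarrow> smooth_open W h"
  by (simp add: smooth_open_iff_Ck Ck_bounded_linear)

lemma smooth_open_ident[smooth_intros]: "open W \<Longrightarrow> smooth_open W (\<lambda>x. x)"
  by (simp add: smooth_open_bounded_linear bounded_linear_ident)

lemma smooth_open_add[smooth_intros]:
  "smooth_open W f \<Longrightarrow> smooth_open W g \<Longrightarrow> smooth_open W (\<lambda>x. f x + g x)"
  by (simp add: smooth_open_iff_Ck Ck_add)

lemma smooth_open_linear_compose:
  "bounded_linear h \<Longrightarrow> smooth_open W f \<Longrightarrow> smooth_open W (\<lambda>x. h (f x))"
  by (simp add: smooth_open_iff_Ck Ck_linear_compose)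

lemma smooth_open_bilinear:
  "bounded_bilinear B \<Longrightarrow> smooth_open W f \<Longrightarrow> smooth_open W g \<Longrightarrow> smooth_open W (\<lambda>x. B (f x) (g x))"
  by (simp add: smooth_open_iff_Ck Ck_bilinear)

lemmas smooth_open_mult[smooth_intros] = smooth_open_bilinear[OF bounded_bilinear_mult]
lemmas smooth_open_inner[smooth_intros] = smooth_open_bilinear[OF bounded_bilinear_inner]
lemmas smooth_open_cnj[smooth_intros] = smooth_open_linear_compose[OF bounded_linear_cnj]
lemmas smooth_open_of_real[smooth_intros] = smooth_open_linear_compose[OF bounded_linear_of_real]
lemmas smooth_open_minus[smooth_intros] = smooth_open_linear_compose[OF bounded_linear_minus[OF bounded_linear_ident]]
lemmas smooth_open_nth[smooth_intros] = smooth_open_linear_compose[OF bounded_linear_vec_nth]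

lemma smooth_open_diff[smooth_intros]:
  "smooth_open W f \<Longrightarrow> smooth_open W g \<Longrightarrow> smooth_open W (\<lambda>x. f x - g x)"
  unfolding diff_conv_add_uminus by (intro smooth_intros)

lemma smooth_open_compose:
  fixes f :: "'b::euclidean_space \<Rightarrow> 'c::real_normed_vector"
  shows "smooth_open V f \<Longrightarrow> smooth_open W g \<Longrightarrow> g ` W \<subseteq> V \<Longrightarrow> smooth_open W (\<lambda>x. f (g x))"
  using Ck_compose unfolding smooth_open_iff_Ck by blast

lemma smooth_open_compose_UNIV:
  fixes f :: "'b::euclidean_space \<Rightarrow> 'c::real_normed_vector"
  shows "smooth_open UNIV f \<Longrightarrow> smooth_open W g \<Longrightarrow> smooth_open W (\<lambda>x. f (g x))"
  by (rule smooth_open_compose) auto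

lemma smooth_open_inverse_aux: "smooth_open (- {0}) (inverse :: 'a::real_normed_field \<Rightarrow> 'a)"
proof -
  have "Ck k (- {0}) (inverse :: 'a \<Rightarrow> 'a)" for k
  proof (induction k)
    case (Suc k)
    show ?case
      by (rule Ck_SucI[where D="\<lambda>x v. - (inverse x * v * inverse x)"])
        (use Suc in \<open>auto intro!: Ck_linear_compose[OF _ bounded_linear_minus[OF bounded_linear_ident]]
           Ck_bilinear[OF _ bounded_bilinear_mult] Ck_const has_derivative_inverse'\<close>)
  qed simp
  then show ?thesis by (simp add: smooth_open_iff_Ck open_Compl)
qed

lemma smooth_open_inverse[smooth_intros]:
  fixes f :: "'a::real_normed_vector \<Rightarrow> 'b::{real_normed_field, euclidean_space}"
  shows "smooth_open W f \<Longrightarrow> (\<And>x. x \<in> W \<Longrightarrow> f x \<noteq> 0) \<Longrightarrow> smooth_open W (\<lambda>x. inverse (f x))"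
  by (rule smooth_open_compose[OF smooth_open_inverse_aux]) auto

lemma smooth_open_divide[smooth_intros]:
  fixes f :: "'a::real_normed_vector \<Rightarrow> 'b::{real_normed_field, euclidean_space}"
  shows "smooth_open W f \<Longrightarrow> smooth_open W g \<Longrightarrow> (\<And>x. x \<in> W \<Longrightarrow> g x \<noteq> 0) \<Longrightarrow> smooth_open W (\<lambda>x. f x / g x)"
  unfolding divide_inverse by (intro smooth_intros)

lemma smooth_open_power[smooth_intros]:
  fixes f :: "'a::real_normed_vector \<Rightarrow> 'b::real_normed_algebra_1"
  assumes "smooth_open W f" shows "smooth_open W (\<lambda>x. f x ^ n)"
  by (induction n) (use assms in \<open>auto intro!: smooth_intros dest: smooth_openD(1)\<close>)

lemma smooth_open_exp[smooth_intros]: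
  fixes f :: "'a::real_normed_vector \<Rightarrow> complex"
  assumes "smooth_open W f" shows "smooth_open W (\<lambda>x. exp (f x))"
proof -
  have "Ck k UNIV (exp :: complex \<Rightarrow> complex)" for k
  proof (induction k)
    case (Suc k)
    show ?case
      by (rule Ck_SucI[where D="\<lambda>x v. v * exp x"])
        (use Suc in \<open>auto intro!: Ck_bilinear[OF _ bounded_bilinear_mult] Ck_const
           derivative_eq_intros\<close>)
  qed simp
  then have "smooth_open UNIV (exp :: complex \<Rightarrow> complex)" by (simp add: smooth_open_iff_Ck)
  from smooth_open_compose_UNIV[OF this assms] show ?thesis .
qed

lemma smooth_open_Ln: "smooth_open (- \<real>\<^sub>\<le>\<^sub>0) Ln"
proof -
  have o: "open (- \<real>\<^sub>\<le>\<^sub>0 :: complex set)" by (simp add: open_Compl)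
  have sub: "- \<real>\<^sub>\<le>\<^sub>0 \<subseteq> (- {0} :: complex set)" by auto
  have "Ck k (- \<real>\<^sub>\<le>\<^sub>0) Ln" for k
  proof (cases k)
    case (Suc n)
    have inv: "Ck n (- \<real>\<^sub>\<le>\<^sub>0) (inverse :: complex \<Rightarrow> complex)"
      using smooth_open_inverse_aux Ck_subset[OF _ sub] unfolding smooth_open_iff_Ck by blast
    have "(Ln has_derivative (\<lambda>v. inverse x * v)) (at x)" if "x \<in> - \<real>\<^sub>\<le>\<^sub>0" for x
      using has_field_derivative_Ln[of x] that by (auto simp: has_field_derivative_def)
    then show ?thesis
      unfolding Suc by (rule Ck_SucI[OF o])
        (auto intro!: Ck_bilinear[OF o bounded_bilinear_mult] Ck_const o inv)
  qed simp
  then show ?thesis by (simp add: smooth_open_iff_Ck o)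
qed

text \<open>Smoothness of \<open>exp (- 1 / x)\<close>, extended by \<open>0\<close>: the family of its products with powers of \<open>1 / x\<close>
  is closed under differentiation.\<close>

definition flat_pow :: "nat \<Rightarrow> real \<Rightarrow> real" where
  "flat_pow n x = (if x \<le> 0 then 0 else exp (- (1 / x)) * (1 / x) ^ n)"

abbreviation flat :: "real \<Rightarrow> real" where "flat \<equiv> flat_pow 0"

lemma flat_pow_tendsto: "((\<lambda>x. flat_pow n x) \<longlongrightarrow> 0) (at_right 0)"
proof -
  have "((\<lambda>x::real. x ^ n / exp x) \<longlongrightarrow> 0) at_top"
    by (rule tendsto_power_div_exp_0)
  then have "((\<lambda>x::real. (inverse x) ^ n / exp (inverse x)) \<longlongrightarrow> 0) (at_right 0)"
    by (rule filterlim_compose[OF _ filterlim_inverse_at_top_right])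
  moreover have "\<forall>\<^sub>F x in at_right 0. (inverse x) ^ n / exp (inverse x) = flat_pow n x"
    by (auto simp: eventually_at_filter flat_pow_def exp_minus field_simps)
  ultimately show ?thesis by (rule Lim_transform_eventually)
qed

lemma flat_pow_deriv:
  "(flat_pow n has_real_derivative (flat_pow (n + 2) x - real n * flat_pow (n + 1) x)) (at x)"
proof (cases x "0::real" rule: linorder_cases)
  case less
  have "((\<lambda>x. 0) has_real_derivative 0) (at x)" by simp
  then have "(flat_pow n has_real_derivative 0) (at x)"
    by (rule has_field_derivative_transform_within_open[where S="{..<0}"])
      (use less in \<open>auto simp: flat_pow_def\<close>)
  then show ?thesis using less by (simp add: flat_pow_def)
next
  case greater
  have "((\<lambda>x. exp (- (1 / x)) * (1 / x) ^ n) has_real_derivative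
     (flat_pow (n + 2) x - real n * flat_pow (n + 1) x)) (at x)"
    using greater
    apply (auto intro!: derivative_eq_intros simp: flat_pow_def)
    apply (cases n)
     apply (auto simp: field_simps power2_eq_square)
    done
  then show ?thesis
    by (rule has_field_derivative_transform_within_open[where S="{0<..}"])
      (use greater in \<open>auto simp: flat_pow_def\<close>)
next
  case equal
  \<comment> \<open>At 0 the difference quotient of \<open>flat_pow n\<close> is exactly
    \<open>flat_pow (n + 1)\<close>.\<close>
  have "((\<lambda>h. flat_pow (n + 1) h) \<longlongrightarrow> 0) (at 0)"
  proof -
    have "((\<lambda>h. flat_pow (n + 1) h) \<longlongrightarrow> 0) (at_left 0)"
      by (rule Lim_transform_eventually[OF tendsto_const])
        (auto simp: eventually_at_filter flat_pow_def)
    then show ?thesis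
      using flat_pow_tendsto[of "n + 1"] filterlim_at_split by blast
  qed
  then have "((\<lambda>h. (flat_pow n (0 + h) - flat_pow n 0) / h) \<longlongrightarrow> 0) (at 0)"
    by (rule Lim_transform_eventually) (auto simp: eventually_at_filter flat_pow_def)
  then show ?thesis using equal by (simp add: DERIV_def flat_pow_def)
qed

lemma smooth_open_flat_pow: "smooth_open UNIV (flat_pow n)"
proof -
  have "Ck k UNIV (flat_pow n)" for k
  proof (induction k arbitrary: n)
    case (Suc k)
    have "(flat_pow n has_derivative (\<lambda>v. (flat_pow (n + 2) x + (- real n) * flat_pow (n + 1) x) * v)) (at x)" for x
      using flat_pow_deriv[of n x] by (simp add: has_field_derivative_def)
    then show ?case
      by (rule Ck_SucI[OF open_UNIV])
        (intro Ck_bilinear[OF _ bounded_bilinear_mult] Ck_add Ck_const Suc.IH open_UNIV)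
  qed simp
  then show ?thesis by (simp add: smooth_open_iff_Ck)
qed

lemma smooth_open_flat[smooth_intros]:
  "smooth_open W f \<Longrightarrow> smooth_open W (\<lambda>x. flat (f x))"
  by (rule smooth_open_compose_UNIV[OF smooth_open_flat_pow])

lemma flat_pos_iff: "flat x > 0 \<longleftrightarrow> x > 0"
  by (auto simp: flat_pow_def)

lemma flat_nonneg: "flat x \<ge> 0"
  by (auto simp: flat_pow_def)

lemma flat_eq_0: "x \<le> 0 \<Longrightarrow> flat x = 0"
  by (auto simp: flat_pow_def)

definition smooth_step :: "real \<Rightarrow> real \<Rightarrow> real" where
  "smooth_step c x = flat x / (flat x + flat (c - x))"

lemma smooth_step_eq_0: "x \<le> 0 \<Longrightarrow> smooth_step c x = 0"
  by (simp add: smooth_step_def flat_eq_0)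

lemma smooth_step_eq_1: "c > 0 \<Longrightarrow> x \<ge> c \<Longrightarrow> smooth_step c x = 1"
  using flat_pos_iff[of x] by (simp add: smooth_step_def flat_eq_0)

lemma smooth_open_smooth_step[smooth_intros]:
  assumes "c > 0" "smooth_open W f" shows "smooth_open W (\<lambda>x. smooth_step c (f x))"
  unfolding smooth_step_def
proof (intro smooth_intros assms)
  fix x assume "x \<in> W"
  have "f x > 0 \<or> c - f x > 0" using assms by linarith
  then show "flat (f x) + flat (c - f x) \<noteq> 0"
    by (metis add_pos_nonneg add_nonneg_pos flat_pos_iff flat_nonneg less_irrefl)
qed (auto intro: smooth_openD assms)

section \<open>Symmetry of second derivatives\<close>

lemma second_difference_mvt:
  fixes g :: "'a::euclidean_space \<Rightarrow> real"
  assumes g: "smooth_open W g" and h: "h > 0"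
    and W: "\<And>s t. 0 \<le> s \<Longrightarrow> s \<le> h \<Longrightarrow> 0 \<le> t \<Longrightarrow> t \<le> h \<Longrightarrow> x + s *\<^sub>R u + t *\<^sub>R v \<in> W"
  obtains s t where "0 \<le> s" "s \<le> h" "0 \<le> t" "t \<le> h"
    "g (x + h *\<^sub>R u + h *\<^sub>R v) - g (x + h *\<^sub>R u) - g (x + h *\<^sub>R v) + g x =
      h\<^sup>2 * frechet_derivative (\<lambda>y. frechet_derivative g (at y) u) (at (x + s *\<^sub>R u + t *\<^sub>R v)) v"
proof -
  define Du where "Du = (\<lambda>y. frechet_derivative g (at y) u)"
  have Du: "smooth_open W Du" unfolding Du_def by (rule smooth_open_deriv[OF g])
  have lin: "linear (frechet_derivative k (at y))" if "smooth_open W k" "y \<in> W" for k :: "'a \<Rightarrow> real" and y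
    using has_derivative_linear smooth_open_has_derivative that by blast
  define A where "A s = g (x + s *\<^sub>R u + h *\<^sub>R v) - g (x + s *\<^sub>R u + 0 *\<^sub>R v)" for s
  have "(A has_derivative (\<lambda>r. r * (Du (x + s *\<^sub>R u + h *\<^sub>R v) - Du (x + s *\<^sub>R u + 0 *\<^sub>R v)))) (at s within {0..h})"
    if s: "0 \<le> s" "s \<le> h" for s
  proof -
    have *: "((\<lambda>s. g (x + s *\<^sub>R u + t *\<^sub>R v)) has_derivative (\<lambda>r. r * Du (x + s *\<^sub>R u + t *\<^sub>R v))) (at s)"
      if t: "0 \<le> t" "t \<le> h" for t
    proof -
      have "((\<lambda>s. g (x + s *\<^sub>R u + t *\<^sub>R v)) has_derivative
          (\<lambda>r. frechet_derivative g (at (x + s *\<^sub>R u + t *\<^sub>R v)) (r *\<^sub>R u))) (at s)"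
        by (rule has_derivative_compose[where g=g, rotated], rule smooth_open_has_derivative[OF g W[OF s t]])
          (auto intro!: derivative_eq_intros)
      then show ?thesis by (simp add: Du_def linear_cmul[OF lin[OF g W[OF s t]]])
    qed
    show ?thesis
      unfolding A_def
      by (rule has_derivative_at_withinI)
        (use has_derivative_diff[OF *[of h] *[of 0]] h in \<open>simp add: algebra_simps\<close>)
  qed
  from mvt_simple[OF h this] obtain s where s: "s \<in> {0<..<h}"
    and "A h - A 0 = (h - 0) * (Du (x + s *\<^sub>R u + h *\<^sub>R v) - Du (x + s *\<^sub>R u + 0 *\<^sub>R v))"
    by auto
  then have A: "A h - A 0 = h * (Du (x + s *\<^sub>R u + h *\<^sub>R v) - Du (x + s *\<^sub>R u + 0 *\<^sub>R v))" by simp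
  have "((\<lambda>t. Du (x + s *\<^sub>R u + t *\<^sub>R v)) has_derivative
      (\<lambda>r. r * frechet_derivative Du (at (x + s *\<^sub>R u + t *\<^sub>R v)) v)) (at t within {0..h})"
    if t: "0 \<le> t" "t \<le> h" for t
  proof -
    have W': "x + s *\<^sub>R u + t *\<^sub>R v \<in> W" using W s t by simp
    have "((\<lambda>t. Du (x + s *\<^sub>R u + t *\<^sub>R v)) has_derivative
          (\<lambda>r. frechet_derivative Du (at (x + s *\<^sub>R u + t *\<^sub>R v)) (r *\<^sub>R v))) (at t)"
      by (rule has_derivative_compose[where g=Du, rotated], rule smooth_open_has_derivative[OF Du W'])
          (auto intro!: derivative_eq_intros)
    then show ?thesis
      by (auto intro!: has_derivative_at_withinI simp: linear_cmul[OF lin[OF Du W']])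
  qed
  from mvt_simple[OF h this] obtain t where t: "t \<in> {0<..<h}"
    and "Du (x + s *\<^sub>R u + h *\<^sub>R v) - Du (x + s *\<^sub>R u + 0 *\<^sub>R v) =
      h * frechet_derivative Du (at (x + s *\<^sub>R u + t *\<^sub>R v)) v" by auto
  with A have "A h - A 0 = h\<^sup>2 * frechet_derivative Du (at (x + s *\<^sub>R u + t *\<^sub>R v)) v"
    by (simp add: power2_eq_square)
  moreover have "A h - A 0 = g (x + h *\<^sub>R u + h *\<^sub>R v) - g (x + h *\<^sub>R u) - g (x + h *\<^sub>R v) + g x"
    by (simp add: A_def)
  ultimately show ?thesis using that[of s t] s t by (simp add: Du_def)
qed

text \<open>The second difference of \<open>g\<close> over the parallelogram with sides
  \<open>h u\<close> and \<open>h v\<close> is symmetric in \<open>u\<close> and \<open>v\<close>.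
  For either order of differentiation it is the square of \<open>h\<close> times a mixed derivative
  at some point of the parallelogram. Continuity of the mixed derivatives does the rest as
  \<open>h\<close> becomes small.\<close>

lemma mixed_derivatives_commute_real:
  fixes g :: "'a::euclidean_space \<Rightarrow> real"
  assumes g: "smooth_open W g" and x: "x \<in> W"
  shows "frechet_derivative (\<lambda>y. frechet_derivative g (at y) u) (at x) v =
         frechet_derivative (\<lambda>y. frechet_derivative g (at y) v) (at x) u"
proof (rule ccontr)
  define F where "F u v = (\<lambda>y. frechet_derivative (\<lambda>y. frechet_derivative g (at y) u) (at y) v)" for u v
  assume "\<not> ?thesis"
  then have ne: "F u v x \<noteq> F v u x" by (simp add: F_def)
  \<comment> \<open>Two values closer than \<open>e\<close> to \<open>F u v x\<close> and
    \<open>F v u x\<close>, respectively, cannot coincide.\<close>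
  define e where "e = \<bar>F u v x - F v u x\<bar> / 2"
  have e: "e > 0" using ne by (simp add: e_def)
  have "isCont (F u v) x" for u v
    using smooth_open_continuous[OF smooth_open_deriv[OF smooth_open_deriv[OF g]]] x smooth_openD(1)[OF g]
    unfolding F_def by (simp add: continuous_on_eq_continuous_at)
  then have "\<exists>d>0. \<forall>y. dist y x < d \<longrightarrow> dist (F u v y) (F u v x) < e" for u v
    using e by (meson continuous_at_eps_delta continuous_at)
  then obtain d1 d2 where d: "d1 > 0" "\<And>y. dist y x < d1 \<Longrightarrow> dist (F u v y) (F u v x) < e"
    "d2 > 0" "\<And>y. dist y x < d2 \<Longrightarrow> dist (F v u y) (F v u x) < e" by metis
  obtain d3 where d3: "d3 > 0" "\<And>y. dist y x < d3 \<Longrightarrow> y \<in> W"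
    using smooth_openD(1)[OF g] x unfolding open_dist by blast
  define d where "d = min d1 (min d2 d3)"
  have dp: "d > 0" using d d3 by (simp add: d_def)
  \<comment> \<open>Keeps the parallelogram within distance \<open>d / 2\<close> of
    \<open>x\<close>; the summand 1 covers the case that \<open>u\<close> and \<open>v\<close> are
    0.\<close>
  define h where "h = d / (2 * (norm u + norm v + 1))"
  have nn: "norm u + norm v + 1 > 0" by (simp add: add_nonneg_pos)
  have h: "h > 0" unfolding h_def using dp nn by simp
  have close: "dist (x + s *\<^sub>R a + t *\<^sub>R b) x < d"
    if "0 \<le> s" "s \<le> h" "0 \<le> t" "t \<le> h" "norm a + norm b = norm u + norm v" for s t a b
  proof -
    have "dist (x + s *\<^sub>R a + t *\<^sub>R b) x \<le> norm (s *\<^sub>R a) + norm (t *\<^sub>R b)"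
      unfolding dist_norm by (metis add_diff_cancel_left' add.assoc norm_triangle_ineq)
    also have "\<dots> \<le> h * norm a + h * norm b" using that by (simp add: mult_right_mono add_mono)
    also have "\<dots> = h * (norm u + norm v)" using that(5) by (simp add: distrib_left[symmetric])
    also have "\<dots> \<le> h * (norm u + norm v + 1)" using h by simp
    also have "\<dots> = d / 2"
    proof -
      have "d / (2 * N) * N = d / 2" if "N > 0" for N :: real using that by simp
      from this[OF nn] show ?thesis by (simp only: h_def)
    qed
    finally show ?thesis using dp by simp
  qed
  have W: "x + s *\<^sub>R a + t *\<^sub>R b \<in> W"
    if "0 \<le> s" "s \<le> h" "0 \<le> t" "t \<le> h" "norm a + norm b = norm u + norm v" for s t a b
    using close[OF that] d3(2) by (simp add: d_def)
  obtain s t where st: "0 \<le> s" "s \<le> h" "0 \<le> t" "t \<le> h"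
    "g (x + h *\<^sub>R u + h *\<^sub>R v) - g (x + h *\<^sub>R u) - g (x + h *\<^sub>R v) + g x = h\<^sup>2 * F u v (x + s *\<^sub>R u + t *\<^sub>R v)"
    unfolding F_def by (rule second_difference_mvt[OF g h, of x u v]) (use W in auto)
  obtain s' t' where st': "0 \<le> s'" "s' \<le> h" "0 \<le> t'" "t' \<le> h"
    "g (x + h *\<^sub>R v + h *\<^sub>R u) - g (x + h *\<^sub>R v) - g (x + h *\<^sub>R u) + g x = h\<^sup>2 * F v u (x + s' *\<^sub>R v + t' *\<^sub>R u)"
    unfolding F_def by (rule second_difference_mvt[OF g h, of x v u]) (use W in \<open>auto simp: add.commute\<close>)
  have "h\<^sup>2 * F u v (x + s *\<^sub>R u + t *\<^sub>R v) = h\<^sup>2 * F v u (x + s' *\<^sub>R v + t' *\<^sub>R u)"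
    unfolding st(5)[symmetric] st'(5)[symmetric] by (simp add: algebra_simps)
  then have "F u v (x + s *\<^sub>R u + t *\<^sub>R v) = F v u (x + s' *\<^sub>R v + t' *\<^sub>R u)" using h by simp
  moreover have "dist (F u v (x + s *\<^sub>R u + t *\<^sub>R v)) (F u v x) < e"
    using close[OF st(1-4)] by (intro d) (auto simp: d_def)
  moreover have "dist (F v u (x + s' *\<^sub>R v + t' *\<^sub>R u)) (F v u x) < e"
    using close[OF st'(1-4), of v u] by (intro d) (auto simp: d_def)
  ultimately show False unfolding e_def dist_real_def by (auto simp: abs_if split: if_splits)
qed

text \<open>The mean value theorem holds with equality for real functions; complex ones are reduced
  to it by \<open>Re\<close> and \<open>Im\<close>, which commute with derivatives.\<close>

lemma mixed_derivatives_commute: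
  fixes f :: "'a::euclidean_space \<Rightarrow> complex"
  assumes f: "smooth_open W f" and x: "x \<in> W"
  shows "frechet_derivative (\<lambda>y. frechet_derivative f (at y) u) (at x) v =
         frechet_derivative (\<lambda>y. frechet_derivative f (at y) v) (at x) u"
proof -
  have *: "h (frechet_derivative (\<lambda>y. frechet_derivative f (at y) u) (at x) v) =
    frechet_derivative (\<lambda>y. frechet_derivative (\<lambda>y. h (f y)) (at y) u) (at x) v"
    if h: "bounded_linear h" for h :: "complex \<Rightarrow> real" and u v
  proof -
    have 1: "frechet_derivative (\<lambda>y. h (g y)) (at y) w = h (frechet_derivative g (at y) w)"
      if "smooth_open W g" "y \<in> W" for g :: "'a \<Rightarrow> complex" and y w
      by (simp add: frechet_derivative_eqI[OF bounded_linear.has_derivative[OF h smooth_open_has_derivative[OF that]]])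
    have "frechet_derivative (\<lambda>y. frechet_derivative (\<lambda>y. h (f y)) (at y) u) (at x) =
        frechet_derivative (\<lambda>y. h (frechet_derivative f (at y) u)) (at x)"
      by (rule frechet_derivative_cong_open[OF smooth_openD(1)[OF f] x]) (simp add: 1[OF f])
    then show ?thesis by (simp add: 1[OF smooth_open_deriv[OF f] x])
  qed
  have "h (frechet_derivative (\<lambda>y. frechet_derivative f (at y) u) (at x) v) =
      h (frechet_derivative (\<lambda>y. frechet_derivative f (at y) v) (at x) u)"
    if h: "bounded_linear h" for h :: "complex \<Rightarrow> real"
    unfolding *[OF h] by (rule mixed_derivatives_commute_real[OF smooth_open_linear_compose[OF h f] x])
  from this[OF bounded_linear_Re] this[OF bounded_linear_Im] show ?thesis by (simp add: complex_eq_iff)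
qed

text \<open>Bounds are required in basis directions, on balls, and for all but finitely many terms,
  which is what weights chosen separately for each index can provide. The condition \<open>P\<close>
  passes to termwise derivatives in basis directions, so that differentiability of all such series
  gives smoothness by induction.\<close>

lemma smooth_open_series:
  fixes f :: "nat \<Rightarrow> 'a::euclidean_space \<Rightarrow> 'b::banach"
  assumes sm: "\<And>n. smooth_open UNIV (f n)"
    and bd: "\<And>vs r. set vs \<subseteq> Basis \<Longrightarrow> \<exists>N M. summable M \<and>
      (\<forall>n\<ge>N. \<forall>z. norm z \<le> r \<longrightarrow> norm (iter_deriv UNIV vs (f n) z) \<le> M n)"
  shows "smooth_open UNIV (\<lambda>z. \<Sum>n. f n z)"
    and "\<And>z. ((\<lambda>z. \<Sum>n. f n z) has_derivative
            (\<lambda>v. \<Sum>b\<in>Basis. (v \<bullet> b) *\<^sub>R (\<Sum>n. frechet_derivative (f n) (at z) b))) (at z)"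
proof -
  define P :: "(nat \<Rightarrow> 'a \<Rightarrow> 'b) \<Rightarrow> bool" where "P f \<longleftrightarrow> (\<forall>n. smooth_open UNIV (f n)) \<and>
    (\<forall>vs r. set vs \<subseteq> Basis \<longrightarrow> (\<exists>N M. summable M \<and>
      (\<forall>n\<ge>N. \<forall>z. norm z \<le> r \<longrightarrow> norm (iter_deriv UNIV vs (f n) z) \<le> M n)))" for f
  define D where "D f z v = (\<Sum>b\<in>Basis. (v \<bullet> b) *\<^sub>R (\<Sum>n. frechet_derivative (f n) (at z) b))"
    for f :: "nat \<Rightarrow> 'a \<Rightarrow> 'b" and z v
  have Pd: "P (\<lambda>n z. frechet_derivative (f n) (at z) b)" if "P f" "b \<in> Basis" for f :: "nat \<Rightarrow> 'a \<Rightarrow> 'b" and b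
    unfolding P_def
  proof (intro conjI allI impI)
    show "smooth_open UNIV (\<lambda>z. frechet_derivative (f n) (at z) b)" for n
      using that(1) unfolding P_def by (blast intro: smooth_open_deriv)
    fix vs :: "'a list" and r assume "set vs \<subseteq> Basis"
    then have "set (vs @ [b]) \<subseteq> Basis" using that by simp
    with that(1) show "\<exists>N M. summable M \<and> (\<forall>n\<ge>N. \<forall>z. norm z \<le> r \<longrightarrow>
        norm (iter_deriv UNIV vs (\<lambda>z. frechet_derivative (f n) (at z) b) z) \<le> M n)"
      unfolding P_def iter_deriv_snoc[symmetric] by blast
  qed
  have der: "((\<lambda>z. \<Sum>n. f n z) has_derivative D f z0) (at z0)" if "P f" for f :: "nat \<Rightarrow> 'a \<Rightarrow> 'b" and z0
  proof -
    define S where "S = ball (0::'a) (norm z0 + 1)"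
    have z0: "z0 \<in> S" by (simp add: S_def)
    have unif: "uniform_limit S (\<lambda>n z. \<Sum>i<n. g i z) (\<lambda>z. \<Sum>i. g i z) sequentially"
      if g: "P g" for g :: "nat \<Rightarrow> 'a \<Rightarrow> 'b"
    proof -
      obtain N M where M: "summable M" "\<And>n z. n \<ge> N \<Longrightarrow> norm z \<le> norm z0 + 1 \<Longrightarrow> norm (g n z) \<le> M n"
        using g unfolding P_def by (metis empty_subsetI iter_deriv.simps(1) list.set(1))
      show ?thesis
        by (rule Weierstrass_m_test_ev[OF _ M(1)])
          (use M(2) in \<open>auto simp: eventually_sequentially S_def intro!: exI[of _ N]\<close>)
    qed
    have "\<forall>\<^sub>F n in sequentially. \<forall>x\<in>S. \<forall>h. norm ((\<Sum>i<n. frechet_derivative (f i) (at x) h) - D f x h) \<le> e * norm h"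
      if e: "e > 0" for e
    proof -
      \<comment> \<open>The error is distributed over the basis directions, each coefficient of
        \<open>h\<close> being at most \<open>norm h\<close>.\<close>
      define e' where "e' = e / DIM('a)"
      have e': "e' > 0" using e by (simp add: e'_def)
      have "\<forall>\<^sub>F n in sequentially. \<forall>b\<in>Basis. \<forall>x\<in>S.
          norm ((\<Sum>i<n. frechet_derivative (f i) (at x) b) - (\<Sum>i. frechet_derivative (f i) (at x) b)) < e'"
        by (rule eventually_ball_finite)
          (use unif[OF Pd[OF \<open>P f\<close>]] e' in \<open>auto simp: uniform_limit_iff dist_norm\<close>)
      then show ?thesis
      proof eventually_elim
        case (elim n)
        show ?case
        proof (intro ballI allI)
          fix x h assume x: "x \<in> S"
          have lin: "linear (frechet_derivative (f i) (at x))" for i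
            using \<open>P f\<close> smooth_open_has_derivative has_derivative_linear unfolding P_def by blast
          have "(\<Sum>i<n. frechet_derivative (f i) (at x) h) =
              (\<Sum>b\<in>Basis. (h \<bullet> b) *\<^sub>R (\<Sum>i<n. frechet_derivative (f i) (at x) b))"
            by (subst linear_eq_sum_Basis[OF lin])
               (simp add: scaleR_sum_right sum.swap[of _ Basis])
          then have "norm ((\<Sum>i<n. frechet_derivative (f i) (at x) h) - D f x h) =
             norm (\<Sum>b\<in>Basis. (h \<bullet> b) *\<^sub>R ((\<Sum>i<n. frechet_derivative (f i) (at x) b)
                - (\<Sum>i. frechet_derivative (f i) (at x) b)))"
            by (simp add: D_def scaleR_diff_right sum_subtractf)
          also have "\<dots> \<le> (\<Sum>b\<in>(Basis::'a set). norm h * e')"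
            by (rule sum_norm_le)
              (use elim x in \<open>auto intro!: mult_mono simp: Basis_le_norm less_imp_le\<close>)
          also have "\<dots> = e * norm h" by (simp add: e'_def)
          finally show "norm ((\<Sum>i<n. frechet_derivative (f i) (at x) h) - D f x h) \<le> e * norm h" .
        qed
      qed
    qed
    note ev = this
    have fd: "(f n has_derivative frechet_derivative (f n) (at x)) (at x within S)" for n x
      using \<open>P f\<close> smooth_open_has_derivative unfolding P_def by (blast intro: has_derivative_at_withinI)
    have lim: "(\<lambda>n. f n x) sums (\<Sum>n. f n x)" if "x \<in> S" for x
      using tendsto_uniform_limitI[OF unif[OF \<open>P f\<close>] that] by (simp add: sums_def)
    have "convex S" by (simp add: S_def)
    from has_derivative_series[OF this fd ev z0 lim[OF z0]]
    obtain g where g: "\<And>x. x \<in> S \<Longrightarrow> (\<lambda>n. f n x) sums (g x) \<and> (g has_derivative D f x) (at x within S)"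
      by blast
    then have 1: "(g has_derivative D f z0) (at z0)"
      using z0 at_within_open[of z0 S] by (metis S_def open_ball)
    have 2: "g x = (\<Sum>n. f n x)" if "x \<in> S" for x using g[OF that] by (simp add: sums_iff)
    show ?thesis
      by (rule has_derivative_transform_within_open[OF 1 _ z0 2]) (simp add: S_def)
  qed
  have "Ck k UNIV (\<lambda>z. \<Sum>n. f n z)" if "P f" for k f
    using that
  proof (induction k arbitrary: f)
    case (Suc k)
    show ?case
      by (rule Ck_SucI[OF open_UNIV der[OF Suc.prems]])
        (use Suc Pd in \<open>auto simp: D_def intro!: Ck_sum Ck_linear_compose[OF _ bounded_linear_scaleR_right]\<close>)
  qed simp
  moreover have "P f" unfolding P_def using sm bd by blast
  ultimately show "smooth_open UNIV (\<lambda>z. \<Sum>n. f n z)" by (simp add: smooth_open_iff_Ck)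
  show "((\<lambda>z. \<Sum>n. f n z) has_derivative
      (\<lambda>v. \<Sum>b\<in>Basis. (v \<bullet> b) *\<^sub>R (\<Sum>n. frechet_derivative (f n) (at z) b))) (at z)" for z
    using der[OF \<open>P f\<close>, of z] by (simp add: D_def[abs_def])
qed

section \<open>Derivatives relative to a domain with boundary\<close>

text \<open>Derivatives within a set are unique if the set contains a small open cone at each of its points.\<close>

definition has_cones :: "'a::real_normed_vector set \<Rightarrow> bool" where
  "has_cones S \<longleftrightarrow> (\<forall>x\<in>S. \<exists>u e. e > 0 \<and> (\<forall>w\<in>ball u e. \<exists>d>0. \<forall>t. 0 < t \<and> t < d \<longrightarrow> x + t *\<^sub>R w \<in> S))"

text \<open>On a segment from \<open>x\<close> into \<open>S\<close> the difference \<open>D\<close>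
  of the two derivatives is the one-dimensional derivative of the zero function. Hence
  \<open>D\<close> vanishes on the open set of directions of the cone, and a linear map that
  vanishes on an open set is zero.\<close>

lemma has_cones_derivative_unique:
  assumes S: "has_cones S" and x: "x \<in> S"
    and "(f has_derivative D1) (at x within S)" "(f has_derivative D2) (at x within S)"
  shows "D1 = D2"
proof -
  define D where "D v = D1 v - D2 v" for v
  have D: "((\<lambda>y. 0) has_derivative D) (at x within S)"
    using has_derivative_diff[OF assms(3,4)] by (simp add: D_def[abs_def])
  have lin: "linear D" using has_derivative_linear[OF D] .
  obtain u e where e: "e > 0" and cone: "\<And>w. w \<in> ball u e \<Longrightarrow> \<exists>d>0. \<forall>t. 0 < t \<and> t < d \<longrightarrow> x + t *\<^sub>R w \<in> S"
    using S x unfolding has_cones_def by blast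
  have zero: "D w = 0" if w: "w \<in> ball u e" for w
  proof -
    obtain d where d: "d > 0" "\<And>t. 0 < t \<Longrightarrow> t < d \<Longrightarrow> x + t *\<^sub>R w \<in> S" using cone[OF w] by blast
    have sub: "(\<lambda>t. x + t *\<^sub>R w) ` {0..d/2} \<subseteq> S"
    proof
      fix y assume "y \<in> (\<lambda>t. x + t *\<^sub>R w) ` {0..d/2}"
      then obtain t where t: "0 \<le> t" "t \<le> d/2" "y = x + t *\<^sub>R w" by auto
      show "y \<in> S" using t x d by (cases "t = 0") auto
    qed
    have "((\<lambda>t. x + t *\<^sub>R w) has_derivative (\<lambda>t. t *\<^sub>R w)) (at 0 within {0..d/2})"
      by (auto intro!: derivative_eq_intros)
    moreover have "((\<lambda>y. 0) has_derivative D) (at (x + 0 *\<^sub>R w) within (\<lambda>t. x + t *\<^sub>R w) ` {0..d/2})"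
      using has_derivative_subset[OF D sub] by simp
    ultimately have "((\<lambda>t. 0) has_derivative (\<lambda>t. D (t *\<^sub>R w))) (at 0 within {0..d/2})"
      by (rule has_derivative_in_compose)
    then have "((\<lambda>t::real. 0) has_vector_derivative D w) (at 0 within {0..d/2})"
      by (simp add: has_vector_derivative_def linear_cmul[OF lin])
    then show ?thesis
      using vector_derivative_unique_within_closed_interval[of 0 "d/2" 0 "\<lambda>t. 0" "D w" 0] d by auto
  qed
  have "D v = 0" for v
  proof -
    \<comment> \<open>Small enough for \<open>u + s *\<^sub>R v\<close> to remain among the
      directions of the cone.\<close>
    define s where "s = e / (2 * (norm v + 1))"
    have pos: "norm v + 1 > 0" by (simp add: add_nonneg_pos)
    have s: "s > 0" using e pos by (simp add: s_def)
    have "s * norm v < e"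
    proof -
      have "s * norm v \<le> s * (norm v + 1)" using s by simp
      also have "\<dots> = e / 2"
      proof -
        have "e / (2 * N) * N = e / 2" if "N > 0" for N :: real using that by simp
        from this[OF pos] show ?thesis by (simp only: s_def)
      qed
      finally show ?thesis using e by simp
    qed
    then have "D (u + s *\<^sub>R v) = 0" using s by (intro zero) (simp add: dist_norm)
    moreover have "D u = 0" using zero e by simp
    ultimately show ?thesis using s by (simp add: linear_add[OF lin] linear_cmul[OF lin])
  qed
  then show ?thesis by (auto simp: D_def fun_eq_iff)
qed

lemma has_cones_open: "open S \<Longrightarrow> has_cones S"
  unfolding has_cones_def
proof (intro ballI)
  fix x assume S: "open S" "x \<in> S"
  then obtain r where r: "r > 0" "ball x r \<subseteq> S" unfolding open_contains_ball by blast
  have "x + t *\<^sub>R w \<in> S" if "w \<in> ball 0 1" "0 < t" "t < r" for w t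
  proof -
    have "norm (t *\<^sub>R w) \<le> t * 1" using that by (simp add: mult_left_mono)
    then have "norm (t *\<^sub>R w) < r" using that by linarith
    then show ?thesis using r by (auto simp: dist_norm subset_iff)
  qed
  then show "\<exists>u e. 0 < e \<and> (\<forall>w\<in>ball u e. \<exists>d>0. \<forall>t. 0 < t \<and> t < d \<longrightarrow> x + t *\<^sub>R w \<in> S)"
    using r zero_less_one by blast
qed

lemma has_cones_frechet_derivative:
  assumes "has_cones S" "x \<in> S" "(f has_derivative D) (at x within S)"
  shows "frechet_derivative f (at x within S) = D"
  using has_cones_derivative_unique[OF assms(1,2) _ assms(3)] assms(3)
  by (metis differentiableI frechet_derivative_works)

lemma has_derivative_within_extension:
  assumes "smooth_open W g" "x \<in> W" "x \<in> S" "\<And>y. y \<in> S \<inter> W \<Longrightarrow> f y = g y"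
  shows "(f has_derivative frechet_derivative g (at x)) (at x within S)"
proof -
  have "(g has_derivative frechet_derivative g (at x)) (at x within S)"
    using smooth_open_has_derivative[OF assms(1,2)] by (rule has_derivative_at_withinI)
  then have "(g has_derivative frechet_derivative g (at x)) (at x within S \<inter> W)"
    by (rule has_derivative_subset) auto
  then have "(f has_derivative frechet_derivative g (at x)) (at x within S \<inter> W)"
    by (rule has_derivative_transform[rotated 2]) (use assms in auto)
  moreover have "at x within S \<inter> W = at x within S"
    by (rule at_within_nhd[OF assms(2) smooth_openD(1)[OF assms(1)]]) auto
  ultimately show ?thesis by simp
qed

section \<open>Functions that are smooth up to the boundary\<close>

lemma smooth_uptoE:
  assumes "smooth_upto S f" "x \<in> S"
  obtains W g where "x \<in> W" "smooth_open W g" "\<forall>y. y \<in> S \<longrightarrow> y \<in> W \<longrightarrow> f y = g y"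
proof -
  from assms obtain W g where "x \<in> W \<and> smooth_open W g \<and> (\<forall>y\<in>S \<inter> W. f y = g y)"
    unfolding smooth_upto_def by auto
  then show ?thesis by (intro that[of W g]) auto
qed

lemma smooth_uptoI:
  assumes "\<And>x. x \<in> S \<Longrightarrow> \<exists>W g. x \<in> W \<and> smooth_open W g \<and> (\<forall>y. y \<in> S \<longrightarrow> y \<in> W \<longrightarrow> f y = g y)"
  shows "smooth_upto S f"
  unfolding smooth_upto_def
proof
  fix x assume x: "x \<in> S"
  obtain W g where "x \<in> W \<and> smooth_open W g \<and> (\<forall>y. y \<in> S \<longrightarrow> y \<in> W \<longrightarrow> f y = g y)"
    using assms[OF x] by (elim exE) (rule that)
  then show "\<exists>W g. x \<in> W \<and> smooth_open W g \<and> (\<forall>y\<in>S \<inter> W. f y = g y)"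
    by (intro exI[of _ W] exI[of _ g]) auto
qed

lemma smooth_upto_subset: "smooth_upto S f \<Longrightarrow> T \<subseteq> S \<Longrightarrow> smooth_upto T f"
proof (rule smooth_uptoI)
  fix x assume f: "smooth_upto S f" and T: "T \<subseteq> S" "x \<in> T"
  then obtain W g where "x \<in> W" "smooth_open W g" "\<forall>y. y \<in> S \<longrightarrow> y \<in> W \<longrightarrow> f y = g y"
    by (auto elim!: smooth_uptoE)
  then show "\<exists>W g. x \<in> W \<and> smooth_open W g \<and> (\<forall>y. y \<in> T \<longrightarrow> y \<in> W \<longrightarrow> f y = g y)"
    using T by (intro exI[of _ W] exI[of _ g]) auto
qed

lemma smooth_upto_cong: "(\<And>x. x \<in> S \<Longrightarrow> f x = g x) \<Longrightarrow> smooth_upto S f \<longleftrightarrow> smooth_upto S g"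
  unfolding smooth_upto_def by auto

lemma smooth_upto_smooth_open: "smooth_open W f \<Longrightarrow> S \<subseteq> W \<Longrightarrow> smooth_upto S f"
proof (rule smooth_uptoI)
  fix x assume "smooth_open W f" "S \<subseteq> W" "x \<in> S"
  then show "\<exists>W g. x \<in> W \<and> smooth_open W g \<and> (\<forall>y. y \<in> S \<longrightarrow> y \<in> W \<longrightarrow> f y = g y)"
    by (intro exI[of _ W] exI[of _ f]) auto
qed

lemma smooth_upto_open_iff: "open S \<Longrightarrow> smooth_upto S f \<longleftrightarrow> smooth_open S f"
proof
  assume S: "open S" and f: "smooth_upto S f"
  show "smooth_open S f"
  proof (rule smooth_open_locally[OF S])
    fix x assume "x \<in> S"
    with f obtain W g where W: "x \<in> W" "smooth_open W g" "\<forall>y. y \<in> S \<longrightarrow> y \<in> W \<longrightarrow> f y = g y"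
      by (rule smooth_uptoE)
    have "smooth_open (S \<inter> W) g" using W(2) S smooth_openD(1)[OF W(2)] by (auto intro: smooth_open_subset)
    then have "smooth_open (S \<inter> W) f" using W(3) smooth_open_cong[of "S \<inter> W" f g] by auto
    then show "\<exists>V. x \<in> V \<and> smooth_open V f" using \<open>x \<in> S\<close> W(1) by blast
  qed
qed (blast intro: smooth_upto_smooth_open)

lemma smooth_upto_locally:
  assumes "\<And>x. x \<in> S \<Longrightarrow> \<exists>V. open V \<and> x \<in> V \<and> smooth_upto (S \<inter> V) f"
  shows "smooth_upto S f"
proof (rule smooth_uptoI)
  fix x assume x: "x \<in> S"
  then obtain V where V: "open V" "x \<in> V" "smooth_upto (S \<inter> V) f" using assms by blast
  then obtain W g where W: "x \<in> W" "smooth_open W g" "\<forall>y. y \<in> S \<inter> V \<longrightarrow> y \<in> W \<longrightarrow> f y = g y"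
    using x by (auto elim!: smooth_uptoE)
  have "smooth_open (V \<inter> W) g" using W(2) V smooth_openD(1)[OF W(2)] by (auto intro: smooth_open_subset)
  then show "\<exists>W g. x \<in> W \<and> smooth_open W g \<and> (\<forall>y. y \<in> S \<longrightarrow> y \<in> W \<longrightarrow> f y = g y)"
    using V W x by (intro exI[of _ "V \<inter> W"] exI[of _ g]) auto
qed

lemma smooth_upto_linear_compose:
  assumes "bounded_linear h" "smooth_upto S f" shows "smooth_upto S (\<lambda>x. h (f x))"
proof (rule smooth_uptoI)
  fix x assume "x \<in> S"
  with assms(2) obtain W g where "x \<in> W" "smooth_open W g" "\<forall>y. y \<in> S \<longrightarrow> y \<in> W \<longrightarrow> f y = g y"
    by (rule smooth_uptoE)
  then show "\<exists>W g. x \<in> W \<and> smooth_open W g \<and> (\<forall>y. y \<in> S \<longrightarrow> y \<in> W \<longrightarrow> h (f y) = g y)"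
    using smooth_open_linear_compose[OF assms(1)] by (intro exI[of _ W] exI[of _ "\<lambda>x. h (g x)"]) auto
qed

lemma smooth_upto_binop:
  fixes S :: "'a::real_normed_vector set"
  assumes op: "\<And>(W :: 'a set) f g. smooth_open W f \<Longrightarrow> smooth_open W g \<Longrightarrow> smooth_open W (\<lambda>x. B (f x) (g x))"
    and "smooth_upto S f" "smooth_upto S g"
  shows "smooth_upto S (\<lambda>x. B (f x) (g x))"
proof (rule smooth_uptoI)
  fix x assume x: "x \<in> S"
  obtain W f' where f: "x \<in> W" "smooth_open W f'" "\<forall>y. y \<in> S \<longrightarrow> y \<in> W \<longrightarrow> f y = f' y"
    using assms(2) x by (rule smooth_uptoE)
  obtain V g' where g: "x \<in> V" "smooth_open V g'" "\<forall>y. y \<in> S \<longrightarrow> y \<in> V \<longrightarrow> g y = g' y"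
    using assms(3) x by (rule smooth_uptoE)
  have o: "open (V \<inter> W)" using f(2) g(2) by (auto dest: smooth_openD)
  have "smooth_open (V \<inter> W) (\<lambda>x. B (f' x) (g' x))"
    by (rule op) (use f(2) g(2) o in \<open>auto intro: smooth_open_subset\<close>)
  then show "\<exists>W h. x \<in> W \<and> smooth_open W h \<and> (\<forall>y. y \<in> S \<longrightarrow> y \<in> W \<longrightarrow> B (f y) (g y) = h y)"
    using f g by (intro exI[of _ "V \<inter> W"] exI[of _ "\<lambda>x. B (f' x) (g' x)"]) auto
qed

lemma smooth_upto_mult[smooth_intros]:
  fixes f g :: "'a::real_normed_vector \<Rightarrow> complex"
  shows "smooth_upto S f \<Longrightarrow> smooth_upto S g \<Longrightarrow> smooth_upto S (\<lambda>x. f x * g x)"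
  by (rule smooth_upto_binop[where B="\<lambda>a b. a * b"]) (rule smooth_open_mult)

lemma smooth_upto_add[smooth_intros]:
  fixes f g :: "'a::real_normed_vector \<Rightarrow> complex"
  shows "smooth_upto S f \<Longrightarrow> smooth_upto S g \<Longrightarrow> smooth_upto S (\<lambda>x. f x + g x)"
  by (rule smooth_upto_binop[where B="\<lambda>a b. a + b"]) (rule smooth_open_add)

lemmas smooth_upto_cnj[smooth_intros] = smooth_upto_linear_compose[OF bounded_linear_cnj]

lemma smooth_upto_const[smooth_intros]: "smooth_upto S (\<lambda>x. c)"
  by (rule smooth_upto_smooth_open[OF smooth_open_const[OF open_UNIV]]) auto

lemma smooth_upto_compose_outer:
  fixes h :: "'b::euclidean_space \<Rightarrow> 'c::real_normed_vector"
  assumes "smooth_open V h" "smooth_upto S f" "f ` S \<subseteq> V" shows "smooth_upto S (\<lambda>x. h (f x))"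
proof (rule smooth_uptoI)
  fix x assume x: "x \<in> S"
  obtain W g where g: "x \<in> W" "smooth_open W g" "\<forall>y. y \<in> S \<longrightarrow> y \<in> W \<longrightarrow> f y = g y"
    using assms(2) x by (rule smooth_uptoE)
  have o: "open (W \<inter> g -` V)"
    using smooth_open_continuous[OF g(2)] smooth_openD(1) assms(1) g(2)
    by (metis continuous_on_open_vimage Int_commute)
  have "smooth_open (W \<inter> g -` V) (\<lambda>x. h (g x))"
    by (rule smooth_open_compose[OF assms(1)]) (use g(2) o in \<open>auto intro: smooth_open_subset\<close>)
  then show "\<exists>W k. x \<in> W \<and> smooth_open W k \<and> (\<forall>y. y \<in> S \<longrightarrow> y \<in> W \<longrightarrow> h (f y) = k y)"
    using g assms(3) x by (intro exI[of _ "W \<inter> g -` V"] exI[of _ "\<lambda>x. h (g x)"]) force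
qed

lemma smooth_upto_compose_inner:
  fixes f :: "'b::euclidean_space \<Rightarrow> 'c::real_normed_vector"
  assumes "smooth_upto S f" "smooth_open V h" "T \<subseteq> V" "h ` T \<subseteq> S"
  shows "smooth_upto T (\<lambda>x. f (h x))"
proof (rule smooth_uptoI)
  fix x assume x: "x \<in> T"
  obtain W g where g: "h x \<in> W" "smooth_open W g" "\<forall>y. y \<in> S \<longrightarrow> y \<in> W \<longrightarrow> f y = g y"
  proof (rule smooth_uptoE[OF assms(1)])
    show "h x \<in> S" using assms(4) x by auto
  qed
  have o: "open (V \<inter> h -` W)"
    using smooth_open_continuous[OF assms(2)] smooth_openD(1) assms(2) g(2)
    by (metis continuous_on_open_vimage Int_commute)
  have "smooth_open (V \<inter> h -` W) (\<lambda>x. g (h x))"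
    by (rule smooth_open_compose[OF g(2)]) (use assms(2) o in \<open>auto intro: smooth_open_subset\<close>)
  then show "\<exists>W k. x \<in> W \<and> smooth_open W k \<and> (\<forall>y. y \<in> T \<longrightarrow> y \<in> W \<longrightarrow> f (h y) = k y)"
    using g assms(3,4) x by (intro exI[of _ "V \<inter> h -` W"] exI[of _ "\<lambda>x. g (h x)"]) force
qed

lemma smooth_upto_continuous: "smooth_upto S f \<Longrightarrow> continuous_on S f"
  unfolding continuous_on_eq_continuous_within
proof
  fix x assume "smooth_upto S f" "x \<in> S"
  then obtain W g where g: "x \<in> W" "smooth_open W g" "\<forall>y. y \<in> S \<longrightarrow> y \<in> W \<longrightarrow> f y = g y"
    by (rule smooth_uptoE)
  show "continuous (at x within S) f"
    by (rule has_derivative_continuous[OF has_derivative_within_extension[OF g(2,1) \<open>x \<in> S\<close>]])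
      (use g(3) in auto)
qed

lemma smooth_upto_extension:
  assumes "smooth_upto (S \<inter> U) f" "open U" "x \<in> S" "x \<in> U"
  obtains W g where "x \<in> W" "W \<subseteq> U" "smooth_open W g" "\<forall>y\<in>S \<inter> W. f y = g y"
proof -
  obtain W g where g: "x \<in> W" "smooth_open W g" "\<forall>y. y \<in> S \<inter> U \<longrightarrow> y \<in> W \<longrightarrow> f y = g y"
  proof (rule smooth_uptoE[OF assms(1)])
    show "x \<in> S \<inter> U" using assms by auto
  qed
  have "smooth_open (U \<inter> W) g" using g(2) assms smooth_openD(1)[OF g(2)] by (auto intro: smooth_open_subset)
  then show ?thesis using that[of "U \<inter> W" g] g assms by auto
qed

text \<open>The extension \<open>g\<close> is not unique, but its derivatives at points of
  \<open>S\<close> are determined by \<open>f\<close>, because derivatives within \<open>S\<close>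
  are unique also at boundary points. Statements about iterated derivatives up to the boundary are
  reduced to open sets in this way.\<close>

lemma iter_deriv_within_extension:
  assumes S: "has_cones S" and g: "smooth_open W g" "\<And>y. y \<in> S \<inter> W \<Longrightarrow> f y = g y" and x: "x \<in> S \<inter> W"
  shows "iter_deriv S vs f x = iter_deriv UNIV vs g x"
  using x
proof (induction vs arbitrary: x)
  case (Cons v vs)
  have der: "(iter_deriv S vs f has_derivative frechet_derivative (iter_deriv UNIV vs g) (at x)) (at x within S)"
    by (rule has_derivative_within_extension[OF smooth_open_iter_deriv[OF g(1)]]) (use Cons in auto)
  show ?case
    using has_cones_frechet_derivative[OF S _ der] Cons.prems by auto
qed (use g in auto)

lemma smooth_upto_iter_deriv:
  assumes "has_cones S" "smooth_upto (S \<inter> U) f" "open U"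
  shows "smooth_upto (S \<inter> U) (iter_deriv S vs f)"
proof (rule smooth_uptoI)
  fix x assume x: "x \<in> S \<inter> U"
  then obtain W g where g: "x \<in> W" "W \<subseteq> U" "smooth_open W g" "\<forall>y\<in>S \<inter> W. f y = g y"
    by (auto elim!: smooth_upto_extension[OF assms(2,3)])
  then show "\<exists>W g. x \<in> W \<and> smooth_open W g \<and> (\<forall>y. y \<in> S \<inter> U \<longrightarrow> y \<in> W \<longrightarrow> iter_deriv S vs f y = g y)"
    using iter_deriv_within_extension[OF assms(1) g(3) bspec[OF g(4)]] smooth_open_iter_deriv[OF g(3)]
    by (intro exI[of _ W] exI[of _ "iter_deriv UNIV vs g"]) auto
qed

lemma smooth_upto_has_derivative:
  assumes "has_cones S" "smooth_upto (S \<inter> U) f" "open U" "x \<in> S" "x \<in> U"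
  shows "(f has_derivative frechet_derivative f (at x within S)) (at x within S)"
proof -
  obtain W g where g: "x \<in> W" "W \<subseteq> U" "smooth_open W g" "\<forall>y\<in>S \<inter> W. f y = g y"
    by (rule smooth_upto_extension[OF assms(2-5)])
  have "(f has_derivative frechet_derivative g (at x)) (at x within S)"
    by (rule has_derivative_within_extension[OF g(3,1) assms(4) bspec[OF g(4)]])
  then show ?thesis
    by (metis has_cones_frechet_derivative[OF assms(1,4)])
qed

section \<open>The Cauchy-Riemann operator in coordinates\<close>

lemma smult_complex_decompose: "(c::complex) *s v = Re c *\<^sub>R v + Im c *\<^sub>R (\<i> *s v)"
  by (simp add: vec_eq_iff complex_eq_iff)

definition conj_part :: "(complex^2 \<Rightarrow> complex) \<Rightarrow> complex^2 \<Rightarrow> complex" where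
  "conj_part D v = (D v + \<i> * D (\<i> *s v)) / 2"

lemma conj_part_smult:
  assumes "linear D" shows "conj_part D (c *s v) = cnj c * conj_part D v"
proof -
  have i: "\<i> *s (c *s v) = (- Im c) *\<^sub>R v + Re c *\<^sub>R (\<i> *s v)"
    by (simp add: vec_eq_iff complex_eq_iff)
  have "cnj c = of_real (Re c) - \<i> * of_real (Im c)" by (simp add: complex_eq_iff)
  moreover have "D (c *s v) = of_real (Re c) * D v + of_real (Im c) * D (\<i> *s v)"
    by (subst smult_complex_decompose)
      (simp only: linear_add[OF assms] linear_cmul[OF assms], simp add: scaleR_conv_of_real)
  moreover have "D (\<i> *s (c *s v)) = - of_real (Im c) * D v + of_real (Re c) * D (\<i> *s v)"
    unfolding i by (simp only: linear_add[OF assms] linear_cmul[OF assms], simp add: scaleR_conv_of_real)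
  ultimately show ?thesis
    unfolding conj_part_def by (simp only:) (simp add: algebra_simps add_divide_distrib diff_divide_distrib)
qed

lemma conj_part_add: "linear D \<Longrightarrow> conj_part D (v + w) = conj_part D v + conj_part D w"
  by (simp add: conj_part_def vector_add_ldistrib linear_add field_simps)

lemma dbar_at_eq:
  assumes "has_cones S" "x \<in> S" "(f has_derivative D) (at x within S)"
  shows "dbar_at S f x v = conj_part D v"
  unfolding dbar_at_def Let_def conj_part_def has_cones_frechet_derivative[OF assms] ..

lemma dbar_at_UNIV: "dbar_at UNIV g x v = conj_part (frechet_derivative g (at x)) v"
  by (simp add: dbar_at_def Let_def conj_part_def)

lemma has_cones_UNIV: "has_cones UNIV"
  by (rule has_cones_open[OF open_UNIV])

lemma dbar_at_UNIV_eq: "(f has_derivative D) (at x) \<Longrightarrow> dbar_at UNIV f x v = conj_part D v"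
  by (rule dbar_at_eq[OF has_cones_UNIV]) auto

lemma dbar_at_extension:
  assumes "has_cones S" "smooth_open W g" "x \<in> S \<inter> W" "\<And>y. y \<in> S \<inter> W \<Longrightarrow> f y = g y"
  shows "dbar_at S f x v = dbar_at UNIV g x v"
  unfolding dbar_at_UNIV
  by (rule dbar_at_eq[OF assms(1)]) (use assms has_derivative_within_extension[OF assms(2)] in auto)

lemma smooth_open_dbar_at: "smooth_open W g \<Longrightarrow> smooth_open W (\<lambda>x. dbar_at UNIV g x v)"
  unfolding dbar_at_UNIV conj_part_def divide_inverse
  by (intro smooth_intros smooth_open_deriv) (auto dest: smooth_openD)

lemma smooth_upto_dbar_at:
  assumes "has_cones S" "smooth_upto (S \<inter> U) f" "open U"
  shows "smooth_upto (S \<inter> U) (\<lambda>x. dbar_at S f x v)"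
proof (rule smooth_uptoI)
  fix x assume x: "x \<in> S \<inter> U"
  then obtain W g where g: "x \<in> W" "W \<subseteq> U" "smooth_open W g" "\<forall>y\<in>S \<inter> W. f y = g y"
    by (auto elim!: smooth_upto_extension[OF assms(2,3)])
  then show "\<exists>W g. x \<in> W \<and> smooth_open W g \<and> (\<forall>y. y \<in> S \<inter> U \<longrightarrow> y \<in> W \<longrightarrow> dbar_at S f y v = g y)"
    using dbar_at_extension[OF assms(1) g(3) _ bspec[OF g(4)]] smooth_open_dbar_at[OF g(3)] g(1)
    by (intro exI[of _ W] exI[of _ "\<lambda>x. dbar_at UNIV g x v"]) auto
qed

lemma dbar_at_cong:
  assumes "open U" "x \<in> S \<inter> U" "\<And>y. y \<in> S \<inter> U \<Longrightarrow> f y = g y"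
  shows "dbar_at S f x v = dbar_at S g x v"
proof -
  have SU: "at x within S \<inter> U = at x within S" by (rule at_within_nhd[of x U]) (use assms in auto)
  have "(f has_derivative D) (at x within S \<inter> U) \<longleftrightarrow> (g has_derivative D) (at x within S \<inter> U)" for D
    using has_derivative_transform[OF assms(2), of f g D] has_derivative_transform[OF assms(2), of g f D] assms(3)
    by auto
  then have "(f has_derivative D) (at x within S) \<longleftrightarrow> (g has_derivative D) (at x within S)" for D
    unfolding SU .
  then show ?thesis unfolding dbar_at_def frechet_derivative_def by simp
qed

lemma dbar_at_smult:
  "(f has_derivative D) (at x within S) \<Longrightarrow> dbar_at S f x (c *s v) = cnj c * dbar_at S f x v"
  using conj_part_smult[of "frechet_derivative f (at x within S)" c v] linear_frechet_derivative[of f]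
  by (simp add: dbar_at_def conj_part_def Let_def differentiableI)

lemma dbar_at_vadd:
  "(f has_derivative D) (at x within S) \<Longrightarrow> dbar_at S f x (v + w) = dbar_at S f x v + dbar_at S f x w"
  using conj_part_add[of "frechet_derivative f (at x within S)" v w] linear_frechet_derivative[of f]
  by (simp add: dbar_at_def conj_part_def Let_def differentiableI)

lemma dbar_at_add:
  assumes "has_cones S" "x \<in> S" "(f has_derivative D) (at x within S)" "(g has_derivative E) (at x within S)"
  shows "dbar_at S (\<lambda>y. f y + g y) x v = dbar_at S f x v + dbar_at S g x v"
  unfolding dbar_at_eq[OF assms(1,2,3)] dbar_at_eq[OF assms(1,2,4)]
    dbar_at_eq[OF assms(1,2) has_derivative_add[OF assms(3,4)]]
  by (simp add: conj_part_def field_simps)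

lemma dbar_at_mult:
  assumes "has_cones S" "x \<in> S" "(f has_derivative D) (at x within S)" "(g has_derivative E) (at x within S)"
  shows "dbar_at S (\<lambda>y. f y * g y) x v = dbar_at S f x v * g x + f x * dbar_at S g x v"
  unfolding dbar_at_eq[OF assms(1,2,3)] dbar_at_eq[OF assms(1,2,4)]
    dbar_at_eq[OF assms(1,2) has_derivative_mult[OF assms(3,4)]]
  by (simp add: conj_part_def field_simps)

lemma dbar_at_const: "has_cones S \<Longrightarrow> x \<in> S \<Longrightarrow> dbar_at S (\<lambda>y. c) x v = 0"
  by (subst dbar_at_eq[where D="\<lambda>_. 0"]) (auto simp: conj_part_def)

lemma dbar_at_holomorphic_outer:
  assumes "has_cones S" "x \<in> S" "(f has_derivative D) (at x within S)" "(h has_field_derivative h') (at (f x))"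
  shows "dbar_at S (\<lambda>y. h (f y)) x v = h' * dbar_at S f x v"
proof -
  have "((\<lambda>y. h (f y)) has_derivative (\<lambda>v. h' * D v)) (at x within S)"
    using has_derivative_compose[OF assms(3)] assms(4) unfolding has_field_derivative_def by blast
  from dbar_at_eq[OF assms(1,2) this] show ?thesis
    unfolding dbar_at_eq[OF assms(1,2,3)] by (simp add: conj_part_def field_simps)
qed

text \<open>The condition on \<open>P\<close> is complex linearity of the derivative of
  \<open>\<psi>\<close>, and composition with a complex linear map respects the conjugate-linear
  part. The set \<open>U\<close> accounts for transition maps, which are defined on a part of the
  chart only.\<close>

lemma dbar_at_holomorphic_inner:
  assumes S: "has_cones S" "x \<in> S" and T: "has_cones T" "\<psi> x \<in> T"
    and f: "(f has_derivative D) (at (\<psi> x) within T)"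
    and \<psi>: "(\<psi> has_derivative P) (at x)" "\<And>v. P (\<i> *s v) = \<i> *s P v"
    and U: "open U" "x \<in> U" "\<psi> ` (S \<inter> U) \<subseteq> T"
  shows "dbar_at S (\<lambda>y. f (\<psi> y)) x v = dbar_at T f (\<psi> x) (P v)"
proof -
  have SU: "at x within S \<inter> U = at x within S" by (rule at_within_nhd[of x U]) (use U in auto)
  have "((\<lambda>y. f (\<psi> y)) has_derivative (\<lambda>v. D (P v))) (at x within S \<inter> U)"
    by (rule has_derivative_in_compose[OF has_derivative_at_withinI[OF \<psi>(1)] has_derivative_subset[OF f U(3)]])
  then have "((\<lambda>y. f (\<psi> y)) has_derivative (\<lambda>v. D (P v))) (at x within S)" unfolding SU .
  from dbar_at_eq[OF S this] show ?thesis
    unfolding dbar_at_eq[OF T f] by (simp add: conj_part_def \<psi>(2))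
qed

text \<open>This is the vanishing of the square of the Cauchy-Riemann operator: both sides expand
  into the same four second derivatives, in the directions \<open>v\<close>,
  \<open>\<i> *s v\<close> and \<open>w\<close>, \<open>\<i> *s w\<close>, up to the order of
  differentiation.\<close>

lemma dbar_at_commute_open:
  assumes g: "smooth_open W g" and x: "x \<in> W"
  shows "dbar_at UNIV (\<lambda>y. dbar_at UNIV g y w) x v = dbar_at UNIV (\<lambda>y. dbar_at UNIV g y v) x w"
proof -
  define H where "H a b = frechet_derivative (\<lambda>y. frechet_derivative g (at y) a) (at x) b" for a b
  have sym: "H a b = H b a" for a b unfolding H_def by (rule mixed_derivatives_commute[OF g x])
  have "((\<lambda>y. dbar_at UNIV g y a) has_derivative (\<lambda>b. (H a b + \<i> * H (\<i> *s a) b) / 2)) (at x)" for a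
    unfolding dbar_at_UNIV conj_part_def divide_inverse H_def
    by (intro has_derivative_mult_left has_derivative_add has_derivative_mult_right
      smooth_open_has_derivative[OF smooth_open_deriv[OF g] x])
  note der = this
  have *: "dbar_at UNIV (\<lambda>y. dbar_at UNIV g y a) x b =
      (H a b + \<i> * H (\<i> *s a) b + \<i> * (H a (\<i> *s b) + \<i> * H (\<i> *s a) (\<i> *s b))) / 4" for a b
    unfolding dbar_at_UNIV_eq[OF der] conj_part_def by (simp add: field_simps)
  show ?thesis using sym[of v w] sym[of v "\<i> *s w"] sym[of "\<i> *s v" w] sym[of "\<i> *s v" "\<i> *s w"]
    unfolding * by (simp add: algebra_simps)
qed

lemma dbar_at_commute:
  assumes S: "has_cones S" "smooth_upto (S \<inter> U) f" "open U" "x \<in> S" "x \<in> U"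
  shows "dbar_at S (\<lambda>y. dbar_at S f y w) x v = dbar_at S (\<lambda>y. dbar_at S f y v) x w"
proof -
  obtain W g where g: "x \<in> W" "W \<subseteq> U" "smooth_open W g" "\<forall>y\<in>S \<inter> W. f y = g y"
    by (rule smooth_upto_extension[OF S(2-5)])
  have 1: "dbar_at S f y a = dbar_at UNIV g y a" if "y \<in> S \<inter> W" for y a
    by (rule dbar_at_extension[OF S(1) g(3) that bspec[OF g(4)]])
  have "dbar_at S (\<lambda>y. dbar_at S f y a) x b = dbar_at UNIV (\<lambda>y. dbar_at UNIV g y a) x b" for a b
    by (rule dbar_at_extension[OF S(1) smooth_open_dbar_at[OF g(3)]]) (use S g 1 in auto)
  then show ?thesis using dbar_at_commute_open[OF g(3,1)] by simp
qed

section \<open>Charts\<close>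

lemma bounded_bilinear_smult: "bounded_bilinear (\<lambda>(c::complex) (v::complex^'n). c *s v)"
  by (rule bilinear_conv_bounded_bilinear[THEN iffD1])
    (auto simp: bilinear_def intro!: linearI simp: vec_eq_iff algebra_simps)

lemmas smooth_open_smult[smooth_intros] = smooth_open_bilinear[OF bounded_bilinear_smult]

lemma norm_complex2: "(norm (z::complex^2))\<^sup>2 = (norm (z$1))\<^sup>2 + (norm (z$2))\<^sup>2"
  by (simp add: norm_vec_def L2_set_def sum_2)

text \<open>The linear part of the affine map \<open>homog i\<close>, hence its derivative at every
  point: it turns a coordinate vector of the chart into a tangent vector in homogeneous
  coordinates.\<close>

definition hlin :: "3 \<Rightarrow> complex^2 \<Rightarrow> complex^3" where
  "hlin i z = (if i = 1 then vector [0, z$1, z$2] else if i = 2 then vector [z$1, 0, z$2] else vector [z$1, z$2, 0])"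

definition rest :: "3 \<Rightarrow> complex^3 \<Rightarrow> complex^2" where
  "rest i Z = (if i = 1 then vector [Z$2, Z$3] else if i = 2 then vector [Z$1, Z$3] else vector [Z$1, Z$2])"

definition dehom :: "3 \<Rightarrow> complex^3 \<Rightarrow> complex^2" where
  "dehom i Z = (1 / Z$i) *s rest i Z"

definition dehomD :: "3 \<Rightarrow> complex^3 \<Rightarrow> complex^3 \<Rightarrow> complex^2" where
  "dehomD i Z V = (- (V$i / (Z$i)\<^sup>2)) *s rest i Z + (1 / Z$i) *s rest i V"

lemma index3_cases: obtains "(i::3) = 1" | "i = 2" | "i = 3"
  using exhaust_3[of i] by blast

lemma homog_eq: "homog i z = axis i 1 + hlin i z"
  by (cases i rule: index3_cases) (simp_all add: homog_def hlin_def vec_eq_iff forall_3 axis_def)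

lemma bounded_linear_hlin: "bounded_linear (hlin i)"
  by (rule linear_conv_bounded_linear[THEN iffD1], rule linearI; cases i rule: index3_cases)
    (simp_all add: hlin_def vec_eq_iff forall_3)

lemma bounded_linear_rest: "bounded_linear (rest i)"
  by (rule linear_conv_bounded_linear[THEN iffD1], rule linearI; cases i rule: index3_cases)
    (simp_all add: rest_def vec_eq_iff forall_2)

lemma hlin_smult: "hlin i (c *s z) = c *s hlin i z"
  by (cases i rule: index3_cases) (simp_all add: hlin_def vec_eq_iff forall_3)

lemma rest_smult: "rest i (c *s z) = c *s rest i z"
  by (cases i rule: index3_cases) (simp_all add: rest_def vec_eq_iff forall_2)

lemma hlin_nth_self [simp]: "hlin i z $ i = 0"
  by (cases i rule: index3_cases) (simp_all add: hlin_def)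

lemma homog_nth_self [simp]: "homog i z $ i = 1"
  by (simp add: homog_eq)

lemma rest_hlin [simp]: "rest i (hlin i z) = z"
  by (cases i rule: index3_cases) (simp_all add: rest_def hlin_def vec_eq_iff forall_2)

lemma rest_axis [simp]: "rest i (axis i 1) = 0"
  by (cases i rule: index3_cases) (simp_all add: rest_def vec_eq_iff forall_2 axis_def)

lemma hlin_rest: "hlin i (rest i Z) = Z - Z$i *s axis i 1"
  by (cases i rule: index3_cases) (simp_all add: hlin_def rest_def vec_eq_iff forall_3 axis_def)

lemma rest_homog [simp]: "rest i (homog i z) = z"
  by (simp add: homog_eq linear_add[OF bounded_linear.linear[OF bounded_linear_rest]])

lemma dehom_homog [simp]: "dehom i (homog i z) = z"
  by (simp add: dehom_def)

lemma homog_dehom: "Z$i \<noteq> 0 \<Longrightarrow> homog i (dehom i Z) = (1 / Z$i) *s Z"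
  by (simp add: homog_eq dehom_def hlin_smult hlin_rest)

text \<open>Apart from the factor \<open>1 / Z$i\<close> the tangent vector changes by a multiple of
  \<open>Z\<close> only, the radial direction that is lost in the projective plane. A homogeneous
  expression that kills the radial direction is therefore compatible with coordinate changes; the
  pole forms rely on this.\<close>

lemma hlin_dehomD: "Z$i \<noteq> 0 \<Longrightarrow> hlin i (dehomD i Z V) = (1 / Z$i) *s V + (- (V$i / (Z$i)\<^sup>2)) *s Z"
  unfolding dehomD_def linear_add[OF bounded_linear.linear[OF bounded_linear_hlin]] hlin_smult hlin_rest
  by (simp add: vec_eq_iff field_simps power2_eq_square)

lemma dehomD_smult: "dehomD i Z (c *s V) = c *s dehomD i Z V"
  by (simp add: dehomD_def rest_smult vec_eq_iff algebra_simps)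

lemma smooth_open_homog: "smooth_open UNIV (homog i)"
  unfolding homog_eq[abs_def]
  by (intro smooth_intros smooth_open_bounded_linear bounded_linear_hlin open_UNIV)

lemma smooth_open_dehom: "smooth_open {Z. Z$i \<noteq> 0} (dehom i)"
proof -
  have o: "open {Z::complex^3. Z$i \<noteq> 0}"
    by (intro open_Collect_neq continuous_intros)
  show ?thesis unfolding dehom_def[abs_def]
    by (intro smooth_intros smooth_open_linear_compose[OF bounded_linear_rest] o) auto
qed

lemma dehom_has_derivative:
  assumes "Z$i \<noteq> 0" shows "(dehom i has_derivative dehomD i Z) (at Z)"
proof -
  have "((\<lambda>Z. (1 / Z$i) *s rest i Z) has_derivative
     (\<lambda>V. (1 / Z$i) *s rest i V + (- (V$i / (Z$i)\<^sup>2)) *s rest i Z)) (at Z)"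
    by (rule bounded_bilinear.FDERIV[OF bounded_bilinear_smult])
      (use assms in \<open>auto intro!: derivative_eq_intros bounded_linear_imp_has_derivative[OF bounded_linear_rest]
        bounded_linear_imp_has_derivative[OF bounded_linear_vec_nth] simp: power2_eq_square divide_inverse\<close>)
  then show ?thesis by (simp add: dehom_def[abs_def] dehomD_def[abs_def] add.commute)
qed

lemma homog_has_derivative: "(homog i has_derivative hlin i) (at z)"
  unfolding homog_eq[abs_def]
  using has_derivative_add[OF has_derivative_const bounded_linear_imp_has_derivative[OF bounded_linear_hlin]]
  by fastforce

definition trans :: "3 \<Rightarrow> 3 \<Rightarrow> complex^2 \<Rightarrow> complex^2" where
  "trans i j z = dehom j (homog i z)"

definition transD :: "3 \<Rightarrow> 3 \<Rightarrow> complex^2 \<Rightarrow> complex^2 \<Rightarrow> complex^2" where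
  "transD i j z v = dehomD j (homog i z) (hlin i v)"

definition tdom :: "3 \<Rightarrow> 3 \<Rightarrow> (complex^2) set" where
  "tdom i j = {z. homog i z $ j \<noteq> 0}"

lemma open_tdom: "open (tdom i j)"
proof -
  have "continuous_on UNIV (\<lambda>z. homog i z $ j)"
    by (intro continuous_intros smooth_open_continuous smooth_open_homog)
  then show ?thesis unfolding tdom_def by (rule open_Collect_neq[OF _ continuous_on_const])
qed

lemma smooth_open_trans: "smooth_open (tdom i j) (trans i j)"
  unfolding trans_def[abs_def]
  by (rule smooth_open_compose[OF smooth_open_dehom])
    (use smooth_open_subset[OF smooth_open_homog open_tdom subset_UNIV] in \<open>auto simp: tdom_def\<close>)

lemma trans_has_derivative: "z \<in> tdom i j \<Longrightarrow> (trans i j has_derivative transD i j z) (at z)"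
  unfolding trans_def[abs_def] transD_def[abs_def] tdom_def
  using has_derivative_compose[OF homog_has_derivative dehom_has_derivative] by blast

lemma transD_smult: "transD i j z (c *s v) = c *s transD i j z v"
  by (simp add: transD_def hlin_smult dehomD_smult)

lemma homog_trans: "z \<in> tdom i j \<Longrightarrow> homog j (trans i j z) = (1 / homog i z $ j) *s homog i z"
  by (simp add: trans_def tdom_def homog_dehom)

lemma hlin_transD: "z \<in> tdom i j \<Longrightarrow> hlin j (transD i j z v) =
    (1 / homog i z $ j) *s hlin i v + (- (hlin i v $ j / (homog i z $ j)\<^sup>2)) *s homog i z"
  by (simp add: transD_def tdom_def hlin_dehomD)

section \<open>The signature form and the coordinate domains\<close>

text \<open>The Hermitian form of signature (2,1) whose negative lines are the points of the ball
  and whose null lines are those of the sphere. It describes \<open>xdom i\<close> by the same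
  inequality in all three charts.\<close>

definition qf :: "complex^3 \<Rightarrow> real" where
  "qf Z = (norm (Z$2))\<^sup>2 + (norm (Z$3))\<^sup>2 - (norm (Z$1))\<^sup>2"

lemma qf_smult: "qf (c *s Z) = (norm c)\<^sup>2 * qf Z"
  by (simp add: qf_def norm_mult power_mult_distrib algebra_simps)

lemma abs_cp2_eq_iff: "v \<noteq> 0 \<Longrightarrow> w \<noteq> 0 \<Longrightarrow> abs_cp2 v = abs_cp2 w \<longleftrightarrow> (\<exists>c. v = c *s w)"
proof -
  assume "v \<noteq> 0" "w \<noteq> 0"
  moreover from this have "proj_rel v v" "proj_rel w w"
    unfolding proj_rel_def using vector_smult_lid by metis+
  ultimately show ?thesis using Quotient3_rel[OF Quotient3_cp2, of v w] by (simp add: proj_rel_def)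
qed

lemma affine_pt_dehom: "v$i \<noteq> 0 \<Longrightarrow> affine_pt i (dehom i v) = abs_cp2 v"
  unfolding affine_pt_def homog_dehom
  by (subst abs_cp2_eq_iff) (auto simp: vec_eq_iff intro!: exI[of _ "1 / v$i"] exI[of _ i])

lemma range_affine_pt_iff: "v \<noteq> 0 \<Longrightarrow> abs_cp2 v \<in> range (affine_pt i) \<longleftrightarrow> v$i \<noteq> 0"
proof
  assume v: "v \<noteq> 0" and "abs_cp2 v \<in> range (affine_pt i)"
  then obtain z where "abs_cp2 v = abs_cp2 (homog i z)" by (auto simp: affine_pt_def)
  then obtain c where c: "homog i z = c *s v" using abs_cp2_eq_iff[OF homog_nonzero v] by metis
  then have "1 = c * v$i" using homog_nth_self[of i z] unfolding c by simp
  then show "v$i \<noteq> 0" by auto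
next
  assume "v$i \<noteq> 0" then show "abs_cp2 v \<in> range (affine_pt i)"
    using affine_pt_dehom by (metis rangeI)
qed

lemma affine_pt_in_range: "affine_pt i z \<in> range (affine_pt j) \<longleftrightarrow> z \<in> tdom i j"
  unfolding affine_pt_def[of i] range_affine_pt_iff[OF homog_nonzero] by (simp add: tdom_def)

lemma affine_pt_trans: "z \<in> tdom i j \<Longrightarrow> affine_pt j (trans i j z) = affine_pt i z"
  unfolding trans_def by (subst affine_pt_dehom) (auto simp: tdom_def affine_pt_def)

lemma inj_affine_pt: "inj (affine_pt i)"
proof (rule injI)
  fix z w assume "affine_pt i z = affine_pt i w"
  then obtain c where c: "homog i z = c *s homog i w" by (auto simp: affine_pt_eq_iff)
  then have "c = 1" using homog_nth_self[of i z] homog_nth_self[of i w]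
    by (metis mult.right_neutral vector_smult_component)
  then show "z = w" using c by (metis dehom_homog vector_smult_lid)
qed

lemma affine_coord_affine_pt [simp]: "affine_coord i (affine_pt i z) = z"
  unfolding affine_coord_def by (rule inv_f_f[OF inj_affine_pt])

lemma affine_coord_trans: "z \<in> tdom i j \<Longrightarrow> affine_coord j (affine_pt i z) = trans i j z"
  by (metis affine_coord_affine_pt affine_pt_trans)

lemma frechet_derivative_transition:
  "z \<in> tdom i j \<Longrightarrow> frechet_derivative (affine_coord j \<circ> affine_pt i) (at z) = transD i j z"
  by (rule frechet_derivative_eqI,
      rule has_derivative_transform_within_open[OF trans_has_derivative open_tdom])
    (auto simp: affine_coord_trans)

lemma qf_homog_1: "qf (homog 1 z) = (norm z)\<^sup>2 - 1"
  by (simp add: qf_def homog_def norm_complex2)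

lemma abs_cp2_in_ball: "v \<noteq> 0 \<Longrightarrow> abs_cp2 v \<in> cp2_ball \<longleftrightarrow> qf v < 0"
proof
  assume v: "v \<noteq> 0" and "abs_cp2 v \<in> cp2_ball"
  then obtain z where z: "norm z < 1" "abs_cp2 v = abs_cp2 (homog 1 z)"
    by (auto simp: cp2_ball_def affine_pt_def)
  then obtain c where c: "v = c *s homog 1 z" using abs_cp2_eq_iff[OF v homog_nonzero] by metis
  then have "c \<noteq> 0" using v by auto
  moreover have "(norm z)\<^sup>2 < 1" using z(1) by (simp add: power_less_one_iff abs_square_less_1)
  ultimately show "qf v < 0" unfolding c qf_smult qf_homog_1 by (simp add: mult_pos_neg)
next
  assume v: "qf v < 0"
  then have v1: "v$1 \<noteq> 0"
    unfolding qf_def by (metis add_nonneg_nonneg diff_zero norm_zero not_less power_zero_numeral zero_le_power2)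
  have "qf (homog 1 (dehom 1 v)) < 0"
    unfolding homog_dehom[OF v1] qf_smult using v v1 by (simp add: mult_pos_neg)
  then have "(norm (dehom 1 v))\<^sup>2 < 1" by (simp add: qf_homog_1)
  then have "norm (dehom 1 v) < 1" by (simp add: abs_square_less_1)
  then show "abs_cp2 v \<in> cp2_ball" using affine_pt_dehom[OF v1] unfolding cp2_ball_def by force
qed

lemma xdom_iff: "z \<in> xdom i \<longleftrightarrow> qf (homog i z) \<ge> 0"
  unfolding xdom_def affine_pt_def using abs_cp2_in_ball[OF homog_nonzero] by auto

lemma xdom_1_iff: "z \<in> xdom 1 \<longleftrightarrow> norm z \<ge> 1"
  unfolding xdom_iff qf_homog_1 using abs_square_less_1[of "norm z"] by (cases "norm z < 1") auto

lemma continuous_on_qf_homog: "continuous_on UNIV (\<lambda>z. qf (homog i z))"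
  unfolding qf_def by (intro continuous_intros smooth_open_continuous smooth_open_homog)

lemma trans_in_xdom: "z \<in> tdom i j \<Longrightarrow> trans i j z \<in> xdom j \<longleftrightarrow> z \<in> xdom i"
  unfolding xdom_iff homog_trans qf_smult by (simp add: tdom_def zero_le_mult_iff)

lemma qf_add_scaleR:
  "qf (A + t *\<^sub>R B) = qf A + t * (2 * (A$2 \<bullet> B$2 + A$3 \<bullet> B$3 - A$1 \<bullet> B$1)) + t\<^sup>2 * qf B"
  unfolding qf_def power2_norm_eq_inner
  by (simp add: inner_add_left inner_add_right inner_commute algebra_simps power2_eq_square)

text \<open>Points with \<open>qf > 0\<close> are covered by openness. At the other ones,
  \<open>qf\<close> along the ray in direction \<open>w\<close> is \<open>t * (B w + t * Q)\<close>,
  where \<open>B\<close> is the differential of \<open>qf\<close> in the chart. The condition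
  \<open>B w > 0\<close> is open in \<open>w\<close>, and some \<open>w\<close> fulfils it.\<close>

lemma has_cones_xdom: "has_cones (xdom i)"
  unfolding has_cones_def
proof
  fix z assume z: "z \<in> xdom i"
  show "\<exists>u e. 0 < e \<and> (\<forall>w\<in>ball u e. \<exists>d>0. \<forall>t. 0 < t \<and> t < d \<longrightarrow> z + t *\<^sub>R w \<in> xdom i)"
  proof (cases "qf (homog i z) > 0")
    case True
    have "open {z. qf (homog i z) > 0}"
      by (rule open_Collect_less[OF continuous_on_const continuous_on_qf_homog])
    from has_cones_open[OF this] True obtain u e where
      "e > 0" "\<forall>w\<in>ball u e. \<exists>d>0. \<forall>t. 0 < t \<and> t < d \<longrightarrow> z + t *\<^sub>R w \<in> {z. qf (homog i z) > 0}"
      unfolding has_cones_def by blast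
    then show ?thesis unfolding xdom_iff
      by (intro exI[of _ u] exI[of _ e]) (metis (mono_tags, lifting) less_imp_le mem_Collect_eq)
  next
    case False
    then have q: "qf (homog i z) = 0" using z by (simp add: xdom_iff)
    define B where "B w = 2 * (homog i z$2 \<bullet> hlin i w$2 + homog i z$3 \<bullet> hlin i w$3 - homog i z$1 \<bullet> hlin i w$1)" for w
    \<comment> \<open>In chart 1 the radial direction leads out of the ball. In the other charts the
      first coordinate is the homogeneous coordinate \<open>Z$1\<close>, and shrinking it increases
      \<open>qf\<close>.\<close>
    define u where "u = (if i = 1 then z else vector [- z$1, 0])"
    have Bu: "B u > 0"
    proof (cases "i = 1")
      case True
      have "B u = 2 * (norm z)\<^sup>2" by (simp add: B_def u_def True homog_def hlin_def norm_complex2 power2_norm_eq_inner)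
      then show ?thesis using q True by (simp add: qf_homog_1)
    next
      case False
      have "B u = 2 * (norm (z$1))\<^sup>2"
        using False by (simp add: B_def u_def homog_def hlin_def power2_norm_eq_inner)
      moreover have "(norm (z$1))\<^sup>2 = 1 + (norm (z$2))\<^sup>2"
        using q False by (simp add: qf_def homog_def split: if_splits)
      moreover have "1 + (norm (z$2))\<^sup>2 > 0" by (simp add: add_pos_nonneg)
      ultimately show ?thesis by simp
    qed
    have "continuous_on UNIV B" unfolding B_def
      by (intro continuous_intros bounded_linear.continuous_on[OF bounded_linear_hlin])
    then have "open {w. 0 < B w}"
      by (rule open_Collect_less[OF continuous_on_const])
    then obtain e where e: "e > 0" "ball u e \<subseteq> {w. 0 < B w}"
      using Bu unfolding open_contains_ball by blast
    have "\<exists>d>0. \<forall>t. 0 < t \<and> t < d \<longrightarrow> z + t *\<^sub>R w \<in> xdom i" if "w \<in> ball u e" for w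
    proof -
      have Bw: "B w > 0" using e that by auto
      define Q where "Q = qf (hlin i w)"
      \<comment> \<open>For \<open>t < d\<close> the quadratic term \<open>t * Q\<close> cannot
        outweigh \<open>B w\<close>.\<close>
      define d where "d = B w / (\<bar>Q\<bar> + 1)"
      have d: "d > 0" using Bw by (simp add: d_def add_nonneg_pos)
      have "z + t *\<^sub>R w \<in> xdom i" if t: "0 < t" "t < d" for t
      proof -
        have "homog i (z + t *\<^sub>R w) = homog i z + t *\<^sub>R hlin i w"
          by (simp add: homog_eq linear_add[OF bounded_linear.linear[OF bounded_linear_hlin]]
            linear_cmul[OF bounded_linear.linear[OF bounded_linear_hlin]])
        then have eq: "qf (homog i (z + t *\<^sub>R w)) = t * (B w + t * Q)"
          by (simp add: qf_add_scaleR q B_def Q_def power2_eq_square algebra_simps)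
        have "t * \<bar>Q\<bar> \<le> t * (\<bar>Q\<bar> + 1)" using t by simp
        also have "\<dots> \<le> d * (\<bar>Q\<bar> + 1)" using t by (simp add: mult_right_mono)
        also have "\<dots> = B w" by (simp add: d_def)
        finally have "t * \<bar>Q\<bar> \<le> B w" .
        moreover have "\<bar>t * Q\<bar> = t * \<bar>Q\<bar>" using t by (simp add: abs_mult)
        ultimately have "B w + t * Q \<ge> 0" by linarith
        then show ?thesis using t by (simp add: xdom_iff eq)
      qed
      then show ?thesis using d by blast
    qed
    then show ?thesis using e by blast
  qed
qed

lemma Rep_xpt: "z \<in> xdom i \<Longrightarrow> Rep_xbar (xpt i z) = affine_pt i z"
  by (simp add: xpt_def xdom_def Abs_xbar_inverse)

lemma crd_xpt [simp]: "z \<in> xdom i \<Longrightarrow> crd i (xpt i z) = z"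
  by (simp add: crd_def Rep_xpt)

lemma xpt_in_chart_dom_iff: "z \<in> xdom i \<Longrightarrow> xpt i z \<in> chart_dom j \<longleftrightarrow> z \<in> tdom i j"
  by (simp add: chart_dom_def Rep_xpt affine_pt_in_range)

lemma tdom_self [simp]: "tdom i i = UNIV"
  by (simp add: tdom_def)

lemma xpt_in_chart_dom [simp]: "z \<in> xdom i \<Longrightarrow> xpt i z \<in> chart_dom i"
  by (simp add: xpt_in_chart_dom_iff)

lemma chart_dom_affine_pt: "x \<in> chart_dom i \<Longrightarrow> affine_pt i (crd i x) = Rep_xbar x"
  by (auto simp: chart_dom_def crd_def)

lemma crd_in_xdom [simp]: "x \<in> chart_dom i \<Longrightarrow> crd i x \<in> xdom i"
  using Rep_xbar[of x] by (simp add: xdom_def chart_dom_affine_pt)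

lemma xpt_crd [simp]: "x \<in> chart_dom i \<Longrightarrow> xpt i (crd i x) = x"
  by (simp add: xpt_def chart_dom_affine_pt Rep_xbar_inverse)

lemma xpt_trans: "z \<in> xdom i \<Longrightarrow> z \<in> tdom i j \<Longrightarrow> xpt j (trans i j z) = xpt i z"
  by (simp add: xpt_def affine_pt_trans)

lemma crd_tdom: "x \<in> chart_dom i \<Longrightarrow> x \<in> chart_dom j \<Longrightarrow> crd i x \<in> tdom i j"
  using xpt_in_chart_dom_iff[of "crd i x" i j] by simp

lemma crd_trans: "x \<in> chart_dom i \<Longrightarrow> x \<in> chart_dom j \<Longrightarrow> crd j x = trans i j (crd i x)"
  by (metis crd_in_xdom crd_tdom crd_xpt trans_in_xdom xpt_crd xpt_trans)

section \<open>Open sets, smooth functions and scalar forms in coordinates\<close>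

definition chart_pre :: "3 \<Rightarrow> xbar set \<Rightarrow> (complex^2) set" where
  "chart_pre i U = {z \<in> xdom i. xpt i z \<in> U}"

lemma open_chart_pre:
  assumes "open U" obtains V where "open V" "chart_pre i U = xdom i \<inter> V"
proof -
  obtain W where W: "open W" "U = Rep_xbar -` W" using assms by (auto simp: open_xbar_def)
  define V where "V = homog i -` {v. v \<noteq> 0 \<and> abs_cp2 v \<in> W}"
  have "open {v. v \<noteq> 0 \<and> abs_cp2 v \<in> W}" using W(1) by (simp add: open_cp2_def)
  then have "open V" unfolding V_def
    by (rule open_vimage[OF _ smooth_open_continuous[OF smooth_open_homog]])
  moreover have "chart_pre i U = xdom i \<inter> V"
    by (auto simp: chart_pre_def V_def W(2) Rep_xpt homog_nonzero affine_pt_def)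
  ultimately show ?thesis by (rule that)
qed

lemma open_chart_set:
  assumes "open V" shows "open {x \<in> chart_dom i. crd i x \<in> V}"
proof -
  define W where "W = affine_pt i ` V"
  have "{v. v \<noteq> 0 \<and> abs_cp2 v \<in> W} = {v. v$i \<noteq> 0} \<inter> dehom i -` V"
  proof (intro set_eqI iffI)
    fix v assume "v \<in> {v. v \<noteq> 0 \<and> abs_cp2 v \<in> W}"
    then obtain z where z: "v \<noteq> 0" "abs_cp2 v = affine_pt i z" "z \<in> V" by (auto simp: W_def)
    then have vi: "v$i \<noteq> 0" using range_affine_pt_iff by blast
    then have "dehom i v = z" using affine_pt_dehom[OF vi] z(2) inj_affine_pt by (metis injD)
    then show "v \<in> {v. v$i \<noteq> 0} \<inter> dehom i -` V" using vi z by simp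
  next
    fix v assume "v \<in> {v. v$i \<noteq> 0} \<inter> dehom i -` V"
    then show "v \<in> {v. v \<noteq> 0 \<and> abs_cp2 v \<in> W}"
      using affine_pt_dehom[of v i] by (auto simp: W_def intro!: image_eqI[of _ _ "dehom i v"])
  qed
  moreover have "open ({v. v$i \<noteq> 0} \<inter> dehom i -` V)"
    using smooth_open_continuous[OF smooth_open_dehom[of i]] smooth_openD(1)[OF smooth_open_dehom[of i]] assms
    by (metis continuous_on_open_vimage Int_commute)
  ultimately have "open W" by (simp add: open_cp2_def)
  moreover have "{x \<in> chart_dom i. crd i x \<in> V} = Rep_xbar -` W"
    by (auto simp: W_def crd_def chart_dom_def)
  ultimately show ?thesis unfolding open_xbar_def by blast
qed

lemma smooth_fun_iff: "smooth_fun U f \<longleftrightarrow> (\<forall>i. smooth_upto (chart_pre i U) (\<lambda>z. f (xpt i z)))"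
  by (simp add: smooth_fun_def chart_pre_def)

lemma chart_pre_chart_dom: "chart_pre j (chart_dom i) = xdom j \<inter> tdom j i"
  by (auto simp: chart_pre_def xpt_in_chart_dom_iff)

text \<open>The transition maps are smooth and carry the property from one chart to its overlaps
  with the others.\<close>

lemma smooth_fun_chart_iff:
  "smooth_fun (chart_dom i) f \<longleftrightarrow> smooth_upto (xdom i) (\<lambda>z. f (xpt i z))"
proof
  assume "smooth_fun (chart_dom i) f"
  then have "smooth_upto (chart_pre i (chart_dom i)) (\<lambda>z. f (xpt i z))"
    by (simp add: smooth_fun_iff)
  then show "smooth_upto (xdom i) (\<lambda>z. f (xpt i z))" by (simp add: chart_pre_chart_dom)
next
  assume f: "smooth_upto (xdom i) (\<lambda>z. f (xpt i z))"
  show "smooth_fun (chart_dom i) f"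
    unfolding smooth_fun_iff chart_pre_chart_dom
  proof
    fix j
    have "smooth_upto (xdom j \<inter> tdom j i) (\<lambda>z. f (xpt i (trans j i z)))"
      by (rule smooth_upto_compose_inner[OF f smooth_open_trans]) (auto simp: trans_in_xdom)
    then show "smooth_upto (xdom j \<inter> tdom j i) (\<lambda>z. f (xpt j z))"
      by (subst smooth_upto_cong[where g="\<lambda>z. f (xpt i (trans j i z))"]) (auto simp: xpt_trans)
  qed
qed

lemma smooth_fun_subset: "smooth_fun U f \<Longrightarrow> V \<subseteq> U \<Longrightarrow> smooth_fun V f"
  unfolding smooth_fun_iff
proof
  fix i assume f: "\<forall>i. smooth_upto (chart_pre i U) (\<lambda>z. f (xpt i z))" and "V \<subseteq> U"
  then have "chart_pre i V \<subseteq> chart_pre i U" by (auto simp: chart_pre_def)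
  with f[rule_format, of i] show "smooth_upto (chart_pre i V) (\<lambda>z. f (xpt i z))"
    by (rule smooth_upto_subset)
qed

lemma smooth_fun_cong: "(\<And>x. x \<in> U \<Longrightarrow> f x = g x) \<Longrightarrow> smooth_fun U f \<longleftrightarrow> smooth_fun U g"
  unfolding smooth_fun_iff by (intro all_cong1 smooth_upto_cong) (auto simp: chart_pre_def)

lemma smooth_fun_locally:
  assumes "\<And>x. x \<in> U \<Longrightarrow> \<exists>V. open V \<and> x \<in> V \<and> smooth_fun (U \<inter> V) f"
  shows "smooth_fun U f"
  unfolding smooth_fun_iff
proof (intro allI smooth_upto_locally)
  fix i z assume z: "z \<in> chart_pre i U"
  then obtain V where V: "open V" "xpt i z \<in> V" "smooth_fun (U \<inter> V) f"
    using assms by (auto simp: chart_pre_def)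
  obtain O' where O': "open O'" "chart_pre i V = xdom i \<inter> O'" using V(1) by (rule open_chart_pre)
  have "chart_pre i U \<inter> O' = chart_pre i (U \<inter> V)" using O'(2) by (auto simp: chart_pre_def)
  moreover have "z \<in> O'" using O'(2) V(2) z by (auto simp: chart_pre_def)
  ultimately show "\<exists>V. open V \<and> z \<in> V \<and> smooth_upto (chart_pre i U \<inter> V) (\<lambda>z. f (xpt i z))"
    using O'(1) V(3) unfolding smooth_fun_iff by metis
qed

lemma smooth_fun_mult: "smooth_fun U f \<Longrightarrow> smooth_fun U g \<Longrightarrow> smooth_fun U (\<lambda>x. f x * g x)"
  and smooth_fun_add: "smooth_fun U f \<Longrightarrow> smooth_fun U g \<Longrightarrow> smooth_fun U (\<lambda>x. f x + g x)"
  and smooth_fun_const: "smooth_fun U (\<lambda>x. c)"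
  unfolding smooth_fun_iff by (auto intro: smooth_intros)

lemma smooth_fun_inverse:
  assumes "smooth_fun U f" "\<And>x. x \<in> U \<Longrightarrow> f x \<noteq> 0" shows "smooth_fun U (\<lambda>x. inverse (f x))"
  unfolding smooth_fun_iff
  by (intro allI smooth_upto_compose_outer[OF smooth_open_inverse_aux])
    (use assms in \<open>auto simp: smooth_fun_iff chart_pre_def\<close>)

lemma A01c_iff:
  "\<alpha> \<in> A01c \<longleftrightarrow>
     (\<forall>i. \<forall>x\<in>- chart_dom i. \<forall>v. \<alpha> x i v = 0) \<and>
     (\<forall>i. \<forall>z\<in>xdom i. \<forall>v w. \<alpha> (xpt i z) i (v + w) = \<alpha> (xpt i z) i v + \<alpha> (xpt i z) i w) \<and>
     (\<forall>i. \<forall>z\<in>xdom i. \<forall>c v. \<alpha> (xpt i z) i (c *s v) = cnj c * \<alpha> (xpt i z) i v) \<and>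
     (\<forall>i j. \<forall>z\<in>xdom i \<inter> tdom i j. \<forall>v. \<alpha> (xpt i z) i v = \<alpha> (xpt i z) j (transD i j z v)) \<and>
     (\<forall>i v. smooth_upto (xdom i) (\<lambda>z. \<alpha> (xpt i z) i v))"
proof -
  have ball: "(\<forall>x\<in>chart_dom i. P x) \<longleftrightarrow> (\<forall>z\<in>xdom i. P (xpt i z))" for i P
    by (metis crd_in_xdom xpt_crd xpt_in_chart_dom)
  have ball2: "(\<forall>x\<in>chart_dom i \<inter> chart_dom j. \<forall>v. \<alpha> x i v =
        \<alpha> x j (frechet_derivative (affine_coord j \<circ> affine_pt i) (at (crd i x)) v)) \<longleftrightarrow>
      (\<forall>z\<in>xdom i \<inter> tdom i j. \<forall>v. \<alpha> (xpt i z) i v = \<alpha> (xpt i z) j (transD i j z v))" for i j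
    unfolding Int_iff Ball_def imp_conjL
    using ball[of i, unfolded Ball_def, of "\<lambda>x. x \<in> chart_dom j \<longrightarrow> (\<forall>v. \<alpha> x i v =
        \<alpha> x j (frechet_derivative (affine_coord j \<circ> affine_pt i) (at (crd i x)) v))"]
    by (auto simp: xpt_in_chart_dom_iff frechet_derivative_transition)
  have sm: "smooth_section product_bundle (chart_dom i) f \<longleftrightarrow> smooth_upto (xdom i) (\<lambda>z. f (xpt i z))" for i f
  proof -
    have "smooth_section product_bundle (chart_dom i) f \<longleftrightarrow> smooth_fun (chart_dom i) f"
    proof -
      have "smooth_section product_bundle (chart_dom i) f \<longleftrightarrow>
          (\<exists>g. smooth_fun (chart_dom i) g \<and> (\<forall>x\<in>chart_dom i. f x = g x))"
        by (simp add: smooth_section_def product_bundle_def)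
      also have "\<dots> \<longleftrightarrow> smooth_fun (chart_dom i) f"
      proof (rule iffI, elim exE conjE)
        fix g assume "smooth_fun (chart_dom i) g" "\<forall>x\<in>chart_dom i. f x = g x"
        then show "smooth_fun (chart_dom i) f" by (subst smooth_fun_cong[of _ f g]) auto
      qed (rule exI[of _ f], simp)
      finally show ?thesis .
    qed
    then show ?thesis by (simp add: smooth_fun_chart_iff)
  qed
  show ?thesis unfolding A01_def mem_Collect_eq ball ball2 sm by (simp add: product_bundle_def)
qed

section \<open>The Cauchy transform and the local Dolbeault lemma\<close>

text \<open>The parameter enters by translation, so the derivative is an integral of the same kind
  with a directional derivative of \<open>F\<close> in place of \<open>F\<close>; smoothness then
  follows by iteration. The derivatives of the integrand are packed into a family \<open>fx\<close>
  of bounded linear maps in order to treat all directions at once.\<close>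

lemma integral_translate_has_derivative:
  fixes F :: "'a::euclidean_space \<Rightarrow> complex" and \<gamma> :: "'s::euclidean_space \<Rightarrow> 'a"
  assumes F: "smooth_open UNIV F" and \<gamma>: "continuous_on (cbox a b) \<gamma>" and w: "continuous_on (cbox a b) w"
  shows "((\<lambda>z. integral (cbox a b) (\<lambda>s. F (z + \<gamma> s) * w s)) has_derivative
     (\<lambda>v. integral (cbox a b) (\<lambda>s. frechet_derivative F (at (z + \<gamma> s)) v * w s))) (at z)"
proof -
  define fx where "fx x s = Blinfun (\<lambda>v. frechet_derivative F (at (x + \<gamma> s)) v * w s)" for x s
  have dF: "(F has_derivative frechet_derivative F (at y)) (at y)" for y
    using smooth_open_has_derivative[OF F] by simp
  have bl: "bounded_linear (\<lambda>v. frechet_derivative F (at (x + \<gamma> s)) v * w s)" for x s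
    by (rule bounded_linear_compose[OF bounded_linear_mult_left has_derivative_bounded_linear[OF dF]])
  have app: "blinfun_apply (fx x s) v = frechet_derivative F (at (x + \<gamma> s)) v * w s" for x s v
    unfolding fx_def using bounded_linear_Blinfun_apply[OF bl] by simp
  have contF: "continuous_on A F" for A
    using smooth_open_continuous[OF F] continuous_on_subset by blast
  have cont_arg: "continuous_on (UNIV \<times> cbox a b) (\<lambda>p. fst p + \<gamma> (snd p))"
    by (intro continuous_intros continuous_on_compose2[OF \<gamma>]) auto
  have contw: "continuous_on (UNIV \<times> cbox a b) (\<lambda>p. w (snd p))"
    by (intro continuous_on_compose2[OF w] continuous_intros) auto
  have cont_fx: "continuous_on (UNIV \<times> cbox a b) (\<lambda>(x, s). fx x s)"
  proof (rule continuous_on_blinfun_componentwise)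
    fix i :: 'a
    have "continuous_on UNIV (\<lambda>y. frechet_derivative F (at y) i)"
      by (rule smooth_open_continuous[OF smooth_open_deriv[OF F]])
    then have "continuous_on (UNIV \<times> cbox a b) (\<lambda>p. frechet_derivative F (at (fst p + \<gamma> (snd p))) i)"
      by (rule continuous_on_compose2[OF _ cont_arg]) auto
    from continuous_on_mult[OF this contw]
    show "continuous_on (UNIV \<times> cbox a b) (\<lambda>x. blinfun_apply (case x of (x, s) \<Rightarrow> fx x s) i)"
      by (simp add: case_prod_beta app)
  qed
  have int: "(\<lambda>s. F (x + \<gamma> s) * w s) integrable_on cbox a b" for x
    by (intro integrable_continuous continuous_intros w continuous_on_compose2[OF contF] \<gamma>) auto
  have "((\<lambda>z. integral (cbox a b) (\<lambda>s. F (z + \<gamma> s) * w s)) has_derivative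
      blinfun_apply (integral (cbox a b) (fx z))) (at z within UNIV)"
  proof (rule leibniz_rule[OF _ int cont_fx])
    show "((\<lambda>x. F (x + \<gamma> s) * w s) has_derivative blinfun_apply (fx x s)) (at x within UNIV)" for x s
    proof -
      have "((\<lambda>x. F (x + \<gamma> s)) has_derivative frechet_derivative F (at (x + \<gamma> s))) (at x)"
        by (rule has_derivative_compose[where g=F and f'="\<lambda>v. v", OF _ dF, simplified])
          (auto intro!: derivative_eq_intros)
      moreover have "blinfun_apply (fx x s) = (\<lambda>v. frechet_derivative F (at (x + \<gamma> s)) v * w s)"
        by (rule ext) (rule app)
      ultimately show ?thesis
        by (simp add: has_derivative_mult_left)
    qed
  qed auto
  moreover have "fx z integrable_on cbox a b"
  proof (rule integrable_continuous)
    have "continuous_on (cbox a b) (\<lambda>s. case (z, s) of (x, s) \<Rightarrow> fx x s)"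
      by (rule continuous_on_compose2[OF cont_fx]) (auto intro!: continuous_intros)
    then show "continuous_on (cbox a b) (fx z)" by simp
  qed
  then have "blinfun_apply (integral (cbox a b) (fx z)) v =
      integral (cbox a b) (\<lambda>s. frechet_derivative F (at (z + \<gamma> s)) v * w s)" for v
    by (subst blinfun_apply_integral) (simp_all add: app)
  then have "blinfun_apply (integral (cbox a b) (fx z)) =
      (\<lambda>v. integral (cbox a b) (\<lambda>s. frechet_derivative F (at (z + \<gamma> s)) v * w s))" by blast
  ultimately show ?thesis by simp
qed

lemma smooth_open_integral_translate:
  fixes F :: "'a::euclidean_space \<Rightarrow> complex" and \<gamma> :: "'s::euclidean_space \<Rightarrow> 'a"
  assumes F: "smooth_open UNIV F" and \<gamma>: "continuous_on (cbox a b) \<gamma>" and w: "continuous_on (cbox a b) w"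
  shows "smooth_open UNIV (\<lambda>z. integral (cbox a b) (\<lambda>s. F (z + \<gamma> s) * w s))"
proof -
  have "Ck k UNIV (\<lambda>z. integral (cbox a b) (\<lambda>s. F (z + \<gamma> s) * w s))" for k
    using F
  proof (induction k arbitrary: F)
    case (Suc k)
    show ?case
      by (rule Ck_SucI[OF open_UNIV integral_translate_has_derivative[OF Suc.prems \<gamma> w]])
        (rule Suc.IH[OF smooth_open_deriv[OF Suc.prems]])
  qed simp
  then show ?thesis by (simp add: smooth_open_iff_Ck)
qed

lemma linear_smult_split:
  assumes "linear D"
  shows "D (c *s v) = c * ((D v - \<i> * D (\<i> *s v)) / 2) + cnj c * conj_part D v"
proof -
  have "D (c *s v) = of_real (Re c) * D v + of_real (Im c) * D (\<i> *s v)"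
    by (subst smult_complex_decompose)
      (simp only: linear_add[OF assms] linear_cmul[OF assms], simp add: scaleR_conv_of_real)
  also have "\<dots> = (of_real (Re c) + \<i> * of_real (Im c)) * ((D v - \<i> * D (\<i> *s v)) / 2) +
      (of_real (Re c) - \<i> * of_real (Im c)) * ((D v + \<i> * D (\<i> *s v)) / 2)"
    by (simp add: field_simps)
  also have "of_real (Re c) + \<i> * of_real (Im c) = c" by (simp add: complex_eq_iff)
  also have "of_real (Re c) - \<i> * of_real (Im c) = cnj c" by (simp add: complex_eq_iff)
  finally show ?thesis unfolding conj_part_def .
qed

text \<open>In polar coordinates around \<open>z\<close> the kernel \<open>1 / \<zeta>\<close> cancels against the Jacobian, so that the
  Cauchy transform has the nonsingular integrand \<open>F (z - r cis \<theta> e) cis (- \<theta>)\<close>.\<close>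

definition polar :: "complex^2 \<Rightarrow> real \<times> real \<Rightarrow> complex^2" where
  "polar e s = - ((of_real (fst s) * cis (snd s)) *s e)"

definition cauchy_transform :: "complex^2 \<Rightarrow> real \<Rightarrow> (complex^2 \<Rightarrow> complex) \<Rightarrow> complex^2 \<Rightarrow> complex" where
  "cauchy_transform e R F z =
     integral (cbox (0, 0) (R, 2 * pi)) (\<lambda>s. F (z + polar e s) * cis (- snd s)) / of_real pi"

lemma continuous_on_polar: "continuous_on S (polar e)"
  unfolding polar_def
  by (intro continuous_intros bounded_linear.continuous_on[OF
      bounded_bilinear.bounded_linear_left[OF bounded_bilinear_smult]])

lemma continuous_on_cis_snd: "continuous_on S (\<lambda>s. cis (- snd s))"
  by (intro continuous_intros)

lemma smooth_open_cauchy_transform: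
  assumes "smooth_open UNIV F" shows "smooth_open UNIV (cauchy_transform e R F)"
  unfolding cauchy_transform_def[abs_def] divide_inverse
  by (intro smooth_intros smooth_open_integral_translate continuous_on_polar continuous_on_cis_snd assms open_UNIV)

lemma dbar_at_cauchy_transform:
  assumes F: "smooth_open UNIV F"
  shows "dbar_at UNIV (cauchy_transform e R F) z v = cauchy_transform e R (\<lambda>z. dbar_at UNIV F z v) z"
proof -
  let ?C = "cbox (0, 0) (R, 2 * pi) :: (real \<times> real) set"
  define I where "I v = integral ?C (\<lambda>s. frechet_derivative F (at (z + polar e s)) v * cis (- snd s))" for v
  have "((\<lambda>z. integral ?C (\<lambda>s. F (z + polar e s) * cis (- snd s))) has_derivative I) (at z)"
    unfolding I_def[abs_def]
    by (rule integral_translate_has_derivative[OF F continuous_on_polar continuous_on_cis_snd])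
  from has_derivative_mult_left[OF this, of "inverse (of_real pi)"]
  have "(cauchy_transform e R F has_derivative (\<lambda>v. I v / of_real pi)) (at z)"
    by (simp add: cauchy_transform_def[abs_def] divide_inverse)
  from dbar_at_UNIV_eq[OF this]
  have eq: "dbar_at UNIV (cauchy_transform e R F) z v = (I v + \<i> * I (\<i> *s v)) / 2 / of_real pi"
    by (simp add: conj_part_def field_simps)
  have int: "(\<lambda>s. frechet_derivative F (at (z + polar e s)) v * cis (- snd s)) integrable_on ?C" for v
  proof (intro integrable_continuous continuous_on_mult continuous_on_cis_snd)
    have "continuous_on UNIV (\<lambda>y. frechet_derivative F (at y) v)"
      by (rule smooth_open_continuous[OF smooth_open_deriv[OF F]])
    then show "continuous_on ?C (\<lambda>s. frechet_derivative F (at (z + polar e s)) v)"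
      by (rule continuous_on_compose2) (auto intro!: continuous_intros continuous_on_polar)
  qed
  have "(I v + \<i> * I (\<i> *s v)) / 2 = integral ?C (\<lambda>s. (frechet_derivative F (at (z + polar e s)) v * cis (- snd s)
      + \<i> * (frechet_derivative F (at (z + polar e s)) (\<i> *s v) * cis (- snd s))) / 2)"
    unfolding I_def by (simp add: integral_add int integrable_on_mult_right)
  also have "\<dots> = integral ?C (\<lambda>s. dbar_at UNIV F (z + polar e s) v * cis (- snd s))"
    by (simp add: dbar_at_UNIV conj_part_def algebra_simps)
  finally show ?thesis unfolding eq cauchy_transform_def by simp
qed

text \<open>With \<open>A\<close> and \<open>B\<close> the linear and the conjugate-linear part of
  the derivative of \<open>F\<close> along \<open>e\<close>, \<open>G\<close> is the radial
  derivative in polar coordinates and \<open>K\<close> is the angular one up to the factor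
  \<open>- \<i> * r\<close>. The integrand of the transform is \<open>- (G + K) / 2\<close>. The
  integral of \<open>K\<close> over a circle vanishes by periodicity, and the radial integral of
  \<open>G\<close> is \<open>- F z\<close>, because \<open>F\<close> vanishes at radius
  \<open>R\<close>.\<close>

lemma cauchy_pompeiu:
  assumes F: "smooth_open UNIV F" and R: "R > 0" and vanish: "\<And>\<theta>. F (z - (of_real R * cis \<theta>) *s e) = 0"
  shows "cauchy_transform e R (\<lambda>z. dbar_at UNIV F z e) z = F z"
proof -
  let ?C = "cbox (0, 0) (R, 2 * pi) :: (real \<times> real) set"
  define p where "p r \<theta> = z - (of_real r * cis \<theta>) *s e" for r \<theta> :: real
  define A where "A r \<theta> = (frechet_derivative F (at (p r \<theta>)) e - \<i> * frechet_derivative F (at (p r \<theta>)) (\<i> *s e)) / 2" for r \<theta>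
  define B where "B r \<theta> = dbar_at UNIV F (p r \<theta>) e" for r \<theta>
  define K where "K r \<theta> = cis \<theta> * A r \<theta> - cis (- \<theta>) * B r \<theta>" for r \<theta>
  define G where "G r \<theta> = - (cis \<theta> * A r \<theta> + cis (- \<theta>) * B r \<theta>)" for r \<theta>
  have pp: "z + polar e s = p (fst s) (snd s)" for s by (simp add: polar_def p_def)
  have dF: "(F has_derivative frechet_derivative F (at y)) (at y)" for y
    using smooth_open_has_derivative[OF F] by simp
  have lin: "linear (frechet_derivative F (at y))" for y using has_derivative_linear[OF dF] .
  have split: "frechet_derivative F (at (p r \<theta>)) (c *s e) = c * A r \<theta> + cnj c * B r \<theta>" for r \<theta> c
    unfolding A_def B_def dbar_at_UNIV by (rule linear_smult_split[OF lin])
  have cp: "continuous_on S (\<lambda>s. p (fst s) (snd s))" for S :: "(real \<times> real) set"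
    unfolding pp[symmetric] by (intro continuous_intros continuous_on_polar)
  have cd: "continuous_on S (\<lambda>s. frechet_derivative F (at (p (fst s) (snd s))) v)" for S v
    by (rule continuous_on_compose2[OF smooth_open_continuous[OF smooth_open_deriv[OF F]] cp]) auto
  have cA: "continuous_on S (\<lambda>s. A (fst s) (snd s))" for S
    unfolding A_def by (intro continuous_intros cd) auto
  have cB: "continuous_on S (\<lambda>s. B (fst s) (snd s))" for S
    unfolding B_def dbar_at_UNIV conj_part_def by (intro continuous_intros cd) auto
  have cK: "continuous_on S (\<lambda>s. K (fst s) (snd s))" for S
    unfolding K_def by (intro continuous_intros cA cB)
  have cG: "continuous_on S (\<lambda>s. G (fst s) (snd s))" for S
    unfolding G_def by (intro continuous_intros cA cB)
  have lin_e: "((\<lambda>c. z - c *s e) has_derivative (\<lambda>c. - (c *s e))) (at c within T)" for c T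
    using has_derivative_diff[OF has_derivative_const bounded_linear_imp_has_derivative[OF
      bounded_bilinear.bounded_linear_left[OF bounded_bilinear_smult]]] by fastforce
  have minus: "frechet_derivative F (at y) (- v) = - frechet_derivative F (at y) v" for y v
    by (rule linear_neg[OF lin])
  have dr: "((\<lambda>r. F (p r \<theta>)) has_vector_derivative G r \<theta>) (at r within T)" for r \<theta> T
  proof -
    have "((\<lambda>r. of_real r * cis \<theta>) has_derivative (\<lambda>h. of_real h * cis \<theta>)) (at r within T)"
      by (auto intro!: derivative_eq_intros)
    from has_derivative_compose[OF has_derivative_compose[OF this lin_e] dF]
    have "((\<lambda>r. F (p r \<theta>)) has_derivative (\<lambda>h. frechet_derivative F (at (p r \<theta>)) (- ((of_real h * cis \<theta>) *s e)))) (at r within T)"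
      by (simp add: p_def)
    moreover have "frechet_derivative F (at (p r \<theta>)) (- ((of_real h * cis \<theta>) *s e)) = h *\<^sub>R G r \<theta>" for h
      unfolding minus split by (simp add: G_def cis_cnj scaleR_conv_of_real algebra_simps)
    ultimately show ?thesis by (simp add: has_vector_derivative_def)
  qed
  have dth: "((\<lambda>\<theta>. F (p r \<theta>)) has_vector_derivative - (\<i> * of_real r * K r \<theta>)) (at \<theta> within T)" for r \<theta> T
  proof -
    have "((\<lambda>\<theta>. of_real r * cis \<theta>) has_derivative (\<lambda>h. of_real r * (h *\<^sub>R (\<i> * cis \<theta>)))) (at \<theta> within T)"
      by (rule has_derivative_mult_right[OF has_derivative_cis[OF has_derivative_ident]])
    from has_derivative_compose[OF has_derivative_compose[OF this lin_e] dF]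
    have "((\<lambda>\<theta>. F (p r \<theta>)) has_derivative
       (\<lambda>h. frechet_derivative F (at (p r \<theta>)) (- ((of_real r * (h *\<^sub>R (\<i> * cis \<theta>))) *s e)))) (at \<theta> within T)"
      by (simp add: p_def)
    moreover have "frechet_derivative F (at (p r \<theta>)) (- ((of_real r * (h *\<^sub>R (\<i> * cis \<theta>))) *s e))
       = h *\<^sub>R (- (\<i> * of_real r * K r \<theta>))" for h
      unfolding minus split by (simp add: K_def cis_cnj scaleR_conv_of_real algebra_simps)
    ultimately show ?thesis by (simp add: has_vector_derivative_def)
  qed
  have intK: "integral {0..2*pi} (K r) = 0" if "r \<noteq> 0" for r
  proof -
    have "((\<lambda>\<theta>. - (\<i> * of_real r * K r \<theta>)) has_integral F (p r (2*pi)) - F (p r 0)) {0..2*pi}"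
      by (rule fundamental_theorem_of_calculus[OF _ dth]) simp
    moreover have "F (p r (2*pi)) = F (p r 0)" by (simp add: p_def)
    ultimately have "((\<lambda>\<theta>. (\<i> / of_real r) * - (\<i> * of_real r * K r \<theta>)) has_integral (\<i> / of_real r) * 0) {0..2*pi}"
      by (intro has_integral_mult_right) simp
    then have "(K r has_integral 0) {0..2*pi}" using that by (simp add: field_simps)
    then show ?thesis by (rule integral_unique)
  qed
  have intG: "integral {0..R} (\<lambda>r. G r \<theta>) = - F z" for \<theta>
  proof -
    have "((\<lambda>r. G r \<theta>) has_integral F (p R \<theta>) - F (p 0 \<theta>)) {0..R}"
      by (rule fundamental_theorem_of_calculus[OF _ dr]) (use R in simp)
    then show ?thesis using vanish by (simp add: integral_unique p_def)
  qed
  have "2 * integral ?C (\<lambda>s. B (fst s) (snd s) * cis (- snd s)) =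
      integral ?C (\<lambda>s. - (G (fst s) (snd s) + K (fst s) (snd s)))"
    unfolding integral_mult_right[symmetric] by (rule integral_cong) (simp add: G_def K_def)
  also have "\<dots> = - integral ?C (\<lambda>s. G (fst s) (snd s)) - integral ?C (\<lambda>s. K (fst s) (snd s))"
    by (subst integral_neg, subst integral_add) (simp_all add: integrable_continuous cG cK)
  also have "integral ?C (\<lambda>s. K (fst s) (snd s)) = integral (cbox 0 R) (\<lambda>r. integral (cbox 0 (2*pi)) (K r))"
    by (subst integral_prod_continuous[OF cK]) simp
  \<comment> \<open>On the degenerate circle \<open>r = 0\<close> the angular derivative says
    nothing about \<open>K\<close>; a single radius is negligible.\<close>
  also have "\<dots> = integral (cbox 0 R) (\<lambda>r. 0)"
    by (rule integral_spike[of "{0}"]) (auto simp: intK)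
  also have "integral ?C (\<lambda>s. G (fst s) (snd s)) = integral (cbox 0 R) (\<lambda>r. integral (cbox 0 (2*pi)) (G r))"
    by (subst integral_prod_continuous[OF cG]) simp
  also have "\<dots> = integral (cbox 0 (2*pi)) (\<lambda>\<theta>. integral (cbox 0 R) (\<lambda>r. G r \<theta>))"
    by (rule integral_swap_continuous) (use cG[of "cbox (0,0) (R, 2*pi)"] in \<open>simp add: case_prod_beta\<close>)
  also have "\<dots> = - of_real (2 * pi) * F z" by (simp add: intG scaleR_conv_of_real)
  finally have "integral ?C (\<lambda>s. B (fst s) (snd s) * cis (- snd s)) = of_real pi * F z" by simp
  then show ?thesis unfolding cauchy_transform_def pp B_def by simp
qed

section \<open>Cut-off functions and the equation in two variables\<close>

lemma dbar_at_invariant: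
  assumes f: "f differentiable (at (P x))" and P: "bounded_linear P" "P v = 0" "P (\<i> *s v) = 0"
    and inv: "\<And>z. f z = f (P z)"
  shows "dbar_at UNIV f x v = 0"
proof -
  have d: "(f has_derivative frechet_derivative f (at (P x))) (at (P x))"
    using f frechet_derivative_works by blast
  from has_derivative_compose[OF bounded_linear_imp_has_derivative[OF P(1)] this]
  have "(f has_derivative (\<lambda>v. frechet_derivative f (at (P x)) (P v))) (at x)"
    unfolding inv[symmetric] .
  then show ?thesis
    using linear_0[OF has_derivative_linear[OF d]] by (subst dbar_at_UNIV_eq) (auto simp: conj_part_def P)
qed

text \<open>A cut-off in one coordinate: the constant is \<open>s\<^sup>2 - (s / 2)\<^sup>2\<close>,
  so that the value is 1 up to distance \<open>s / 2\<close> and 0 from distance \<open>s\<close>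
  on. In a product of two bumps, each factor is constant for the Cauchy-Riemann operator in the
  other coordinate.\<close>

definition bump :: "2 \<Rightarrow> complex^2 \<Rightarrow> real \<Rightarrow> complex^2 \<Rightarrow> complex" where
  "bump j c s z = of_real (smooth_step (3 * s\<^sup>2 / 4) (s\<^sup>2 - (norm (z$j - c$j))\<^sup>2))"

lemma smooth_open_bump: "s > 0 \<Longrightarrow> smooth_open UNIV (bump j c s)"
  unfolding bump_def[abs_def] power2_norm_eq_inner by (intro smooth_intros open_UNIV) auto

lemma bump_eq_0: "s > 0 \<Longrightarrow> norm (z$j - c$j) \<ge> s \<Longrightarrow> bump j c s z = 0"
  unfolding bump_def by (subst smooth_step_eq_0) (auto intro: power_mono)

lemma bump_eq_1:
  assumes "s > 0" "norm (z$j - c$j) \<le> s / 2" shows "bump j c s z = 1"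
proof -
  have "(norm (z$j - c$j))\<^sup>2 \<le> (s / 2)\<^sup>2" using assms by (intro power_mono) auto
  then show ?thesis unfolding bump_def using assms
    by (subst smooth_step_eq_1) (auto simp: power_divide)
qed

definition polydisc :: "complex^2 \<Rightarrow> real \<Rightarrow> (complex^2) set" where
  "polydisc c s = {z. norm (z$1 - c$1) < s \<and> norm (z$2 - c$2) < s}"

lemma open_polydisc: "open (polydisc c s)"
  unfolding polydisc_def by (intro open_Collect_conj open_Collect_less continuous_intros)

lemma ball_subset_polydisc: "ball c s \<subseteq> polydisc c s"
proof
  fix z assume "z \<in> ball c s"
  then have "norm (z - c) < s" by (simp add: dist_norm norm_minus_commute)
  moreover have "norm ((z - c)$j) \<le> norm (z - c)" for j by (rule Finite_Cartesian_Product.norm_nth_le)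
  ultimately show "z \<in> polydisc c s" unfolding polydisc_def by (metis (mono_tags, lifting) mem_Collect_eq order_le_less_trans vector_minus_component)
qed

definition cut_off :: "complex^2 \<Rightarrow> real \<Rightarrow> (complex^2 \<Rightarrow> complex) \<Rightarrow> complex^2 \<Rightarrow> complex" where
  "cut_off c s f z = (if z \<in> polydisc c (2 * s) then bump 1 c s z * bump 2 c s z * f z else 0)"

lemma cut_off_outside: "s > 0 \<Longrightarrow> norm (z$j - c$j) \<ge> s \<Longrightarrow> cut_off c s f z = 0"
  using bump_eq_0[of s z j c] exhaust_2[of j] by (auto simp: cut_off_def)

lemma cut_off_inside:
  assumes "s > 0" "norm (z$1 - c$1) \<le> s / 2" "norm (z$2 - c$2) \<le> s / 2"
  shows "cut_off c s f z = f z"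
proof -
  have "z \<in> polydisc c (2 * s)" using assms by (auto simp: polydisc_def)
  then show ?thesis using assms by (simp add: cut_off_def bump_eq_1)
qed

lemma smooth_open_cut_off:
  assumes s: "s > 0" and f: "smooth_open (polydisc c (2 * s)) f"
  shows "smooth_open UNIV (cut_off c s f)"
proof (rule smooth_open_locally[OF open_UNIV])
  fix z
  show "\<exists>V. z \<in> V \<and> smooth_open V (cut_off c s f)"
  proof (cases "z \<in> polydisc c (2 * s)")
    case True
    have "smooth_open (polydisc c (2 * s)) (\<lambda>z. bump 1 c s z * bump 2 c s z * f z)"
      by (intro smooth_intros f smooth_open_subset[OF smooth_open_bump[OF s] open_polydisc]) auto
    then have "smooth_open (polydisc c (2 * s)) (cut_off c s f)"
      by (subst smooth_open_cong[where g="\<lambda>z. bump 1 c s z * bump 2 c s z * f z"]) (auto simp: cut_off_def)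
    then show ?thesis using True by blast
  next
    case False
    then obtain j where j: "norm (z$j - c$j) \<ge> 2 * s" by (auto simp: polydisc_def not_less)
    define V where "V = {z. norm ((z::complex^2)$j - c$j) > s}"
    have "open V" unfolding V_def by (intro open_Collect_less continuous_intros)
    then have "smooth_open V (\<lambda>z. 0 :: complex)" by (rule smooth_open_const)
    then have "smooth_open V (cut_off c s f)"
      by (subst smooth_open_cong[where g="\<lambda>z. 0"]) (auto simp: V_def intro!: cut_off_outside[OF s, where j=j])
    then show ?thesis using j s by (intro exI[of _ V]) (auto simp: V_def)
  qed
qed

text \<open>The radius \<open>2 * s\<close> is chosen so that, seen from a point whose j-th
  coordinate is within \<open>s\<close> of the centre, the outer circle lies where \<open>F\<close>
  vanishes, as \<open>cauchy_pompeiu\<close> requires.\<close>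

lemma cauchy_transform_solves:
  assumes F: "smooth_open UNIV F" and s: "s > 0"
    and F0: "\<And>z. norm (z$j - c$j) \<ge> s \<Longrightarrow> F z = 0" and z: "norm (z$j - c$j) \<le> s"
  shows "dbar_at UNIV (cauchy_transform (axis j 1) (2 * s) F) z (axis j 1) = F z"
  unfolding dbar_at_cauchy_transform[OF F]
proof (rule cauchy_pompeiu[OF F])
  fix \<theta>
  have "norm (of_real (2 * s) * cis \<theta>) \<le> norm (z$j - c$j) + norm (z$j - of_real (2 * s) * cis \<theta> - c$j)"
    using norm_triangle_ineq4[of "z$j - c$j" "z$j - of_real (2 * s) * cis \<theta> - c$j"]
    by (simp only: diff_diff_eq2) (simp add: algebra_simps)
  then have "s \<le> norm (z$j - of_real (2 * s) * cis \<theta> - c$j)" using z s by (simp add: norm_mult)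
  then show "F (z - (of_real (2 * s) * cis \<theta>) *s axis j 1) = 0"
    by (intro F0) simp
qed (use s in auto)

text \<open>One variable at a time. \<open>U1\<close> solves the equation for \<open>f1\<close>; by
  closedness the remaining coefficient \<open>h\<close> is holomorphic in the first variable near
  \<open>c\<close>. The transform \<open>U2\<close> of \<open>h\<close> in the second variable
  solves the second equation and stays holomorphic in the first variable, because the transform
  commutes with the Cauchy-Riemann operator and moves points in the second coordinate only.\<close>

lemma local_dolbeault:
  assumes f1: "smooth_open W f1" and f2: "smooth_open W f2" and c: "c \<in> W"
    and closed: "\<And>z. z \<in> W \<Longrightarrow> dbar_at UNIV f1 z (axis 2 1) = dbar_at UNIV f2 z (axis 1 1)"
  obtains r u where "r > 0" "ball c r \<subseteq> W" "smooth_open (ball c r) u"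
    "\<forall>z\<in>ball c r. dbar_at UNIV u z (axis 1 1) = f1 z \<and> dbar_at UNIV u z (axis 2 1) = f2 z"
proof -
  let ?e1 = "axis 1 1 :: complex^2" and ?e2 = "axis 2 1 :: complex^2"
  obtain \<delta> where \<delta>: "\<delta> > 0" "ball c \<delta> \<subseteq> W"
    using smooth_openD(1)[OF f1] c unfolding open_contains_ball by blast
  \<comment> \<open>The points of a polydisc of radius \<open>2 * s\<close> are at distance less
    than \<open>4 * s = \<delta>\<close> from \<open>c\<close>.\<close>
  define s where "s = \<delta> / 4"
  have s: "s > 0" using \<delta> by (simp add: s_def)
  have pW: "polydisc c (2 * s) \<subseteq> W"
  proof
    fix z assume z: "z \<in> polydisc c (2 * s)"
    have "norm (z - c) \<le> norm ((z - c)$1) + norm ((z - c)$2)"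
      using L2_set_le_sum[of UNIV "\<lambda>i. norm ((z - c)$i)"] by (simp add: norm_vec_def sum_2)
    also have "\<dots> < \<delta>" using z by (simp add: polydisc_def s_def)
    finally show "z \<in> W" using \<delta> by (auto simp: dist_norm norm_minus_commute)
  qed
  have mono: "polydisc c t \<subseteq> W" if "t \<le> 2 * s" for t
    using pW that by (auto simp: polydisc_def)
  define F where "F = cut_off c s f1"
  have F: "smooth_open UNIV F"
    unfolding F_def by (rule smooth_open_cut_off[OF s smooth_open_subset[OF f1 open_polydisc pW]])
  define U1 where "U1 = cauchy_transform ?e1 (2 * s) F"
  have U1: "smooth_open UNIV U1" unfolding U1_def by (rule smooth_open_cauchy_transform[OF F])
  have U1F: "dbar_at UNIV U1 z ?e1 = F z" if "norm (z$1 - c$1) \<le> s" for z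
    unfolding U1_def
    by (rule cauchy_transform_solves[OF F s _ that]) (simp add: F_def cut_off_outside[OF s])
  define h where "h z = f2 z - dbar_at UNIV U1 z ?e2" for z
  have h: "smooth_open W h"
    unfolding h_def[abs_def]
    by (intro smooth_intros f2 smooth_open_dbar_at smooth_open_subset[OF U1 smooth_openD(1)[OF f2]]) auto
  have dh: "dbar_at UNIV h z ?e1 = 0" if z: "z \<in> polydisc c (s / 2)" for z
  proof -
    have zW: "z \<in> W" using mono[of "s/2"] s z by auto
    have "dbar_at UNIV h z ?e1 = dbar_at UNIV f2 z ?e1 - dbar_at UNIV (\<lambda>y. dbar_at UNIV U1 y ?e2) z ?e1"
    proof -
      have d: "(f2 has_derivative frechet_derivative f2 (at z)) (at z)"
        "((\<lambda>y. dbar_at UNIV U1 y ?e2) has_derivative frechet_derivative (\<lambda>y. dbar_at UNIV U1 y ?e2) (at z)) (at z)"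
        using smooth_open_has_derivative[OF f2 zW] smooth_open_has_derivative[OF smooth_open_dbar_at[OF U1]] by auto
      show ?thesis
        unfolding h_def[abs_def] dbar_at_UNIV_eq[OF has_derivative_diff[OF d]] dbar_at_UNIV_eq[OF d(1)] dbar_at_UNIV_eq[OF d(2)]
        by (simp add: conj_part_def field_simps)
    qed
    also have "dbar_at UNIV (\<lambda>y. dbar_at UNIV U1 y ?e2) z ?e1 = dbar_at UNIV (\<lambda>y. dbar_at UNIV U1 y ?e1) z ?e2"
      by (rule dbar_at_commute_open[OF U1]) simp
    also have "\<dots> = dbar_at UNIV f1 z ?e2"
      by (rule dbar_at_cong[OF open_polydisc[of c "s/2"]])
        (use z s in \<open>auto simp: polydisc_def U1F F_def cut_off_inside[OF s]\<close>)
    finally show ?thesis using closed[OF zW] by simp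
  qed
  \<comment> \<open>Then \<open>2 * t = s / 2\<close>: the second cut-off uses \<open>h\<close> only
    where the first one has no effect and \<open>h\<close> is holomorphic in the first
    variable.\<close>
  define t where "t = s / 4"
  have t: "t > 0" using s by (simp add: t_def)
  define H where "H = cut_off c t h"
  have H: "smooth_open UNIV H"
    unfolding H_def by (rule smooth_open_cut_off[OF t smooth_open_subset[OF h open_polydisc mono]])
      (use s in \<open>simp add: t_def\<close>)
  define U2 where "U2 = cauchy_transform ?e2 (2 * t) H"
  have U2: "smooth_open UNIV U2" unfolding U2_def by (rule smooth_open_cauchy_transform[OF H])
  have U2H: "dbar_at UNIV U2 z ?e2 = H z" if "norm (z$2 - c$2) \<le> t" for z
    unfolding U2_def
    by (rule cauchy_transform_solves[OF H t _ that]) (simp add: H_def cut_off_outside[OF t])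
  have dH: "dbar_at UNIV H z ?e1 = 0" if z: "norm (z$1 - c$1) < t / 2" for z
  \<comment> \<open>Near points of the first kind the bump in the first coordinate is 1, so
    \<open>H\<close> is \<open>h\<close> times a function of the second variable; near the others
    \<open>H\<close> vanishes.\<close>
  proof (cases "norm (z$2 - c$2) < 2 * t")
    case True
    define V where "V = {z::complex^2. norm (z$1 - c$1) < t / 2 \<and> norm (z$2 - c$2) < 2 * t}"
    have V: "open V" unfolding V_def by (intro open_Collect_conj open_Collect_less continuous_intros)
    have zV: "z \<in> V" using z True by (simp add: V_def)
    have zp: "z \<in> polydisc c (s / 2)" using zV s by (simp add: V_def polydisc_def t_def)
    have zW: "z \<in> W" using mono[of "s/2"] s zp by auto
    have "dbar_at UNIV H z ?e1 = dbar_at UNIV (\<lambda>z. bump 2 c t z * h z) z ?e1"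
      by (rule dbar_at_cong[OF V]) (use zV t in \<open>auto simp: H_def V_def cut_off_def polydisc_def bump_eq_1\<close>)
    also have "\<dots> = dbar_at UNIV (bump 2 c t) z ?e1 * h z + bump 2 c t z * dbar_at UNIV h z ?e1"
      by (rule dbar_at_mult[OF has_cones_UNIV _ smooth_open_has_derivative[OF smooth_open_bump[OF t]]
          smooth_open_has_derivative[OF h zW]]) auto
    also have "dbar_at UNIV (bump 2 c t) z ?e1 = 0"
    proof (rule dbar_at_invariant[where P="\<lambda>z. z$2 *s ?e2"])
      show "bump 2 c t differentiable at (z$2 *s ?e2)"
        using smooth_openD(2)[OF smooth_open_bump[OF t]] by simp
      show "bounded_linear (\<lambda>z::complex^2. z$2 *s ?e2)"
        by (rule bounded_linear_compose[OF bounded_bilinear.bounded_linear_left[OF bounded_bilinear_smult] bounded_linear_vec_nth])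
    qed (auto simp: bump_def axis_def vec_eq_iff)
    finally show ?thesis using dh[OF zp] by simp
  next
    case False
    define V where "V = {z::complex^2. norm (z$2 - c$2) > t}"
    have V: "open V" unfolding V_def by (intro open_Collect_less continuous_intros)
    have "dbar_at UNIV H z ?e1 = dbar_at UNIV (\<lambda>z. 0) z ?e1"
      by (rule dbar_at_cong[OF V]) (use False t in \<open>auto simp: H_def V_def cut_off_outside[OF t, of _ 2]\<close>)
    then show ?thesis by (simp add: dbar_at_const[OF has_cones_UNIV])
  qed
  have U20: "dbar_at UNIV U2 z ?e1 = 0" if z: "norm (z$1 - c$1) < t / 2" for z
  proof -
    have "dbar_at UNIV H (z + polar ?e2 s') ?e1 = 0" for s'
      by (rule dH) (use z in \<open>simp add: polar_def axis_def\<close>)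
    then show ?thesis unfolding U2_def dbar_at_cauchy_transform[OF H] by (simp add: cauchy_transform_def)
  qed
  define r where "r = t / 2"
  have r: "r > 0" "r \<le> t / 2" "r \<le> s / 2" "r \<le> 2 * s" using t s by (auto simp: r_def t_def)
  have rp: "ball c r \<subseteq> polydisc c r" by (rule ball_subset_polydisc)
  show ?thesis
  proof (rule that[of r "\<lambda>z. U1 z + U2 z"])
    show "ball c r \<subseteq> W" using rp mono[OF r(4)] by blast
    show "smooth_open (ball c r) (\<lambda>z. U1 z + U2 z)"
      by (intro smooth_intros smooth_open_subset[OF U1] smooth_open_subset[OF U2]) auto
    show "\<forall>z\<in>ball c r. dbar_at UNIV (\<lambda>z. U1 z + U2 z) z ?e1 = f1 z \<and> dbar_at UNIV (\<lambda>z. U1 z + U2 z) z ?e2 = f2 z"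
    proof
      fix z assume "z \<in> ball c r"
      then have z: "norm (z$1 - c$1) < r" "norm (z$2 - c$2) < r" using rp by (auto simp: polydisc_def)
      have add: "dbar_at UNIV (\<lambda>z. U1 z + U2 z) z v = dbar_at UNIV U1 z v + dbar_at UNIV U2 z v" for v
        by (rule dbar_at_add[OF has_cones_UNIV _ smooth_open_has_derivative[OF U1] smooth_open_has_derivative[OF U2]]) auto
      have "F z = f1 z" unfolding F_def by (rule cut_off_inside[OF s]) (use z r in auto)
      moreover have "H z = h z" unfolding H_def by (rule cut_off_inside[OF t]) (use z r in auto)
      moreover have "norm (z$1 - c$1) \<le> s" "norm (z$2 - c$2) \<le> t" "norm (z$1 - c$1) < t / 2"
        using z r s t by auto
      ultimately show "dbar_at UNIV (\<lambda>z. U1 z + U2 z) z ?e1 = f1 z \<and> dbar_at UNIV (\<lambda>z. U1 z + U2 z) z ?e2 = f2 z"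
        by (simp add: add U1F U20 U2H h_def)
    qed
  qed (use r in auto)
qed

section \<open>Forms and Dolbeault operators\<close>

lemma smooth_upto_xdom_derivative:
  assumes "smooth_upto (xdom i) f" "z \<in> xdom i"
  shows "(f has_derivative frechet_derivative f (at z within xdom i)) (at z within xdom i)"
  using smooth_upto_has_derivative[OF has_cones_xdom, of i UNIV f z] assms by simp

lemma smooth_fun_xpt: "smooth_fun UNIV f \<Longrightarrow> smooth_upto (xdom i) (\<lambda>z. f (xpt i z))"
  unfolding smooth_fun_iff by (auto simp: chart_pre_def dest: spec[of _ i])

lemma A01cD:
  assumes "\<alpha> \<in> A01c"
  shows "x \<notin> chart_dom i \<Longrightarrow> \<alpha> x i v = 0"
    and "z \<in> xdom i \<Longrightarrow> \<alpha> (xpt i z) i (v + w) = \<alpha> (xpt i z) i v + \<alpha> (xpt i z) i w"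
    and "z \<in> xdom i \<Longrightarrow> \<alpha> (xpt i z) i (c *s v) = cnj c * \<alpha> (xpt i z) i v"
    and "z \<in> xdom i \<Longrightarrow> z \<in> tdom i j \<Longrightarrow> \<alpha> (xpt i z) i v = \<alpha> (xpt i z) j (transD i j z v)"
    and "smooth_upto (xdom i) (\<lambda>z. \<alpha> (xpt i z) i v)"
  using assms unfolding A01c_iff by blast+

lemma A01c_eq_0:
  assumes \<alpha>: "\<alpha> \<in> A01c" and x: "x \<in> chart_dom j" and 0: "\<And>v. \<alpha> x j v = 0"
  shows "\<alpha> x i v = 0"
proof (cases "x \<in> chart_dom i")
  case True
  then show ?thesis
    using A01cD(4)[OF \<alpha> crd_in_xdom[OF True] crd_tdom[OF True x], of v] 0 by simp
qed (rule A01cD(1)[OF \<alpha>])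

lemma A01c_add: "\<alpha> \<in> A01c \<Longrightarrow> \<beta> \<in> A01c \<Longrightarrow> \<alpha> + \<beta> \<in> A01c"
  unfolding A01c_iff by (auto simp: algebra_simps intro: smooth_intros)

lemma A01c_fun_mult:
  "smooth_fun UNIV f \<Longrightarrow> \<alpha> \<in> A01c \<Longrightarrow> (\<lambda>x i v. f x * \<alpha> x i v) \<in> A01c"
  unfolding A01c_iff by (auto simp: algebra_simps intro!: smooth_upto_mult[OF smooth_fun_xpt])

lemma A01c_form_scale: "\<alpha> \<in> A01c \<Longrightarrow> form_scale c \<alpha> \<in> A01c"
  unfolding form_scale_def by (rule A01c_fun_mult[OF smooth_fun_const])

lemma dbar_fun_xpt: "z \<in> xdom i \<Longrightarrow> dbar_fun f (xpt i z) i v = dbar_at (xdom i) (\<lambda>z. f (xpt i z)) z v"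
  by (simp add: dbar_fun_def)

lemma dbar_fun_A01c:
  assumes f: "smooth_fun UNIV f" shows "dbar_fun f \<in> A01c"
  unfolding A01c_iff
proof (intro conjI allI ballI)
  note sf = smooth_fun_xpt[OF f]
  note df = smooth_upto_xdom_derivative[OF sf]
  fix i v z
  show "dbar_fun f x i v = 0" if "x \<in> - chart_dom i" for x using that by (simp add: dbar_fun_def)
  show "smooth_upto (xdom i) (\<lambda>z. dbar_fun f (xpt i z) i v)"
    using smooth_upto_dbar_at[OF has_cones_xdom, of i UNIV] sf
    by (subst smooth_upto_cong[OF dbar_fun_xpt]) auto
  show "dbar_fun f (xpt i z) i (v + w) = dbar_fun f (xpt i z) i v + dbar_fun f (xpt i z) i w" if "z \<in> xdom i" for w
    using that by (simp add: dbar_fun_xpt dbar_at_vadd[OF df])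
  show "dbar_fun f (xpt i z) i (c *s v) = cnj c * dbar_fun f (xpt i z) i v" if "z \<in> xdom i" for c
    using that by (simp add: dbar_fun_xpt dbar_at_smult[OF df])
  show "dbar_fun f (xpt i z) i v = dbar_fun f (xpt i z) j (transD i j z v)" if z: "z \<in> xdom i \<inter> tdom i j" for j
  proof -
    have "dbar_fun f (xpt i z) i v = dbar_at (xdom i) (\<lambda>y. f (xpt j (trans i j y))) z v"
      using z by (simp add: dbar_fun_xpt, intro dbar_at_cong[OF open_tdom[of i j]]) (auto simp: xpt_trans)
    also have "\<dots> = dbar_at (xdom j) (\<lambda>z. f (xpt j z)) (trans i j z) (transD i j z v)"
      by (rule dbar_at_holomorphic_inner[OF has_cones_xdom _ has_cones_xdom _ df trans_has_derivative _ open_tdom[of i j]])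
        (use z in \<open>auto simp: trans_in_xdom transD_smult\<close>)
    also have "\<dots> = dbar_fun f (xpt j (trans i j z)) j (transD i j z v)"
      using z by (simp add: dbar_fun_xpt trans_in_xdom)
    finally show ?thesis using z by (simp add: xpt_trans)
  qed
qed

lemma dbar_form_xpt:
  "z \<in> xdom i \<Longrightarrow> dbar_form \<alpha> (xpt i z) i v w =
     dbar_at (xdom i) (\<lambda>z. \<alpha> (xpt i z) i w) z v - dbar_at (xdom i) (\<lambda>z. \<alpha> (xpt i z) i v) z w"
  by (simp add: dbar_form_def)

lemma dbar_form_outside: "x \<notin> chart_dom i \<Longrightarrow> dbar_form \<alpha> x i v w = 0"
  by (simp add: dbar_form_def)

lemma form02_cases:
  assumes "x \<notin> chart_dom i \<Longrightarrow> P" "\<And>z. x = xpt i z \<Longrightarrow> z \<in> xdom i \<Longrightarrow> P" shows P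
  using assms crd_in_xdom xpt_crd by metis

lemma dbar_form_add:
  assumes "\<alpha> \<in> A01c" "\<beta> \<in> A01c"
  shows "dbar_form (\<alpha> + \<beta>) x i v w = dbar_form \<alpha> x i v w + dbar_form \<beta> x i v w"
proof (rule form02_cases[of x i])
  fix z assume "x = xpt i z" "z \<in> xdom i"
  then show ?thesis
    using dbar_at_add[OF has_cones_xdom _ smooth_upto_xdom_derivative smooth_upto_xdom_derivative] A01cD(5)[OF assms(1)] A01cD(5)[OF assms(2)]
    by (simp add: dbar_form_xpt)
qed (simp add: dbar_form_outside)

lemma dbar_form_fun_mult:
  assumes f: "smooth_fun UNIV f" and \<alpha>: "\<alpha> \<in> A01c"
  shows "dbar_form (\<lambda>x i v. f x * \<alpha> x i v) x i v w =
    dbar_fun f x i v * \<alpha> x i w - dbar_fun f x i w * \<alpha> x i v + f x * dbar_form \<alpha> x i v w"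
proof (rule form02_cases[of x i])
  fix z assume "x = xpt i z" "z \<in> xdom i"
  then show ?thesis
    using dbar_at_mult[OF has_cones_xdom _ smooth_upto_xdom_derivative smooth_upto_xdom_derivative] A01cD(5)[OF \<alpha>] smooth_fun_xpt[OF f]
    by (simp add: dbar_form_xpt dbar_fun_xpt algebra_simps)
qed (simp add: dbar_form_outside dbar_fun_def)

lemma dbar_form_dbar_fun:
  assumes f: "smooth_fun UNIV f" shows "dbar_form (dbar_fun f) x i v w = 0"
proof (rule form02_cases[of x i])
  fix z assume z: "x = xpt i z" "z \<in> xdom i"
  have "dbar_at (xdom i) (\<lambda>z. dbar_fun f (xpt i z) i w) z v =
      dbar_at (xdom i) (\<lambda>y. dbar_at (xdom i) (\<lambda>z. f (xpt i z)) y w) z v" for v w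
    by (rule dbar_at_cong[OF open_UNIV]) (use z in \<open>auto simp: dbar_fun_xpt\<close>)
  then show ?thesis
    using dbar_at_commute[OF has_cones_xdom, of i UNIV] smooth_fun_xpt[OF f] z
    by (simp add: dbar_form_xpt)
qed (simp add: dbar_form_outside)

lemma Z01_iff: "\<alpha> \<in> Z01 \<longleftrightarrow> \<alpha> \<in> A01c \<and> (\<forall>x i v w. dbar_form \<alpha> x i v w = 0)"
  by (auto simp: Z01_def fun_eq_iff)

lemma Z01_add: "\<alpha> \<in> Z01 \<Longrightarrow> \<beta> \<in> Z01 \<Longrightarrow> \<alpha> + \<beta> \<in> Z01"
  by (simp add: Z01_iff A01c_add dbar_form_add)

lemma dbar_fun_const: "dbar_fun (\<lambda>x. c) x i v = 0"
  by (simp add: dbar_fun_def dbar_at_const[OF has_cones_xdom])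

lemma Z01_form_scale: "\<alpha> \<in> Z01 \<Longrightarrow> form_scale c \<alpha> \<in> Z01"
  using dbar_form_fun_mult[OF smooth_fun_const, of \<alpha> c]
  by (simp add: Z01_iff A01c_form_scale dbar_fun_const) (simp add: form_scale_def)

text \<open>Chart 1 is enough, as it contains the sphere. The primitive is smooth up to the
  boundary, but the equation is imposed on \<open>xdom 1\<close> only and not on any extension into
  the ball.\<close>

definition exact_near :: "complex form01 \<Rightarrow> complex^2 \<Rightarrow> bool" where
  "exact_near \<alpha> c \<longleftrightarrow> (\<exists>r>0. \<exists>u. smooth_upto (xdom 1 \<inter> ball c r) u \<and>
     (\<forall>z\<in>xdom 1 \<inter> ball c r. \<forall>v. dbar_at (xdom 1) u z v = \<alpha> (xpt 1 z) 1 v))"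

section \<open>Translation of bundle data into scalar functions and forms\<close>

locale trivialized_bundle =
  fixes L :: "'v::ab_group_add line_bundle" and \<sigma>\<^sub>0 :: "xbar \<Rightarrow> 'v"
  assumes L: "smooth_line_bundle L" and triv: "trivializing_section L \<sigma>\<^sub>0"
begin

sublocale vs: vector_space "lscale L"
  using L unfolding smooth_line_bundle_def by blast

lemma \<sigma>\<^sub>0_nonzero [simp]: "\<sigma>\<^sub>0 x \<noteq> 0"
  using triv by (simp add: trivializing_section_def)

lemma \<sigma>\<^sub>0_section: "smooth_section L UNIV \<sigma>\<^sub>0"
  using triv by (simp add: trivializing_section_def global_sections_def)

lemma scale_\<sigma>\<^sub>0_eq_iff [simp]: "lscale L a (\<sigma>\<^sub>0 x) = lscale L b (\<sigma>\<^sub>0 x) \<longleftrightarrow> a = b"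
  using \<sigma>\<^sub>0_nonzero by simp

lemma frame_cover: obtains U e where "(U, e) \<in> lframes L" "x \<in> U"
  using L unfolding smooth_line_bundle_def by blast

lemma frameD:
  assumes "(U, e) \<in> lframes L"
  shows "open U" "x \<in> U \<Longrightarrow> e x \<noteq> 0" "x \<in> U \<Longrightarrow> lfibre L x = range (\<lambda>c. lscale L c (e x))"
  using L assms unfolding smooth_line_bundle_def by blast+

lemma \<sigma>\<^sub>0_frame:
  assumes "(V, e) \<in> lframes L"
  obtains g where "smooth_fun V g" "\<And>x. x \<in> V \<Longrightarrow> \<sigma>\<^sub>0 x = lscale L (g x) (e x)" "\<And>x. x \<in> V \<Longrightarrow> g x \<noteq> 0"
proof -
  obtain g where g: "smooth_fun V g" "\<And>x. x \<in> V \<Longrightarrow> \<sigma>\<^sub>0 x = lscale L (g x) (e x)"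
    using \<sigma>\<^sub>0_section assms unfolding smooth_section_def by fastforce
  have "g x \<noteq> 0" if "x \<in> V" for x using g(2)[OF that] \<sigma>\<^sub>0_nonzero[of x] by auto
  then show ?thesis using that g by blast
qed

lemma fibre_iff: "v \<in> lfibre L x \<longleftrightarrow> (\<exists>c. v = lscale L c (\<sigma>\<^sub>0 x))"
proof -
  obtain U e where e: "(U, e) \<in> lframes L" "x \<in> U" by (rule frame_cover)
  obtain g where g: "\<And>x. x \<in> U \<Longrightarrow> \<sigma>\<^sub>0 x = lscale L (g x) (e x)" "\<And>x. x \<in> U \<Longrightarrow> g x \<noteq> 0"
    using \<sigma>\<^sub>0_frame[OF e(1)] by metis
  have "lscale L c (e x) = lscale L (c / g x) (\<sigma>\<^sub>0 x)" for c
    using g e by simp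
  moreover have "lscale L c (\<sigma>\<^sub>0 x) = lscale L (c * g x) (e x)" for c
    using g e by simp
  ultimately show ?thesis unfolding frameD(3)[OF e] by blast
qed

text \<open>Over a local frame write \<open>s = h e\<close> and
  \<open>\<sigma>\<^sub>0 = g e\<close>. The coefficient with respect to
  \<open>\<sigma>\<^sub>0\<close> is \<open>h / g\<close>, which is smooth because \<open>g\<close>
  has no zeros. The local quotients fit together, as the coefficients are unique.\<close>

lemma smooth_section_iff:
  "smooth_section L U s \<longleftrightarrow> (\<exists>f. smooth_fun U f \<and> (\<forall>x\<in>U. s x = lscale L (f x) (\<sigma>\<^sub>0 x)))"
proof
  assume s: "smooth_section L U s"
  define f where "f x = (THE c. s x = lscale L c (\<sigma>\<^sub>0 x))" for x
  have f: "s x = lscale L (f x) (\<sigma>\<^sub>0 x)" if "x \<in> U" for x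
  proof -
    have "s x \<in> lfibre L x" using s that by (simp add: smooth_section_def)
    then obtain c where "s x = lscale L c (\<sigma>\<^sub>0 x)" unfolding fibre_iff by blast
    then show ?thesis by (simp add: f_def)
  qed
  have "smooth_fun U f"
  proof (rule smooth_fun_locally)
    fix x assume "x \<in> U"
    obtain V e where e: "(V, e) \<in> lframes L" "x \<in> V" by (rule frame_cover)
    obtain g where g: "smooth_fun V g" "\<And>x. x \<in> V \<Longrightarrow> \<sigma>\<^sub>0 x = lscale L (g x) (e x)" "\<And>x. x \<in> V \<Longrightarrow> g x \<noteq> 0"
      using \<sigma>\<^sub>0_frame[OF e(1)] by metis
    obtain h where h: "smooth_fun (U \<inter> V) h" "\<And>x. x \<in> U \<inter> V \<Longrightarrow> s x = lscale L (h x) (e x)"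
      using s e(1) unfolding smooth_section_def by fastforce
    have "f y = h y * inverse (g y)" if y: "y \<in> U \<inter> V" for y
    proof -
      have "lscale L (f y * g y) (e y) = lscale L (h y) (e y)"
        using f[of y] g(2)[of y] h(2)[OF y] y by (metis IntD1 IntD2 vs.scale_scale)
      then have "f y * g y = h y" using frameD(2)[OF e(1)] y by simp
      then show ?thesis using g(3)[of y] y by (auto simp: field_simps)
    qed
    then have "smooth_fun (U \<inter> V) f"
      by (subst smooth_fun_cong[of "U \<inter> V" f "\<lambda>y. h y * inverse (g y)"])
        (auto intro!: smooth_fun_mult smooth_fun_inverse h smooth_fun_subset[OF g(1)] g(3))
    then show "\<exists>V. open V \<and> x \<in> V \<and> smooth_fun (U \<inter> V) f" using e frameD(1) by blast
  qed
  then show "\<exists>f. smooth_fun U f \<and> (\<forall>x\<in>U. s x = lscale L (f x) (\<sigma>\<^sub>0 x))" using f by blast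
next
  assume "\<exists>f. smooth_fun U f \<and> (\<forall>x\<in>U. s x = lscale L (f x) (\<sigma>\<^sub>0 x))"
  then obtain f where f: "smooth_fun U f" "\<And>x. x \<in> U \<Longrightarrow> s x = lscale L (f x) (\<sigma>\<^sub>0 x)" by blast
  show "smooth_section L U s"
    unfolding smooth_section_def
  proof (intro conjI ballI, goal_cases)
    case (1 x) then show ?case using f(2) fibre_iff by blast
  next
    case (2 Ve)
    obtain V e where Ve: "Ve = (V, e)" by (cases Ve)
    obtain g where g: "smooth_fun V g" "\<And>x. x \<in> V \<Longrightarrow> \<sigma>\<^sub>0 x = lscale L (g x) (e x)"
      using \<sigma>\<^sub>0_frame 2 unfolding Ve by metis
    have "smooth_fun (U \<inter> V) (\<lambda>x. f x * g x)"
      by (intro smooth_fun_mult smooth_fun_subset[OF f(1)] smooth_fun_subset[OF g(1)]) auto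
    moreover have "\<forall>x\<in>U \<inter> V. s x = lscale L (f x * g x) (e x)" using f(2) g(2) by simp
    ultimately show ?case unfolding Ve by (auto intro!: exI[of _ "\<lambda>x. f x * g x"])
  qed
qed

definition sec :: "(xbar \<Rightarrow> complex) \<Rightarrow> xbar \<Rightarrow> 'v" where
  "sec f = (\<lambda>x. lscale L (f x) (\<sigma>\<^sub>0 x))"

definition tens :: "complex form01 \<Rightarrow> 'v form01" where
  "tens \<alpha> = tensor01 L \<alpha> \<sigma>\<^sub>0"

lemma tens_apply: "tens \<alpha> x i v = lscale L (\<alpha> x i v) (\<sigma>\<^sub>0 x)"
  by (simp add: tens_def tensor01_def)

lemma tens_eq_iff [simp]: "tens \<alpha> = tens \<beta> \<longleftrightarrow> \<alpha> = \<beta>"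
  by (auto simp: fun_eq_iff tens_apply)

lemma tens_add: "tens (\<alpha> + \<beta>) = tens \<alpha> + tens \<beta>"
  by (simp add: fun_eq_iff tens_apply vs.scale_left_distrib)

lemma sec_eq_iff [simp]: "sec f = sec g \<longleftrightarrow> f = g"
  by (auto simp: fun_eq_iff sec_def)

lemma sec_add: "sec (\<lambda>x. f x + g x) = sec f + sec g"
  by (simp add: fun_eq_iff sec_def vs.scale_left_distrib)

lemma sec_1: "sec (\<lambda>x. 1) = \<sigma>\<^sub>0"
  by (simp add: sec_def)

lemma global_sections_iff: "s \<in> global_sections L \<longleftrightarrow> (\<exists>f. smooth_fun UNIV f \<and> s = sec f)"
  unfolding global_sections_def mem_Collect_eq smooth_section_iff by (auto simp: sec_def fun_eq_iff)

lemma sec_global: "smooth_fun UNIV f \<Longrightarrow> sec f \<in> global_sections L"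
  by (auto simp: global_sections_iff)

lemma A01_iff: "\<omega> \<in> A01 L \<longleftrightarrow> (\<exists>\<alpha>\<in>A01c. \<omega> = tens \<alpha>)"
proof
  assume \<omega>: "\<omega> \<in> A01 L"
  define \<alpha> where "\<alpha> x i v = (if x \<in> chart_dom i then (THE c. \<omega> x i v = lscale L c (\<sigma>\<^sub>0 x)) else 0)" for x i v
  have sec: "smooth_section L (chart_dom i) (\<lambda>x. \<omega> x i v)" for i v using \<omega> by (auto simp: A01_def)
  have eq: "\<omega> x i v = lscale L (\<alpha> x i v) (\<sigma>\<^sub>0 x)" for x i v
  proof (cases "x \<in> chart_dom i")
    case True
    then have "\<omega> x i v \<in> lfibre L x" using sec[of i v] by (simp add: smooth_section_def)
    then obtain c where "\<omega> x i v = lscale L c (\<sigma>\<^sub>0 x)" unfolding fibre_iff by blast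
    then show ?thesis using True by (simp add: \<alpha>_def)
  next
    case False
    then show ?thesis using \<omega> by (simp add: \<alpha>_def A01_def)
  qed
  have "\<alpha> \<in> A01c"
    unfolding A01c_iff
  proof (intro conjI allI ballI)
    fix i z v
    show "\<alpha> x i v = 0" if "x \<in> - chart_dom i" for x using that by (simp add: \<alpha>_def)
    show "\<alpha> (xpt i z) i (v + w) = \<alpha> (xpt i z) i v + \<alpha> (xpt i z) i w" if z: "z \<in> xdom i" for w
    proof -
      have "\<omega> (xpt i z) i (v + w) = \<omega> (xpt i z) i v + \<omega> (xpt i z) i w"
        using \<omega> xpt_in_chart_dom[OF z] unfolding A01_def by blast
      then show ?thesis unfolding eq vs.scale_left_distrib[symmetric] by simp
    qed
    show "\<alpha> (xpt i z) i (c *s v) = cnj c * \<alpha> (xpt i z) i v" if z: "z \<in> xdom i" for c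
    proof -
      have "\<omega> (xpt i z) i (c *s v) = lscale L (cnj c) (\<omega> (xpt i z) i v)"
        using \<omega> xpt_in_chart_dom[OF z] unfolding A01_def by blast
      then show ?thesis unfolding eq by simp
    qed
    show "\<alpha> (xpt i z) i v = \<alpha> (xpt i z) j (transD i j z v)" if z: "z \<in> xdom i \<inter> tdom i j" for j
    proof -
      have "xpt i z \<in> chart_dom i \<inter> chart_dom j" using z by (simp add: xpt_in_chart_dom_iff)
      then have "\<omega> (xpt i z) i v = \<omega> (xpt i z) j
          (frechet_derivative (affine_coord j \<circ> affine_pt i) (at (crd i (xpt i z))) v)"
        using \<omega> unfolding A01_def by blast
      then show ?thesis using z unfolding eq by (simp add: frechet_derivative_transition)
    qed
    obtain f where f: "smooth_fun (chart_dom i) f" "\<And>x. x \<in> chart_dom i \<Longrightarrow> \<omega> x i v = lscale L (f x) (\<sigma>\<^sub>0 x)"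
      using sec[of i v] unfolding smooth_section_iff by blast
    have "\<alpha> x i v = f x" if "x \<in> chart_dom i" for x using f(2)[OF that] unfolding eq by simp
    then have "smooth_fun (chart_dom i) (\<lambda>x. \<alpha> x i v)" using f(1) by (subst smooth_fun_cong[of _ _ f]) auto
    then show "smooth_upto (xdom i) (\<lambda>z. \<alpha> (xpt i z) i v)" by (simp add: smooth_fun_chart_iff)
  qed
  moreover have "\<omega> = tens \<alpha>" by (auto simp: fun_eq_iff tens_apply eq)
  ultimately show "\<exists>\<alpha>\<in>A01c. \<omega> = tens \<alpha>" by blast
next
  assume "\<exists>\<alpha>\<in>A01c. \<omega> = tens \<alpha>"
  then obtain \<alpha> where \<alpha>: "\<alpha> \<in> A01c" "\<omega> = tens \<alpha>" by blast
  have sm: "smooth_section L (chart_dom i) (\<lambda>x. \<omega> x i v)" for i v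
    unfolding smooth_section_iff
    using A01cD(5)[OF \<alpha>(1), of i v] by (auto simp: smooth_fun_chart_iff \<alpha>(2) tens_apply intro!: exI[of _ "\<lambda>x. \<alpha> x i v"])
  show "\<omega> \<in> A01 L"
    unfolding A01_def mem_Collect_eq
  proof (intro conjI allI ballI)
    fix i x v
    show "\<omega> x i v = 0" if "x \<in> - chart_dom i"
      using A01cD(1)[OF \<alpha>(1)] that by (simp add: \<alpha>(2) tens_apply)
    show "\<omega> x i (v + w) = \<omega> x i v + \<omega> x i w" if "x \<in> chart_dom i" for w
      using A01cD(2)[OF \<alpha>(1) crd_in_xdom[OF that], of v w] that
      by (simp add: \<alpha>(2) tens_apply vs.scale_left_distrib)
    show "\<omega> x i (c *s v) = lscale L (cnj c) (\<omega> x i v)" if "x \<in> chart_dom i" for c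
      using A01cD(3)[OF \<alpha>(1) crd_in_xdom[OF that], of c v] that by (simp add: \<alpha>(2) tens_apply)
    show "\<omega> x i v = \<omega> x j (frechet_derivative (affine_coord j \<circ> affine_pt i) (at (crd i x)) v)"
      if "x \<in> chart_dom i \<inter> chart_dom j" for j
      using A01cD(4)[OF \<alpha>(1) crd_in_xdom crd_tdom, of x i j v] that
      by (simp add: \<alpha>(2) tens_apply frechet_derivative_transition[OF crd_tdom])
  qed (rule sm)
qed

lemma tens_A01: "\<alpha> \<in> A01c \<Longrightarrow> tens \<alpha> \<in> A01 L"
  by (auto simp: A01_iff)

lemma connection_form_eqI: "\<alpha> \<in> A01c \<Longrightarrow> \<delta> \<sigma>\<^sub>0 = tens \<alpha> \<Longrightarrow> connection_form L \<sigma>\<^sub>0 \<delta> = \<alpha>"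
  unfolding connection_form_def tens_def[symmetric] by (rule the_equality) auto

text \<open>The Leibniz rule gives \<open>\<delta> (f \<sigma>\<^sub>0) = (dbar f + f \<alpha>)
  \<sigma>\<^sub>0\<close>; this is the scalar form on the right.\<close>

definition twisted :: "complex form01 \<Rightarrow> (xbar \<Rightarrow> complex) \<Rightarrow> complex form01" where
  "twisted \<alpha> f = dbar_fun f + (\<lambda>x i v. f x * \<alpha> x i v)"

lemma twisted_A01c: "smooth_fun UNIV f \<Longrightarrow> \<alpha> \<in> A01c \<Longrightarrow> twisted \<alpha> f \<in> A01c"
  unfolding twisted_def by (intro A01c_add dbar_fun_A01c A01c_fun_mult)

text \<open>Applied to \<open>\<delta> \<sigma>\<^sub>0\<close>, the prolongation yields the
  coefficient \<open>dbar \<alpha> - \<alpha> \<and> \<alpha>\<close>, and the wedge square of a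
  scalar form of degree 1 vanishes. So integrability on a line bundle is the linear equation
  \<open>dbar \<alpha> = 0\<close>, which is the source of the affine structure.\<close>

lemma Delta_operator:
  assumes "\<delta> \<in> Delta L"
  shows "connection_form L \<sigma>\<^sub>0 \<delta> \<in> Z01"
    and "smooth_fun UNIV f \<Longrightarrow> \<delta> (sec f) = tens (twisted (connection_form L \<sigma>\<^sub>0 \<delta>) f)"
proof -
  have \<delta>: "\<delta> \<in> global_sections L \<rightarrow>\<^sub>E A01 L"
    "\<And>f s. smooth_fun UNIV f \<Longrightarrow> s \<in> global_sections L \<Longrightarrow>
        \<delta> (fun_section L f s) = tensor01 L (dbar_fun f) s + fun_form L f (\<delta> s)"
    using assms unfolding Delta_def dolbeault_operator_def by auto
  have \<sigma>\<^sub>0: "\<sigma>\<^sub>0 \<in> global_sections L" using triv by (simp add: trivializing_section_def)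
  obtain \<alpha> where \<alpha>: "\<alpha> \<in> A01c" "\<delta> \<sigma>\<^sub>0 = tens \<alpha>" using \<delta>(1) \<sigma>\<^sub>0 A01_iff by blast
  have cf: "connection_form L \<sigma>\<^sub>0 \<delta> = \<alpha>" by (rule connection_form_eqI[of \<alpha> \<delta>, OF \<alpha>])
  obtain D where D: "dolbeault_prolongation L \<delta> D" "D (\<delta> \<sigma>\<^sub>0) = 0"
    using assms \<sigma>\<^sub>0 unfolding Delta_def formally_integrable_def by auto
  have "D (tensor01 L \<alpha> \<sigma>\<^sub>0) = tensor02 L (dbar_form \<alpha>) \<sigma>\<^sub>0 - wedge L \<alpha> (\<delta> \<sigma>\<^sub>0)"
    using D(1) \<alpha>(1) \<sigma>\<^sub>0 unfolding dolbeault_prolongation_def by blast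
  then have "tensor02 L (dbar_form \<alpha>) \<sigma>\<^sub>0 - wedge L \<alpha> (tens \<alpha>) = 0"
    using D(2) unfolding \<alpha>(2) by (simp add: tens_def)
  then have "lscale L (dbar_form \<alpha> x i v w) (\<sigma>\<^sub>0 x) = 0" for x i v w
    by (simp add: fun_eq_iff tensor02_def wedge_def tens_apply mult.commute)
  then show "connection_form L \<sigma>\<^sub>0 \<delta> \<in> Z01"
    using \<alpha>(1) \<sigma>\<^sub>0_nonzero unfolding cf Z01_iff by simp
  show "\<delta> (sec f) = tens (twisted (connection_form L \<sigma>\<^sub>0 \<delta>) f)" if f: "smooth_fun UNIV f"
    using \<delta>(2)[OF f \<sigma>\<^sub>0] unfolding cf \<alpha>(2)
    by (simp add: fun_section_def sec_def tens_def twisted_def fun_form_def tensor01_def fun_eq_iff vs.scale_left_distrib)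
qed

definition operator_of :: "complex form01 \<Rightarrow> (xbar \<Rightarrow> 'v) \<Rightarrow> 'v form01" where
  "operator_of \<alpha> = restrict (\<lambda>s. tens (twisted \<alpha> (THE f. s = sec f))) (global_sections L)"

lemma operator_of_sec: "smooth_fun UNIV f \<Longrightarrow> operator_of \<alpha> (sec f) = tens (twisted \<alpha> f)"
  by (simp add: operator_of_def sec_global)

lemma dbar_fun_add:
  assumes "smooth_fun UNIV f" "smooth_fun UNIV g"
  shows "dbar_fun (\<lambda>x. f x + g x) = dbar_fun f + dbar_fun g"
  unfolding fun_eq_iff
  using dbar_at_add[OF has_cones_xdom crd_in_xdom smooth_upto_xdom_derivative smooth_upto_xdom_derivative]
    smooth_fun_xpt[OF assms(1)] smooth_fun_xpt[OF assms(2)]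
  by (auto simp: dbar_fun_def)

lemma dbar_fun_mult:
  assumes "smooth_fun UNIV f" "smooth_fun UNIV g"
  shows "dbar_fun (\<lambda>x. f x * g x) x i v = dbar_fun f x i v * g x + f x * dbar_fun g x i v"
  using dbar_at_mult[OF has_cones_xdom crd_in_xdom smooth_upto_xdom_derivative smooth_upto_xdom_derivative]
    smooth_fun_xpt[OF assms(1)] smooth_fun_xpt[OF assms(2)]
  by (auto simp: dbar_fun_def)

text \<open>The prolongation has to be \<open>D (\<eta> \<sigma>\<^sub>0) = (dbar \<eta> - \<eta>
  \<and> \<alpha>) \<sigma>\<^sub>0\<close>. For \<open>\<eta> = dbar f + f \<alpha>\<close> with
  closed \<open>\<alpha>\<close> both terms are the wedge product of \<open>dbar f\<close> and
  \<open>\<alpha>\<close>, so they cancel.\<close>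

lemma operator_of_Delta:
  assumes \<alpha>: "\<alpha> \<in> Z01"
  shows "operator_of \<alpha> \<in> Delta L" "connection_form L \<sigma>\<^sub>0 (operator_of \<alpha>) = \<alpha>"
proof -
  have \<alpha>': "\<alpha> \<in> A01c" "\<And>x i v w. dbar_form \<alpha> x i v w = 0" using \<alpha> by (auto simp: Z01_iff)
  have "operator_of \<alpha> \<sigma>\<^sub>0 = tens (twisted \<alpha> (\<lambda>x. 1))"
    using operator_of_sec[OF smooth_fun_const, of \<alpha> 1] by (simp add: sec_1)
  also have "twisted \<alpha> (\<lambda>x. 1) = \<alpha>" by (simp add: twisted_def fun_eq_iff dbar_fun_const)
  finally show "connection_form L \<sigma>\<^sub>0 (operator_of \<alpha>) = \<alpha>" by (rule connection_form_eqI[OF \<alpha>'(1)])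
  have "dolbeault_operator L (operator_of \<alpha>)"
    unfolding dolbeault_operator_def
  proof (intro conjI ballI allI impI)
    have "operator_of \<alpha> s \<in> A01 L" if "s \<in> global_sections L" for s
      using that by (auto simp: global_sections_iff operator_of_sec intro!: tens_A01 twisted_A01c \<alpha>')
    then show "operator_of \<alpha> \<in> global_sections L \<rightarrow>\<^sub>E A01 L"
      by (auto simp: PiE_iff operator_of_def)
  next
    fix s t assume "s \<in> global_sections L" "t \<in> global_sections L"
    then obtain f g where fg: "smooth_fun UNIV f" "smooth_fun UNIV g" "s = sec f" "t = sec g"
      by (auto simp: global_sections_iff)
    have "twisted \<alpha> (\<lambda>x. f x + g x) = twisted \<alpha> f + twisted \<alpha> g"
      by (simp add: twisted_def dbar_fun_add fg fun_eq_iff algebra_simps)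
    then show "operator_of \<alpha> (s + t) = operator_of \<alpha> s + operator_of \<alpha> t"
      using fg by (simp add: sec_add[symmetric] operator_of_sec smooth_fun_add tens_add)
  next
    fix f s assume f: "smooth_fun UNIV f" and "s \<in> global_sections L"
    then obtain g where g: "smooth_fun UNIV g" "s = sec g" by (auto simp: global_sections_iff)
    have "fun_section L f s = sec (\<lambda>x. f x * g x)" by (simp add: g fun_section_def sec_def)
    then show "operator_of \<alpha> (fun_section L f s) = tensor01 L (dbar_fun f) s + fun_form L f (operator_of \<alpha> s)"
      using f g by (simp add: operator_of_sec smooth_fun_mult)
        (simp add: fun_eq_iff tens_apply twisted_def dbar_fun_mult tensor01_def sec_def fun_form_def
          vs.scale_left_distrib vs.scale_right_distrib algebra_simps)
  qed
  moreover have "formally_integrable L (operator_of \<alpha>)"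
  proof -
    define D where "D \<omega> = (let \<eta> = (THE \<eta>. \<omega> = tens \<eta>) in
      (\<lambda>x i v w. lscale L (dbar_form \<eta> x i v w - (\<eta> x i v * \<alpha> x i w - \<eta> x i w * \<alpha> x i v)) (\<sigma>\<^sub>0 x)))" for \<omega>
    have D: "D (tens \<eta>) = (\<lambda>x i v w. lscale L (dbar_form \<eta> x i v w - (\<eta> x i v * \<alpha> x i w - \<eta> x i w * \<alpha> x i v)) (\<sigma>\<^sub>0 x))" for \<eta>
      by (simp add: D_def)
    have "dolbeault_prolongation L (operator_of \<alpha>) D"
      unfolding dolbeault_prolongation_def
    proof (intro conjI ballI)
      fix \<omega> \<omega>' assume "\<omega> \<in> A01 L" "\<omega>' \<in> A01 L"
      then obtain \<eta> \<eta>' where \<eta>: "\<eta> \<in> A01c" "\<eta>' \<in> A01c" "\<omega> = tens \<eta>" "\<omega>' = tens \<eta>'" by (auto simp: A01_iff)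
      show "D (\<omega> + \<omega>') = D \<omega> + D \<omega>'"
        unfolding \<eta>(3,4) tens_add[symmetric] D
        by ((rule ext)+, simp only: plus_fun_apply dbar_form_add[OF \<eta>(1,2)] vs.scale_left_distrib[symmetric]
          scale_\<sigma>\<^sub>0_eq_iff) (simp add: algebra_simps)
    next
      fix \<beta> s assume \<beta>: "\<beta> \<in> A01c" and "s \<in> global_sections L"
      then obtain f where f: "smooth_fun UNIV f" "s = sec f" by (auto simp: global_sections_iff)
      have "tensor01 L \<beta> s = tens (\<lambda>x i v. f x * \<beta> x i v)"
        by (simp add: fun_eq_iff f tens_apply tensor01_def sec_def mult.commute)
      then show "D (tensor01 L \<beta> s) = tensor02 L (dbar_form \<beta>) s - wedge L \<beta> (operator_of \<alpha> s)"
        unfolding f(2) operator_of_sec[OF f(1)]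
        by (simp only: D) ((rule ext)+, simp only: minus_apply dbar_form_fun_mult[OF f(1) \<beta>] tensor02_def wedge_def
          sec_def tens_apply vs.scale_scale vs.scale_left_diff_distrib[symmetric] scale_\<sigma>\<^sub>0_eq_iff,
          simp add: twisted_def algebra_simps)
    qed
    moreover have "D (operator_of \<alpha> s) = 0" if s: "s \<in> global_sections L" for s
    proof -
      obtain f where f: "smooth_fun UNIV f" "s = sec f" using s unfolding global_sections_iff by blast
      have "dbar_form (twisted \<alpha> f) x i v w = dbar_fun f x i v * \<alpha> x i w - dbar_fun f x i w * \<alpha> x i v" for x i v w
        unfolding twisted_def
        by (simp add: dbar_form_add[OF dbar_fun_A01c[OF f(1)] A01c_fun_mult[OF f(1) \<alpha>'(1)]]
          dbar_form_dbar_fun[OF f(1)] dbar_form_fun_mult[OF f(1) \<alpha>'(1)] \<alpha>'(2))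
      then show ?thesis
        by (simp add: f operator_of_sec D fun_eq_iff) (simp add: twisted_def algebra_simps)
    qed
    ultimately show ?thesis unfolding formally_integrable_def by blast
  qed
  ultimately show "operator_of \<alpha> \<in> Delta L" by (simp add: Delta_def)
qed

end

section \<open>Holomorphic frames and local primitives\<close>

lemma xbar_boundary_eq: "xbar_boundary = xpt 1 ` sphere 0 1"
proof (intro set_eqI iffI)
  fix x assume "x \<in> xbar_boundary"
  then obtain z where z: "norm z = 1" "Rep_xbar x = affine_pt 1 z" by (auto simp: xbar_boundary_def)
  then have "xpt 1 z = x" by (simp add: xpt_def z(2)[symmetric] Rep_xbar_inverse)
  then show "x \<in> xpt 1 ` sphere 0 1" using z by (auto intro!: image_eqI[of _ _ z])
next
  fix x assume "x \<in> xpt 1 ` sphere 0 1"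
  then obtain z where z: "norm z = 1" "x = xpt 1 z" by auto
  then have "Rep_xbar x = affine_pt 1 z" by (simp add: Rep_xpt xdom_1_iff)
  then show "x \<in> xbar_boundary" using z by (auto simp: xbar_boundary_def)
qed

text \<open>In homogeneous coordinates \<open>Z\<close> the condition \<open>norm (rest 1 Z - Z$1 *s c) > t * norm (Z$1)\<close> describes
  the complement of a closed ball around \<open>c\<close>, including the points at infinity.\<close>

lemma smooth_fun_extend_by_0:
  assumes u: "smooth_upto (xdom 1 \<inter> ball c r) h" and t: "0 < t" "t < r"
    and h0: "\<And>z. z \<in> xdom 1 \<Longrightarrow> dist c z > t \<Longrightarrow> z \<in> ball c r \<Longrightarrow> h z = 0"
  shows "smooth_fun UNIV (\<lambda>x. if x \<in> chart_dom 1 \<and> crd 1 x \<in> ball c r then h (crd 1 x) else 0)"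
  (is "smooth_fun UNIV ?f")
  unfolding smooth_fun_iff
proof (intro allI smooth_upto_locally)
  fix i z assume "z \<in> chart_pre i UNIV"
  then have z: "z \<in> xdom i" by (simp add: chart_pre_def)
  have pre: "chart_pre i UNIV = xdom i" by (simp add: chart_pre_def)
  define Z where "Z = homog i"
  have cZ: "continuous_on UNIV Z" unfolding Z_def by (rule smooth_open_continuous[OF smooth_open_homog])
  define V1 where "V1 = tdom i 1 \<inter> trans i 1 -` ball c r"
  define V2 where "V2 = {y. norm (rest 1 (Z y) - Z y$1 *s c) > t * norm (Z y$1)}"
  have V1: "open V1" unfolding V1_def
    using smooth_open_continuous[OF smooth_open_trans[of i 1]] open_tdom[of i 1]
    by (metis continuous_on_open_vimage open_ball Int_commute)
  have V2: "open V2" unfolding V2_def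
    by (intro open_Collect_less continuous_intros cZ bounded_linear.continuous_on[OF bounded_linear_rest]
      bounded_linear.continuous_on[OF bounded_bilinear.bounded_linear_left[OF bounded_bilinear_smult]])
  have tr: "norm (rest 1 (Z y) - Z y$1 *s c) = norm (Z y$1) * dist c (trans i 1 y)" if "y \<in> tdom i 1" for y
  proof -
    have 1: "rest 1 (Z y) - Z y$1 *s c = Z y$1 *s (trans i 1 y - c)"
      using that by (simp add: trans_def dehom_def Z_def tdom_def vec_eq_iff right_diff_distrib)
    have 2: "norm (a *s v) = norm a * norm v" for a :: complex and v :: "complex^2"
      by (simp add: norm_vec_def L2_set_def norm_mult power_mult_distrib sum_distrib_left[symmetric] real_sqrt_mult)
    show ?thesis unfolding 1 2 by (simp add: dist_norm norm_minus_commute)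
  qed
  have "z \<in> V1 \<or> z \<in> V2"
  proof (cases "z \<in> tdom i 1")
    case True
    have pos: "norm (Z z$1) > 0" using True by (simp add: tdom_def Z_def)
    show ?thesis
    proof (cases "dist c (trans i 1 z) < r")
      case True then show ?thesis using \<open>z \<in> tdom i 1\<close> by (simp add: V1_def)
    next
      case False
      then have "t < dist c (trans i 1 z)" using t by simp
      then show ?thesis using pos tr[OF \<open>z \<in> tdom i 1\<close>] by (simp add: V2_def mult.commute)
    qed
  next
    case False
    then have "Z z$1 = 0" by (simp add: tdom_def Z_def)
    moreover have "rest 1 (Z z) \<noteq> 0"
    proof
      assume "rest 1 (Z z) = 0"
      then have "Z z = Z z$1 *s axis 1 1" using hlin_rest[of 1 "Z z"]
        by (simp add: linear_0[OF bounded_linear.linear[OF bounded_linear_hlin]])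
      then show False using \<open>Z z$1 = 0\<close> homog_nonzero[of i z] by (simp add: Z_def)
    qed
    ultimately show ?thesis by (simp add: V2_def)
  qed
  moreover have "smooth_upto (xdom i \<inter> V1) (\<lambda>z. ?f (xpt i z))"
  proof -
    have "smooth_upto (xdom i \<inter> V1) (\<lambda>z. h (trans i 1 z))"
      by (rule smooth_upto_compose_inner[OF u smooth_open_trans]) (auto simp: V1_def trans_in_xdom)
    moreover have "?f (xpt i y) = h (trans i 1 y)" if "y \<in> xdom i \<inter> V1" for y
      using that crd_trans[of "xpt i y" i 1] by (auto simp: V1_def xpt_in_chart_dom_iff)
    ultimately show ?thesis by (subst smooth_upto_cong)
  qed
  moreover have "smooth_upto (xdom i \<inter> V2) (\<lambda>z. ?f (xpt i z))"
  proof -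
    have "?f (xpt i y) = 0" if y: "y \<in> xdom i \<inter> V2" for y
    proof (cases "y \<in> tdom i 1")
      case True
      have "norm (Z y$1) > 0" using True by (simp add: tdom_def Z_def)
      then have "dist c (trans i 1 y) > t" using y tr[OF True] by (simp add: V2_def mult.commute)
      moreover have "crd 1 (xpt i y) = trans i 1 y" using crd_trans[of "xpt i y" i 1] y True
        by (simp add: xpt_in_chart_dom_iff)
      ultimately show ?thesis using h0[of "trans i 1 y"] y True by (auto simp: trans_in_xdom)
    qed (use y in \<open>simp add: xpt_in_chart_dom_iff\<close>)
    then show ?thesis by (subst smooth_upto_cong[where g="\<lambda>y. 0"]) (auto intro: smooth_intros)
  qed
  ultimately show "\<exists>V. open V \<and> z \<in> V \<and> smooth_upto (chart_pre i UNIV \<inter> V) (\<lambda>z. ?f (xpt i z))"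
    unfolding pre using V1 V2 by (elim disjE) (rule exI, intro conjI, assumption+)+
qed

context trivialized_bundle
begin

lemma frame_imp_exact_near:
  assumes \<delta>: "\<delta> \<in> Delta L" and c: "c \<in> xdom 1" and fr: "holomorphic_frame_around L \<delta> (xpt 1 c) U \<sigma>"
  shows "exact_near (connection_form L \<sigma>\<^sub>0 \<delta>) c"
proof -
  define \<alpha> where "\<alpha> = connection_form L \<sigma>\<^sub>0 \<delta>"
  have U: "open U" "xpt 1 c \<in> U" "smooth_section L U \<sigma>" "\<And>y. y \<in> U \<Longrightarrow> \<sigma> y \<noteq> 0" "vanishes_on L \<delta> U \<sigma>"
    using fr by (auto simp: holomorphic_frame_around_def)
  obtain f where f: "smooth_fun U f" "\<And>x. x \<in> U \<Longrightarrow> \<sigma> x = lscale L (f x) (\<sigma>\<^sub>0 x)"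
    using U(3) unfolding smooth_section_iff by blast
  have f0: "f x \<noteq> 0" if "x \<in> U" for x using U(4)[OF that] f(2)[OF that] by auto
  define F where "F z = f (xpt 1 z)" for z
  obtain W where W: "open W" "chart_pre 1 U = xdom 1 \<inter> W" using U(1) by (rule open_chart_pre)
  have F: "smooth_upto (xdom 1 \<inter> W) F"
    using f(1) unfolding smooth_fun_iff W(2)[symmetric] F_def by blast
  have inU: "xpt 1 z \<in> U" if "z \<in> xdom 1 \<inter> W" for z using that W(2) by (auto simp: chart_pre_def)
  have dF: "dbar_at (xdom 1) F z v = - (F z * \<alpha> (xpt 1 z) 1 v)" if z: "z \<in> xdom 1 \<inter> W" for z v
  proof -
    \<comment> \<open>The operator acts on global sections, so the equation at a point is read off a
      global section that agrees with the frame nearby.\<close>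
    obtain V s where Vs: "open V \<and> xpt 1 z \<in> V \<and> V \<subseteq> U \<and> s \<in> global_sections L \<and>
        (\<forall>x\<in>V. s x = \<sigma> x) \<and> (\<forall>x\<in>V. \<delta> s x = 0)"
      using bspec[OF U(5)[unfolded vanishes_on_def] inU[OF z]] by (elim exE) (rule that)
    then have V: "open V" "xpt 1 z \<in> V" "V \<subseteq> U" "s \<in> global_sections L"
      "\<And>x. x \<in> V \<Longrightarrow> s x = \<sigma> x" "\<And>x. x \<in> V \<Longrightarrow> \<delta> s x = 0" by auto
    obtain g where g: "smooth_fun UNIV g" "s = sec g" using V(4) unfolding global_sections_iff by blast
    have "tens (twisted \<alpha> g) (xpt 1 z) 1 v = 0"
      using V(6)[OF V(2)] unfolding g(2) Delta_operator(2)[OF \<delta> g(1)] \<alpha>_def by simp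
    then have eq: "dbar_fun g (xpt 1 z) 1 v + g (xpt 1 z) * \<alpha> (xpt 1 z) 1 v = 0"
      by (simp add: tens_apply twisted_def)
    have gf: "g x = f x" if "x \<in> V" for x
      using V(5)[OF that] f(2)[of x] V(3) that unfolding g(2) sec_def by auto
    obtain W' where W': "open W'" "chart_pre 1 V = xdom 1 \<inter> W'" using V(1) by (rule open_chart_pre)
    have "dbar_fun g (xpt 1 z) 1 v = dbar_at (xdom 1) (\<lambda>z. g (xpt 1 z)) z v"
      using z by (simp add: dbar_fun_xpt)
    also have "\<dots> = dbar_at (xdom 1) F z v"
      by (rule dbar_at_cong[OF W'(1)]) (use z V(2) W'(2) gf in \<open>auto simp: F_def chart_pre_def\<close>)
    finally show ?thesis using eq gf[OF V(2)] by (simp add: F_def add_eq_0_iff)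
  qed
  have cW: "c \<in> xdom 1 \<inter> W" using U(2) c W(2) by (auto simp: chart_pre_def)
  have Fc: "F c \<noteq> 0" using f0[OF inU[OF cW]] by (simp add: F_def)
  \<comment> \<open>Division by the constant \<open>F c\<close> moves the values near
    \<open>c\<close> into the disc of radius 1 around 1, away from the branch cut of
    \<open>Ln\<close>, and does not affect logarithmic derivatives.\<close>
  have "continuous_on (xdom 1 \<inter> W) (\<lambda>z. F z / F c)"
    by (intro continuous_intros smooth_upto_continuous[OF F]) (use Fc in auto)
  then obtain d where d: "d > 0" "\<And>z. z \<in> xdom 1 \<inter> W \<Longrightarrow> dist z c < d \<Longrightarrow> dist (F z / F c) (F c / F c) < 1"
    using cW unfolding continuous_on_iff by (metis zero_less_one)
  obtain d' where d': "d' > 0" "ball c d' \<subseteq> W" using W(1) cW unfolding open_contains_ball by blast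
  define r where "r = min d d'"
  have r: "r > 0" "\<And>z. z \<in> xdom 1 \<inter> ball c r \<Longrightarrow> z \<in> xdom 1 \<inter> W"
    "\<And>z. z \<in> xdom 1 \<inter> ball c r \<Longrightarrow> norm (F z / F c - 1) < 1"
    using d d' Fc by (auto simp: r_def dist_norm norm_minus_commute subset_iff)
  have slit: "F z / F c \<in> - \<real>\<^sub>\<le>\<^sub>0" if "z \<in> xdom 1 \<inter> ball c r" for z
  proof -
    have "\<bar>Re (F z / F c - 1)\<bar> < 1" using r(3)[OF that] abs_Re_le_cmod by (rule le_less_trans[rotated])
    then have "Re (F z / F c) > 0" by auto
    then show ?thesis by (auto simp: complex_nonpos_Reals_iff)
  qed
  define u where "u z = - Ln (F z / F c)" for z
  have "smooth_upto (xdom 1 \<inter> ball c r) (\<lambda>z. F z * inverse (F c))"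
    by (intro smooth_intros smooth_upto_subset[OF F]) (use r(2) in auto)
  then have "smooth_upto (xdom 1 \<inter> ball c r) (\<lambda>z. Ln (F z / F c))"
    by (intro smooth_upto_compose_outer[OF smooth_open_Ln]) (use slit in \<open>auto simp: divide_inverse\<close>)
  then have "smooth_upto (xdom 1 \<inter> ball c r) u"
    unfolding u_def by (rule smooth_upto_linear_compose[OF bounded_linear_minus[OF bounded_linear_ident]])
  moreover have "dbar_at (xdom 1) u z v = \<alpha> (xpt 1 z) 1 v" if z: "z \<in> xdom 1 \<inter> ball c r" for z v
  proof -
    have zW: "z \<in> xdom 1 \<inter> W" using r(2)[OF z] .
    have Fz: "F z \<noteq> 0" using f0[OF inU[OF zW]] by (simp add: F_def)
    have "((\<lambda>w. - Ln (w / F c)) has_field_derivative - (1 / F z)) (at (F z))"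
      using slit[OF z] Fz Fc by (auto intro!: derivative_eq_intros simp: field_simps)
    from dbar_at_holomorphic_outer[OF has_cones_xdom _ smooth_upto_has_derivative[OF has_cones_xdom F W(1)] this]
    have "dbar_at (xdom 1) u z v = - (1 / F z) * dbar_at (xdom 1) F z v"
      using zW by (simp add: u_def[abs_def])
    then show ?thesis using dF[OF zW] Fz by simp
  qed
  ultimately show ?thesis unfolding exact_near_def \<alpha>_def[symmetric] using r(1) by blast
qed

text \<open>Operators act on global sections, so the local solution \<open>exp (- u)\<close> is
  multiplied by a cut-off and extended by 0 to all of \<open>xbar\<close>. On a smaller ball, where
  the cut-off is 1, the product is nowhere zero and solves the equation.\<close>

lemma exact_near_imp_frame:
  assumes \<delta>: "\<delta> \<in> Delta L" and c: "c \<in> xdom 1" and ex: "exact_near (connection_form L \<sigma>\<^sub>0 \<delta>) c"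
  shows "\<exists>U \<sigma>. holomorphic_frame_around L \<delta> (xpt 1 c) U \<sigma>"
proof -
  define \<alpha> where "\<alpha> = connection_form L \<sigma>\<^sub>0 \<delta>"
  have \<alpha>: "\<alpha> \<in> A01c" using Delta_operator(1)[OF \<delta>] by (simp add: \<alpha>_def Z01_iff)
  obtain r u where r: "r > 0" and u: "smooth_upto (xdom 1 \<inter> ball c r) u"
    and du: "\<And>z v. z \<in> xdom 1 \<inter> ball c r \<Longrightarrow> dbar_at (xdom 1) u z v = \<alpha> (xpt 1 z) 1 v"
    using ex unfolding exact_near_def \<alpha>_def by blast
  define t where "t = r / 2"
  define b where "b z = complex_of_real (smooth_step (3 * t\<^sup>2 / 4) (t\<^sup>2 - (norm (z - c))\<^sup>2))" for z :: "complex^2"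
  have b: "smooth_open UNIV b"
    unfolding b_def[abs_def] power2_norm_eq_inner by (intro smooth_intros open_UNIV) (use r in \<open>auto simp: t_def\<close>)
  have b0: "b z = 0" if "dist c z > t" for z
  proof -
    have "t\<^sup>2 \<le> (norm (z - c))\<^sup>2" using that r by (intro power_mono) (auto simp: dist_norm norm_minus_commute t_def)
    then show ?thesis unfolding b_def by (subst smooth_step_eq_0) auto
  qed
  have b1: "b z = 1" if "dist c z \<le> t / 2" for z
  proof -
    have "(norm (z - c))\<^sup>2 \<le> (t / 2)\<^sup>2" using that by (intro power_mono) (auto simp: dist_norm norm_minus_commute)
    then show ?thesis unfolding b_def using r by (subst smooth_step_eq_1) (auto simp: t_def power_divide)
  qed
  define h where "h z = b z * exp (- u z)" for z
  have exp: "smooth_open UNIV (exp :: complex \<Rightarrow> complex)"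
    by (intro smooth_open_exp smooth_open_ident open_UNIV)
  have "smooth_upto (xdom 1 \<inter> ball c r) (\<lambda>z. - u z)"
    by (rule smooth_upto_linear_compose[OF bounded_linear_minus[OF bounded_linear_ident] u])
  then have h: "smooth_upto (xdom 1 \<inter> ball c r) h"
    unfolding h_def by (intro smooth_intros smooth_upto_compose_outer[OF exp] smooth_upto_smooth_open[OF b]) auto
  define f where "f x = (if x \<in> chart_dom 1 \<and> crd 1 x \<in> ball c r then h (crd 1 x) else 0)" for x
  have f: "smooth_fun UNIV f"
    unfolding f_def by (rule smooth_fun_extend_by_0[OF h, where t=t]) (use r in \<open>auto simp: t_def h_def intro: b0[unfolded t_def]\<close>)
  define U where "U = {x \<in> chart_dom 1. crd 1 x \<in> ball c (t / 2)}"
  have U: "open U" unfolding U_def by (rule open_chart_set[OF open_ball])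
  have sub: "ball c (t / 2) \<subseteq> ball c r" using r by (auto simp: t_def)
  have fx: "f (xpt 1 z) = exp (- u z)" if "z \<in> xdom 1" "z \<in> ball c (t / 2)" for z
    using that sub b1[of z] by (auto simp: f_def h_def)
  have tw: "twisted \<alpha> f x i v = 0" if x: "x \<in> U" for x i v
  proof (rule A01c_eq_0[OF twisted_A01c[OF f \<alpha>], of _ 1])
    show x1: "x \<in> chart_dom 1" using x by (simp add: U_def)
    fix v
    define z where "z = crd 1 x"
    have z: "z \<in> xdom 1" "z \<in> ball c (t / 2)" "x = xpt 1 z" using x by (auto simp: U_def z_def)
    have zr: "z \<in> xdom 1" "z \<in> ball c r" using z sub by auto
    have "dbar_fun f x 1 v = dbar_at (xdom 1) (\<lambda>z. f (xpt 1 z)) z v"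
      using z by (simp add: dbar_fun_xpt)
    also have "\<dots> = dbar_at (xdom 1) (\<lambda>z. exp (- u z)) z v"
      by (rule dbar_at_cong[OF open_ball[of c "t/2"]]) (use z fx in auto)
    also have "\<dots> = - exp (- u z) * dbar_at (xdom 1) u z v"
      by (rule dbar_at_holomorphic_outer[OF has_cones_xdom zr(1) smooth_upto_has_derivative[OF has_cones_xdom u open_ball zr]])
        (auto intro!: derivative_eq_intros)
    also have "\<dots> = - f x * \<alpha> x 1 v" using du[of z v] zr fx[OF z(1,2)] z(3) by simp
    finally show "twisted \<alpha> f x 1 v = 0" by (simp add: twisted_def)
  qed
  have "holomorphic_frame_around L \<delta> (xpt 1 c) U (sec f)"
    unfolding holomorphic_frame_around_def vanishes_on_def
  proof (intro conjI ballI)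
    show "xpt 1 c \<in> U" using c r by (simp add: U_def t_def)
    show "smooth_section L U (sec f)"
      unfolding smooth_section_iff using smooth_fun_subset[OF f subset_UNIV] by (auto simp: sec_def)
    show "sec f y \<noteq> 0" if "y \<in> U" for y
      using that fx[of "crd 1 y"] by (simp add: U_def sec_def)
    show "\<exists>V s. open V \<and> y \<in> V \<and> V \<subseteq> U \<and> s \<in> global_sections L \<and> (\<forall>x\<in>V. s x = sec f x) \<and> (\<forall>x\<in>V. \<delta> s x = 0)"
      if "y \<in> U" for y
      using that U sec_global[OF f] tw
      by (intro exI[of _ U] exI[of _ "sec f"])
        (auto simp: Delta_operator(2)[OF \<delta> f] \<alpha>_def[symmetric] tens_apply fun_eq_iff)
  qed (rule U)
  then show ?thesis by blast
qed

lemma Delta_at_eq: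
  assumes "c \<in> sphere 0 1"
  shows "Delta_at L (xpt 1 c) = {\<delta> \<in> Delta L. exact_near (connection_form L \<sigma>\<^sub>0 \<delta>) c}"
proof -
  have "c \<in> xdom 1" using assms by (simp add: xdom_1_iff)
  then show ?thesis unfolding Delta_at_def using frame_imp_exact_near exact_near_imp_frame by blast
qed

lemma connection_form_image:
  "connection_form L \<sigma>\<^sub>0 ` {\<delta> \<in> Delta L. P (connection_form L \<sigma>\<^sub>0 \<delta>)} = {\<alpha> \<in> Z01. P \<alpha>}"
proof (intro set_eqI iffI)
  fix \<alpha> assume "\<alpha> \<in> {\<alpha> \<in> Z01. P \<alpha>}"
  then show "\<alpha> \<in> connection_form L \<sigma>\<^sub>0 ` {\<delta> \<in> Delta L. P (connection_form L \<sigma>\<^sub>0 \<delta>)}"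
    using operator_of_Delta[of \<alpha>] by (auto intro!: image_eqI[of _ _ "operator_of \<alpha>"])
qed (auto simp: Delta_operator(1))

end

section \<open>Convergence of forms\<close>

lemma frechet_derivative_cong_within:
  assumes "x \<in> S" "\<And>y. y \<in> S \<Longrightarrow> f y = g y"
  shows "frechet_derivative f (at x within S) = frechet_derivative g (at x within S)"
proof -
  have "(f has_derivative D) (at x within S) \<longleftrightarrow> (g has_derivative D) (at x within S)" for D
    using has_derivative_transform[OF assms(1), of f g D] has_derivative_transform[OF assms(1), of g f D] assms(2)
    by auto
  then show ?thesis by (simp add: frechet_derivative_def)
qed

lemma iter_deriv_cong:
  assumes "\<And>y. y \<in> S \<Longrightarrow> f y = g y" "x \<in> S"
  shows "iter_deriv S vs f x = iter_deriv S vs g x"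
  using assms(2)
proof (induction vs arbitrary: x)
  case (Cons v vs)
  have "frechet_derivative (iter_deriv S vs f) (at x within S) = frechet_derivative (iter_deriv S vs g) (at x within S)"
    by (rule frechet_derivative_cong_within) (use Cons in auto)
  then show ?case by simp
qed (use assms in simp)

lemma smooth_upto_iter_deriv': "has_cones S \<Longrightarrow> smooth_upto S f \<Longrightarrow> smooth_upto S (iter_deriv S vs f)"
  using smooth_upto_iter_deriv[of S UNIV f vs] by simp

lemma smooth_upto_has_derivative':
  "has_cones S \<Longrightarrow> smooth_upto S f \<Longrightarrow> x \<in> S \<Longrightarrow> (f has_derivative frechet_derivative f (at x within S)) (at x within S)"
  using smooth_upto_has_derivative[of S UNIV f x] by simp

lemma iter_deriv_add_mult:
  fixes f g :: "'a::real_normed_vector \<Rightarrow> complex"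
  assumes S: "has_cones S" and f: "smooth_upto S f" and g: "smooth_upto S g" and x: "x \<in> S"
  shows "iter_deriv S vs (\<lambda>y. f y + c * g y) x = iter_deriv S vs f x + c * iter_deriv S vs g x"
  using x
proof (induction vs arbitrary: x)
  case (Cons v vs)
  have "((\<lambda>y. iter_deriv S vs f y + c * iter_deriv S vs g y) has_derivative
      (\<lambda>v. frechet_derivative (iter_deriv S vs f) (at x within S) v + c * frechet_derivative (iter_deriv S vs g) (at x within S) v))
      (at x within S)"
    by (intro has_derivative_add has_derivative_mult_right smooth_upto_has_derivative' smooth_upto_iter_deriv' S f g Cons.prems)
  from has_cones_frechet_derivative[OF S Cons.prems this]
  have "frechet_derivative (\<lambda>y. iter_deriv S vs f y + c * iter_deriv S vs g y) (at x within S) v =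
     iter_deriv S (v # vs) f x + c * iter_deriv S (v # vs) g x" by simp
  moreover have "frechet_derivative (iter_deriv S vs (\<lambda>y. f y + c * g y)) (at x within S) =
      frechet_derivative (\<lambda>y. iter_deriv S vs f y + c * iter_deriv S vs g y) (at x within S)"
    by (rule frechet_derivative_cong_within) (use Cons in auto)
  ultimately show ?case by simp
qed simp

lemma iter_deriv_linear_compose:
  fixes f :: "'a::real_normed_vector \<Rightarrow> complex"
  assumes S: "has_cones S" and f: "smooth_upto S f" and P: "bounded_linear P" "P ` S \<subseteq> S" and x: "x \<in> S"
  shows "iter_deriv S vs (\<lambda>y. f (P y)) x = iter_deriv S (map P vs) f (P x)"
  using x
proof (induction vs arbitrary: x)
  case (Cons v vs)
  let ?h = "iter_deriv S (map P vs) f"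
  have Px: "P x \<in> S" using P(2) Cons.prems by auto
  have "(?h has_derivative frechet_derivative ?h (at (P x) within S)) (at (P x) within P ` S)"
    by (rule has_derivative_subset[OF smooth_upto_has_derivative'[OF S smooth_upto_iter_deriv'[OF S f] Px] P(2)])
  from has_derivative_in_compose[OF bounded_linear_imp_has_derivative[OF P(1)] this]
  have "((\<lambda>y. ?h (P y)) has_derivative (\<lambda>v. frechet_derivative ?h (at (P x) within S) (P v))) (at x within S)" .
  from has_cones_frechet_derivative[OF S Cons.prems this]
  have "frechet_derivative (\<lambda>y. ?h (P y)) (at x within S) v = iter_deriv S (map P (v # vs)) f (P x)" by simp
  moreover have "frechet_derivative (iter_deriv S vs (\<lambda>y. f (P y))) (at x within S) = frechet_derivative (\<lambda>y. ?h (P y)) (at x within S)"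
    by (rule frechet_derivative_cong_within) (use Cons in auto)
  ultimately show ?case by simp
qed simp

lemma smooth_upto_bounded_on_compact:
  fixes f :: "'a::real_normed_vector \<Rightarrow> complex"
  assumes "smooth_upto S f" "compact K" "K \<subseteq> S" obtains M where "M \<ge> 0" "\<forall>y\<in>K. norm (f y) \<le> M"
proof -
  have "compact (f ` K)"
    by (rule compact_continuous_image[OF continuous_on_subset[OF smooth_upto_continuous[OF assms(1)] assms(3)] assms(2)])
  then obtain M where "\<forall>y\<in>K. norm (f y) \<le> M" using compact_imp_bounded bounded_iff by (metis imageI)
  then show ?thesis using that[of "max M 0"] by (meson max.cobounded1 max.cobounded2 order_trans)
qed

text \<open>A map close to the identity changes the directions of differentiation in the chain rule;
  this bounds the effect. The induction is from the end of the list, where the innermost derivative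
  stands: it is linear in its direction, and it is again smooth up to the boundary, which is why
  \<open>f\<close> is generalised.\<close>

lemma iter_deriv_perturbed_directions:
  fixes f :: "'a::real_normed_vector \<Rightarrow> complex"
  assumes S: "has_cones S" and K: "compact K" "K \<subseteq> S" and f: "smooth_upto S f"
  shows "\<exists>C\<ge>0. \<forall>e y. \<bar>e\<bar> \<le> 1 \<longrightarrow> y \<in> K \<longrightarrow>
    norm (iter_deriv S (map (\<lambda>v. v + e *\<^sub>R P v) vs) f y - iter_deriv S vs f y) \<le> C * \<bar>e\<bar>"
  using f
proof (induction vs arbitrary: f rule: rev_induct)
  case (snoc u vs)
  define D where "D w = (\<lambda>x. frechet_derivative f (at x within S) w)" for w
  have D: "smooth_upto S (D w)" for w
    using smooth_upto_iter_deriv'[OF S snoc.prems, of "[w]"] by (simp add: D_def)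
  obtain C1 where C1: "C1 \<ge> 0" "\<And>e y. \<bar>e\<bar> \<le> 1 \<Longrightarrow> y \<in> K \<Longrightarrow>
    norm (iter_deriv S (map (\<lambda>v. v + e *\<^sub>R P v) vs) (D u) y - iter_deriv S vs (D u) y) \<le> C1 * \<bar>e\<bar>"
    using snoc.IH[OF D[of u]] by blast
  obtain C2 where C2: "C2 \<ge> 0" "\<And>e y. \<bar>e\<bar> \<le> 1 \<Longrightarrow> y \<in> K \<Longrightarrow>
    norm (iter_deriv S (map (\<lambda>v. v + e *\<^sub>R P v) vs) (D (P u)) y - iter_deriv S vs (D (P u)) y) \<le> C2 * \<bar>e\<bar>"
    using snoc.IH[OF D[of "P u"]] by blast
  obtain M where M: "M \<ge> 0" "\<forall>y\<in>K. norm (iter_deriv S vs (D (P u)) y) \<le> M"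
    by (rule smooth_upto_bounded_on_compact[OF smooth_upto_iter_deriv'[OF S D] K])
  have "norm (iter_deriv S (map (\<lambda>v. v + e *\<^sub>R P v) (vs @ [u])) f y - iter_deriv S (vs @ [u]) f y) \<le> (C1 + (C2 + M)) * \<bar>e\<bar>"
    if e: "\<bar>e\<bar> \<le> 1" and y: "y \<in> K" for e y
  proof -
    let ?L = "map (\<lambda>v. v + e *\<^sub>R P v) vs"
    have yS: "y \<in> S" using y K by auto
    have "iter_deriv S (map (\<lambda>v. v + e *\<^sub>R P v) (vs @ [u])) f y = iter_deriv S ?L (D (u + e *\<^sub>R P u)) y"
      by (simp add: iter_deriv_append D_def)
    also have "\<dots> = iter_deriv S ?L (\<lambda>y. D u y + of_real e * D (P u) y) y"
    proof (rule iter_deriv_cong[OF _ yS])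
      fix x assume "x \<in> S"
      then have "linear (frechet_derivative f (at x within S))"
        using has_derivative_linear smooth_upto_has_derivative'[OF S snoc.prems] by blast
      then show "D (u + e *\<^sub>R P u) x = D u x + of_real e * D (P u) x"
        by (simp add: D_def linear_add linear_cmul scaleR_conv_of_real)
    qed
    also have "\<dots> = iter_deriv S ?L (D u) y + of_real e * iter_deriv S ?L (D (P u)) y"
      by (rule iter_deriv_add_mult[OF S D D yS])
    finally have eq: "iter_deriv S (map (\<lambda>v. v + e *\<^sub>R P v) (vs @ [u])) f y =
      iter_deriv S ?L (D u) y + of_real e * iter_deriv S ?L (D (P u)) y" .
    have eq2: "iter_deriv S (vs @ [u]) f y = iter_deriv S vs (D u) y" by (simp add: iter_deriv_append D_def)
    have b1: "norm (iter_deriv S ?L (D u) y - iter_deriv S vs (D u) y) \<le> C1 * \<bar>e\<bar>" using C1(2)[OF e y] .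
    have "norm (iter_deriv S ?L (D (P u)) y) \<le>
        norm (iter_deriv S ?L (D (P u)) y - iter_deriv S vs (D (P u)) y) + norm (iter_deriv S vs (D (P u)) y)"
      by (subst add.commute) (rule norm_triangle_sub)
    also have "\<dots> \<le> C2 * \<bar>e\<bar> + M" using C2(2)[OF e y] M(2) y by (intro add_mono) auto
    also have "\<dots> \<le> C2 + M" using e C2(1) by (simp add: mult_left_le)
    finally have b2: "norm (of_real e * iter_deriv S ?L (D (P u)) y) \<le> (C2 + M) * \<bar>e\<bar>"
      by (simp add: norm_mult mult.commute mult_left_mono)
    have "norm (iter_deriv S ?L (D u) y + of_real e * iter_deriv S ?L (D (P u)) y - iter_deriv S vs (D u) y) \<le>
      norm (iter_deriv S ?L (D u) y - iter_deriv S vs (D u) y) + norm (of_real e * iter_deriv S ?L (D (P u)) y)"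
      using norm_triangle_ineq[of "iter_deriv S ?L (D u) y - iter_deriv S vs (D u) y" "of_real e * iter_deriv S ?L (D (P u)) y"]
      by (simp add: algebra_simps)
    then show ?thesis unfolding eq eq2 using b1 b2 by (simp add: distrib_right)
  qed
  moreover have "C1 + (C2 + M) \<ge> 0" using C1 C2 M by simp
  ultimately show ?case by blast
qed (auto intro!: exI[of _ 0])

text \<open>Convergence in all seminorms along a filter. It serves both for motion along a line in
  the space of forms and for dilation factors tending to 1.\<close>

definition cinf_tendsto :: "('s \<Rightarrow> complex form01) \<Rightarrow> complex form01 \<Rightarrow> 's filter \<Rightarrow> bool" where
  "cinf_tendsto \<gamma> \<alpha> F \<longleftrightarrow> (\<forall>\<^sub>F s in F. \<gamma> s \<in> A01c) \<and>
    (\<forall>i K vs v e. compact K \<longrightarrow> K \<subseteq> xdom i \<longrightarrow> e > 0 \<longrightarrow> (\<forall>\<^sub>F s in F. \<forall>z\<in>K.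
      norm (iter_deriv (xdom i) vs (\<lambda>y. \<gamma> s (xpt i y) i v) z - iter_deriv (xdom i) vs (\<lambda>y. \<alpha> (xpt i y) i v) z) < e))"

lemma cinf_tendsto_open:
  assumes \<gamma>: "cinf_tendsto \<gamma> \<alpha> F" and U: "openin A01_topology U" "\<alpha> \<in> U"
  shows "\<forall>\<^sub>F s in F. \<gamma> s \<in> U"
proof -
  let ?B = "{cinf_nbhd i K vs v \<epsilon> \<alpha> | i K vs v \<epsilon> \<alpha>. compact K \<and> K \<subseteq> xdom i \<and> \<epsilon> > 0 \<and> \<alpha> \<in> A01c}"
  have "generate_topology_on ?B U"
    using U(1) unfolding A01_topology_def openin_topology_generated_by_iff .
  then show ?thesis using U(2)
  proof (induction U)
    case (Int a b) then show ?case by (auto intro: eventually_conj)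
  next
    case (UN A)
    then obtain a where "a \<in> A" "\<alpha> \<in> a" by blast
    with UN.IH have "\<forall>\<^sub>F s in F. \<gamma> s \<in> a" by blast
    then show ?case by eventually_elim (use \<open>a \<in> A\<close> in blast)
  next
    case (Basis s)
    then obtain i K vs v e \<beta> where s: "s = cinf_nbhd i K vs v e \<beta>" and K: "compact K" "K \<subseteq> xdom i" and "e > 0" and \<beta>: "\<beta> \<in> A01c"
      by blast
    define f where "f \<omega> = iter_deriv (xdom i) vs (\<lambda>y. \<omega> (xpt i y) i v)" for \<omega> :: "complex form01"
    have \<alpha>: "\<alpha> \<in> A01c" "\<forall>z\<in>K. norm (f \<alpha> z - f \<beta> z) < e" using Basis.prems unfolding s cinf_nbhd_def f_def by auto
    have sm: "smooth_upto (xdom i) (f \<omega>)" if "\<omega> \<in> A01c" for \<omega>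
      unfolding f_def by (rule smooth_upto_iter_deriv'[OF has_cones_xdom A01cD(5)[OF that]])
    \<comment> \<open>Subbasic neighbourhoods are centred at an arbitrary \<open>\<beta>\<close>. By
      compactness of \<open>K\<close> the strict inequality at \<open>\<alpha>\<close> leaves a
      margin \<open>e - m\<close>, within which \<open>\<gamma> s\<close> may deviate from
      \<open>\<alpha>\<close>.\<close>
    obtain m where m: "m < e" "\<forall>z\<in>K. norm (f \<alpha> z - f \<beta> z) \<le> m"
    proof (cases "K = {}")
      case True then show ?thesis using that[of "e - 1"] by simp
    next
      case False
      have "continuous_on K (\<lambda>z. norm (f \<alpha> z - f \<beta> z))"
        by (intro continuous_intros continuous_on_subset[OF smooth_upto_continuous[OF sm] K(2)] \<alpha> \<beta>)
      from continuous_attains_sup[OF K(1) False this] show ?thesis using that \<alpha>(2) by blast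
    qed
    have "\<forall>\<^sub>F s in F. \<forall>z\<in>K. norm (f (\<gamma> s) z - f \<alpha> z) < e - m"
      using \<gamma> K m(1) unfolding cinf_tendsto_def f_def by simp
    moreover have "\<forall>\<^sub>F s in F. \<gamma> s \<in> A01c" using \<gamma> by (simp add: cinf_tendsto_def)
    ultimately show ?case
    proof eventually_elim
      case (elim t)
      have "norm (f (\<gamma> t) z - f \<beta> z) < e" if z: "z \<in> K" for z
      proof -
        have "norm (f (\<gamma> t) z - f \<beta> z) \<le> norm (f (\<gamma> t) z - f \<alpha> z) + norm (f \<alpha> z - f \<beta> z)"
          by (metis diff_add_cancel add_diff_eq norm_triangle_ineq)
        then show ?thesis using elim(1) m(2) z by fastforce
      qed
      then show ?case using elim(2) unfolding s cinf_nbhd_def f_def by simp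
    qed
  qed simp
qed

lemma cinf_tendsto_line:
  assumes \<alpha>: "\<alpha> \<in> A01c" and \<beta>: "\<beta> \<in> A01c"
  shows "cinf_tendsto (\<lambda>s::real. \<alpha> + form_scale (of_real s) \<beta>) \<alpha> (at_right 0)"
  unfolding cinf_tendsto_def
proof (intro conjI allI impI)
  show "\<forall>\<^sub>F s::real in at_right 0. \<alpha> + form_scale (of_real s) \<beta> \<in> A01c"
    by (simp add: A01c_add A01c_form_scale \<alpha> \<beta>)
  fix i :: 3 and K :: "(complex^2) set" and vs and v :: "complex^2" and e :: real
  assume K: "compact K" "K \<subseteq> xdom i" and e: "e > 0"
  define f where "f \<omega> = iter_deriv (xdom i) vs (\<lambda>y. \<omega> (xpt i y) i v)" for \<omega> :: "complex form01"
  obtain M where M: "M \<ge> 0" "\<forall>y\<in>K. norm (f \<beta> y) \<le> M"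
    unfolding f_def
    by (rule smooth_upto_bounded_on_compact[OF smooth_upto_iter_deriv'[OF has_cones_xdom A01cD(5)[OF \<beta>]] K])
  have eq: "f (\<alpha> + form_scale (of_real s) \<beta>) z - f \<alpha> z = of_real s * f \<beta> z" if "z \<in> K" for s z
  proof -
    have "f (\<alpha> + form_scale (of_real s) \<beta>) z = f \<alpha> z + of_real s * f \<beta> z"
      using iter_deriv_add_mult[OF has_cones_xdom A01cD(5)[OF \<alpha>] A01cD(5)[OF \<beta>], of z] that K
      by (auto simp: f_def form_scale_def)
    then show ?thesis by simp
  qed
  have "\<forall>\<^sub>F s::real in at_right 0. s < e / (M + 1)"
    using e M by (intro order_tendstoD(2)[OF tendsto_ident_at]) (simp add: add_nonneg_pos)
  then have "\<forall>\<^sub>F s::real in at_right 0. \<forall>z\<in>K. norm (f (\<alpha> + form_scale (of_real s) \<beta>) z - f \<alpha> z) < e"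
    using eventually_at_right_less[of 0]
  proof eventually_elim
    case (elim s)
    show ?case
    proof
      fix z assume z: "z \<in> K"
      have "norm (f (\<alpha> + form_scale (of_real s) \<beta>) z - f \<alpha> z) = s * norm (f \<beta> z)"
        using elim by (simp add: eq[OF z] norm_mult)
      also have "\<dots> \<le> s * (M + 1)" using M z elim by (intro mult_left_mono) (auto intro: order_trans)
      also have "\<dots> < e" using elim M by (simp add: pos_less_divide_eq)
      finally show "norm (f (\<alpha> + form_scale (of_real s) \<beta>) z - f \<alpha> z) < e" .
    qed
  qed
  then show "\<forall>\<^sub>F s::real in at_right 0. \<forall>z\<in>K.
      norm (iter_deriv (xdom i) vs (\<lambda>y. (\<alpha> + form_scale (of_real s) \<beta>) (xpt i y) i v) z -
        iter_deriv (xdom i) vs (\<lambda>y. \<alpha> (xpt i y) i v) z) < e"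
    unfolding f_def .
qed

section \<open>Dilations\<close>

text \<open>The automorphism \<open>[Z\<^sub>1 : Z\<^sub>2 : Z\<^sub>3] \<mapsto> [Z\<^sub>1 : r Z\<^sub>2 : r Z\<^sub>3]\<close> of the projective plane in coordinates.
  For \<open>r > 1\<close> it maps a neighbourhood of \<open>xbar\<close> into \<open>xbar\<close>, so that pulling back along it makes a closed
  form extend to a closed form near the boundary.\<close>

definition dil :: "3 \<Rightarrow> real \<Rightarrow> complex^2 \<Rightarrow> complex^2" where
  "dil i r z = (if i = 1 then of_real r *s z else vector [z$1 / of_real r, z$2])"

definition dil_eps :: "3 \<Rightarrow> real \<Rightarrow> real" where
  "dil_eps i r = (if i = 1 then r - 1 else 1 / r - 1)"

definition dil_proj :: "3 \<Rightarrow> complex^2 \<Rightarrow> complex^2" where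
  "dil_proj i v = (if i = 1 then v else vector [v$1, 0])"

text \<open>In every chart the dilation is the identity plus a small multiple of a fixed linear map,
  the shape that \<open>iter_deriv_perturbed_directions\<close> handles.\<close>

lemma dil_eq: "dil i r v = v + dil_eps i r *\<^sub>R dil_proj i v"
  by (simp add: dil_def dil_eps_def dil_proj_def vec_eq_iff forall_2) (simp add: scaleR_conv_of_real algebra_simps)

lemma dil_eps_1 [simp]: "dil_eps i 1 = 0"
  by (simp add: dil_eps_def)

lemma scaleR_eq_smult: "c *\<^sub>R (v::complex^'n) = of_real c *s v"
  by (simp add: vec_eq_iff) (simp add: scaleR_conv_of_real)

lemma dil_smult: "dil i r (c *s v) = c *s dil i r v"
  by (simp add: dil_def vec_eq_iff forall_2)

lemma dil_add: "dil i r (v + w) = dil i r v + dil i r w"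
  by (simp add: dil_def vec_eq_iff forall_2 algebra_simps add_divide_distrib)

lemma bounded_linear_dil: "bounded_linear (dil i r)"
proof (rule linear_conv_bounded_linear[THEN iffD1], rule linearI)
  show "dil i r (v + w) = dil i r v + dil i r w" for v w by (rule dil_add)
  show "dil i r (c *\<^sub>R v) = c *\<^sub>R dil i r v" for c v
    by (simp add: dil_def vec_eq_iff forall_2 scaleR_conv_of_real)
qed

lemma dil_trans:
  assumes "r > 0" "z \<in> tdom i j"
  shows "dil i r z \<in> tdom i j" "trans i j (dil i r z) = dil j r (trans i j z)"
    "transD i j (dil i r z) (dil i r v) = dil j r (transD i j z v)"
  using assms
  by (cases i rule: index3_cases; cases j rule: index3_cases;
      simp add: tdom_def trans_def transD_def dil_def dehom_def dehomD_def homog_def hlin_def rest_def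
        vec_eq_iff forall_2 field_simps power2_eq_square)+

lemma dil_xdom: assumes "r \<ge> 1" "z \<in> xdom i" shows "dil i r z \<in> xdom i"
proof (cases "i = 1")
  case True
  have "norm (of_real r *s z) = r * norm z"
    using assms by (simp add: scaleR_conv_of_real[symmetric] norm_vec_def L2_set_def norm_mult power_mult_distrib
      sum_distrib_left[symmetric] real_sqrt_mult)
  moreover have "r * norm z \<ge> 1 * 1" using assms True by (intro mult_mono) (auto simp: xdom_1_iff)
  ultimately show ?thesis using True by (simp add: dil_def xdom_1_iff)
next
  case False
  have "norm (z$1 / of_real r) \<le> norm (z$1)"
    using assms by (simp add: norm_divide divide_le_eq mult_left_le mult_right_le_one_le pos_divide_le_eq mult_le_cancel_left1)
  then have "(norm (z$1 / of_real r))\<^sup>2 \<le> (norm (z$1))\<^sup>2" by (intro power_mono) auto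
  moreover have "(norm (z$1))\<^sup>2 \<le> 1 + (norm (z$2))\<^sup>2"
    using assms(2) False by (simp add: xdom_iff qf_def homog_def split: if_splits)
  ultimately have "(norm (z$1 / of_real r))\<^sup>2 \<le> 1 + (norm (z$2))\<^sup>2" by linarith
  then show ?thesis using False by (simp add: xdom_iff qf_def homog_def dil_def)
qed

definition dilate :: "real \<Rightarrow> complex form01 \<Rightarrow> complex form01" where
  "dilate r \<alpha> = (\<lambda>x i v. if x \<in> chart_dom i then \<alpha> (xpt i (dil i r (crd i x))) i (dil i r v) else 0)"

lemma dilate_xpt: "z \<in> xdom i \<Longrightarrow> dilate r \<alpha> (xpt i z) i v = \<alpha> (xpt i (dil i r z)) i (dil i r v)"
  by (simp add: dilate_def)

lemma smooth_upto_dilate: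
  assumes "\<alpha> \<in> A01c" "r \<ge> 1" shows "smooth_upto (xdom i) (\<lambda>z. \<alpha> (xpt i (dil i r z)) i v)"
  by (rule smooth_upto_compose_inner[OF A01cD(5)[OF assms(1)] smooth_open_bounded_linear[OF open_UNIV bounded_linear_dil]])
    (use dil_xdom[OF assms(2)] in auto)

lemma dilate_A01c:
  assumes \<alpha>: "\<alpha> \<in> A01c" and r: "r \<ge> 1" shows "dilate r \<alpha> \<in> A01c"
  unfolding A01c_iff
proof (intro conjI allI ballI)
  fix i v z
  show "dilate r \<alpha> x i v = 0" if "x \<in> - chart_dom i" for x using that by (simp add: dilate_def)
  show "smooth_upto (xdom i) (\<lambda>z. dilate r \<alpha> (xpt i z) i v)"
    by (subst smooth_upto_cong[OF dilate_xpt]) (auto intro: smooth_upto_dilate[OF \<alpha> r])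
  show "dilate r \<alpha> (xpt i z) i (v + w) = dilate r \<alpha> (xpt i z) i v + dilate r \<alpha> (xpt i z) i w" if "z \<in> xdom i" for w
    using that A01cD(2)[OF \<alpha> dil_xdom[OF r]] by (simp add: dilate_xpt dil_add)
  show "dilate r \<alpha> (xpt i z) i (c *s v) = cnj c * dilate r \<alpha> (xpt i z) i v" if "z \<in> xdom i" for c
    using that A01cD(3)[OF \<alpha> dil_xdom[OF r]] by (simp add: dilate_xpt dil_smult)
  show "dilate r \<alpha> (xpt i z) i v = dilate r \<alpha> (xpt i z) j (transD i j z v)" if z: "z \<in> xdom i \<inter> tdom i j" for j
  proof -
    have rp: "r > 0" using r by simp
    have z': "z \<in> xdom i" "z \<in> tdom i j" "dil i r z \<in> xdom i" "dil i r z \<in> tdom i j"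
      using z dil_xdom[OF r] dil_trans(1)[OF rp] by auto
    have "dilate r \<alpha> (xpt i z) j (transD i j z v) = dilate r \<alpha> (xpt j (trans i j z)) j (transD i j z v)"
      using z' by (simp add: xpt_trans)
    also have "\<dots> = \<alpha> (xpt j (trans i j (dil i r z))) j (transD i j (dil i r z) (dil i r v))"
      using z' by (simp add: dilate_xpt trans_in_xdom dil_trans[OF rp z'(2)])
    also have "\<dots> = \<alpha> (xpt i (dil i r z)) i (dil i r v)"
      using z' A01cD(4)[OF \<alpha> z'(3,4)] by (simp add: xpt_trans)
    finally show ?thesis using z' by (simp add: dilate_xpt)
  qed
qed

lemma dbar_at_dilate:
  assumes \<alpha>: "\<alpha> \<in> A01c" and r: "r \<ge> 1" and z: "z \<in> xdom i"
  shows "dbar_at (xdom i) (\<lambda>z. \<alpha> (xpt i (dil i r z)) i w) z v = dbar_at (xdom i) (\<lambda>z. \<alpha> (xpt i z) i w) (dil i r z) (dil i r v)"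
  by (rule dbar_at_holomorphic_inner[OF has_cones_xdom z has_cones_xdom _ smooth_upto_xdom_derivative[OF A01cD(5)[OF \<alpha>]]
      bounded_linear_imp_has_derivative[OF bounded_linear_dil] _ open_UNIV])
    (use dil_xdom[OF r] z in \<open>auto simp: dil_smult\<close>)

lemma dilate_Z01:
  assumes \<alpha>: "\<alpha> \<in> Z01" and r: "r \<ge> 1" shows "dilate r \<alpha> \<in> Z01"
proof -
  have \<alpha>': "\<alpha> \<in> A01c" "\<And>x i v w. dbar_form \<alpha> x i v w = 0" using \<alpha> by (auto simp: Z01_iff)
  have "dbar_form (dilate r \<alpha>) x i v w = 0" for x i v w
  proof (rule form02_cases[of x i])
    fix z assume z: "x = xpt i z" "z \<in> xdom i"
    have "dbar_at (xdom i) (\<lambda>z. dilate r \<alpha> (xpt i z) i w) z v =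
        dbar_at (xdom i) (\<lambda>z. \<alpha> (xpt i z) i (dil i r w)) (dil i r z) (dil i r v)" for v w
      unfolding dbar_at_dilate[OF \<alpha>'(1) r z(2), symmetric]
      by (rule dbar_at_cong[OF open_UNIV]) (use z in \<open>auto simp: dilate_xpt\<close>)
    then show ?thesis
      using \<alpha>'(2)[of "xpt i (dil i r z)" i "dil i r v" "dil i r w"] z dil_xdom[OF r z(2)] by (simp add: dbar_form_xpt)
  qed (simp add: dbar_form_outside)
  then show ?thesis using dilate_A01c[OF \<alpha>'(1) r] by (simp add: Z01_iff)
qed

lemma dilate_exact_near:
  assumes \<alpha>: "\<alpha> \<in> Z01" and r: "r > 1" and c: "norm c = 1"
  shows "exact_near (dilate r \<alpha>) c"
proof -
  have \<alpha>': "\<alpha> \<in> A01c" "\<And>x i v w. dbar_form \<alpha> x i v w = 0" using \<alpha> by (auto simp: Z01_iff)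
  have r1: "r \<ge> 1" using r by simp
  \<comment> \<open>The dilation sends this neighbourhood of the sphere, which reaches into the
    ball, to \<open>xdom 1\<close>; so the pulled-back coefficients are smooth on an open
    set.\<close>
  define W where "W = {z::complex^2. norm z > 1 / r}"
  have W: "open W" unfolding W_def by (intro open_Collect_less continuous_intros)
  have nd: "norm (dil 1 r z) = r * norm z" for z
    using r by (simp add: dil_def norm_vec_def L2_set_def norm_mult power_mult_distrib
      sum_distrib_left[symmetric] real_sqrt_mult)
  have dW: "dil 1 r z \<in> xdom 1" if "z \<in> W" for z
    using that r by (simp add: xdom_1_iff nd W_def field_simps)
  define f where "f w z = \<alpha> (xpt 1 (dil 1 r z)) 1 (dil 1 r w)" for w z
  have f: "smooth_open W (f w)" for w
  proof -
    have "smooth_upto W (f w)" unfolding f_def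
      by (rule smooth_upto_compose_inner[OF A01cD(5)[OF \<alpha>'(1)] smooth_open_bounded_linear[OF open_UNIV bounded_linear_dil]])
        (use dW in auto)
    then show ?thesis using smooth_upto_open_iff[OF W] by blast
  qed
  have df: "dbar_at UNIV (f w) z v = dbar_at (xdom 1) (\<lambda>z. \<alpha> (xpt 1 z) 1 (dil 1 r w)) (dil 1 r z) (dil 1 r v)" if "z \<in> W" for z v w
    unfolding f_def
    by (rule dbar_at_holomorphic_inner[OF has_cones_UNIV _ has_cones_xdom _ smooth_upto_xdom_derivative[OF A01cD(5)[OF \<alpha>'(1)]]
      bounded_linear_imp_has_derivative[OF bounded_linear_dil] _ W])
      (use dW that in \<open>auto simp: dil_smult\<close>)
  have closed: "dbar_at UNIV (f v) z w = dbar_at UNIV (f w) z v" if z: "z \<in> W" for z v w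
    using \<alpha>'(2)[of "xpt 1 (dil 1 r z)" 1 "dil 1 r v" "dil 1 r w"] dW[OF z] unfolding df[OF z]
    by (simp add: dbar_form_xpt)
  have cW: "c \<in> W" using c r by (simp add: W_def)
  obtain \<rho> u where u: "\<rho> > 0" "ball c \<rho> \<subseteq> W" "smooth_open (ball c \<rho>) u"
    "\<forall>z\<in>ball c \<rho>. dbar_at UNIV u z (axis 1 1) = f (axis 1 1) z \<and> dbar_at UNIV u z (axis 2 1) = f (axis 2 1) z"
    by (rule local_dolbeault[OF f f cW closed])
  have "dbar_at (xdom 1) u z v = dilate r \<alpha> (xpt 1 z) 1 v" if z: "z \<in> xdom 1 \<inter> ball c \<rho>" for z v
  proof -
    have v: "v = v$1 *s axis 1 1 + v$2 *s axis 2 1" by (simp add: vec_eq_iff forall_2 axis_def)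
    have d: "(u has_derivative frechet_derivative u (at z)) (at z)"
      using smooth_open_has_derivative[OF u(3)] z by auto
    have "dbar_at (xdom 1) u z v = dbar_at UNIV u z v"
      by (rule dbar_at_extension[OF has_cones_xdom u(3) z]) simp
    also have "\<dots> = cnj (v$1) * dbar_at UNIV u z (axis 1 1) + cnj (v$2) * dbar_at UNIV u z (axis 2 1)"
      by (subst v) (simp only: dbar_at_vadd[OF d] dbar_at_smult[OF d])
    also have "\<dots> = cnj (v$1) * dilate r \<alpha> (xpt 1 z) 1 (axis 1 1) + cnj (v$2) * dilate r \<alpha> (xpt 1 z) 1 (axis 2 1)"
      using u(4) z by (simp add: f_def dilate_xpt)
    also have "\<dots> = dilate r \<alpha> (xpt 1 z) 1 (v$1 *s axis 1 1 + v$2 *s axis 2 1)"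
      using z by (simp add: A01cD(2,3)[OF dilate_A01c[OF \<alpha>'(1) r1]])
    also have "\<dots> = dilate r \<alpha> (xpt 1 z) 1 v" by (simp only: v[symmetric])
    finally show ?thesis .
  qed
  then show ?thesis
    unfolding exact_near_def using u(1) smooth_upto_smooth_open[OF u(3), of "xdom 1 \<inter> ball c \<rho>"]
    by (intro exI[of _ \<rho>] exI[of _ u] conjI) auto
qed

text \<open>The derivative of the pulled-back coefficient differs from the original one in three
  ways: in the directions of differentiation, in the vector inserted into the form, and in the point
  of evaluation. The first two effects are linear in \<open>dil_eps i r\<close>, the third is
  controlled by uniform continuity.\<close>

lemma dilate_tendsto:
  assumes \<alpha>: "\<alpha> \<in> A01c"
  shows "cinf_tendsto (\<lambda>r. dilate r \<alpha>) \<alpha> (at_right 1)"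
  unfolding cinf_tendsto_def
proof (intro conjI allI impI)
  have ev2: "\<forall>\<^sub>F r in at_right (1::real). r < 2" by (rule order_tendstoD(2)[OF tendsto_ident_at]) simp
  have ev1: "\<forall>\<^sub>F r in at_right (1::real). 1 < r" by (rule eventually_at_right_less)
  show "\<forall>\<^sub>F r in at_right 1. dilate r \<alpha> \<in> A01c"
    using ev1 by eventually_elim (simp add: dilate_A01c[OF \<alpha>])
  fix i :: 3 and K :: "(complex^2) set" and vs and v :: "complex^2" and e :: real
  assume K: "compact K" "K \<subseteq> xdom i" and e: "e > 0"
  let ?S = "xdom i"
  define A where "A w = (\<lambda>y. \<alpha> (xpt i y) i w)" for w
  have A: "smooth_upto ?S (A w)" for w unfolding A_def by (rule A01cD(5)[OF \<alpha>])
  \<comment> \<open>A compact subset of \<open>xdom i\<close> that contains all dilates of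
    \<open>K\<close> with factor between 1 and 2, so that the constants below do not depend on the
    factor.\<close>
  define K' where "K' = (\<lambda>(r, z). z + dil_eps i r *\<^sub>R dil_proj i z) ` ({1..2} \<times> K)"
  have cproj: "continuous_on UNIV (dil_proj i)"
  proof -
    have "bounded_linear (dil_proj i)"
      by (rule linear_conv_bounded_linear[THEN iffD1], rule linearI)
        (simp_all add: dil_proj_def vec_eq_iff forall_2)
    then show ?thesis by (rule bounded_linear.continuous_on[OF _ continuous_on_id])
  qed
  have ceps: "continuous_on {1..2} (dil_eps i)"
    unfolding dil_eps_def[abs_def] by (cases "i = 1") (auto intro!: continuous_intros)
  have "compact K'"
    unfolding K'_def case_prod_beta
    by (intro compact_continuous_image compact_Times K continuous_intros
      continuous_on_compose2[OF cproj] continuous_on_compose2[OF ceps]) auto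
  have inK': "dil i r z \<in> K'" if "1 \<le> r" "r \<le> 2" "z \<in> K" for r z
    using that unfolding K'_def dil_eq by force
  have K'S: "K' \<subseteq> ?S" unfolding K'_def dil_eq[symmetric] using dil_xdom K by auto
  have KK': "K \<subseteq> K'" using inK'[of 1] by (auto simp: dil_eq)
  have cont: "continuous_on K' (iter_deriv ?S vs (A v))"
    by (rule continuous_on_subset[OF smooth_upto_continuous[OF smooth_upto_iter_deriv'[OF has_cones_xdom A]] K'S])
  obtain d where d: "d > 0" "\<And>x y. x \<in> K' \<Longrightarrow> y \<in> K' \<Longrightarrow> dist y x < d \<Longrightarrow>
      dist (iter_deriv ?S vs (A v) y) (iter_deriv ?S vs (A v) x) < e / 2"
    using compact_uniformly_continuous[OF cont \<open>compact K'\<close>] e unfolding uniformly_continuous_on_def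
    by (metis half_gt_zero)
  obtain C1 where C1: "C1 \<ge> 0" "\<And>\<epsilon> y. \<bar>\<epsilon>\<bar> \<le> 1 \<Longrightarrow> y \<in> K' \<Longrightarrow>
    norm (iter_deriv ?S (map (\<lambda>v. v + \<epsilon> *\<^sub>R dil_proj i v) vs) (A v) y - iter_deriv ?S vs (A v) y) \<le> C1 * \<bar>\<epsilon>\<bar>"
    using iter_deriv_perturbed_directions[OF has_cones_xdom \<open>compact K'\<close> K'S A] by blast
  obtain C2 where C2: "C2 \<ge> 0" "\<And>\<epsilon> y. \<bar>\<epsilon>\<bar> \<le> 1 \<Longrightarrow> y \<in> K' \<Longrightarrow>
    norm (iter_deriv ?S (map (\<lambda>v. v + \<epsilon> *\<^sub>R dil_proj i v) vs) (A (dil_proj i v)) y - iter_deriv ?S vs (A (dil_proj i v)) y) \<le> C2 * \<bar>\<epsilon>\<bar>"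
    using iter_deriv_perturbed_directions[OF has_cones_xdom \<open>compact K'\<close> K'S A] by blast
  obtain M where M: "M \<ge> 0" "\<forall>y\<in>K'. norm (iter_deriv ?S vs (A (dil_proj i v)) y) \<le> M"
    by (rule smooth_upto_bounded_on_compact[OF smooth_upto_iter_deriv'[OF has_cones_xdom A] \<open>compact K'\<close> K'S])
  have "compact (dil_proj i ` K)"
    by (rule compact_continuous_image[OF continuous_on_subset[OF cproj subset_UNIV] K(1)])
  then obtain B where B: "\<forall>z\<in>K. norm (dil_proj i z) \<le> B" using compact_imp_bounded bounded_iff by (metis imageI)
  define C where "C = C1 + (C2 + M) + 1"
  have C: "C > 0" using C1 C2 M by (simp add: C_def)
  have "(dil_eps i \<longlongrightarrow> 0) (at_right 1)"
  proof -
    have "(dil_eps i \<longlongrightarrow> dil_eps i 1) (at_right 1)"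
      unfolding dil_eps_def[abs_def] by (cases "i = 1") (auto intro!: tendsto_eq_intros)
    then show ?thesis by simp
  qed
  then have lim: "((\<lambda>r. \<bar>dil_eps i r\<bar>) \<longlongrightarrow> 0) (at_right 1)" by (rule tendsto_rabs_zero)
  have ev3: "\<forall>\<^sub>F r in at_right 1. \<bar>dil_eps i r\<bar> < min 1 (min (e / (2 * C)) (d / (\<bar>B\<bar> + 1)))"
    by (rule order_tendstoD(2)[OF lim]) (use e C d in \<open>simp add: add_nonneg_pos\<close>)
  show "\<forall>\<^sub>F r in at_right 1. \<forall>z\<in>K. norm (iter_deriv ?S vs (\<lambda>y. dilate r \<alpha> (xpt i y) i v) z -
      iter_deriv ?S vs (\<lambda>y. \<alpha> (xpt i y) i v) z) < e"
    using ev1 ev2 ev3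
  proof eventually_elim
    case (elim r)
    define \<epsilon> where "\<epsilon> = dil_eps i r"
    define P where "P = dil_proj i"
    have eps: "\<bar>\<epsilon>\<bar> \<le> 1" "\<bar>\<epsilon>\<bar> * C < e / 2" "\<bar>\<epsilon>\<bar> * (\<bar>B\<bar> + 1) < d"
      using elim(3) C by (auto simp: \<epsilon>_def field_simps add_nonneg_pos)
    have dl: "dil i r = (\<lambda>v. v + \<epsilon> *\<^sub>R P v)" by (rule ext) (simp add: dil_eq \<epsilon>_def P_def)
    show ?case
    proof
      fix z assume z: "z \<in> K"
      have zS: "z \<in> ?S" using z K by auto
      let ?y = "dil i r z"
      have y: "?y \<in> K'" using inK' elim z by simp
      have yS: "?y \<in> ?S" using y K'S by auto
      have img: "dil i r ` ?S \<subseteq> ?S" using dil_xdom elim by auto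
      let ?L = "map (\<lambda>v. v + \<epsilon> *\<^sub>R P v) vs"
      have "iter_deriv ?S vs (\<lambda>y. dilate r \<alpha> (xpt i y) i v) z = iter_deriv ?S vs (\<lambda>y. A (dil i r v) (dil i r y)) z"
        by (rule iter_deriv_cong[OF _ zS]) (simp add: dilate_xpt A_def)
      also have "\<dots> = iter_deriv ?S ?L (A (dil i r v)) ?y"
        by (subst iter_deriv_linear_compose[OF has_cones_xdom A bounded_linear_dil img zS]) (simp add: dl)
      also have "\<dots> = iter_deriv ?S ?L (\<lambda>y. A v y + of_real \<epsilon> * A (P v) y) ?y"
      proof (rule iter_deriv_cong[OF _ yS])
        fix y assume y: "y \<in> ?S"
        have "A (dil i r v) y = A (v + of_real \<epsilon> *s P v) y"
          by (simp only: dl scaleR_eq_smult)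
        also have "\<dots> = A v y + of_real \<epsilon> * A (P v) y"
          unfolding A_def by (simp only: A01cD(2,3)[OF \<alpha> y]) simp
        finally show "A (dil i r v) y = A v y + of_real \<epsilon> * A (P v) y" .
      qed
      also have "\<dots> = iter_deriv ?S ?L (A v) ?y + of_real \<epsilon> * iter_deriv ?S ?L (A (P v)) ?y"
        by (rule iter_deriv_add_mult[OF has_cones_xdom A A yS])
      finally have eq: "iter_deriv ?S vs (\<lambda>y. dilate r \<alpha> (xpt i y) i v) z =
        iter_deriv ?S ?L (A v) ?y + of_real \<epsilon> * iter_deriv ?S ?L (A (P v)) ?y" .
      have b1: "norm (iter_deriv ?S ?L (A v) ?y - iter_deriv ?S vs (A v) ?y) \<le> C1 * \<bar>\<epsilon>\<bar>"
        using C1(2)[OF eps(1) y] by (simp add: P_def)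
      have "norm (iter_deriv ?S ?L (A (P v)) ?y) \<le>
          norm (iter_deriv ?S ?L (A (P v)) ?y - iter_deriv ?S vs (A (P v)) ?y) + norm (iter_deriv ?S vs (A (P v)) ?y)"
        by (subst add.commute) (rule norm_triangle_sub)
      also have "\<dots> \<le> C2 * \<bar>\<epsilon>\<bar> + M" using C2(2)[OF eps(1) y] M(2) y by (intro add_mono) (auto simp: P_def)
      also have "\<dots> \<le> C2 + M" using eps C2(1) by (simp add: mult_left_le)
      finally have b2: "norm (of_real \<epsilon> * iter_deriv ?S ?L (A (P v)) ?y) \<le> (C2 + M) * \<bar>\<epsilon>\<bar>"
        by (simp add: norm_mult mult.commute mult_left_mono)
      have "dist ?y z = \<bar>\<epsilon>\<bar> * norm (P z)" by (simp add: dl dist_norm)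
      also have "\<dots> \<le> \<bar>\<epsilon>\<bar> * (\<bar>B\<bar> + 1)" using B z by (intro mult_left_mono) (force simp: P_def)+
      finally have "dist ?y z < d" using eps by simp
      then have b3: "norm (iter_deriv ?S vs (A v) ?y - iter_deriv ?S vs (A v) z) < e / 2"
        using d(2)[of z ?y] KK' z y by (auto simp: dist_norm)
      have "norm ((a + b) - c) \<le> norm (a - a') + norm b + norm (a' - c)" for a b c a' :: complex
      proof -
        have "(a + b) - c = (a - a') + b + (a' - c)" by simp
        then show ?thesis by (metis add_mono_thms_linordered_semiring(3) norm_triangle_ineq norm_triangle_le)
      qed
      from this[of "iter_deriv ?S ?L (A v) ?y" _ "iter_deriv ?S vs (A v) z" "iter_deriv ?S vs (A v) ?y"]
      have "norm (iter_deriv ?S ?L (A v) ?y + of_real \<epsilon> * iter_deriv ?S ?L (A (P v)) ?y - iter_deriv ?S vs (A v) z)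
         \<le> C1 * \<bar>\<epsilon>\<bar> + (C2 + M) * \<bar>\<epsilon>\<bar> + norm (iter_deriv ?S vs (A v) ?y - iter_deriv ?S vs (A v) z)"
        using b1 b2 by (meson add_mono order_refl order_trans)
      also have "\<dots> < \<bar>\<epsilon>\<bar> * C + e / 2" using b3 by (simp add: C_def algebra_simps add_strict_increasing2)
      also have "\<dots> < e" using eps(2) by simp
      finally show "norm (iter_deriv ?S vs (\<lambda>y. dilate r \<alpha> (xpt i y) i v) z - iter_deriv ?S vs (\<lambda>y. \<alpha> (xpt i y) i v) z) < e"
        unfolding eq A_def[symmetric] .
    qed
  qed
qed

section \<open>Integrals over rectangles\<close>

lemma continuous_on_compose_pair:
  assumes "continuous_on (U \<times> V) (\<lambda>(x, y). f x y)" "continuous_on S g" "continuous_on S h"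
    "\<And>s. s \<in> S \<Longrightarrow> g s \<in> U" "\<And>s. s \<in> S \<Longrightarrow> h s \<in> V"
  shows "continuous_on S (\<lambda>s. f (g s) (h s))"
proof -
  have "(\<lambda>s. (g s, h s)) ` S \<subseteq> U \<times> V" using assms(4,5) by auto
  from continuous_on_compose2[OF assms(1) continuous_on_Pair[OF assms(2,3)] this] show ?thesis by simp
qed

definition cell :: "complex \<Rightarrow> complex \<Rightarrow> real \<times> real \<Rightarrow> complex" where
  "cell a b s = Complex (Re a + fst s * (Re b - Re a)) (Im a + snd s * (Im b - Im a))"

text \<open>The area integral over the rectangle with opposite corners \<open>a\<close> and
  \<open>b\<close>, pulled back to the unit square of pairs of reals, where iterated integrals are
  available.\<close>

definition rint :: "complex \<Rightarrow> complex \<Rightarrow> (complex \<Rightarrow> complex) \<Rightarrow> complex" where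
  "rint a b f = of_real ((Re b - Re a) * (Im b - Im a)) * integral (cbox (0, 0) (1, 1)) (\<lambda>s. f (cell a b s))"

abbreviation "corner2 a b \<equiv> Complex (Re b) (Im a)"
abbreviation "corner4 a b \<equiv> Complex (Re a) (Im b)"

definition three_edges :: "complex \<Rightarrow> complex \<Rightarrow> complex set" where
  "three_edges a b = closed_segment a (corner2 a b) \<union> closed_segment (corner2 a b) b \<union> closed_segment (corner4 a b) b"

definition left_edge :: "complex \<Rightarrow> complex \<Rightarrow> complex set" where
  "left_edge a b = closed_segment a (corner4 a b)"

text \<open>The contour integral over the boundary of a rectangle is \<open>three_int - left_int\<close>; the left edge is
  the one that will lie inside the ball.\<close>

definition three_int :: "complex \<Rightarrow> complex \<Rightarrow> (complex \<Rightarrow> complex) \<Rightarrow> complex" where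
  "three_int a b f = contour_integral (linepath a (corner2 a b)) f + contour_integral (linepath (corner2 a b) b) f
     - contour_integral (linepath (corner4 a b) b) f"

definition left_int :: "complex \<Rightarrow> complex \<Rightarrow> (complex \<Rightarrow> complex) \<Rightarrow> complex" where
  "left_int a b f = contour_integral (linepath a (corner4 a b)) f"

definition bint :: "complex \<Rightarrow> complex \<Rightarrow> (complex \<Rightarrow> complex) \<Rightarrow> complex" where
  "bint a b f = three_int a b f - left_int a b f"

lemma cell_in_cbox:
  assumes "Re a \<le> Re b" "Im a \<le> Im b" "s \<in> cbox (0, 0) (1, 1)" shows "cell a b s \<in> cbox a b"
proof -
  have "fst s * (Re b - Re a) \<le> 1 * (Re b - Re a)" "snd s * (Im b - Im a) \<le> 1 * (Im b - Im a)"
    using assms by (intro mult_right_mono; auto simp: mem_Times_iff cbox_Pair_eq)+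
  moreover have "fst s * (Re b - Re a) \<ge> 0" "snd s * (Im b - Im a) \<ge> 0"
    using assms by (intro mult_nonneg_nonneg; auto simp: mem_Times_iff cbox_Pair_eq)+
  ultimately show ?thesis by (simp add: cell_def in_cbox_complex_iff)
qed

lemma continuous_on_cell: "continuous_on S (cell a b)"
  unfolding cell_def[abs_def] by (intro continuous_intros)

lemma edges_subset:
  assumes "Re a \<le> Re b" "Im a \<le> Im b"
  shows "three_edges a b \<subseteq> cbox a b" "left_edge a b \<subseteq> cbox a b"
proof -
  have "convex (cbox a b)" by simp
  moreover have "a \<in> cbox a b" "b \<in> cbox a b" "corner2 a b \<in> cbox a b" "corner4 a b \<in> cbox a b"
    using assms by (auto simp: in_cbox_complex_iff)
  ultimately show "three_edges a b \<subseteq> cbox a b" "left_edge a b \<subseteq> cbox a b"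
    unfolding three_edges_def left_edge_def by (auto simp: closed_segment_subset)
qed

lemma compact_three_edges: "compact (three_edges a b)" and compact_left_edge: "compact (left_edge a b)"
  unfolding three_edges_def left_edge_def by (intro compact_Un compact_segment)+

text \<open>Green's formula, from the fundamental theorem of calculus in each variable of the unit
  square and an exchange of the order of integration. Derivatives are taken within the closed
  rectangle, because primitives are smooth up to the boundary of the domain only.\<close>

lemma green_rectangle:
  assumes ab: "Re a \<le> Re b" "Im a \<le> Im b"
    and f: "\<And>z. z \<in> cbox a b \<Longrightarrow> (f has_derivative D z) (at z within cbox a b)"
    and c1: "continuous_on (cbox a b) (\<lambda>z. D z 1)" and ci: "continuous_on (cbox a b) (\<lambda>z. D z \<i>)"
  shows "bint a b f = 2 * \<i> * rint a b (\<lambda>z. (D z 1 + \<i> * D z \<i>) / 2)"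
proof -
  define A where "A = Re b - Re a"
  define B where "B = Im b - Im a"
  let ?C = "cbox (0, 0) (1, 1) :: (real \<times> real) set"
  define g where "g s t = f (cell a b (s, t))" for s t
  define gs where "gs s t = A *\<^sub>R D (cell a b (s, t)) 1" for s t
  define gt where "gt s t = B *\<^sub>R D (cell a b (s, t)) \<i>" for s t
  have inb: "cell a b (s, t) \<in> cbox a b" if "s \<in> {0..1}" "t \<in> {0..1}" for s t
    using cell_in_cbox[OF ab, of "(s, t)"] that by (simp add: cbox_Pair_eq)
  have lin: "linear (D z)" if "z \<in> cbox a b" for z using has_derivative_linear[OF f[OF that]] .
  have cc: "continuous_on ?C (\<lambda>s. h (cell a b s))" if "continuous_on (cbox a b) h" for h :: "complex \<Rightarrow> complex"
    by (rule continuous_on_compose2[OF that continuous_on_cell]) (use cell_in_cbox[OF ab] in blast)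
  have cgs: "continuous_on ?C (\<lambda>(s, t). gs s t)" and cgt: "continuous_on ?C (\<lambda>(s, t). gt s t)"
    using continuous_on_scaleR[OF continuous_on_const cc[OF c1], of A] continuous_on_scaleR[OF continuous_on_const cc[OF ci], of B]
    by (simp_all add: gs_def gt_def case_prod_beta)
  have ds: "((\<lambda>s. g s t) has_vector_derivative gs s t) (at s within {0..1})" if st: "s \<in> {0..1}" "t \<in> {0..1}" for s t
  proof -
    have cd: "((\<lambda>s. cell a b (s, t)) has_derivative (\<lambda>h. of_real (h * A))) (at s within {0..1})"
      unfolding cell_def Complex_eq A_def
      by (auto intro!: derivative_eq_intros simp: algebra_simps)
    have "(f has_derivative D (cell a b (s, t))) (at (cell a b (s, t)) within (\<lambda>s. cell a b (s, t)) ` {0..1})"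
      by (rule has_derivative_subset[OF f[OF inb[OF st]]]) (use inb st in auto)
    from has_derivative_in_compose[OF cd this]
    have "((\<lambda>s. g s t) has_derivative (\<lambda>h. D (cell a b (s, t)) (of_real (h * A)))) (at s within {0..1})"
      by (simp add: g_def)
    moreover have "D (cell a b (s, t)) (of_real (h * A)) = h *\<^sub>R gs s t" for h
      using linear_cmul[OF lin[OF inb[OF st]], of "h * A" 1] by (simp add: gs_def scaleR_conv_of_real)
    ultimately show ?thesis by (simp add: has_vector_derivative_def)
  qed
  have dt: "((\<lambda>t. g s t) has_vector_derivative gt s t) (at t within {0..1})" if st: "s \<in> {0..1}" "t \<in> {0..1}" for s t
  proof -
    have cd: "((\<lambda>t. cell a b (s, t)) has_derivative (\<lambda>h. of_real (h * B) * \<i>)) (at t within {0..1})"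
      unfolding cell_def Complex_eq B_def
      by (auto intro!: derivative_eq_intros simp: algebra_simps)
    have "(f has_derivative D (cell a b (s, t))) (at (cell a b (s, t)) within (\<lambda>t. cell a b (s, t)) ` {0..1})"
      by (rule has_derivative_subset[OF f[OF inb[OF st]]]) (use inb st in auto)
    from has_derivative_in_compose[OF cd this]
    have "((\<lambda>t. g s t) has_derivative (\<lambda>h. D (cell a b (s, t)) (of_real (h * B) * \<i>))) (at t within {0..1})"
      by (simp add: g_def)
    moreover have "D (cell a b (s, t)) (of_real (h * B) * \<i>) = h *\<^sub>R gt s t" for h
      using linear_cmul[OF lin[OF inb[OF st]], of "h * B" \<i>] by (simp add: gt_def scaleR_conv_of_real)
    ultimately show ?thesis by (simp add: has_vector_derivative_def)
  qed
  have int_s: "integral {0..1} (\<lambda>s. gs s t) = g 1 t - g 0 t" if "t \<in> {0..1}" for t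
    by (rule integral_unique, rule fundamental_theorem_of_calculus) (use ds that in auto)
  have int_t: "integral {0..1} (\<lambda>t. gt s t) = g s 1 - g s 0" if "s \<in> {0..1}" for s
    by (rule integral_unique, rule fundamental_theorem_of_calculus) (use dt that in auto)
  have cf: "continuous_on (cbox a b) f" by (rule has_derivative_continuous_on[OF f])
  have cg: "continuous_on ?C (\<lambda>(s, t). g s t)"
    using cc[OF cf] by (simp add: g_def case_prod_unfold)
  have cgl: "continuous_on {0..1} (\<lambda>s. g s t)" "continuous_on {0..1} (\<lambda>s. g t s)" if "t \<in> {0..1}" for t
    unfolding g_def
    by (rule continuous_on_compose2[OF cf], rule continuous_on_compose2[OF continuous_on_cell[of UNIV]];
        use inb that in \<open>auto intro!: continuous_intros\<close>)+
  have "integral ?C (\<lambda>(s, t). gs s t) = integral {0..1} (\<lambda>s. integral {0..1} (\<lambda>t. gs s t))"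
    using integral_prod_continuous[OF cgs] by simp
  also have "\<dots> = integral {0..1} (\<lambda>t. integral {0..1} (\<lambda>s. gs s t))"
    using integral_swap_continuous[OF cgs] by simp
  also have "\<dots> = integral {0..1} (\<lambda>t. g 1 t - g 0 t)" by (rule integral_cong) (simp add: int_s)
  also have "\<dots> = integral {0..1} (\<lambda>t. g 1 t) - integral {0..1} (\<lambda>t. g 0 t)"
    by (intro integral_diff integrable_continuous_real cgl) auto
  finally have Is: "integral ?C (\<lambda>(s, t). gs s t) = integral {0..1} (\<lambda>t. g 1 t) - integral {0..1} (\<lambda>t. g 0 t)" .
  have "integral ?C (\<lambda>(s, t). gt s t) = integral {0..1} (\<lambda>s. integral {0..1} (\<lambda>t. gt s t))"
    using integral_prod_continuous[OF cgt] by simp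
  also have "\<dots> = integral {0..1} (\<lambda>s. g s 1 - g s 0)" by (rule integral_cong) (simp add: int_t)
  also have "\<dots> = integral {0..1} (\<lambda>s. g s 1) - integral {0..1} (\<lambda>s. g s 0)"
    by (intro integral_diff integrable_continuous_real cgl) auto
  finally have It: "integral ?C (\<lambda>(s, t). gt s t) = integral {0..1} (\<lambda>s. g s 1) - integral {0..1} (\<lambda>s. g s 0)" .
  have lp: "f (linepath a (corner2 a b) s) = g s 0" "f (linepath (corner2 a b) b s) = g 1 s"
    "f (linepath (corner4 a b) b s) = g s 1" "f (linepath a (corner4 a b) s) = g 0 s" for s
  proof -
    have "linepath a (corner2 a b) s = cell a b (s, 0)" "linepath (corner2 a b) b s = cell a b (1, s)"
      "linepath (corner4 a b) b s = cell a b (s, 1)" "linepath a (corner4 a b) s = cell a b (0, s)"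
      by (auto simp: cell_def linepath_def complex_eq_iff algebra_simps)
    then show "f (linepath a (corner2 a b) s) = g s 0" "f (linepath (corner2 a b) b s) = g 1 s"
      "f (linepath (corner4 a b) b s) = g s 1" "f (linepath a (corner4 a b) s) = g 0 s"
      by (simp_all add: g_def)
  qed
  have diffs: "corner2 a b - a = of_real A" "b - corner2 a b = \<i> * of_real B" "b - corner4 a b = of_real A"
    "corner4 a b - a = \<i> * of_real B"
    by (auto simp: A_def B_def complex_eq_iff)
  have "bint a b f = of_real A * integral {0..1} (\<lambda>s. g s 0) + \<i> * of_real B * integral {0..1} (\<lambda>t. g 1 t)
     - of_real A * integral {0..1} (\<lambda>s. g s 1) - \<i> * of_real B * integral {0..1} (\<lambda>t. g 0 t)"
    unfolding bint_def three_int_def left_int_def contour_integral_integral vector_derivative_linepath_at lp diffs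
    by simp
  also have "\<dots> = \<i> * of_real B * integral ?C (\<lambda>(s, t). gs s t) - of_real A * integral ?C (\<lambda>(s, t). gt s t)"
    unfolding Is It by (simp add: algebra_simps)
  also have "\<dots> = integral ?C (\<lambda>p. \<i> * of_real B * gs (fst p) (snd p) - of_real A * gt (fst p) (snd p))"
  proof -
    have "(\<lambda>p. gs (fst p) (snd p)) integrable_on ?C" "(\<lambda>p. gt (fst p) (snd p)) integrable_on ?C"
      using integrable_continuous[OF cgs] integrable_continuous[OF cgt] by (simp_all add: case_prod_unfold)
    then show ?thesis by (subst integral_diff) (auto simp: case_prod_unfold intro!: integrable_on_mult_right)
  qed
  also have "\<dots> = integral ?C (\<lambda>p. 2 * \<i> * (of_real (A * B) * ((D (cell a b p) 1 + \<i> * D (cell a b p) \<i>) / 2)))"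
    by (rule integral_cong) (simp add: gs_def gt_def scaleR_conv_of_real algebra_simps add_divide_distrib)
  also have "\<dots> = 2 * \<i> * rint a b (\<lambda>z. (D z 1 + \<i> * D z \<i>) / 2)"
    by (simp add: rint_def A_def B_def)
  finally show ?thesis .
qed

section \<open>Continuity, linearity, bounds and exchange of the integrals\<close>

lemma continuous_on_rint:
  assumes cd: "Re c \<le> Re d" "Im c \<le> Im d" and f: "continuous_on (U \<times> cbox c d) (\<lambda>(w, w'). f w w')"
  shows "continuous_on U (\<lambda>w. rint c d (f w))"
proof -
  have "continuous_on (U \<times> cbox (0, 0) (1, 1)) (\<lambda>(w, s). f w (cell c d s))"
    unfolding case_prod_unfold
    by (intro continuous_on_compose_pair[OF f] continuous_intros continuous_on_compose2[OF continuous_on_cell[of UNIV]])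
      (use cell_in_cbox[OF cd] in auto)
  from integral_continuous_on_param[OF this] show ?thesis
    unfolding rint_def by (intro continuous_intros)
qed

lemma rint_integrable:
  fixes f :: "complex \<Rightarrow> complex"
  assumes "Re a \<le> Re b" "Im a \<le> Im b" "continuous_on (cbox a b) f"
  shows "(\<lambda>s. f (cell a b s)) integrable_on cbox (0, 0) (1, 1)"
proof -
  have "continuous_on (cbox (0, 0) (1, 1)) (\<lambda>s. f (cell a b s))"
    by (rule continuous_on_compose2[OF assms(3) continuous_on_cell]) (use cell_in_cbox[OF assms(1,2)] in blast)
  then show ?thesis by (rule integrable_continuous)
qed

lemma rint_add_mult:
  assumes ab: "Re a \<le> Re b" "Im a \<le> Im b" and f: "continuous_on (cbox a b) f" and g: "continuous_on (cbox a b) g"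
  shows "rint a b (\<lambda>z. f z + k * g z) = rint a b f + k * rint a b g"
  unfolding rint_def
  by (subst integral_add) (auto intro: rint_integrable[OF ab] f integrable_on_mult_right[OF rint_integrable[OF ab g]]
    simp: algebra_simps)

lemma rint_bound:
  assumes ab: "Re a \<le> Re b" "Im a \<le> Im b" and f: "continuous_on (cbox a b) f"
    and B: "0 \<le> B" "\<And>z. z \<in> cbox a b \<Longrightarrow> norm (f z) \<le> B"
  shows "norm (rint a b f) \<le> (Re b - Re a) * (Im b - Im a) * B"
proof -
  have "norm (integral (cbox (0, 0) (1, 1)) (\<lambda>s. f (cell a b s))) \<le> B * measure lborel (cbox (0::real, 0::real) (1, 1))"
    by (rule integrable_bound[OF B(1) rint_integrable[OF ab f]]) (use B(2) cell_in_cbox[OF ab] in blast)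
  then have "norm (integral (cbox (0, 0) (1, 1)) (\<lambda>s. f (cell a b s))) \<le> B" by (simp add: content_Pair)
  moreover have "norm (of_real ((Re b - Re a) * (Im b - Im a)) :: complex) = (Re b - Re a) * (Im b - Im a)"
    using ab by (simp only: norm_of_real) simp
  ultimately show ?thesis unfolding rint_def norm_mult using ab by (simp only:) (intro mult_left_mono; simp)
qed

lemma contour_integral_linepath_add_mult:
  assumes "continuous_on (closed_segment p q) f" "continuous_on (closed_segment p q) g"
  shows "contour_integral (linepath p q) (\<lambda>z. f z + k * g z) =
    contour_integral (linepath p q) f + k * contour_integral (linepath p q) g"
proof -
  have f: "f contour_integrable_on linepath p q" and g: "g contour_integrable_on linepath p q"
    using assms by (auto intro: contour_integrable_continuous_linepath)
  show ?thesis
    using contour_integral_add[OF f contour_integrable_lmul[OF g, of k]] contour_integral_lmul[OF g, of k] by simp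
qed

lemma three_int_add_mult:
  assumes "continuous_on (three_edges a b) f" "continuous_on (three_edges a b) g"
  shows "three_int a b (\<lambda>z. f z + k * g z) = three_int a b f + k * three_int a b g"
  unfolding three_int_def
  by (subst (1 2 3) contour_integral_linepath_add_mult)
    (auto intro: continuous_on_subset[OF assms(1)] continuous_on_subset[OF assms(2)] simp: three_edges_def algebra_simps)

lemma left_int_add_mult:
  assumes "continuous_on (left_edge a b) f" "continuous_on (left_edge a b) g"
  shows "left_int a b (\<lambda>z. f z + k * g z) = left_int a b f + k * left_int a b g"
  using assms contour_integral_linepath_add_mult unfolding left_int_def left_edge_def by blast

lemma bint_add_mult:
  assumes "continuous_on (three_edges a b \<union> left_edge a b) f" "continuous_on (three_edges a b \<union> left_edge a b) g"
  shows "bint a b (\<lambda>z. f z + k * g z) = bint a b f + k * bint a b g"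
  unfolding bint_def
  by (subst three_int_add_mult, (rule continuous_on_subset[OF assms(1)] continuous_on_subset[OF assms(2)], blast)+,
      subst left_int_add_mult, (rule continuous_on_subset[OF assms(1)] continuous_on_subset[OF assms(2)], blast)+)
    (simp add: algebra_simps)

lemma contour_integral_cmult: "contour_integral g (\<lambda>z. k * f z) = k * contour_integral g f"
  unfolding contour_integral_integral mult.assoc by (rule integral_mult_right)

lemma bint_cmult: "bint a b (\<lambda>z. k * f z) = k * bint a b f"
  unfolding bint_def three_int_def left_int_def contour_integral_cmult by (simp add: algebra_simps)

lemma left_int_bound:
  assumes "continuous_on (left_edge a b) f" "0 \<le> B" "\<And>z. z \<in> left_edge a b \<Longrightarrow> norm (f z) \<le> B"
  shows "norm (left_int a b f) \<le> B * \<bar>Im b - Im a\<bar>"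
proof -
  have "norm (left_int a b f) \<le> B * norm (corner4 a b - a)"
    unfolding left_int_def using assms
    by (intro contour_integral_bound_linepath contour_integrable_continuous_linepath) (auto simp: left_edge_def)
  also have "corner4 a b - a = Complex 0 (Im b - Im a)" by (simp add: complex_eq_iff)
  also have "norm (Complex 0 (Im b - Im a)) = \<bar>Im b - Im a\<bar>" by (simp add: complex_norm)
  finally show ?thesis .
qed

lemma three_int_bound:
  assumes "continuous_on (three_edges a b) f" "0 \<le> B" "\<And>z. z \<in> three_edges a b \<Longrightarrow> norm (f z) \<le> B"
  shows "norm (three_int a b f) \<le> B * (norm (corner2 a b - a) + norm (b - corner2 a b) + norm (b - corner4 a b))"
proof -
  have *: "norm (contour_integral (linepath p q) f) \<le> B * norm (q - p)" if "closed_segment p q \<subseteq> three_edges a b" for p q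
    using assms that
    by (intro contour_integral_bound_linepath contour_integrable_continuous_linepath continuous_on_subset[OF assms(1)]) auto
  have "norm (three_int a b f) \<le> norm (contour_integral (linepath a (corner2 a b)) f) +
      norm (contour_integral (linepath (corner2 a b) b) f) + norm (contour_integral (linepath (corner4 a b) b) f)"
    unfolding three_int_def by (meson add_mono norm_triangle_ineq norm_triangle_ineq4 order_refl order_trans)
  also have "\<dots> \<le> B * norm (corner2 a b - a) + B * norm (b - corner2 a b) + B * norm (b - corner4 a b)"
    by (intro add_mono *) (auto simp: three_edges_def)
  finally show ?thesis by (simp add: algebra_simps)
qed

lemma contour_integral_linepath_cong:
  "(\<And>z. z \<in> closed_segment p q \<Longrightarrow> f z = g z) \<Longrightarrow> contour_integral (linepath p q) f = contour_integral (linepath p q) g"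
  by (rule contour_integral_eq) simp

lemma three_int_cong: "(\<And>z. z \<in> three_edges a b \<Longrightarrow> f z = g z) \<Longrightarrow> three_int a b f = three_int a b g"
  unfolding three_int_def three_edges_def
  by (intro arg_cong2[where f="(-)"] arg_cong2[where f="(+)"] contour_integral_linepath_cong) auto

lemma left_int_cong: "(\<And>z. z \<in> left_edge a b \<Longrightarrow> f z = g z) \<Longrightarrow> left_int a b f = left_int a b g"
  unfolding left_int_def left_edge_def by (intro contour_integral_linepath_cong) auto

lemma bint_cong: "(\<And>z. z \<in> three_edges a b \<union> left_edge a b \<Longrightarrow> f z = g z) \<Longrightarrow> bint a b f = bint a b g"
  unfolding bint_def by (intro arg_cong2[where f="(-)"] three_int_cong left_int_cong) auto

lemma contour_integral_linepath_swap:
  assumes "continuous_on (closed_segment p q \<times> closed_segment r s) (\<lambda>(x, y). f x y)"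
  shows "contour_integral (linepath p q) (\<lambda>x. contour_integral (linepath r s) (f x)) =
    contour_integral (linepath r s) (\<lambda>y. contour_integral (linepath p q) (\<lambda>x. f x y))"
  by (rule contour_integral_swap) (use assms in \<open>auto simp: vector_derivative_linepath_at\<close>)

lemma continuous_on_contour_integral_linepath:
  assumes "continuous_on (U \<times> closed_segment r s) (\<lambda>(x, y). f x y)"
  shows "continuous_on U (\<lambda>x. contour_integral (linepath r s) (f x))"
proof -
  have "continuous_on (U \<times> cbox 0 1) (\<lambda>p. linepath r s (snd p))"
    unfolding linepath_def by (intro continuous_intros)
  then have "continuous_on (U \<times> cbox 0 1) (\<lambda>(x, t). f x (linepath r s t))"
    unfolding case_prod_unfold
    by (intro continuous_on_compose_pair[OF assms] continuous_intros) (auto simp: linepath_in_path)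
  from integral_continuous_on_param[OF this]
  have "continuous_on U (\<lambda>x. integral {0..1} (\<lambda>t. f x (linepath r s t)))" by simp
  then have "continuous_on U (\<lambda>x. integral {0..1} (\<lambda>t. f x (linepath r s t)) * (s - r))"
    by (intro continuous_intros)
  then show ?thesis by (simp add: contour_integral_integral vector_derivative_linepath_at)
qed

lemma continuous_on_bint:
  assumes "continuous_on (U \<times> (three_edges c d \<union> left_edge c d)) (\<lambda>(x, y). f x y)"
  shows "continuous_on U (\<lambda>x. bint c d (f x))"
  unfolding bint_def three_int_def left_int_def
  by (intro continuous_intros continuous_on_contour_integral_linepath continuous_on_subset[OF assms])
    (auto simp: three_edges_def left_edge_def)

lemma contour_integral_bint_swap:
  assumes "continuous_on (closed_segment p q \<times> (three_edges c d \<union> left_edge c d)) (\<lambda>(x, y). f x y)"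
  shows "contour_integral (linepath p q) (\<lambda>x. bint c d (f x)) = bint c d (\<lambda>y. contour_integral (linepath p q) (\<lambda>x. f x y))"
proof -
  have sub: "closed_segment c (corner2 c d) \<subseteq> three_edges c d \<union> left_edge c d"
    "closed_segment (corner2 c d) d \<subseteq> three_edges c d \<union> left_edge c d"
    "closed_segment (corner4 c d) d \<subseteq> three_edges c d \<union> left_edge c d"
    "closed_segment c (corner4 c d) \<subseteq> three_edges c d \<union> left_edge c d"
    by (auto simp: three_edges_def left_edge_def)
  have i: "(\<lambda>x. contour_integral (linepath r s) (f x)) contour_integrable_on linepath p q"
    if "closed_segment r s \<subseteq> three_edges c d \<union> left_edge c d" for r s
    by (intro contour_integrable_continuous_linepath continuous_on_contour_integral_linepath continuous_on_subset[OF assms])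
      (use that in auto)
  have sw: "contour_integral (linepath p q) (\<lambda>x. contour_integral (linepath r s) (f x)) =
    contour_integral (linepath r s) (\<lambda>y. contour_integral (linepath p q) (\<lambda>x. f x y))"
    if "closed_segment r s \<subseteq> three_edges c d \<union> left_edge c d" for r s
    by (intro contour_integral_linepath_swap continuous_on_subset[OF assms]) (use that in auto)
  show ?thesis
    unfolding bint_def three_int_def left_int_def
    by (simp add: contour_integral_diff contour_integral_add contour_integrable_add contour_integrable_diff i sub sw)
qed

lemma bint_swap:
  assumes "continuous_on ((three_edges a b \<union> left_edge a b) \<times> (three_edges c d \<union> left_edge c d)) (\<lambda>(x, y). f x y)"
  shows "bint a b (\<lambda>x. bint c d (f x)) = bint c d (\<lambda>y. bint a b (\<lambda>x. f x y))"
proof -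
  let ?E = "three_edges a b \<union> left_edge a b" and ?F = "three_edges c d \<union> left_edge c d"
  have sub: "closed_segment a (corner2 a b) \<subseteq> ?E" "closed_segment (corner2 a b) b \<subseteq> ?E"
    "closed_segment (corner4 a b) b \<subseteq> ?E" "closed_segment a (corner4 a b) \<subseteq> ?E"
    by (auto simp: three_edges_def left_edge_def)
  have sw: "contour_integral (linepath p q) (\<lambda>x. bint c d (f x)) = bint c d (\<lambda>y. contour_integral (linepath p q) (\<lambda>x. f x y))"
    if "closed_segment p q \<subseteq> ?E" for p q
    by (intro contour_integral_bint_swap continuous_on_subset[OF assms]) (use that in auto)
  have c: "continuous_on ?F (\<lambda>y. contour_integral (linepath p q) (\<lambda>x. f x y))" if "closed_segment p q \<subseteq> ?E" for p q
  proof (rule continuous_on_contour_integral_linepath)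
    show "continuous_on (?F \<times> closed_segment p q) (\<lambda>(x, y). f y x)"
      unfolding case_prod_unfold
      by (intro continuous_on_compose_pair[OF assms] continuous_intros) (use that in auto)
  qed
  have add: "bint c d (\<lambda>y. g y + h y) = bint c d g + bint c d h" and diff: "bint c d (\<lambda>y. g y - h y) = bint c d g - bint c d h"
    if "continuous_on ?F g" "continuous_on ?F h" for g h
    using bint_add_mult[OF that, of 1] bint_add_mult[OF that, of "-1"] by simp_all
  show ?thesis
    unfolding bint_def[of a b] three_int_def[of a b] left_int_def[of a b]
    by (simp add: sw sub add diff c continuous_on_add continuous_on_diff)
qed

text \<open>In \<open>three_int\<close> and \<open>left_int\<close> the top and left edges run in
  the direction of increasing coordinates. Reversing both turns \<open>bint\<close> into the
  integral over the positively oriented rectangle, to which Cauchy's formula applies.\<close>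

lemma bint_cauchy:
  assumes f: "f holomorphic_on UNIV" and ab: "Re a < Re b" "Im a < Im b"
  shows "p \<in> box a b \<Longrightarrow> bint a b (\<lambda>w. f w / (w - p)) = 2 * pi * \<i> * f p"
    and "p \<notin> cbox a b \<Longrightarrow> bint a b (\<lambda>w. f w / (w - p)) = 0"
proof -
  have path: "bint a b g = contour_integral (rectpath a b) g" if g: "continuous_on (path_image (rectpath a b)) g" for g
  proof -
    have ed: "path_image (rectpath a b) = closed_segment a (corner2 a b) \<union> (closed_segment (corner2 a b) b \<union>
        (closed_segment b (corner4 a b) \<union> closed_segment (corner4 a b) a))"
      by (simp add: rectpath_def Let_def path_image_join)
    have i: "g contour_integrable_on linepath p q" if "closed_segment p q \<subseteq> path_image (rectpath a b)" for p q
      by (intro contour_integrable_continuous_linepath continuous_on_subset[OF g that])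
    have s: "closed_segment a (corner2 a b) \<subseteq> path_image (rectpath a b)" "closed_segment (corner2 a b) b \<subseteq> path_image (rectpath a b)"
      "closed_segment b (corner4 a b) \<subseteq> path_image (rectpath a b)" "closed_segment (corner4 a b) a \<subseteq> path_image (rectpath a b)"
      unfolding ed by auto
    have r: "contour_integral (linepath (corner4 a b) b) g = - contour_integral (linepath b (corner4 a b)) g"
      "contour_integral (linepath a (corner4 a b)) g = - contour_integral (linepath (corner4 a b) a) g"
      by (intro contour_integral_reverse_linepath continuous_on_subset[OF g]; use s in \<open>simp add: closed_segment_commute\<close>)+
    show ?thesis
      unfolding rectpath_def Let_def bint_def three_int_def left_int_def
      by (simp add: contour_integrable_joinI i s r)
  qed
  have cont: "continuous_on (path_image (rectpath a b)) (\<lambda>w. f w / (w - p))" if "p \<notin> path_image (rectpath a b)" for p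
    using that by (intro continuous_intros holomorphic_on_imp_continuous_on[OF holomorphic_on_subset[OF f subset_UNIV]]) auto
  have main: "bint a b (\<lambda>w. f w / (w - p)) = 2 * pi * \<i> * winding_number (rectpath a b) p * f p"
    if p: "p \<notin> path_image (rectpath a b)" for p
  proof -
    have "((\<lambda>w. f w / (w - p)) has_contour_integral (2*pi * \<i> * winding_number (rectpath a b) p * f p)) (rectpath a b)"
      by (rule Cauchy_integral_formula_convex_simple[OF convex_UNIV f]) (use p in auto)
    then show ?thesis unfolding path[OF cont[OF p]] by (rule contour_integral_unique)
  qed
  show "bint a b (\<lambda>w. f w / (w - p)) = 2 * pi * \<i> * f p" if "p \<in> box a b"
  proof -
    have "p \<notin> path_image (rectpath a b)" using path_image_rectpath_inter_box[of a b] ab that by fastforce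
    then show ?thesis using main winding_number_rectpath[OF that] by simp
  qed
  show "bint a b (\<lambda>w. f w / (w - p)) = 0" if "p \<notin> cbox a b"
  proof -
    have "p \<notin> path_image (rectpath a b)" using path_image_rectpath_subset_cbox[of a b] ab that by fastforce
    then show ?thesis using main winding_number_rectpath_outside[of a b p] ab that by simp
  qed
qed

section \<open>The pairing of a form with a holomorphic function\<close>

text \<open>The boundary of the bidisc \<open>cbox a b \<times> cbox c d\<close>, from which the part over the left edge of
  \<open>cbox a b\<close> has been removed, is the domain of integration of \<open>\<phi> \<alpha> \<and> dw \<and> dw'\<close>, where \<open>\<alpha>\<close> has the
  coefficients \<open>a1\<close> and \<open>a2\<close>.\<close>

definition pairing :: "(complex \<Rightarrow> complex) \<Rightarrow> complex \<Rightarrow> complex \<Rightarrow> complex \<Rightarrow> complex \<Rightarrow>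
    (complex \<Rightarrow> complex \<Rightarrow> complex) \<Rightarrow> (complex \<Rightarrow> complex \<Rightarrow> complex) \<Rightarrow> complex" where
  "pairing \<phi> a b c d a1 a2 = three_int a b (\<lambda>w. \<phi> w * (2 * \<i> * rint c d (a2 w)))
     - 2 * \<i> * bint c d (\<lambda>w'. rint a b (\<lambda>w. \<phi> w * a1 w w'))"

locale birectangle =
  fixes a b c d :: complex and \<phi> :: "complex \<Rightarrow> complex"
  assumes ab: "Re a < Re b" "Im a < Im b" and cd: "Re c < Re d" "Im c < Im d" and hol: "\<phi> holomorphic_on UNIV"
begin

abbreviation "bdry \<equiv> three_edges c d \<union> left_edge c d"

lemma cont_\<phi>: "continuous_on S \<phi>"
  using holomorphic_on_imp_continuous_on[OF hol] continuous_on_subset by blast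

text \<open>After the wedge product with \<open>dw \<and> dw'\<close> only one coefficient survives
  on each face: \<open>a2\<close> over the edges of the first rectangle, \<open>a1\<close> over
  those of the second. Accordingly each coefficient is considered on its own faces.\<close>

definition coefs_continuous :: "(complex \<Rightarrow> complex \<Rightarrow> complex) \<Rightarrow> (complex \<Rightarrow> complex \<Rightarrow> complex) \<Rightarrow> bool" where
  "coefs_continuous a1 a2 \<longleftrightarrow> continuous_on (cbox a b \<times> bdry) (\<lambda>(w, w'). a1 w w') \<and>
     continuous_on (three_edges a b \<times> cbox c d) (\<lambda>(w, w'). a2 w w')"

lemma coefs_continuousD:
  assumes "coefs_continuous a1 a2"
  shows "w' \<in> bdry \<Longrightarrow> continuous_on (cbox a b) (\<lambda>w. \<phi> w * a1 w w')"
    and "w \<in> three_edges a b \<Longrightarrow> continuous_on (cbox c d) (a2 w)"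
    and "continuous_on (three_edges a b) (\<lambda>w. \<phi> w * (2 * \<i> * rint c d (a2 w)))"
    and "continuous_on bdry (\<lambda>w'. rint a b (\<lambda>w. \<phi> w * a1 w w'))"
proof -
  have 1: "continuous_on (cbox a b \<times> bdry) (\<lambda>(w, w'). a1 w w')" and 2: "continuous_on (three_edges a b \<times> cbox c d) (\<lambda>(w, w'). a2 w w')"
    using assms by (auto simp: coefs_continuous_def)
  show "continuous_on (cbox a b) (\<lambda>w. \<phi> w * a1 w w')" if "w' \<in> bdry"
    by (intro continuous_intros cont_\<phi> continuous_on_compose_pair[OF 1]) (use that in auto)
  show "continuous_on (cbox c d) (a2 w)" if "w \<in> three_edges a b"
    using continuous_on_compose_pair[OF 2 continuous_on_const continuous_on_id, of "cbox c d" w] that by simp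
  show "continuous_on (three_edges a b) (\<lambda>w. \<phi> w * (2 * \<i> * rint c d (a2 w)))"
    by (intro continuous_intros cont_\<phi> continuous_on_rint 2) (use cd in auto)
  show "continuous_on bdry (\<lambda>w'. rint a b (\<lambda>w. \<phi> w * a1 w w'))"
  proof (rule continuous_on_rint)
    have "continuous_on (bdry \<times> cbox a b) (\<lambda>p. a1 (snd p) (fst p))"
      by (intro continuous_on_compose_pair[OF 1] continuous_intros) auto
    then show "continuous_on (bdry \<times> cbox a b) (\<lambda>(w', w). \<phi> w * a1 w w')"
      unfolding case_prod_unfold
      by (intro continuous_intros continuous_on_compose2[OF cont_\<phi>[of UNIV]]) auto
  qed (use ab in auto)
qed

lemma pairing_add_mult:
  assumes f: "coefs_continuous a1 a2" and g: "coefs_continuous b1 b2"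
  shows "pairing \<phi> a b c d (\<lambda>w w'. a1 w w' + k * b1 w w') (\<lambda>w w'. a2 w w' + k * b2 w w') =
    pairing \<phi> a b c d a1 a2 + k * pairing \<phi> a b c d b1 b2"
proof -
  have "three_int a b (\<lambda>w. \<phi> w * (2 * \<i> * rint c d (\<lambda>w'. a2 w w' + k * b2 w w'))) =
    three_int a b (\<lambda>w. \<phi> w * (2 * \<i> * rint c d (a2 w)) + k * (\<phi> w * (2 * \<i> * rint c d (b2 w))))"
    by (rule three_int_cong)
      (use cd in \<open>simp add: rint_add_mult coefs_continuousD(2)[OF f] coefs_continuousD(2)[OF g] algebra_simps\<close>)
  also have "\<dots> = three_int a b (\<lambda>w. \<phi> w * (2 * \<i> * rint c d (a2 w))) + k * three_int a b (\<lambda>w. \<phi> w * (2 * \<i> * rint c d (b2 w)))"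
    by (rule three_int_add_mult[OF coefs_continuousD(3)[OF f] coefs_continuousD(3)[OF g]])
  finally have 1: "three_int a b (\<lambda>w. \<phi> w * (2 * \<i> * rint c d (\<lambda>w'. a2 w w' + k * b2 w w'))) = \<dots>" .
  have "rint a b (\<lambda>w. \<phi> w * (a1 w w' + k * b1 w w')) = rint a b (\<lambda>w. \<phi> w * a1 w w') + k * rint a b (\<lambda>w. \<phi> w * b1 w w')"
    if "w' \<in> bdry" for w'
    using rint_add_mult[OF _ _ coefs_continuousD(1)[OF f that] coefs_continuousD(1)[OF g that], of k] ab
    by (simp add: algebra_simps)
  then have "bint c d (\<lambda>w'. rint a b (\<lambda>w. \<phi> w * (a1 w w' + k * b1 w w'))) =
    bint c d (\<lambda>w'. rint a b (\<lambda>w. \<phi> w * a1 w w') + k * rint a b (\<lambda>w. \<phi> w * b1 w w'))"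
    by (intro bint_cong) auto
  also have "\<dots> = bint c d (\<lambda>w'. rint a b (\<lambda>w. \<phi> w * a1 w w')) + k * bint c d (\<lambda>w'. rint a b (\<lambda>w. \<phi> w * b1 w w'))"
    by (rule bint_add_mult[OF coefs_continuousD(4)[OF f] coefs_continuousD(4)[OF g]])
  finally show ?thesis using 1 unfolding pairing_def by (simp add: algebra_simps)
qed

text \<open>The bound involves nothing but the values of the coefficients on the faces; continuity
  of the functionals in the topology of forms rests on it.\<close>

lemma pairing_bound:
  obtains C where "C \<ge> 0" "\<And>a1 a2 B. coefs_continuous a1 a2 \<Longrightarrow> 0 \<le> B \<Longrightarrow>
    (\<And>w w'. w \<in> cbox a b \<Longrightarrow> w' \<in> bdry \<Longrightarrow> norm (a1 w w') \<le> B) \<Longrightarrow>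
    (\<And>w w'. w \<in> three_edges a b \<Longrightarrow> w' \<in> cbox c d \<Longrightarrow> norm (a2 w w') \<le> B) \<Longrightarrow>
    norm (pairing \<phi> a b c d a1 a2) \<le> C * B"
proof -
  have sub: "three_edges a b \<subseteq> cbox a b" using edges_subset(1)[of a b] ab by simp
  have "compact (\<phi> ` cbox a b)" by (rule compact_continuous_image[OF cont_\<phi>]) simp
  then obtain M' where M': "\<And>w. w \<in> cbox a b \<Longrightarrow> norm (\<phi> w) \<le> M'" using compact_imp_bounded bounded_iff by (metis imageI)
  define M where "M = max M' 0"
  have M: "M \<ge> 0" "\<And>w. w \<in> cbox a b \<Longrightarrow> norm (\<phi> w) \<le> M" using M' by (auto simp: M_def le_max_iff_disj)
  define A where "A = (Re b - Re a) * (Im b - Im a)"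
  define A' where "A' = (Re d - Re c) * (Im d - Im c)"
  define E where "E = norm (corner2 a b - a) + norm (b - corner2 a b) + norm (b - corner4 a b)"
  define E' where "E' = norm (corner2 c d - c) + norm (d - corner2 c d) + norm (d - corner4 c d)"
  have pos: "A \<ge> 0" "A' \<ge> 0" "E \<ge> 0" "E' \<ge> 0" using ab cd by (auto simp: A_def A'_def E_def E'_def)
  define C where "C = M * (2 * A') * E + 2 * (A * M * E' + A * M * \<bar>Im d - Im c\<bar>)"
  have "norm (pairing \<phi> a b c d a1 a2) \<le> C * B"
    if cc: "coefs_continuous a1 a2" and B: "0 \<le> B"
      and b1: "\<And>w w'. w \<in> cbox a b \<Longrightarrow> w' \<in> bdry \<Longrightarrow> norm (a1 w w') \<le> B"
      and b2: "\<And>w w'. w \<in> three_edges a b \<Longrightarrow> w' \<in> cbox c d \<Longrightarrow> norm (a2 w w') \<le> B" for a1 a2 B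
  proof -
    have "norm (\<phi> w * (2 * \<i> * rint c d (a2 w))) \<le> M * (2 * (A' * B))" if w: "w \<in> three_edges a b" for w
    proof -
      have "norm (rint c d (a2 w)) \<le> A' * B"
        unfolding A'_def using cd b2[OF w] B by (intro rint_bound coefs_continuousD(2)[OF cc w]) auto
      then show ?thesis unfolding norm_mult using M sub w B pos by (intro mult_mono) auto
    qed
    then have 1: "norm (three_int a b (\<lambda>w. \<phi> w * (2 * \<i> * rint c d (a2 w)))) \<le> M * (2 * (A' * B)) * E"
      unfolding E_def by (intro three_int_bound coefs_continuousD(3)[OF cc]) (use M B pos in auto)
    have r: "norm (rint a b (\<lambda>w. \<phi> w * a1 w w')) \<le> A * (M * B)" if w': "w' \<in> bdry" for w'
      unfolding A_def using ab M B b1[OF _ w']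
      by (intro rint_bound coefs_continuousD(1)[OF cc w']) (auto simp: norm_mult intro!: mult_mono)
    have 2: "norm (three_int c d (\<lambda>w'. rint a b (\<lambda>w. \<phi> w * a1 w w'))) \<le> A * (M * B) * E'"
      unfolding E'_def by (intro three_int_bound continuous_on_subset[OF coefs_continuousD(4)[OF cc]]) (use M B pos r in auto)
    have 3: "norm (left_int c d (\<lambda>w'. rint a b (\<lambda>w. \<phi> w * a1 w w'))) \<le> A * (M * B) * \<bar>Im d - Im c\<bar>"
      by (intro left_int_bound continuous_on_subset[OF coefs_continuousD(4)[OF cc]]) (use M B pos r in auto)
    have "norm (bint c d (\<lambda>w'. rint a b (\<lambda>w. \<phi> w * a1 w w'))) \<le> A * (M * B) * E' + A * (M * B) * \<bar>Im d - Im c\<bar>"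
      unfolding bint_def using norm_triangle_ineq4 2 3 by (meson add_mono order_trans)
    note n2 = this
    have n1: "norm (pairing \<phi> a b c d a1 a2) \<le> norm (three_int a b (\<lambda>w. \<phi> w * (2 * \<i> * rint c d (a2 w)))) +
        2 * norm (bint c d (\<lambda>w'. rint a b (\<lambda>w. \<phi> w * a1 w w')))"
      unfolding pairing_def by (rule order_trans[OF norm_triangle_ineq4]) (simp add: norm_mult)
    have "norm (pairing \<phi> a b c d a1 a2) \<le> M * (2 * (A' * B)) * E + 2 * (A * (M * B) * E' + A * (M * B) * \<bar>Im d - Im c\<bar>)"
      by (rule order_trans[OF n1 add_mono[OF 1 mult_left_mono[OF n2]]]) simp
    also have "\<dots> = C * B" by (simp add: C_def algebra_simps)
    finally show ?thesis .
  qed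
  moreover have "C \<ge> 0" unfolding C_def using pos M by simp
  ultimately show ?thesis using that by blast
qed

lemma pairing_primitive:
  assumes u: "\<And>w w'. w \<in> three_edges a b \<Longrightarrow> w' \<in> cbox c d \<Longrightarrow> (u w has_derivative Du w w') (at w' within cbox c d)"
    and cu: "\<And>w. w \<in> three_edges a b \<Longrightarrow> continuous_on (cbox c d) (\<lambda>w'. Du w w' 1)"
      "\<And>w. w \<in> three_edges a b \<Longrightarrow> continuous_on (cbox c d) (\<lambda>w'. Du w w' \<i>)"
    and a2: "\<And>w w'. w \<in> three_edges a b \<Longrightarrow> w' \<in> cbox c d \<Longrightarrow> a2 w w' = (Du w w' 1 + \<i> * Du w w' \<i>) / 2"
    and v: "\<And>w w'. w \<in> cbox a b \<Longrightarrow> w' \<in> bdry \<Longrightarrow> ((\<lambda>w. v w w') has_derivative Dv w w') (at w within cbox a b)"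
    and cv: "\<And>w'. w' \<in> bdry \<Longrightarrow> continuous_on (cbox a b) (\<lambda>w. Dv w w' 1)"
      "\<And>w'. w' \<in> bdry \<Longrightarrow> continuous_on (cbox a b) (\<lambda>w. Dv w w' \<i>)"
    and a1: "\<And>w w'. w \<in> cbox a b \<Longrightarrow> w' \<in> bdry \<Longrightarrow> a1 w w' = (Dv w w' 1 + \<i> * Dv w w' \<i>) / 2"
    and cont_v: "continuous_on (cbox a b \<times> bdry) (\<lambda>(w, w'). v w w')"
  shows "pairing \<phi> a b c d a1 a2 = three_int a b (\<lambda>w. \<phi> w * bint c d (u w)) - bint a b (\<lambda>w. \<phi> w * bint c d (v w))"
proof -
  have cdw: "Re c \<le> Re d" "Im c \<le> Im d" and abw: "Re a \<le> Re b" "Im a \<le> Im b" using ab cd by auto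
  have "2 * \<i> * rint c d (a2 w) = bint c d (u w)" if w: "w \<in> three_edges a b" for w
  proof -
    have "rint c d (a2 w) = rint c d (\<lambda>w'. (Du w w' 1 + \<i> * Du w w' \<i>) / 2)"
      unfolding rint_def using cell_in_cbox[OF cdw] a2[OF w] by (intro arg_cong2[where f="(*)"] integral_cong) auto
    then show ?thesis using green_rectangle[OF cdw u[OF w] cu[OF w]] by simp
  qed
  then have 1: "three_int a b (\<lambda>w. \<phi> w * (2 * \<i> * rint c d (a2 w))) = three_int a b (\<lambda>w. \<phi> w * bint c d (u w))"
    by (intro three_int_cong) simp
  have "2 * \<i> * rint a b (\<lambda>w. \<phi> w * a1 w w') = bint a b (\<lambda>w. \<phi> w * v w w')" if w': "w' \<in> bdry" for w'
  proof -
    have dphi: "(\<phi> has_derivative (\<lambda>h. deriv \<phi> w * h)) (at w within cbox a b)" for w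
    proof -
      have "(\<phi> has_field_derivative deriv \<phi> w) (at w within cbox a b)"
        by (rule holomorphic_derivI[OF hol open_UNIV UNIV_I])
      then show ?thesis by (simp add: has_field_derivative_def)
    qed
    have cdphi: "continuous_on S (deriv \<phi>)" for S
      using holomorphic_on_imp_continuous_on[OF holomorphic_deriv[OF hol open_UNIV]] continuous_on_subset by blast
    \<comment> \<open>The derivative of \<open>\<phi> * v\<close>. The part that comes from
      \<open>\<phi>\<close> is complex linear in \<open>h\<close>, so that the conjugate-linear part
      is \<open>\<phi> * a1\<close>.\<close>
    define D where "D w h = \<phi> w * Dv w w' h + deriv \<phi> w * h * v w w'" for w h
    have D: "((\<lambda>w. \<phi> w * v w w') has_derivative D w) (at w within cbox a b)" if "w \<in> cbox a b" for w
      unfolding D_def by (rule has_derivative_mult[OF dphi v[OF that w']])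
    have cvv: "continuous_on (cbox a b) (\<lambda>w. v w w')"
      using v[OF _ w'] by (rule has_derivative_continuous_on)
    have eq: "\<phi> w * a1 w w' = (D w 1 + \<i> * D w \<i>) / 2" if "w \<in> cbox a b" for w
      unfolding a1[OF that w'] D_def by (simp add: algebra_simps)
    have "rint a b (\<lambda>w. \<phi> w * a1 w w') = rint a b (\<lambda>w. (D w 1 + \<i> * D w \<i>) / 2)"
      unfolding rint_def using cell_in_cbox[OF abw] eq by (intro arg_cong2[where f="(*)"] integral_cong) auto
    moreover have "continuous_on (cbox a b) (\<lambda>w. D w 1)" "continuous_on (cbox a b) (\<lambda>w. D w \<i>)"
      unfolding D_def by (intro continuous_intros cont_\<phi> cv[OF w'] cdphi cvv)+
    ultimately show ?thesis using green_rectangle[OF abw D] by simp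
  qed
  then have "2 * \<i> * bint c d (\<lambda>w'. rint a b (\<lambda>w. \<phi> w * a1 w w')) = bint c d (\<lambda>w'. bint a b (\<lambda>w. \<phi> w * v w w'))"
  proof -
    have lin: "2 * \<i> * bint c d g = bint c d (\<lambda>w'. 2 * \<i> * g w')" for g
      by (simp only: bint_cmult)
    show ?thesis unfolding lin by (rule bint_cong) fact
  qed
  also have "\<dots> = bint a b (\<lambda>w. bint c d (\<lambda>w'. \<phi> w * v w w'))"
  proof (rule bint_swap[symmetric])
    have "three_edges a b \<union> left_edge a b \<subseteq> cbox a b" using edges_subset[OF abw] by simp
    then have "continuous_on ((three_edges a b \<union> left_edge a b) \<times> bdry) (\<lambda>(w, w'). v w w')"
      by (intro continuous_on_subset[OF cont_v]) auto
    then show "continuous_on ((three_edges a b \<union> left_edge a b) \<times> bdry) (\<lambda>(x, y). \<phi> x * v x y)"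
      unfolding case_prod_unfold
      by (intro continuous_intros continuous_on_compose2[OF cont_\<phi>[of UNIV]]) auto
  qed
  also have "\<dots> = bint a b (\<lambda>w. \<phi> w * bint c d (v w))"
    by (simp only: bint_cmult)
  finally show ?thesis unfolding pairing_def 1 by simp
qed

end

section \<open>The obstruction functionals\<close>

text \<open>Chosen so that \<open>x\<close> and \<open>perp x\<close> form a unitary basis if
  \<open>x\<close> is a unit vector.\<close>

definition perp :: "complex^2 \<Rightarrow> complex^2" where
  "perp x = vector [- cnj (x$2), cnj (x$1)]"

definition pt :: "complex^2 \<Rightarrow> complex \<Rightarrow> complex \<Rightarrow> complex^2" where
  "pt x w w' = w *s x + w' *s perp x"

definition rho :: "nat \<Rightarrow> real" where "rho n = 1 / 2 ^ n"

text \<open>The ratio gives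
  \<open>(1 - eta n)\<^sup>2 + (rho n)\<^sup>2 = 1 + (eta n)\<^sup>2\<close>, so points with
  \<open>Re w \<ge> 1 - eta n\<close> are outside of the ball as soon as
  \<open>\<bar>Im w\<bar>\<close> or \<open>norm w'\<close> reaches \<open>rho n\<close>.\<close>

definition eta :: "nat \<Rightarrow> real" where "eta n = (rho n)\<^sup>2 / 2"

definition "ra n = Complex (1 - eta n) (- rho n)"
definition "rb n = Complex (1 + eta n) (rho n)"
definition "qa n = Complex (- rho n) (- rho n)"
definition "qb n = Complex (rho n) (rho n)"

definition phi :: "real \<Rightarrow> complex \<Rightarrow> complex" where "phi t w = exp (of_real t * (w - 1))"

abbreviation "qbdry n \<equiv> three_edges (qa n) (qb n) \<union> left_edge (qa n) (qb n)"

lemma rho_pos: "rho n > 0" by (simp add: rho_def)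
lemma rho_le: "rho n \<le> 1" by (simp add: rho_def)
lemma eta_pos: "eta n > 0" using rho_pos[of n] by (simp add: eta_def)
lemma eta_le: "eta n \<le> 1 / 2" using rho_pos[of n] rho_le[of n] by (simp add: eta_def power_le_one)
lemma eta_le_rho: "eta n \<le> rho n"
  using rho_pos[of n] rho_le[of n] by (simp add: eta_def power2_eq_square mult_left_le)

lemma birectangle_n: "birectangle (ra n) (rb n) (qa n) (qb n) (phi t)"
proof
  show "phi t holomorphic_on UNIV" unfolding phi_def[abs_def] by (intro holomorphic_intros)
qed (use rho_pos[of n] eta_pos[of n] in \<open>auto simp: ra_def rb_def qa_def qb_def\<close>)

lemma norm_phi: "norm (phi t w) = exp (t * (Re w - 1))"
  by (simp add: phi_def norm_exp_eq_Re)

lemma mem_edges: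
  assumes "Re a \<le> Re b" "Im a \<le> Im b"
  shows "w \<in> three_edges a b \<longleftrightarrow> (Im w \<in> {Im a, Im b} \<and> Re w \<in> {Re a..Re b}) \<or> (Re w = Re b \<and> Im w \<in> {Im a..Im b})"
    and "w \<in> left_edge a b \<longleftrightarrow> Re w = Re a \<and> Im w \<in> {Im a..Im b}"
  using assms
  by (auto simp: three_edges_def left_edge_def closed_segment_same_Re closed_segment_same_Im closed_segment_eq_real_ivl)

lemma norm_pt:
  assumes "norm x = 1" shows "(norm (pt x w w'))\<^sup>2 = (norm w)\<^sup>2 + (norm w')\<^sup>2"
proof -
  have x: "x$1 * cnj (x$1) + x$2 * cnj (x$2) = 1"
  proof -
    have "complex_of_real ((norm (x$1))\<^sup>2 + (norm (x$2))\<^sup>2) = 1"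
      using norm_complex2[of x] assms by simp
    then show ?thesis unfolding of_real_add complex_norm_square .
  qed
  have "complex_of_real ((norm (pt x w w'))\<^sup>2) =
      (w * x$1 - w' * cnj (x$2)) * cnj (w * x$1 - w' * cnj (x$2)) + (w * x$2 + w' * cnj (x$1)) * cnj (w * x$2 + w' * cnj (x$1))"
    unfolding norm_complex2 of_real_add complex_norm_square by (simp add: pt_def perp_def)
  also have "\<dots> = (w * cnj w + w' * cnj w') * (x$1 * cnj (x$1) + x$2 * cnj (x$2))"
    by (simp add: algebra_simps)
  also have "\<dots> = complex_of_real ((norm w)\<^sup>2 + (norm w')\<^sup>2)" unfolding x of_real_add complex_norm_square by simp
  finally show ?thesis unfolding of_real_eq_iff .
qed

lemma pt_diff: "pt x w w' - of_real p *s x = pt x (w - of_real p) w'"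
  by (simp add: pt_def vec_eq_iff algebra_simps)

lemma continuous_on_pt: "continuous_on S g \<Longrightarrow> continuous_on S h \<Longrightarrow> continuous_on S (\<lambda>s. pt x (g s) (h s))"
  unfolding pt_def by (intro continuous_intros bounded_linear.continuous_on[OF
      bounded_bilinear.bounded_linear_left[OF bounded_bilinear_smult]])

lemma qbdry_norm: "w' \<in> qbdry n \<Longrightarrow> norm w' \<ge> rho n"
  using rho_pos[of n] abs_Re_le_cmod[of w'] abs_Im_le_cmod[of w']
  by (auto simp: mem_edges qa_def qb_def)

lemma qbdry_subset: "qbdry n \<subseteq> cbox (qa n) (qb n)"
  using edges_subset[of "qa n" "qb n"] rho_pos[of n] by (simp add: qa_def qb_def)

lemma three_edges_subset: "three_edges (ra n) (rb n) \<subseteq> cbox (ra n) (rb n)"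
  and left_edge_subset: "left_edge (ra n) (rb n) \<subseteq> cbox (ra n) (rb n)"
  using edges_subset[of "ra n" "rb n"] rho_pos[of n] eta_pos[of n] by (simp_all add: ra_def rb_def)

lemma one_le_squares: "1 \<le> (1 - eta n)\<^sup>2 + (rho n)\<^sup>2"
proof -
  have "(1 - eta n)\<^sup>2 + (rho n)\<^sup>2 = 1 + (eta n)\<^sup>2"
    by (simp add: eta_def power2_eq_square algebra_simps)
  then show ?thesis by simp
qed

text \<open>Over the boundary of the second rectangle, \<open>Re w \<ge> 1 - eta n\<close> and
  \<open>norm w' \<ge> rho n\<close>. On the horizontal edges of the first rectangle
  \<open>\<bar>Im w\<bar>\<close> takes over the role of \<open>norm w'\<close>, and on its right
  edge \<open>Re w > 1\<close>. The face over the left edge is the one that enters the ball.\<close>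

lemma region_in_xdom:
  assumes x: "norm x = 1"
  shows "w \<in> cbox (ra n) (rb n) \<Longrightarrow> w' \<in> qbdry n \<Longrightarrow> pt x w w' \<in> xdom 1"
    and "w \<in> three_edges (ra n) (rb n) \<Longrightarrow> pt x w w' \<in> xdom 1"
proof -
  have *: "pt x w w' \<in> xdom 1" if "1 \<le> (norm w)\<^sup>2 + (norm w')\<^sup>2" for w w'
    using that unfolding norm_pt[OF x, symmetric] xdom_1_iff
    by (metis abs_norm_cancel abs_square_less_1 linorder_not_le)
  have re: "(1 - eta n)\<^sup>2 \<le> (Re w)\<^sup>2" if "Re w \<ge> 1 - eta n" for w
    using that eta_le[of n] by (intro power_mono) auto
  show "pt x w w' \<in> xdom 1" if w: "w \<in> cbox (ra n) (rb n)" and w': "w' \<in> qbdry n"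
  proof (rule *)
    have "(1 - eta n)\<^sup>2 \<le> (norm w)\<^sup>2"
      using re[of w] w unfolding cmod_power2 by (simp add: in_cbox_complex_iff ra_def add_increasing2)
    moreover have "(rho n)\<^sup>2 \<le> (norm w')\<^sup>2" using qbdry_norm[OF w'] rho_pos[of n] by (intro power_mono) auto
    ultimately show "1 \<le> (norm w)\<^sup>2 + (norm w')\<^sup>2" using one_le_squares[of n] by linarith
  qed
  show "pt x w w' \<in> xdom 1" if w: "w \<in> three_edges (ra n) (rb n)"
  proof (rule *)
    have "1 \<le> (Re w)\<^sup>2 + (Im w)\<^sup>2"
    proof (cases "Re w = 1 + eta n")
      case True
      have "1 \<le> (1 + eta n)\<^sup>2" using eta_pos[of n] by simp
      then show ?thesis unfolding True by (simp add: add_increasing2)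
    next
      case False
      then have "(Im w)\<^sup>2 = (rho n)\<^sup>2" "Re w \<ge> 1 - eta n"
        using w rho_pos[of n] eta_pos[of n] by (auto simp: mem_edges ra_def rb_def)
      then show ?thesis using re[of w] one_le_squares[of n] by linarith
    qed
    then show "1 \<le> (norm w)\<^sup>2 + (norm w')\<^sup>2" by (simp add: cmod_power2 add_increasing2)
  qed
qed

section \<open>The functionals on forms and their decay on exact forms\<close>

definition coef :: "complex^2 \<Rightarrow> complex form01 \<Rightarrow> complex^2 \<Rightarrow> complex \<Rightarrow> complex \<Rightarrow> complex" where
  "coef x \<alpha> v w w' = \<alpha> (xpt 1 (pt x w w')) 1 v"

definition Lam :: "complex^2 \<Rightarrow> nat \<Rightarrow> real \<Rightarrow> complex form01 \<Rightarrow> complex" where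
  "Lam x n t \<alpha> = pairing (phi t) (ra n) (rb n) (qa n) (qb n) (coef x \<alpha> x) (coef x \<alpha> (perp x))"

lemma coefs_continuous_coef:
  assumes x: "norm x = 1" and \<alpha>: "\<alpha> \<in> A01c"
  shows "birectangle.coefs_continuous (ra n) (rb n) (qa n) (qb n) (coef x \<alpha> x) (coef x \<alpha> (perp x))"
proof -
  have c: "continuous_on (xdom 1) (\<lambda>z. \<alpha> (xpt 1 z) 1 v)" for v
    by (rule smooth_upto_continuous[OF A01cD(5)[OF \<alpha>]])
  show ?thesis
    unfolding birectangle.coefs_continuous_def[OF birectangle_n] coef_def case_prod_unfold
    by (intro conjI continuous_on_compose2[OF c] continuous_on_pt continuous_intros)
      (use region_in_xdom[OF x] in auto)
qed

lemma Lam_add_scale: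
  assumes x: "norm x = 1" and "\<alpha> \<in> A01c" "\<beta> \<in> A01c"
  shows "Lam x n t (\<alpha> + form_scale k \<beta>) = Lam x n t \<alpha> + k * Lam x n t \<beta>"
  using birectangle.pairing_add_mult[OF birectangle_n coefs_continuous_coef[OF x assms(2)] coefs_continuous_coef[OF x assms(3)], where k=k]
  unfolding Lam_def coef_def by (simp add: form_scale_def)

lemma Lam_bound:
  assumes x: "norm x = 1"
  obtains C K where "C \<ge> 0" "compact K" "K \<subseteq> xdom 1"
    "\<And>\<alpha> B. \<alpha> \<in> A01c \<Longrightarrow> 0 \<le> B \<Longrightarrow> \<forall>z\<in>K. norm (\<alpha> (xpt 1 z) 1 x) \<le> B \<and> norm (\<alpha> (xpt 1 z) 1 (perp x)) \<le> B \<Longrightarrow>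
      norm (Lam x n t \<alpha>) \<le> C * B"
proof -
  interpret birectangle "ra n" "rb n" "qa n" "qb n" "phi t" by (rule birectangle_n)
  obtain C where C: "C \<ge> 0" "\<And>a1 a2 B. coefs_continuous a1 a2 \<Longrightarrow> 0 \<le> B \<Longrightarrow>
    (\<And>w w'. w \<in> cbox (ra n) (rb n) \<Longrightarrow> w' \<in> bdry \<Longrightarrow> norm (a1 w w') \<le> B) \<Longrightarrow>
    (\<And>w w'. w \<in> three_edges (ra n) (rb n) \<Longrightarrow> w' \<in> cbox (qa n) (qb n) \<Longrightarrow> norm (a2 w w') \<le> B) \<Longrightarrow>
    norm (pairing (phi t) (ra n) (rb n) (qa n) (qb n) a1 a2) \<le> C * B"
    using pairing_bound by blast
  define K where "K = (\<lambda>p. pt x (fst p) (snd p)) ` (cbox (ra n) (rb n) \<times> bdry \<union> three_edges (ra n) (rb n) \<times> cbox (qa n) (qb n))"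
  have "compact K" unfolding K_def
    by (intro compact_continuous_image continuous_on_pt continuous_intros compact_Un compact_Times
      compact_three_edges compact_left_edge compact_cbox)
  moreover have "K \<subseteq> xdom 1" unfolding K_def using region_in_xdom[OF x] by auto
  moreover have "norm (Lam x n t \<alpha>) \<le> C * B"
    if "\<alpha> \<in> A01c" "0 \<le> B" and b: "\<forall>z\<in>K. norm (\<alpha> (xpt 1 z) 1 x) \<le> B \<and> norm (\<alpha> (xpt 1 z) 1 (perp x)) \<le> B" for \<alpha> B
    unfolding Lam_def
  proof (rule C(2)[OF coefs_continuous_coef[OF x that(1)] that(2)])
    show "norm (coef x \<alpha> x w w') \<le> B" if "w \<in> cbox (ra n) (rb n)" "w' \<in> bdry" for w w'
    proof -
      have "pt x w w' \<in> K" unfolding K_def using that by (intro image_eqI[of _ _ "(w, w')"]) auto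
      then show ?thesis using b by (simp add: coef_def)
    qed
    show "norm (coef x \<alpha> (perp x) w w') \<le> B" if "w \<in> three_edges (ra n) (rb n)" "w' \<in> cbox (qa n) (qb n)" for w w'
    proof -
      have "pt x w w' \<in> K" unfolding K_def using that by (intro image_eqI[of _ _ "(w, w')"]) auto
      then show ?thesis using b by (simp add: coef_def)
    qed
  qed
  ultimately show ?thesis using that C(1) by blast
qed

lemma left_int_phi_bound:
  assumes "continuous_on (left_edge (ra n) (rb n)) g" "0 \<le> B" "\<And>w. w \<in> left_edge (ra n) (rb n) \<Longrightarrow> norm (g w) \<le> B"
  shows "norm (left_int (ra n) (rb n) (\<lambda>w. phi t w * g w)) \<le> 2 * rho n * B * exp (- (t * eta n))"
proof -
  interpret birectangle "ra n" "rb n" "qa n" "qb n" "phi t" by (rule birectangle_n)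
  have "norm (left_int (ra n) (rb n) (\<lambda>w. phi t w * g w)) \<le> (exp (- (t * eta n)) * B) * \<bar>Im (rb n) - Im (ra n)\<bar>"
  proof (rule left_int_bound)
    show "continuous_on (left_edge (ra n) (rb n)) (\<lambda>w. phi t w * g w)"
      by (intro continuous_intros assms cont_\<phi>)
    fix w assume w: "w \<in> left_edge (ra n) (rb n)"
    then have "Re w = 1 - eta n" using ab by (simp add: mem_edges ra_def)
    then have "norm (phi t w) = exp (- (t * eta n))" by (simp add: norm_phi)
    then show "norm (phi t w * g w) \<le> exp (- (t * eta n)) * B"
      using assms(3)[OF w] by (simp add: norm_mult mult_left_mono)
  qed (use assms in auto)
  also have "\<bar>Im (rb n) - Im (ra n)\<bar> = 2 * rho n" using rho_pos[of n] by (simp add: ra_def rb_def)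
  finally show ?thesis by (simp add: mult_ac)
qed

lemma Lam_exact_near:
  assumes x: "norm x = 1" and ex: "exact_near \<alpha> x"
  shows "\<exists>n0. \<forall>n\<ge>n0. \<exists>M. \<forall>t. norm (Lam x n t \<alpha>) \<le> M * exp (- (t * eta n))"
proof -
  obtain r u where r: "r > 0" and u: "smooth_upto (xdom 1 \<inter> ball x r) u"
    and du: "\<And>z v. z \<in> xdom 1 \<inter> ball x r \<Longrightarrow> dbar_at (xdom 1) u z v = \<alpha> (xpt 1 z) 1 v"
    using ex unfolding exact_near_def by blast
  obtain n0 where n0: "(1/2) ^ n0 < r / 2" using real_arch_pow_inv[of "r/2" "1/2"] r by auto
  show ?thesis
  proof (intro exI[of _ n0] allI impI)
    fix n assume n: "n \<ge> n0"
    have "rho n \<le> (1/2) ^ n0" unfolding rho_def using n by (simp add: power_one_over power_decreasing divide_simps)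
    then have rho: "2 * rho n < r" using n0 by simp
    define R where "R = (cbox (ra n) (rb n) \<times> qbdry n) \<union> (three_edges (ra n) (rb n) \<times> cbox (qa n) (qb n))"
    have inS: "pt x w w' \<in> xdom 1 \<inter> ball x r" if "(w, w') \<in> R" for w w'
    proof -
      have b: "w \<in> cbox (ra n) (rb n)" "w' \<in> cbox (qa n) (qb n)"
        using that three_edges_subset qbdry_subset unfolding R_def by blast+
      have "(norm (pt x w w' - x))\<^sup>2 = (norm (w - 1))\<^sup>2 + (norm w')\<^sup>2"
        using pt_diff[of x w w' 1] norm_pt[OF x, of "w - 1" w'] by simp
      also have "\<dots> \<le> ((rho n)\<^sup>2 + (rho n)\<^sup>2) + ((rho n)\<^sup>2 + (rho n)\<^sup>2)"
        unfolding cmod_power2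
        by (intro add_mono; rule abs_le_square_iff[THEN iffD1];
          use b eta_le_rho[of n] rho_pos[of n] in \<open>auto simp: in_cbox_complex_iff ra_def rb_def qa_def qb_def\<close>)
      also have "\<dots> = (2 * rho n)\<^sup>2" by (simp add: power2_eq_square)
      finally have "norm (pt x w w' - x) \<le> 2 * rho n" by (rule power2_le_imp_le) (use rho_pos[of n] in simp)
      then have "pt x w w' \<in> ball x r" using rho by (simp add: dist_norm norm_minus_commute)
      moreover have "pt x w w' \<in> xdom 1" using that region_in_xdom[OF x] unfolding R_def by blast
      ultimately show ?thesis by simp
    qed
    define D where "D z = frechet_derivative u (at z within xdom 1)" for z
    have D: "(u has_derivative D z) (at z within xdom 1)" if "z \<in> xdom 1 \<inter> ball x r" for z
      unfolding D_def by (rule smooth_upto_has_derivative[OF has_cones_xdom u]) (use that in auto)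
    have cD: "continuous_on (xdom 1 \<inter> ball x r) (\<lambda>z. D z v)" for v
      using smooth_upto_continuous[OF smooth_upto_iter_deriv[OF has_cones_xdom u open_ball, of "[v]"]]
      by (simp add: D_def)
    define U where "U w w' = u (pt x w w')" for w w'
    have dw': "(U w has_derivative (\<lambda>h. D (pt x w w') (h *s perp x))) (at w' within T)"
      if "(w, w') \<in> R" "\<And>s. s \<in> T \<Longrightarrow> (w, s) \<in> R" for w w' T
    proof -
      have "((\<lambda>w'. pt x w w') has_derivative (\<lambda>h. h *s perp x)) (at w' within T)"
        unfolding pt_def
        using has_derivative_add[OF has_derivative_const bounded_linear_imp_has_derivative[OF
          bounded_bilinear.bounded_linear_left[OF bounded_bilinear_smult]]] by fastforce
      moreover have "(u has_derivative D (pt x w w')) (at (pt x w w') within (\<lambda>w'. pt x w w') ` T)"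
        by (rule has_derivative_subset[OF D[OF inS]]) (use that inS in auto)
      ultimately show ?thesis unfolding U_def by (rule has_derivative_in_compose)
    qed
    have dw: "((\<lambda>w. U w w') has_derivative (\<lambda>h. D (pt x w w') (h *s x))) (at w within T)"
      if "(w, w') \<in> R" "\<And>s. s \<in> T \<Longrightarrow> (s, w') \<in> R" for w w' T
    proof -
      have "((\<lambda>w. pt x w w') has_derivative (\<lambda>h. h *s x)) (at w within T)"
        unfolding pt_def
        using has_derivative_add[OF bounded_linear_imp_has_derivative[OF
          bounded_bilinear.bounded_linear_left[OF bounded_bilinear_smult]] has_derivative_const] by fastforce
      moreover have "(u has_derivative D (pt x w w')) (at (pt x w w') within (\<lambda>w. pt x w w') ` T)"
        by (rule has_derivative_subset[OF D[OF inS]]) (use that inS in auto)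
      ultimately show ?thesis unfolding U_def by (rule has_derivative_in_compose)
    qed
    have cf: "coef x \<alpha> v w w' = (D (pt x w w') (1 *s v) + \<i> * D (pt x w w') (\<i> *s v)) / 2" if "(w, w') \<in> R" for v w w'
      unfolding coef_def du[OF inS[OF that], symmetric] dbar_at_def Let_def D_def by simp
    have cDw: "continuous_on T (\<lambda>s. D (pt x (g s) (h s)) v)"
      if "continuous_on T g" "continuous_on T h" "\<And>s. s \<in> T \<Longrightarrow> (g s, h s) \<in> R" for T :: "'z::topological_space set" and g h v
      by (rule continuous_on_compose2[OF cD continuous_on_pt[OF that(1,2)]]) (use that(3) inS in blast)
    have cU: "continuous_on T (\<lambda>s. U (g s) (h s))"
      if "continuous_on T g" "continuous_on T h" "\<And>s. s \<in> T \<Longrightarrow> (g s, h s) \<in> R" for T :: "'z::topological_space set" and g h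
      unfolding U_def
      by (rule continuous_on_compose2[OF smooth_upto_continuous[OF u] continuous_on_pt[OF that(1,2)]]) (use that(3) inS in blast)
    have R1: "(w, w') \<in> R" if "w \<in> three_edges (ra n) (rb n)" "w' \<in> cbox (qa n) (qb n)" for w w' using that by (simp add: R_def)
    have R2: "(w, w') \<in> R" if "w \<in> cbox (ra n) (rb n)" "w' \<in> qbdry n" for w w' using that by (simp add: R_def)
    \<comment> \<open>With the same primitive on all faces, the integral over three edges cancels
      against the full contour up to the left edge.\<close>
    have eq: "Lam x n t \<alpha> = left_int (ra n) (rb n) (\<lambda>w. phi t w * bint (qa n) (qb n) (U w))" for t
    proof -
      have "Lam x n t \<alpha> = three_int (ra n) (rb n) (\<lambda>w. phi t w * bint (qa n) (qb n) (U w)) -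
          bint (ra n) (rb n) (\<lambda>w. phi t w * bint (qa n) (qb n) (U w))"
        unfolding Lam_def
      proof (rule birectangle.pairing_primitive[OF birectangle_n,
          where Du="\<lambda>w w' h. D (pt x w w') (h *s perp x)" and Dv="\<lambda>w w' h. D (pt x w w') (h *s x)"], goal_cases)
        case (1 w w') then show ?case by (intro dw') (auto intro: R1)
      next
        case (2 w) then show ?case by (intro cDw continuous_intros) (auto intro: R1)
      next
        case (3 w) then show ?case by (intro cDw continuous_intros) (auto intro: R1)
      next
        case (4 w w') then show ?case by (intro cf R1)
      next
        case (5 w w') then show ?case by (intro dw) (auto intro: R2)
      next
        case (6 w') then show ?case by (intro cDw continuous_intros) (auto intro: R2)
      next
        case (7 w') then show ?case by (intro cDw continuous_intros) (auto intro: R2)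
      next
        case (8 w w') then show ?case by (intro cf R2)
      next
        case 9 show ?case unfolding case_prod_unfold by (intro cU continuous_intros) (auto intro: R2)
      qed
      then show ?thesis by (simp add: bint_def[of "ra n"])
    qed
    \<comment> \<open>Over the left edge only the boundary of the second rectangle enters, and there
      the points lie outside of the ball. The bound \<open>B\<close> obtained below is independent
      of \<open>t\<close>.\<close>
    have cb: "continuous_on (left_edge (ra n) (rb n)) (\<lambda>w. bint (qa n) (qb n) (U w))"
      by (rule continuous_on_bint, unfold case_prod_unfold, intro cU continuous_intros)
        (use left_edge_subset in \<open>auto intro!: R2\<close>)
    have "compact ((\<lambda>w. bint (qa n) (qb n) (U w)) ` left_edge (ra n) (rb n))"
      by (rule compact_continuous_image[OF cb compact_left_edge])
    then obtain B where B: "\<And>w. w \<in> left_edge (ra n) (rb n) \<Longrightarrow> norm (bint (qa n) (qb n) (U w)) \<le> B"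
      using compact_imp_bounded bounded_iff by (metis imageI)
    have "norm (Lam x n t \<alpha>) \<le> 2 * rho n * max B 0 * exp (- (t * eta n))" for t
      unfolding eq by (rule left_int_phi_bound[OF cb]) (use B in \<open>auto simp: le_max_iff_disj\<close>)
    then show "\<exists>M. \<forall>t. norm (Lam x n t \<alpha>) \<le> M * exp (- (t * eta n))" by blast
  qed
qed

section \<open>The Bochner-Martinelli kernel\<close>

text \<open>The form with coefficients \<open>- cnj w' / N\<^sup>2\<close> and \<open>cnj (w - p) / N\<^sup>2\<close>, \<open>N = \<bar>w - p\<bar>\<^sup>2 + \<bar>w'\<bar>\<^sup>2\<close>, has the primitive
  \<open>kern (w - p) w'\<close> off \<open>w = p\<close> and the primitive \<open>- kern w' (w - p)\<close> off \<open>w' = 0\<close>.\<close>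

definition kern :: "complex \<Rightarrow> complex \<Rightarrow> complex" where
  "kern c s = cnj s / (c * (c * cnj c + s * cnj s))"

definition kernD :: "complex \<Rightarrow> complex \<Rightarrow> complex \<Rightarrow> complex" where
  "kernD c s h = (c * cnj c * cnj h - (cnj s)\<^sup>2 * h) / (c * (c * cnj c + s * cnj s)\<^sup>2)"

lemma kern_denom: "c \<noteq> 0 \<Longrightarrow> c * cnj c + s * cnj s \<noteq> 0"
proof -
  assume "c \<noteq> 0"
  then have "(norm c)\<^sup>2 + (norm s)\<^sup>2 \<noteq> 0" by (simp add: add_nonneg_eq_0_iff)
  moreover have "c * cnj c + s * cnj s = of_real ((norm c)\<^sup>2 + (norm s)\<^sup>2)"
    unfolding of_real_add complex_norm_square ..
  ultimately show ?thesis by (metis of_real_eq_0_iff)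
qed

lemma kern_has_derivative:
  assumes c: "c \<noteq> 0" shows "(kern c has_derivative kernD c s) (at s within T)"
proof -
  have cn: "(cnj has_derivative cnj) (at s within T)" by (rule bounded_linear_imp_has_derivative[OF bounded_linear_cnj])
  have nz: "c * (c * cnj c + s * cnj s) \<noteq> 0" using kern_denom[OF c] c by simp
  have d: "((\<lambda>s. c * (c * cnj c + s * cnj s)) has_derivative (\<lambda>h. c * (s * cnj h + h * cnj s))) (at s within T)"
    by (rule derivative_eq_intros cn refl | simp)+
  have "((\<lambda>s. cnj s / (c * (c * cnj c + s * cnj s))) has_derivative
     (\<lambda>h. (cnj h * (c * (c * cnj c + s * cnj s)) - cnj s * (c * (s * cnj h + h * cnj s))) /
       ((c * (c * cnj c + s * cnj s)) * (c * (c * cnj c + s * cnj s))))) (at s within T)"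
    by (rule has_derivative_divide'[OF cn d nz])
  also have "(\<lambda>h. (cnj h * (c * (c * cnj c + s * cnj s)) - cnj s * (c * (s * cnj h + h * cnj s))) /
       ((c * (c * cnj c + s * cnj s)) * (c * (c * cnj c + s * cnj s)))) = kernD c s"
  proof
    fix h
    have "cnj h * (c * (c * cnj c + s * cnj s)) - cnj s * (c * (s * cnj h + h * cnj s)) = c * (c * cnj c * cnj h - (cnj s)\<^sup>2 * h)"
      by (simp add: algebra_simps power2_eq_square)
    then show "(cnj h * (c * (c * cnj c + s * cnj s)) - cnj s * (c * (s * cnj h + h * cnj s))) /
       ((c * (c * cnj c + s * cnj s)) * (c * (c * cnj c + s * cnj s))) = kernD c s h"
      using c kern_denom[OF c, of s] by (simp add: kernD_def power2_eq_square)
  qed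
  finally show ?thesis by (simp add: kern_def[abs_def])
qed

lemma kernD_conj_part: "c \<noteq> 0 \<Longrightarrow> (kernD c s 1 + \<i> * kernD c s \<i>) / 2 = cnj c / (c * cnj c + s * cnj s)\<^sup>2"
  using kern_denom[of c s] by (simp add: kernD_def divide_simps) (simp add: algebra_simps)

text \<open>The two primitives \<open>kern c s\<close> and \<open>- kern s c\<close> differ by
  \<open>1 / (c * s)\<close>, the kernel of the double Cauchy integral. This term carries the
  residue at the pole.\<close>

lemma kern_add: "c \<noteq> 0 \<Longrightarrow> s \<noteq> 0 \<Longrightarrow> kern c s + kern s c = 1 / (c * s)"
  using kern_denom[of c s] by (simp add: kern_def divide_simps add.commute[of "s * cnj s"])

lemma continuous_on_kern:
  assumes "continuous_on T g" "continuous_on T h" "\<And>s. s \<in> T \<Longrightarrow> g s \<noteq> 0"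
  shows "continuous_on T (\<lambda>s. kern (g s) (h s))"
  unfolding kern_def by (intro continuous_intros assms) (use kern_denom assms(3) in auto)

lemma continuous_on_kernD:
  assumes "continuous_on T g" "continuous_on T h" "\<And>s. s \<in> T \<Longrightarrow> g s \<noteq> 0"
  shows "continuous_on T (\<lambda>s. kernD (g s) (h s) v)"
  unfolding kernD_def by (intro continuous_intros assms) (use kern_denom assms(3) in auto)

lemma norm_kern_le:
  assumes "c \<noteq> 0" "s \<noteq> 0" shows "norm (kern c s) \<le> 1 / (norm c * norm s)"
proof -
  have "c * cnj c + s * cnj s = of_real ((norm c)\<^sup>2 + (norm s)\<^sup>2)" unfolding of_real_add complex_norm_square ..
  then have "norm (c * cnj c + s * cnj s) = (norm c)\<^sup>2 + (norm s)\<^sup>2" by (simp only: norm_of_real) simp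
  then have "norm (kern c s) = norm s / (norm c * ((norm c)\<^sup>2 + (norm s)\<^sup>2))" by (simp add: kern_def norm_divide norm_mult)
  also have "\<dots> \<le> norm s / (norm c * (norm s)\<^sup>2)"
    using assms by (intro divide_left_mono mult_left_mono mult_pos_pos add_pos_nonneg) auto
  also have "\<dots> = 1 / (norm c * norm s)" using assms by (simp add: power2_eq_square)
  finally show ?thesis .
qed

definition bm1 :: "real \<Rightarrow> complex \<Rightarrow> complex \<Rightarrow> complex" where
  "bm1 p w w' = - cnj w' / ((w - p) * cnj (w - p) + w' * cnj w')\<^sup>2"

definition bm2 :: "real \<Rightarrow> complex \<Rightarrow> complex \<Rightarrow> complex" where
  "bm2 p w w' = cnj (w - p) / ((w - p) * cnj (w - p) + w' * cnj w')\<^sup>2"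

text \<open>The primitive \<open>u\<close> is used over the three edges and \<open>v\<close> over
  the second boundary. Their difference, integrated over both full contours, is the square of
  \<open>2 * pi * \<i>\<close> times \<open>phi t p\<close> if the pole lies in the first rectangle,
  and 0 otherwise. What is left is an integral of \<open>u\<close> over the left edge. The margin
  \<open>eta n / 2\<close> keeps the pole away from this edge, so that \<open>C\<close> does not
  depend on \<open>p\<close> and \<open>t\<close>.\<close>

lemma pairing_bm:
  "\<exists>C\<ge>0. \<forall>p t. p < 1 \<longrightarrow> \<bar>p - (1 - eta n)\<bar> \<ge> eta n / 2 \<longrightarrow>
    norm (pairing (phi t) (ra n) (rb n) (qa n) (qb n) (bm1 p) (bm2 p)
      - (if p > 1 - eta n then - 4 * pi\<^sup>2 * exp (- (t * (1 - p))) else 0)) \<le> C * exp (- (t * eta n))"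
proof -
  define P where "P = norm (corner2 (qa n) (qb n) - qa n) + norm (qb n - corner2 (qa n) (qb n)) +
    norm (qb n - corner4 (qa n) (qb n)) + \<bar>Im (qb n) - Im (qa n)\<bar>"
  have P: "P \<ge> 0" by (simp add: P_def)
  \<comment> \<open>Bounds the kernel over the left edge, where
    \<open>norm (w - p) \<ge> eta n / 2\<close> and \<open>norm w' \<ge> rho n\<close>.\<close>
  define B where "B = 1 / (eta n / 2 * rho n)"
  have B: "B > 0" using eta_pos[of n] rho_pos[of n] by (simp add: B_def)
  define C where "C = 2 * rho n * (B * P)"
  have "norm (pairing (phi t) (ra n) (rb n) (qa n) (qb n) (bm1 p) (bm2 p)
      - (if p > 1 - eta n then - 4 * pi\<^sup>2 * exp (- (t * (1 - p))) else 0)) \<le> C * exp (- (t * eta n))"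
    if p1: "p < 1" and p: "\<bar>p - (1 - eta n)\<bar> \<ge> eta n / 2" for p t
  proof -
    interpret birectangle "ra n" "rb n" "qa n" "qb n" "phi t" by (rule birectangle_n)
    have e0: "eta n > 0" and r0: "rho n > 0" by (rule eta_pos rho_pos)+
    let ?E = "three_edges (ra n) (rb n)" and ?L = "left_edge (ra n) (rb n)"
    have w0: "w - of_real p \<noteq> 0" if "w \<in> ?E" for w
    proof
      assume "w - of_real p = 0"
      then have "w = of_real p" by simp
      then show False using that p1 e0 r0 ab by (auto simp: mem_edges ra_def rb_def)
    qed
    have wL: "norm (w - of_real p) \<ge> eta n / 2" if "w \<in> ?L" for w
    proof -
      have "\<bar>Re (w - of_real p)\<bar> \<ge> eta n / 2" using that p ab by (simp add: mem_edges ra_def abs_minus_commute)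
      then show ?thesis using abs_Re_le_cmod[of "w - of_real p"] by linarith
    qed
    have wL0: "w - of_real p \<noteq> 0" if "w \<in> ?L" for w using wL[OF that] e0 by auto
    have q0: "w' \<noteq> 0" if "w' \<in> bdry" for w' using qbdry_norm[OF that] r0 by auto
    define u where "u w w' = kern (w - of_real p) w'" for w w'
    define v where "v w w' = - kern w' (w - of_real p)" for w w'
    have uv: "u w w' = v w w' + 1 / (w - of_real p) * (1 / (w' - 0))" if "w - of_real p \<noteq> 0" "w' \<in> bdry" for w w'
      using kern_add[OF that(1) q0[OF that(2)]] by (simp add: u_def v_def eq_diff_eq)
    have main: "pairing (phi t) (ra n) (rb n) (qa n) (qb n) (bm1 p) (bm2 p) =
        three_int (ra n) (rb n) (\<lambda>w. phi t w * bint (qa n) (qb n) (u w)) -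
        bint (ra n) (rb n) (\<lambda>w. phi t w * bint (qa n) (qb n) (v w))"
    proof (rule pairing_primitive[where Du="\<lambda>w w'. kernD (w - of_real p) w'" and Dv="\<lambda>w w' h. - kernD w' (w - of_real p) h"], goal_cases)
      case (1 w w') then show ?case unfolding u_def by (intro kern_has_derivative w0)
    next
      case (2 w) then show ?case by (intro continuous_on_kernD continuous_intros) (use w0 in auto)
    next
      case (3 w) then show ?case by (intro continuous_on_kernD continuous_intros) (use w0 in auto)
    next
      case (4 w w') then show ?case unfolding bm2_def by (intro kernD_conj_part[symmetric] w0)
    next
      case (5 w w')
      have "((\<lambda>w. w - of_real p) has_derivative (\<lambda>h. h)) (at w within cbox (ra n) (rb n))"
        by (auto intro!: derivative_eq_intros)
      from has_derivative_compose[OF this kern_has_derivative[OF q0[OF 5(2)], where T=UNIV]]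
      show ?case unfolding v_def by (intro has_derivative_minus) simp
    next
      case (6 w') then show ?case by (intro continuous_on_minus continuous_on_kernD continuous_intros) (use q0 in auto)
    next
      case (7 w') then show ?case by (intro continuous_on_minus continuous_on_kernD continuous_intros) (use q0 in auto)
    next
      case (8 w w')
      have "(- kernD w' (w - of_real p) 1 + \<i> * - kernD w' (w - of_real p) \<i>) / 2 =
          - ((kernD w' (w - of_real p) 1 + \<i> * kernD w' (w - of_real p) \<i>) / 2)" by (simp add: field_simps)
      also note kernD_conj_part[OF q0[OF 8(2)], of "w - of_real p"]
      finally show ?case by (simp add: bm1_def add.commute del: complex_cnj_diff)
    next
      case 9 then show ?case unfolding v_def case_prod_unfold
        by (intro continuous_on_minus continuous_on_kern continuous_intros) (use q0 in auto)
    qed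
    have cv: "continuous_on T (\<lambda>w. bint (qa n) (qb n) (v w))" for T
      by (rule continuous_on_bint, unfold v_def case_prod_unfold,
          intro continuous_on_minus continuous_on_kern continuous_intros) (use q0 in auto)
    have cq: "continuous_on bdry (v w)" for w
      unfolding v_def by (intro continuous_on_minus continuous_on_kern continuous_intros) (use q0 in auto)
    have b0: "bint (qa n) (qb n) (\<lambda>w'. 1 / (w' - 0)) = 2 * pi * \<i>"
      by (rule bint_cauchy(1)[where f="\<lambda>_. 1", simplified mult_1_right])
        (use cd r0 in \<open>auto simp: in_box_complex_iff qa_def qb_def\<close>)
    have bu: "bint (qa n) (qb n) (u w) = bint (qa n) (qb n) (v w) + (2 * pi * \<i>) * (1 / (w - of_real p))" if w: "w - of_real p \<noteq> 0" for w
    proof -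
      have "bint (qa n) (qb n) (u w) = bint (qa n) (qb n) (\<lambda>w'. v w w' + 1 / (w - of_real p) * (1 / (w' - 0)))"
        by (rule bint_cong) (rule uv[OF w])
      also have "\<dots> = bint (qa n) (qb n) (v w) + 1 / (w - of_real p) * bint (qa n) (qb n) (\<lambda>w'. 1 / (w' - 0))"
        by (rule bint_add_mult[OF cq]) (intro continuous_intros, use q0 in auto)
      finally show ?thesis unfolding b0 by simp
    qed
    let ?g = "\<lambda>w. phi t w / (w - of_real p)" and ?V = "\<lambda>w. phi t w * bint (qa n) (qb n) (v w)"
    have cg: "continuous_on ?E ?g" "continuous_on ?L ?g"
      by (intro continuous_intros cont_\<phi>; use w0 wL0 in auto)+
    have cV: "continuous_on T ?V" for T by (intro continuous_intros cont_\<phi> cv)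
    have "three_int (ra n) (rb n) (\<lambda>w. phi t w * bint (qa n) (qb n) (u w)) = three_int (ra n) (rb n) (\<lambda>w. ?V w + (2 * pi * \<i>) * ?g w)"
      by (rule three_int_cong) (use w0 in \<open>simp add: bu algebra_simps\<close>)
    also have "\<dots> = three_int (ra n) (rb n) ?V + (2 * pi * \<i>) * three_int (ra n) (rb n) ?g"
      by (rule three_int_add_mult[OF cV cg(1)])
    finally have t1: "three_int (ra n) (rb n) (\<lambda>w. phi t w * bint (qa n) (qb n) (u w)) = \<dots>" .
    have "left_int (ra n) (rb n) (\<lambda>w. phi t w * bint (qa n) (qb n) (u w)) = left_int (ra n) (rb n) (\<lambda>w. ?V w + (2 * pi * \<i>) * ?g w)"
      by (rule left_int_cong) (use wL0 in \<open>simp add: bu algebra_simps\<close>)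
    also have "\<dots> = left_int (ra n) (rb n) ?V + (2 * pi * \<i>) * left_int (ra n) (rb n) ?g"
      by (rule left_int_add_mult[OF cV cg(2)])
    finally have t2: "left_int (ra n) (rb n) (\<lambda>w. phi t w * bint (qa n) (qb n) (u w)) = \<dots>" .
    \<comment> \<open>The contour of \<open>?g\<close> is completed by the left edge, and the
      resulting integral of \<open>?g\<close> over this edge combines with that of \<open>?V\<close>
      to the one with \<open>u\<close>.\<close>
    have eq: "pairing (phi t) (ra n) (rb n) (qa n) (qb n) (bm1 p) (bm2 p) =
        (2 * pi * \<i>) * bint (ra n) (rb n) ?g + left_int (ra n) (rb n) (\<lambda>w. phi t w * bint (qa n) (qb n) (u w))"
      unfolding main t1 t2 bint_def[of "ra n"] by (simp add: algebra_simps)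
    have res: "(2 * pi * \<i>) * bint (ra n) (rb n) ?g = (if p > 1 - eta n then - 4 * pi\<^sup>2 * exp (- (t * (1 - p))) else 0)"
    proof (cases "p > 1 - eta n")
      case True
      have "of_real p \<in> box (ra n) (rb n)" using True p1 e0 r0 by (auto simp: in_box_complex_iff ra_def rb_def)
      then have "bint (ra n) (rb n) ?g = 2 * pi * \<i> * phi t (of_real p)" by (rule bint_cauchy(1)[OF hol ab])
      then have "(2 * pi * \<i>) * bint (ra n) (rb n) ?g = of_real (- 4 * pi\<^sup>2) * phi t (of_real p)"
        by (simp only:) (simp add: power2_eq_square)
      moreover have "phi t (of_real p) = of_real (exp (- (t * (1 - p))))"
        by (simp add: phi_def exp_of_real[symmetric] algebra_simps)
      ultimately show ?thesis unfolding if_P[OF True] by (simp only: of_real_mult)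
    next
      case False
      then have "of_real p \<notin> cbox (ra n) (rb n)" using p e0 by (auto simp: in_cbox_complex_iff ra_def rb_def)
      then have "bint (ra n) (rb n) ?g = 0" by (rule bint_cauchy(2)[OF hol ab])
      then show ?thesis unfolding if_not_P[OF False] by (simp only: mult_zero_right of_real_0)
    qed
    have "norm (left_int (ra n) (rb n) (\<lambda>w. phi t w * bint (qa n) (qb n) (u w))) \<le> 2 * rho n * (B * P) * exp (- (t * eta n))"
    proof (rule left_int_phi_bound)
      show "continuous_on ?L (\<lambda>w. bint (qa n) (qb n) (u w))"
        by (rule continuous_on_bint, unfold u_def case_prod_unfold, intro continuous_on_kern continuous_intros) (use wL0 in auto)
      show "0 \<le> B * P" using B P by simp
      fix w assume w: "w \<in> ?L"
      have cu: "continuous_on T (u w)" for T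
        unfolding u_def by (intro continuous_on_kern continuous_intros) (use wL0[OF w] in auto)
      have ub: "norm (u w w') \<le> B" if w': "w' \<in> bdry" for w'
      proof -
        have "norm (u w w') \<le> 1 / (norm (w - of_real p) * norm w')"
          unfolding u_def by (rule norm_kern_le[OF wL0[OF w] q0[OF w']])
        also have "\<dots> \<le> B" unfolding B_def
          using wL[OF w] qbdry_norm[OF w'] e0 r0 by (intro divide_left_mono mult_mono mult_pos_pos) auto
        finally show ?thesis .
      qed
      have "norm (three_int (qa n) (qb n) (u w)) \<le> B * (norm (corner2 (qa n) (qb n) - qa n) + norm (qb n - corner2 (qa n) (qb n)) + norm (qb n - corner4 (qa n) (qb n)))"
        by (rule three_int_bound[OF cu]) (use ub B in auto)
      moreover have "norm (left_int (qa n) (qb n) (u w)) \<le> B * \<bar>Im (qb n) - Im (qa n)\<bar>"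
        by (rule left_int_bound[OF cu]) (use ub B in auto)
      ultimately show "norm (bint (qa n) (qb n) (u w)) \<le> B * P"
        unfolding bint_def P_def distrib_left using norm_triangle_ineq4[of "three_int (qa n) (qb n) (u w)" "left_int (qa n) (qb n) (u w)"]
        by linarith
    qed
    then show ?thesis unfolding eq res C_def by simp
  qed
  moreover have "C \<ge> 0" using B P rho_pos[of n] by (simp add: C_def)
  ultimately show ?thesis by blast
qed

section \<open>Closed forms with a pole inside the ball\<close>

text \<open>The homogeneous version of \<open>z - p\<close>: it equals \<open>z - p\<close> at
  \<open>homog 1 z\<close> and makes sense also at infinity.\<close>

definition offset :: "complex^2 \<Rightarrow> complex^3 \<Rightarrow> complex^2" where
  "offset p Z = rest 1 Z - Z$1 *s p"

text \<open>In the affine chart the correction lives on the ball of radius \<open>d\<close> around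
  \<open>p\<close>, which touches the unit sphere from inside if \<open>norm p = 1 - d\<close>. It
  makes the coefficients smooth on the entire coordinate space, so that series of them can be
  treated there.\<close>

definition pole_denom :: "real \<Rightarrow> complex^2 \<Rightarrow> complex^3 \<Rightarrow> real" where
  "pole_denom d p Z = offset p Z \<bullet> offset p Z + flat (d\<^sup>2 * (Z$1 \<bullet> Z$1) - offset p Z \<bullet> offset p Z)"

text \<open>A conjugate determinant, so it vanishes for parallel arguments. Adding a multiple of the
  homogeneous vector to a tangent vector therefore has no effect, as a form on the projective plane
  requires.\<close>

definition pole_num :: "complex^2 \<Rightarrow> complex^2 \<Rightarrow> complex" where
  "pole_num Y W = cnj (Y$1) * cnj (W$2) - cnj (Y$2) * cnj (W$1)"

text \<open>In the affine chart this is the Bochner-Martinelli form with pole \<open>p\<close>, where \<open>\<bar>p\<bar> = 1 - d\<close>; the flat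
  function removes the singularity without changing the form outside of the ball.\<close>

definition pole_coef :: "real \<Rightarrow> complex^2 \<Rightarrow> 3 \<Rightarrow> complex^2 \<Rightarrow> complex^2 \<Rightarrow> complex" where
  "pole_coef d p i z v = (homog i z $ 1)\<^sup>2 * pole_num (offset p (homog i z)) (offset p (hlin i v)) /
     (of_real (pole_denom d p (homog i z)))\<^sup>2"

definition pole_form :: "real \<Rightarrow> complex^2 \<Rightarrow> complex form01" where
  "pole_form d p x i v = (if x \<in> chart_dom i then pole_coef d p i (crd i x) v else 0)"

lemma pole_form_xpt: "z \<in> xdom i \<Longrightarrow> pole_form d p (xpt i z) i v = pole_coef d p i z v"
  by (simp add: pole_form_def)

lemma offset_smult: "offset p (c *s Z) = c *s offset p Z"
  by (simp add: offset_def rest_smult vec_eq_iff algebra_simps)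

lemma bounded_linear_offset: "bounded_linear (offset p)"
  unfolding offset_def[abs_def]
  by (intro bounded_linear_sub bounded_linear_rest bounded_linear_compose[OF bounded_bilinear.bounded_linear_left[OF
    bounded_bilinear_smult] bounded_linear_vec_nth])

lemma offset_add: "offset p (Z + W) = offset p Z + offset p W"
  by (rule linear_add[OF bounded_linear.linear[OF bounded_linear_offset]])

lemma pole_num_self: "pole_num Y Y = 0" by (simp add: pole_num_def)
lemma pole_num_add: "pole_num Y (V + W) = pole_num Y V + pole_num Y W" by (simp add: pole_num_def algebra_simps)
lemma pole_num_smult: "pole_num Y (c *s W) = cnj c * pole_num Y W" "pole_num (c *s Y) W = cnj c * pole_num Y W"
  by (simp_all add: pole_num_def algebra_simps)

lemma pole_denom_pos:
  assumes "Z \<noteq> 0" "d > 0" shows "pole_denom d p Z > 0"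
proof (cases "offset p Z = 0")
  case True
  have "Z$1 \<noteq> 0"
  proof
    assume 0: "Z$1 = 0"
    then have "rest 1 Z = 0" using True by (simp add: offset_def vec_eq_iff)
    then show False using 0 assms(1) by (simp add: rest_def vec_eq_iff forall_3 forall_2)
  qed
  then show ?thesis using assms(2) by (simp add: pole_denom_def True flat_pos_iff)
next
  case False
  then have "offset p Z \<bullet> offset p Z > 0" by simp
  then show ?thesis unfolding pole_denom_def using flat_nonneg[of "d\<^sup>2 * (Z$1 \<bullet> Z$1) - offset p Z \<bullet> offset p Z"] by linarith
qed

text \<open>Outside of the ball \<open>norm (rest 1 Z) \<ge> norm (Z$1)\<close>. Subtracting a
  vector of norm \<open>(1 - d) * norm (Z$1)\<close> leaves at least \<open>d * norm (Z$1)\<close>,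
  and there the flat function vanishes.\<close>

lemma pole_denom_eq:
  assumes "qf Z \<ge> 0" "norm p = 1 - d" "d \<ge> 0" shows "pole_denom d p Z = offset p Z \<bullet> offset p Z"
proof -
  have "(norm (Z$1))\<^sup>2 \<le> (norm (rest 1 Z))\<^sup>2" using assms(1) by (simp add: qf_def norm_complex2 rest_def)
  then have "norm (Z$1) \<le> norm (rest 1 Z)" by (rule power2_le_imp_le) simp
  moreover have "norm (Z$1 *s p) = norm (Z$1) * (1 - d)"
    unfolding assms(2)[symmetric] by (simp add: norm_vec_def norm_mult L2_set_right_distrib)
  ultimately have "d * norm (Z$1) \<le> norm (offset p Z)"
    unfolding offset_def using norm_triangle_ineq2[of "rest 1 Z" "Z$1 *s p"] by (simp add: algebra_simps)
  then have "(d * norm (Z$1))\<^sup>2 \<le> (norm (offset p Z))\<^sup>2" using assms(3) by (intro power_mono) auto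
  then show ?thesis by (simp add: pole_denom_def power2_norm_eq_inner[symmetric] power_mult_distrib flat_eq_0)
qed

lemma inner_complex2: "complex_of_real (Y \<bullet> Y) = Y$1 * cnj (Y$1) + Y$2 * cnj (Y$2)" for Y :: "complex^2"
  unfolding power2_norm_eq_inner[symmetric] norm_complex2 of_real_add complex_norm_square ..

lemma smooth_open_pole_coef:
  assumes "d > 0" shows "smooth_open UNIV (\<lambda>z. pole_coef d p i z v)"
proof -
  have o: "smooth_open UNIV (\<lambda>z. offset p (homog i z))"
    by (rule smooth_open_linear_compose[OF bounded_linear_offset smooth_open_homog])
  have f: "smooth_open UNIV (\<lambda>z. pole_denom d p (homog i z))"
    unfolding pole_denom_def by (intro smooth_intros o smooth_open_homog open_UNIV)
  show ?thesis unfolding pole_coef_def pole_num_def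
    by (intro smooth_intros o f smooth_open_homog open_UNIV) (use pole_denom_pos[OF homog_nonzero assms] in \<open>simp add: less_imp_neq[THEN not_sym]\<close>)
qed

lemma pole_coef_add: "pole_coef d p i z (v + w) = pole_coef d p i z v + pole_coef d p i z w"
  by (simp add: pole_coef_def linear_add[OF bounded_linear.linear[OF bounded_linear_hlin]] offset_add pole_num_add
    distrib_left add_divide_distrib)

lemma pole_coef_smult: "pole_coef d p i z (c *s v) = cnj c * pole_coef d p i z v"
  by (simp add: pole_coef_def hlin_smult offset_smult pole_num_smult)

lemma pole_coef_xdom:
  assumes "norm p = 1 - d" "d \<ge> 0" "z \<in> xdom i"
  shows "pole_coef d p i z v = (homog i z $ 1)\<^sup>2 * pole_num (offset p (homog i z)) (offset p (hlin i v)) /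
     (offset p (homog i z) $ 1 * cnj (offset p (homog i z) $ 1) + offset p (homog i z) $ 2 * cnj (offset p (homog i z) $ 2))\<^sup>2"
  unfolding pole_coef_def pole_denom_eq[OF xdom_iff[THEN iffD1, OF assms(3)] assms(1,2)] inner_complex2 ..

lemma pole_form_A01c:
  assumes p: "norm p = 1 - d" "d > 0" shows "pole_form d p \<in> A01c"
proof -
  have "pole_form d p (xpt i z) i v = pole_form d p (xpt i z) j (transD i j z v)" if z: "z \<in> xdom i" "z \<in> tdom i j" for i j z v
  proof -
    have c: "homog i z $ j \<noteq> 0" using z(2) by (simp add: tdom_def)
    define c where "c = 1 / homog i z $ j"
    have c0: "c \<noteq> 0" using c by (simp add: c_def)
    have z': "trans i j z \<in> xdom j" using z by (simp add: trans_in_xdom)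
    \<comment> \<open>A change of chart multiplies the numerator by the square of
      \<open>cnj c\<close> and the denominator by that of \<open>c * cnj c\<close>; the factor
      \<open>(homog i z $ 1)\<^sup>2\<close> supplies what is missing. The flat term is not
      homogeneous, so the formula on \<open>xdom\<close>, from which it is absent, is used.\<close>
    have cancel: "(c * Z)\<^sup>2 * (cnj c * (cnj c * N)) / (c * a * cnj (c * a) + c * b * cnj (c * b))\<^sup>2 =
        Z\<^sup>2 * N / (a * cnj a + b * cnj b)\<^sup>2" for Z N a b
    proof -
      have "(c * Z)\<^sup>2 * (cnj c * (cnj c * N)) = (c * cnj c)\<^sup>2 * (Z\<^sup>2 * N)"
        "(c * a * cnj (c * a) + c * b * cnj (c * b))\<^sup>2 = (c * cnj c)\<^sup>2 * (a * cnj a + b * cnj b)\<^sup>2"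
        by (simp_all add: power2_eq_square algebra_simps)
      then show ?thesis using c0 by (simp only:) simp
    qed
    have "pole_form d p (xpt i z) j (transD i j z v) = pole_coef d p j (trans i j z) (transD i j z v)"
      using pole_form_xpt[OF z'] z by (simp add: xpt_trans)
    also have "\<dots> = pole_coef d p i z v"
      unfolding pole_coef_xdom[OF p(1) less_imp_le[OF p(2)] z'] pole_coef_xdom[OF p(1) less_imp_le[OF p(2)] z(1)]
        homog_trans[OF z(2)] hlin_transD[OF z(2)] c_def[symmetric] offset_smult offset_add pole_num_add pole_num_smult pole_num_self
      by (simp only: vector_smult_component mult_zero_right add_0_right cancel)
    finally show ?thesis using z by (simp add: pole_form_xpt)
  qed
  moreover have "smooth_upto (xdom i) (\<lambda>z. pole_form d p (xpt i z) i v)" for i v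
    using smooth_upto_smooth_open[OF smooth_open_pole_coef[OF p(2)], of "xdom i" p i v]
    by (simp add: pole_form_xpt cong: smooth_upto_cong)
  ultimately show ?thesis
    unfolding A01c_iff by (auto simp: pole_form_xpt pole_coef_add pole_coef_smult) (simp add: pole_form_def)
qed

text \<open>Complex linear terms in the derivative of the quotient drop out. After
  antisymmetrisation in \<open>v\<close> and \<open>w\<close> the claim is an identity in dimension
  two: the conjugate determinant of \<open>A v\<close> and \<open>A w\<close> times the squared norm
  of \<open>Y\<close> is the antisymmetrised product of the determinant with \<open>Y\<close> and
  the Hermitian product with \<open>Y\<close>.\<close>

lemma pole_form_Z01:
  assumes p: "norm p = 1 - d" "d > 0" shows "pole_form d p \<in> Z01"
  unfolding Z01_iff
proof (intro conjI allI pole_form_A01c[OF p])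
  fix x i v w
  show "dbar_form (pole_form d p) x i v w = 0"
  proof (rule form02_cases[of x i])
    fix z assume z: "x = xpt i z" "z \<in> xdom i"
    define Y where "Y z = offset p (homog i z)" for z
    define A where "A v = offset p (hlin i v)" for v
    define S where "S z = Y z $ 1 * cnj (Y z $ 1) + Y z $ 2 * cnj (Y z $ 2)" for z
    have S0: "S z \<noteq> 0"
      using pole_denom_pos[OF homog_nonzero p(2), of p i z] pole_denom_eq[OF xdom_iff[THEN iffD1, OF z(2)] p(1)] p(2)
      by (simp add: S_def Y_def flip: inner_complex2)
    have dY: "(Y has_derivative A) (at z within T)" for T
      unfolding Y_def A_def
      by (rule has_derivative_at_withinI, rule has_derivative_compose[OF homog_has_derivative
        bounded_linear_imp_has_derivative[OF bounded_linear_offset]])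
    have dYj: "((\<lambda>z. Y z $ j) has_derivative (\<lambda>h. A h $ j)) (at z within T)" for j T
      by (rule bounded_linear.has_derivative[OF bounded_linear_vec_nth dY])
    have dYc: "((\<lambda>z. cnj (Y z $ j)) has_derivative (\<lambda>h. cnj (A h $ j))) (at z within T)" for j T
      by (rule bounded_linear.has_derivative[OF bounded_linear_cnj dYj])
    have dZ: "((\<lambda>z. homog i z $ 1) has_derivative (\<lambda>h. hlin i h $ 1)) (at z within T)" for T
      by (rule bounded_linear.has_derivative[OF bounded_linear_vec_nth has_derivative_at_withinI[OF homog_has_derivative]])
    have Ai: "A (\<i> *s h) = \<i> *s A h" for h by (simp add: A_def hlin_smult offset_smult)
    have "dbar_at (xdom i) (\<lambda>z. pole_form d p (xpt i z) i w) z v =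
        (homog i z $ 1)\<^sup>2 * ((cnj (A v $ 1) * cnj (A w $ 2) - cnj (A v $ 2) * cnj (A w $ 1)) * S z
          - 2 * pole_num (Y z) (A w) * (Y z $ 1 * cnj (A v $ 1) + Y z $ 2 * cnj (A v $ 2))) / (S z) ^ 3" for v w
    proof -
      have "dbar_at (xdom i) (\<lambda>z. pole_form d p (xpt i z) i w) z v =
          dbar_at (xdom i) (\<lambda>z. (homog i z $ 1)\<^sup>2 * pole_num (Y z) (A w) / (S z)\<^sup>2) z v"
        by (rule dbar_at_cong[OF open_UNIV])
          (use z p in \<open>auto simp: pole_form_xpt pole_coef_xdom[OF p(1) less_imp_le[OF p(2)]] S_def Y_def A_def\<close>)
      also have "\<dots> = conj_part (\<lambda>h. (((2 * homog i z $ 1 * hlin i h $ 1) * pole_num (Y z) (A w)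
          + (homog i z $ 1)\<^sup>2 * (cnj (A h $ 1) * cnj (A w $ 2) - cnj (A h $ 2) * cnj (A w $ 1))) * (S z)\<^sup>2 -
          (homog i z $ 1)\<^sup>2 * pole_num (Y z) (A w) * (2 * S z * (A h $ 1 * cnj (Y z $ 1) + Y z $ 1 * cnj (A h $ 1) + A h $ 2 * cnj (Y z $ 2) + Y z $ 2 * cnj (A h $ 2))))
          / ((S z)\<^sup>2 * (S z)\<^sup>2)) v"
      proof (rule dbar_at_eq[OF has_cones_xdom z(2)], rule has_derivative_divide')
        show "(S z)\<^sup>2 \<noteq> 0" using S0 by simp
        show "((\<lambda>z. (homog i z $ 1)\<^sup>2 * pole_num (Y z) (A w)) has_derivative
            (\<lambda>h. (2 * homog i z $ 1 * hlin i h $ 1) * pole_num (Y z) (A w)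
          + (homog i z $ 1)\<^sup>2 * (cnj (A h $ 1) * cnj (A w $ 2) - cnj (A h $ 2) * cnj (A w $ 1)))) (at z within xdom i)"
          unfolding power2_eq_square pole_num_def by (rule derivative_eq_intros dYc dZ | simp add: algebra_simps)+
        show "((\<lambda>z. (S z)\<^sup>2) has_derivative (\<lambda>h. 2 * S z * (A h $ 1 * cnj (Y z $ 1) + Y z $ 1 * cnj (A h $ 1) + A h $ 2 * cnj (Y z $ 2) + Y z $ 2 * cnj (A h $ 2)))) (at z within xdom i)"
          unfolding power2_eq_square S_def by (rule derivative_eq_intros dYc dYj | simp add: algebra_simps)+
      qed
      also have "\<dots> = (homog i z $ 1)\<^sup>2 * ((cnj (A v $ 1) * cnj (A w $ 2) - cnj (A v $ 2) * cnj (A w $ 1)) * S z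
          - 2 * pole_num (Y z) (A w) * (Y z $ 1 * cnj (A v $ 1) + Y z $ 2 * cnj (A v $ 2))) / (S z) ^ 3"
        unfolding conj_part_def Ai hlin_smult using S0
        by (simp add: power2_eq_square power3_eq_cube divide_simps) (simp add: algebra_simps)
      finally show ?thesis .
    qed
    then show ?thesis using z(2)
      unfolding z(1) dbar_form_xpt[OF z(2)]
      by (simp only:) (simp add: S_def pole_num_def algebra_simps diff_divide_distrib[symmetric])
  qed (simp add: dbar_form_outside)
qed

lemma coef_pole_form:
  assumes x: "norm x = 1" and p: "0 \<le> p" "p < 1" and z: "pt x w w' \<in> xdom 1"
  shows "coef x (pole_form (1 - p) (of_real p *s x)) x w w' = bm1 p w w'"
    and "coef x (pole_form (1 - p) (of_real p *s x)) (perp x) w w' = bm2 p w w'"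
proof -
  have n: "norm (of_real p *s x) = 1 - (1 - p)"
    using x p by (simp add: scaleR_eq_smult[symmetric])
  have o: "offset (of_real p *s x) (homog 1 (pt x w w')) = pt x (w - of_real p) w'"
    unfolding pt_diff[symmetric] offset_def by simp
  have o1: "offset q (hlin 1 v) = v" for q v by (simp add: offset_def vec_eq_iff)
  have xx: "x$1 * cnj (x$1) + x$2 * cnj (x$2) = 1"
    using inner_complex2[of x] x by (simp add: power2_norm_eq_inner[symmetric])
  have N: "pt x c s $ 1 * cnj (pt x c s $ 1) + pt x c s $ 2 * cnj (pt x c s $ 2) = c * cnj c + s * cnj s" for c s
    using inner_complex2[of "pt x c s"] norm_pt[OF x, of c s]
    unfolding power2_norm_eq_inner[symmetric] by (simp only: of_real_add complex_norm_square)
  have *: "coef x (pole_form (1 - p) (of_real p *s x)) v w w' =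
      pole_num (pt x (w - of_real p) w') v / ((w - of_real p) * cnj (w - of_real p) + w' * cnj w')\<^sup>2" for v
  proof -
    have "0 \<le> 1 - p" using p by simp
    from pole_coef_xdom[OF n this z] show ?thesis
      unfolding coef_def pole_form_xpt[OF z] by (simp only: o o1 N homog_nth_self power_one mult_1)
  qed
  have "pole_num (pt x c s) x = - cnj s * cnj (x$1 * cnj (x$1) + x$2 * cnj (x$2))" for c s
    by (simp add: pole_num_def pt_def perp_def algebra_simps)
  then show "coef x (pole_form (1 - p) (of_real p *s x)) x w w' = bm1 p w w'"
    unfolding * bm1_def xx by simp
  have "pole_num (pt x c s) (perp x) = cnj c * cnj (x$1 * cnj (x$1) + x$2 * cnj (x$2))" for c s
    by (simp add: pole_num_def pt_def perp_def algebra_simps)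
  then show "coef x (pole_form (1 - p) (of_real p *s x)) (perp x) w w' = bm2 p w w'"
    unfolding * bm2_def xx by simp
qed

lemma (in birectangle) pairing_cong:
  assumes "\<And>w w'. w \<in> cbox a b \<Longrightarrow> w' \<in> bdry \<Longrightarrow> a1 w w' = b1 w w'"
    and "\<And>w w'. w \<in> three_edges a b \<Longrightarrow> w' \<in> cbox c d \<Longrightarrow> a2 w w' = b2 w w'"
  shows "pairing \<phi> a b c d a1 a2 = pairing \<phi> a b c d b1 b2"
proof -
  have r: "rint p q f = rint p q g" if "\<And>z. z \<in> cbox p q \<Longrightarrow> f z = g z" "Re p < Re q" "Im p < Im q" for p q f g
  proof -
    have "integral (cbox (0, 0) (1, 1)) (\<lambda>s. f (cell p q s)) = integral (cbox (0, 0) (1, 1)) (\<lambda>s. g (cell p q s))"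
      by (rule integral_cong) (intro that(1) cell_in_cbox, use that in auto)
    then show ?thesis unfolding rint_def by simp
  qed
  have 2: "rint c d (a2 w) = rint c d (b2 w)" if "w \<in> three_edges a b" for w
    by (rule r[OF assms(2)[OF that] cd])
  have 1: "rint a b (\<lambda>w. \<phi> w * a1 w w') = rint a b (\<lambda>w. \<phi> w * b1 w w')" if "w' \<in> bdry" for w'
    by (rule r[OF _ ab]) (simp add: assms(1)[OF _ that])
  have "three_int a b (\<lambda>w. \<phi> w * (2 * \<i> * rint c d (a2 w))) = three_int a b (\<lambda>w. \<phi> w * (2 * \<i> * rint c d (b2 w)))"
    by (rule three_int_cong) (simp only: 2)
  moreover have "bint c d (\<lambda>w'. rint a b (\<lambda>w. \<phi> w * a1 w w')) = bint c d (\<lambda>w'. rint a b (\<lambda>w. \<phi> w * b1 w w'))"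
    by (rule bint_cong) (simp only: 1)
  ultimately show ?thesis unfolding pairing_def by simp
qed

lemma Lam_pole_form:
  assumes x: "norm x = 1"
  shows "\<exists>C\<ge>0. \<forall>p t. 0 \<le> p \<longrightarrow> p < 1 \<longrightarrow> \<bar>p - (1 - eta n)\<bar> \<ge> eta n / 2 \<longrightarrow>
    norm (Lam x n t (pole_form (1 - p) (of_real p *s x))
      - (if p > 1 - eta n then - 4 * pi\<^sup>2 * exp (- (t * (1 - p))) else 0)) \<le> C * exp (- (t * eta n))"
proof -
  have "Lam x n t (pole_form (1 - p) (of_real p *s x)) = pairing (phi t) (ra n) (rb n) (qa n) (qb n) (bm1 p) (bm2 p)"
    if "0 \<le> p" "p < 1" for p t
    unfolding Lam_def by (rule birectangle.pairing_cong[OF birectangle_n])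
      (use coef_pole_form[OF x that] region_in_xdom[OF x] in auto)
  then show ?thesis using pairing_bm[of n] by metis
qed

section \<open>Superpositions of pole forms\<close>

text \<open>The pole at distance \<open>eta k / 2\<close> from \<open>x\<close> is inside the n-th
  bidisc for \<open>k \<ge> n\<close> and beyond its left edge for \<open>k < n\<close>, in both
  cases at distance at least \<open>eta n / 2\<close> from that edge.\<close>

definition pole_at :: "complex^2 \<Rightarrow> nat \<Rightarrow> complex form01" where
  "pole_at x k = pole_form (eta k / 2) (of_real (1 - eta k / 2) *s x)"

definition pole_at_coef :: "complex^2 \<Rightarrow> nat \<Rightarrow> 3 \<Rightarrow> complex^2 \<Rightarrow> complex^2 \<Rightarrow> complex" where
  "pole_at_coef x k i z v = pole_coef (eta k / 2) (of_real (1 - eta k / 2) *s x) i z v"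

lemma pole_at_xpt: "z \<in> xdom i \<Longrightarrow> pole_at x k (xpt i z) i v = pole_at_coef x k i z v"
  by (simp add: pole_at_def pole_at_coef_def pole_form_xpt)

lemma pole_at_Z01: "norm x = 1 \<Longrightarrow> pole_at x k \<in> Z01"
  unfolding pole_at_def scaleR_eq_smult[symmetric] using eta_pos[of k] eta_le[of k]
  by (intro pole_form_Z01) simp_all

lemma iter_deriv_0: "iter_deriv S vs (\<lambda>z::'a::real_normed_vector. 0::'b::real_normed_vector) = (\<lambda>z. 0)" if "S = UNIV"
  unfolding that by (induction vs) (simp_all add: frechet_derivative_const)

lemma smooth_open_pole_at_coef: "smooth_open UNIV (\<lambda>z. pole_at_coef x k i z v)"
  unfolding pole_at_coef_def using eta_pos[of k] by (intro smooth_open_pole_coef) simp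

text \<open>Conjugate linearity in \<open>v\<close> reduces all estimates to two vectors, so that
  the choice of a weight concerns finitely many coefficients.\<close>

lemma iter_deriv_pole_at_coef:
  "norm (iter_deriv UNIV vs (\<lambda>z. pole_at_coef x k i z v) z) \<le>
    norm (v$1) * norm (iter_deriv UNIV vs (\<lambda>z. pole_at_coef x k i z (axis 1 1)) z) +
    norm (v$2) * norm (iter_deriv UNIV vs (\<lambda>z. pole_at_coef x k i z (axis 2 1)) z)"
proof -
  have s: "smooth_upto UNIV (\<lambda>z. pole_at_coef x k i z w)" for w
    by (rule smooth_upto_smooth_open[OF smooth_open_pole_at_coef]) simp
  have s0: "smooth_upto UNIV (\<lambda>z. 0 :: complex)" by (rule smooth_upto_const)
  have v: "v = v$1 *s axis 1 1 + v$2 *s axis 2 1" by (simp add: vec_eq_iff forall_2 axis_def)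
  have "pole_at_coef x k i z v = (0 + cnj (v$1) * pole_at_coef x k i z (axis 1 1)) + cnj (v$2) * pole_at_coef x k i z (axis 2 1)" for z
    by (subst v) (simp only: pole_at_coef_def pole_coef_add pole_coef_smult add_0_left)
  then have "iter_deriv UNIV vs (\<lambda>z. pole_at_coef x k i z v) z =
      iter_deriv UNIV vs (\<lambda>z. 0 + cnj (v$1) * pole_at_coef x k i z (axis 1 1)) z
      + cnj (v$2) * iter_deriv UNIV vs (\<lambda>z. pole_at_coef x k i z (axis 2 1)) z"
    by (simp only:) (rule iter_deriv_add_mult[OF has_cones_UNIV]; (intro smooth_intros s s0)?; simp)
  also have "iter_deriv UNIV vs (\<lambda>z. 0 + cnj (v$1) * pole_at_coef x k i z (axis 1 1)) z =
      iter_deriv UNIV vs (\<lambda>z. 0) z + cnj (v$1) * iter_deriv UNIV vs (\<lambda>z. pole_at_coef x k i z (axis 1 1)) z"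
    by (rule iter_deriv_add_mult[OF has_cones_UNIV s0 s]) simp
  finally show ?thesis by (simp add: iter_deriv_0 norm_mult norm_triangle_le)
qed

text \<open>For fixed \<open>k\<close> there are finitely many charts, basis vectors and lists of
  directions, and each derivative is bounded on the compact ball of radius \<open>k\<close>. Letting
  order and radius grow with the index is a diagonal choice: every derivative on every bounded set
  is eventually controlled.\<close>

lemma weight_exists:
  "\<exists>g>0. g \<le> (1/2) ^ k \<and> (\<forall>i j vs z. set vs \<subseteq> Basis \<longrightarrow> length vs \<le> k \<longrightarrow> norm z \<le> real k \<longrightarrow>
     g * norm (iter_deriv UNIV vs (\<lambda>z. pole_at_coef x k i z (axis j 1)) z) \<le> (1/2) ^ k)"
proof -
  define V where "V = {vs :: (complex^2) list. set vs \<subseteq> Basis \<and> length vs \<le> k}"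
  define f where "f = (\<lambda>(i, j, vs) z. iter_deriv UNIV vs (\<lambda>z. pole_at_coef x k i z (axis j 1)) z)"
  have "finite V" unfolding V_def by (rule finite_lists_length_le) simp
  moreover have "bounded (f a ` cball 0 (real k))" for a
    unfolding f_def case_prod_unfold
    by (intro compact_imp_bounded compact_continuous_image compact_cball
        continuous_on_subset[OF smooth_open_continuous[OF smooth_open_iter_deriv[OF smooth_open_pole_at_coef]]]) simp
  ultimately have "bounded (\<Union>a\<in>UNIV \<times> UNIV \<times> V. f a ` cball 0 (real k))"
    by (intro bounded_UN ballI finite_cartesian_product finite)
  then obtain B where B0: "B > 0" and B': "\<forall>y\<in>(\<Union>a\<in>UNIV \<times> UNIV \<times> V. f a ` cball 0 (real k)). norm y \<le> B"
    unfolding bounded_pos by (elim exE conjE) (rule that)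
  note B = B'[rule_format]
  have b: "norm (iter_deriv UNIV vs (\<lambda>z. pole_at_coef x k i z (axis j 1)) z) \<le> B"
    if "set vs \<subseteq> Basis" "length vs \<le> k" "norm z \<le> real k" for i j vs z
  proof (rule B, rule UN_I)
    show "(i, j, vs) \<in> UNIV \<times> UNIV \<times> V" using that by (simp add: V_def)
    show "iter_deriv UNIV vs (\<lambda>z. pole_at_coef x k i z (axis j 1)) z \<in> f (i, j, vs) ` cball 0 (real k)"
      by (rule image_eqI[where x=z]) (use that in \<open>simp_all add: f_def\<close>)
  qed
  define g where "g = (1/2) ^ k / (1 + B)"
  show ?thesis
  proof (intro exI[of _ g] conjI allI impI)
    show "g > 0" "g \<le> (1/2) ^ k" using B0 by (simp_all add: g_def divide_simps)
    fix i j and vs :: "(complex^2) list" and z :: "complex^2" assume "set vs \<subseteq> Basis" "length vs \<le> k" "norm z \<le> real k"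
    from b[OF this, of i j] have "g * norm (iter_deriv UNIV vs (\<lambda>z. pole_at_coef x k i z (axis j 1)) z) \<le> g * (1 + B)"
      using \<open>g > 0\<close> by (intro mult_left_mono) auto
    also have "\<dots> = (1/2) ^ k" using B0 by (simp add: g_def)
    finally show "g * norm (iter_deriv UNIV vs (\<lambda>z. pole_at_coef x k i z (axis j 1)) z) \<le> (1/2) ^ k" .
  qed
qed

definition weight :: "complex^2 \<Rightarrow> nat \<Rightarrow> real" where
  "weight x k = (SOME g. g > 0 \<and> g \<le> (1/2) ^ k \<and> (\<forall>i j vs z. set vs \<subseteq> Basis \<longrightarrow> length vs \<le> k \<longrightarrow> norm z \<le> real k \<longrightarrow>
     g * norm (iter_deriv UNIV vs (\<lambda>z. pole_at_coef x k i z (axis j 1)) z) \<le> (1/2) ^ k))"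

lemma
  shows weight_pos: "weight x k > 0" and weight_le: "weight x k \<le> (1/2) ^ k"
    and weight_iter_deriv: "set vs \<subseteq> Basis \<Longrightarrow> length vs \<le> k \<Longrightarrow> norm z \<le> real k \<Longrightarrow>
     weight x k * norm (iter_deriv UNIV vs (\<lambda>z. pole_at_coef x k i z (axis j 1)) z) \<le> (1/2) ^ k"
  using someI_ex[OF weight_exists[of k x], folded weight_def] by auto

section \<open>Convergence of the weighted series and its image under the functionals\<close>

definition mix_term :: "complex^2 \<Rightarrow> (nat \<Rightarrow> complex) \<Rightarrow> nat \<Rightarrow> 3 \<Rightarrow> complex^2 \<Rightarrow> complex^2 \<Rightarrow> complex" where
  "mix_term x m k i z v = m k * of_real (weight x k) * pole_at_coef x k i z v"

text \<open>The coefficients are left free: a constant sequence serves for the category argument,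
  powers for the codimension, and truncated sequences for the exchange of sum and
  functional.\<close>

definition pole_mix :: "complex^2 \<Rightarrow> (nat \<Rightarrow> complex) \<Rightarrow> complex form01" where
  "pole_mix x m y i v = (\<Sum>k. m k * of_real (weight x k) * pole_at x k y i v)"

lemma pole_mix_xpt: "z \<in> xdom i \<Longrightarrow> pole_mix x m (xpt i z) i v = (\<Sum>k. mix_term x m k i z v)"
  by (simp add: pole_mix_def pole_at_xpt mix_term_def)

lemma smooth_open_mix_term: "smooth_open UNIV (\<lambda>z. mix_term x m k i z v)"
  unfolding mix_term_def by (intro smooth_intros smooth_open_pole_at_coef open_UNIV)

lemma mix_term_bound:
  assumes m: "\<And>k. norm (m k) \<le> 1" and "set vs \<subseteq> Basis" "length vs \<le> k" "norm z \<le> real k"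
  shows "norm (iter_deriv UNIV vs (\<lambda>z. mix_term x m k i z v) z) \<le> (norm (v$1) + norm (v$2)) * (1/2) ^ k"
proof -
  have s: "smooth_upto UNIV (\<lambda>z. pole_at_coef x k i z v)"
    by (rule smooth_upto_smooth_open[OF smooth_open_pole_at_coef]) simp
  have s0: "smooth_upto UNIV (\<lambda>z. 0 :: complex)" by (rule smooth_upto_const)
  have "iter_deriv UNIV vs (\<lambda>z. 0 + (m k * of_real (weight x k)) * pole_at_coef x k i z v) z =
      iter_deriv UNIV vs (\<lambda>z. 0) z + (m k * of_real (weight x k)) * iter_deriv UNIV vs (\<lambda>z. pole_at_coef x k i z v) z"
    by (rule iter_deriv_add_mult[OF has_cones_UNIV s0 s]) simp
  then have "norm (iter_deriv UNIV vs (\<lambda>z. mix_term x m k i z v) z) =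
      norm (m k) * (weight x k * norm (iter_deriv UNIV vs (\<lambda>z. pole_at_coef x k i z v) z))"
    using weight_pos[of x k] by (simp add: mix_term_def norm_mult iter_deriv_0)
  also have "\<dots> \<le> 1 * (weight x k * norm (iter_deriv UNIV vs (\<lambda>z. pole_at_coef x k i z v) z))"
    using weight_pos[of x k] m by (intro mult_right_mono) auto
  also have "\<dots> \<le> weight x k * (norm (v$1) * norm (iter_deriv UNIV vs (\<lambda>z. pole_at_coef x k i z (axis 1 1)) z) +
    norm (v$2) * norm (iter_deriv UNIV vs (\<lambda>z. pole_at_coef x k i z (axis 2 1)) z))"
    using iter_deriv_pole_at_coef weight_pos[of x k] by simp
  also have "\<dots> = norm (v$1) * (weight x k * norm (iter_deriv UNIV vs (\<lambda>z. pole_at_coef x k i z (axis 1 1)) z)) +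
    norm (v$2) * (weight x k * norm (iter_deriv UNIV vs (\<lambda>z. pole_at_coef x k i z (axis 2 1)) z))"
    by (simp add: algebra_simps)
  also have "\<dots> \<le> norm (v$1) * (1/2) ^ k + norm (v$2) * (1/2) ^ k"
    by (intro add_mono mult_left_mono weight_iter_deriv assms) auto
  finally show ?thesis by (simp add: distrib_right)
qed

lemma mix_term_series_bound:
  assumes m: "\<And>k. norm (m k) \<le> 1" and "set vs \<subseteq> Basis"
  shows "\<exists>N M. summable M \<and> (\<forall>k\<ge>N. \<forall>z. norm z \<le> r \<longrightarrow> norm (iter_deriv UNIV vs (\<lambda>z. mix_term x m k i z v) z) \<le> M k)"
proof -
  obtain N where N: "max r (real (length vs)) \<le> real N" using real_arch_simple by blast
  show ?thesis
  proof (intro exI[of _ N] exI[of _ "\<lambda>k. (norm (v$1) + norm (v$2)) * (1/2) ^ k"] conjI allI impI)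
    show "summable (\<lambda>k. (norm (v$1) + norm (v$2)) * (1/2) ^ k)" by (intro summable_mult summable_geometric) simp
  qed (use N assms in \<open>auto intro!: mix_term_bound\<close>)
qed

lemma mix_term_deriv_summable:
  assumes m: "\<And>k. norm (m k) \<le> 1" and "set vs \<subseteq> Basis"
  shows "summable (\<lambda>k. iter_deriv UNIV vs (\<lambda>z. mix_term x m k i z v) z)"
proof -
  from mix_term_series_bound[where m=m and r="norm z" and x=x and i=i and v=v and vs=vs, OF assms]
  obtain N M where M: "summable M"
    "\<forall>k\<ge>N. \<forall>w. norm w \<le> norm z \<longrightarrow> norm (iter_deriv UNIV vs (\<lambda>z. mix_term x m k i z v) w) \<le> M k"
    by (elim exE conjE) (rule that)
  show ?thesis
  proof (rule summable_comparison_test'[OF M(1)])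
    fix k assume "N \<le> k"
    from M(2)[rule_format, OF this order_refl]
    show "norm (iter_deriv UNIV vs (\<lambda>z. mix_term x m k i z v) z) \<le> M k" .
  qed
qed

lemma mix_term_summable:
  assumes "\<And>k. norm (m k) \<le> 1" shows "summable (\<lambda>k. mix_term x m k i z v)"
  using mix_term_deriv_summable[where m=m and vs="[]", OF assms] by simp

lemma smooth_open_mix:
  assumes "\<And>k. norm (m k) \<le> 1" shows "smooth_open UNIV (\<lambda>z. \<Sum>k. mix_term x m k i z v)"
  by (rule smooth_open_series(1)[OF smooth_open_mix_term]) (rule mix_term_series_bound[OF assms])

lemma dbar_at_mix:
  assumes m: "\<And>k. norm (m k) \<le> 1"
  shows "(\<lambda>k. dbar_at UNIV (\<lambda>z. mix_term x m k i z w) z v) sums dbar_at UNIV (\<lambda>z. \<Sum>k. mix_term x m k i z w) z v"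
proof -
  let ?D = "\<lambda>k. frechet_derivative (\<lambda>z. mix_term x m k i z w) (at z)"
  define D where "D v = (\<Sum>b\<in>Basis. (v \<bullet> b) *\<^sub>R (\<Sum>k. ?D k b))" for v
  have d: "((\<lambda>z. \<Sum>k. mix_term x m k i z w) has_derivative D) (at z)"
    unfolding D_def by (rule smooth_open_series(2)[OF smooth_open_mix_term]) (rule mix_term_series_bound[OF m])
  have "(\<lambda>k. ?D k b) sums (\<Sum>k. ?D k b)" if "b \<in> Basis" for b
    using mix_term_deriv_summable[where m=m and vs="[b]" and x=x and i=i and v=w and z=z, OF m] that by (auto intro: summable_sums)
  then have s1: "(\<lambda>k. \<Sum>b\<in>Basis. (h \<bullet> b) *\<^sub>R ?D k b) sums D h" for h
    unfolding D_def by (intro sums_sum sums_scaleR_right)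
  have eq: "?D k h = (\<Sum>b\<in>Basis. (h \<bullet> b) *\<^sub>R ?D k b)" for k h
    by (rule linear_eq_sum_Basis, rule has_derivative_linear[OF smooth_open_has_derivative[OF smooth_open_mix_term]]) simp
  have s: "(\<lambda>k. ?D k h) sums D h" for h unfolding eq[of _ h] by (rule s1)
  show ?thesis
    by (subst dbar_at_UNIV_eq[OF d], unfold dbar_at_UNIV conj_part_def)
      (intro sums_divide sums_add sums_mult s)
qed

lemma pole_mix_A01c:
  assumes x: "norm x = 1" and m: "\<And>k. norm (m k) \<le> 1" shows "pole_mix x m \<in> A01c"
  unfolding A01c_iff
proof (intro conjI allI ballI)
  fix i y v assume "y \<in> - chart_dom i"
  then show "pole_mix x m y i v = 0" by (simp add: pole_mix_def pole_at_def pole_form_def)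
next
  fix i z v w assume z: "z \<in> xdom i"
  have "mix_term x m k i z (v + w) = mix_term x m k i z v + mix_term x m k i z w" for k
    by (simp add: mix_term_def pole_at_coef_def pole_coef_add algebra_simps)
  then show "pole_mix x m (xpt i z) i (v + w) = pole_mix x m (xpt i z) i v + pole_mix x m (xpt i z) i w"
    using suminf_add[OF mix_term_summable[OF m] mix_term_summable[OF m]] by (simp add: pole_mix_xpt[OF z])
next
  fix i z c v assume z: "z \<in> xdom i"
  have "mix_term x m k i z (c *s v) = cnj c * mix_term x m k i z v" for k
    by (simp add: mix_term_def pole_at_coef_def pole_coef_smult)
  then show "pole_mix x m (xpt i z) i (c *s v) = cnj c * pole_mix x m (xpt i z) i v"
    using suminf_mult[OF mix_term_summable[OF m]] by (simp add: pole_mix_xpt[OF z])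
next
  fix i j z v assume z: "z \<in> xdom i \<inter> tdom i j"
  have "pole_at x k \<in> A01c" for k using pole_at_Z01[OF x] by (simp add: Z01_iff)
  from A01cD(4)[OF this, of z i j _ v] z
  have "pole_at x k (xpt i z) i v = pole_at x k (xpt i z) j (transD i j z v)" for k by blast
  then show "pole_mix x m (xpt i z) i v = pole_mix x m (xpt i z) j (transD i j z v)"
    unfolding pole_mix_def by (simp only:)
next
  fix i v
  have "smooth_upto (xdom i) (\<lambda>z. \<Sum>k. mix_term x m k i z v)"
    by (rule smooth_upto_smooth_open[OF smooth_open_mix[OF m] subset_UNIV])
  then show "smooth_upto (xdom i) (\<lambda>z. pole_mix x m (xpt i z) i v)"
    by (simp add: pole_mix_xpt cong: smooth_upto_cong)
qed

lemma pole_mix_Z01: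
  assumes x: "norm x = 1" and m: "\<And>k. norm (m k) \<le> 1" shows "pole_mix x m \<in> Z01"
  unfolding Z01_iff
proof (intro conjI allI pole_mix_A01c[OF x m])
  fix y i v w
  show "dbar_form (pole_mix x m) y i v w = 0"
  proof (rule form02_cases[of y i])
    fix z assume z: "y = xpt i z" "z \<in> xdom i"
    let ?d = "\<lambda>k v w. dbar_at UNIV (\<lambda>z. mix_term x m k i z w) z v"
    have ext: "dbar_at (xdom i) f z v = dbar_at UNIV g z v"
      if "smooth_open UNIV g" "\<And>z. z \<in> xdom i \<Longrightarrow> f z = g z" for f g v
      by (rule dbar_at_extension[OF has_cones_xdom that(1)]) (use z that(2) in auto)
    have "dbar_form (pole_mix x m) y i v w =
        dbar_at UNIV (\<lambda>z. \<Sum>k. mix_term x m k i z w) z v - dbar_at UNIV (\<lambda>z. \<Sum>k. mix_term x m k i z v) z w"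
      unfolding z(1) dbar_form_xpt[OF z(2)] by (intro arg_cong2[where f="(-)"] ext smooth_open_mix m pole_mix_xpt)
    moreover have sms: "(\<lambda>k. ?d k v w - ?d k w v) sums
        (dbar_at UNIV (\<lambda>z. \<Sum>k. mix_term x m k i z w) z v - dbar_at UNIV (\<lambda>z. \<Sum>k. mix_term x m k i z v) z w)"
      by (intro sums_diff dbar_at_mix m)
    have 0: "?d k v w - ?d k w v = 0" for k
    proof -
      have "form_scale (m k * of_real (weight x k)) (pole_at x k) \<in> Z01" by (intro Z01_form_scale pole_at_Z01 x)
      then have "dbar_form (form_scale (m k * of_real (weight x k)) (pole_at x k)) (xpt i z) i v w = 0" unfolding Z01_iff by blast
      moreover have "dbar_at (xdom i) (\<lambda>z. form_scale (m k * of_real (weight x k)) (pole_at x k) (xpt i z) i w) z v = ?d k v w" for v w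
        by (rule ext[OF smooth_open_mix_term]) (simp add: form_scale_def mix_term_def pole_at_xpt)
      ultimately show ?thesis unfolding dbar_form_xpt[OF z(2)] by simp
    qed
    moreover have "dbar_at UNIV (\<lambda>z. \<Sum>k. mix_term x m k i z w) z v - dbar_at UNIV (\<lambda>z. \<Sum>k. mix_term x m k i z v) z w = 0"
      by (rule sums_unique2[OF sms]) (simp only: 0 sums_zero)
    ultimately show ?thesis by (simp only:)
  qed (simp add: dbar_form_outside)
qed

lemma pole_mix_summable:
  assumes m: "\<And>k. norm (m k) \<le> 1" shows "summable (\<lambda>k. m k * of_real (weight x k) * pole_at x k y i v)"
proof (rule form02_cases[of y i])
  fix z assume z: "y = xpt i z" "z \<in> xdom i"
  show ?thesis using mix_term_summable[where m=m and x=x and i=i and z=z and v=v, OF m]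
    unfolding z(1) pole_at_xpt[OF z(2)] mix_term_def .
qed (simp add: pole_at_def pole_form_def)

lemma pole_mix_add_scale:
  assumes "\<And>k. norm (m k) \<le> 1" "\<And>k. norm (m' k) \<le> 1"
  shows "pole_mix x (\<lambda>k. m k + c * m' k) = pole_mix x m + form_scale c (pole_mix x m')"
proof (intro ext)
  fix y i v
  let ?a = "\<lambda>m k. m k * of_real (weight x k) * pole_at x k y i v"
  have "(\<lambda>k. ?a m k + c * ?a m' k) sums (suminf (?a m) + c * suminf (?a m'))"
    by (intro sums_add sums_mult summable_sums pole_mix_summable assms)
  moreover have "?a m k + c * ?a m' k = (m k + c * m' k) * of_real (weight x k) * pole_at x k y i v" for k
    by (simp add: algebra_simps)
  ultimately have "(\<lambda>k. (m k + c * m' k) * of_real (weight x k) * pole_at x k y i v) sums (suminf (?a m) + c * suminf (?a m'))"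
    by (simp only:)
  then show "pole_mix x (\<lambda>k. m k + c * m' k) y i v = (pole_mix x m + form_scale c (pole_mix x m')) y i v"
    by (simp add: pole_mix_def form_scale_def sums_unique[symmetric])
qed

lemma pole_mix_single:
  "pole_mix x (\<lambda>k. if k = N then 1 else 0) = form_scale (of_real (weight x N)) (pole_at x N)"
proof (intro ext)
  fix y i v
  have "(\<lambda>k. if k = N then of_real (weight x k) * pole_at x k y i v else 0) sums (of_real (weight x N) * pole_at x N y i v)"
    by (rule sums_single)
  then show "pole_mix x (\<lambda>k. if k = N then 1 else 0) y i v = form_scale (of_real (weight x N)) (pole_at x N) y i v"
    by (simp add: pole_mix_def form_scale_def sums_iff if_distrib[of "\<lambda>a. a * _"] cong: if_cong)
qed

lemma half_tail_sums: "(\<lambda>k. if k < N then 0 else c * (1/2) ^ k) sums (c * 2 * (1/2) ^ N :: real)"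
proof -
  have "(\<lambda>k. (c * (1/2) ^ N) * (1/2) ^ k) sums (c * (1/2) ^ N * (1 / (1 - 1/2)) :: real)"
    by (intro sums_mult geometric_sums) simp
  then have "(\<lambda>k. if k + N < N then 0 else c * (1/2) ^ (k + N)) sums (c * 2 * (1/2) ^ N)"
    by (simp add: power_add mult_ac)
  then show ?thesis by (subst (asm) sums_iff_shift) simp
qed

text \<open>The functional sees a form on a compact set only. Once the index exceeds the radius of
  this set, the weights bound the remaining terms by a geometric series.\<close>

lemma Lam_pole_mix_tail:
  assumes x: "norm x = 1" and m: "\<And>k. norm (m k) \<le> 1"
  shows "(\<lambda>N. Lam x n t (pole_mix x (\<lambda>k. if k < N then 0 else m k))) \<longlonglongrightarrow> 0"
proof -
  obtain C K where C: "C \<ge> 0" and K: "compact K" "K \<subseteq> xdom 1" and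
    b: "\<And>\<alpha> B. \<alpha> \<in> A01c \<Longrightarrow> 0 \<le> B \<Longrightarrow> \<forall>z\<in>K. norm (\<alpha> (xpt 1 z) 1 x) \<le> B \<and> norm (\<alpha> (xpt 1 z) 1 (perp x)) \<le> B \<Longrightarrow>
      norm (Lam x n t \<alpha>) \<le> C * B"
    by (rule Lam_bound[OF x, of n t]) (rule that)
  obtain r where r: "\<And>z. z \<in> K \<Longrightarrow> norm z \<le> r" using compact_imp_bounded[OF K(1)] bounded_iff by metis
  define c where "c = norm (x$1) + norm (x$2)"
  have c0: "c \<ge> 0" by (simp add: c_def)
  have tail: "norm (pole_mix x (\<lambda>k. if k < N then 0 else m k) (xpt 1 z) 1 v) \<le> c * 2 * (1/2) ^ N"
    if N: "r \<le> real N" and z: "z \<in> K" and v: "v = x \<or> v = perp x" for N z v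
  proof -
    have c: "norm (v$1) + norm (v$2) = c" using v by (auto simp: c_def perp_def)
    have tm: "norm ((if k < N then 0 else m k) :: complex) \<le> 1" for k using m by simp
    have zd: "z \<in> xdom 1" using K(2) z by blast
    have "norm (mix_term x (\<lambda>k. if k < N then 0 else m k) k 1 z v) \<le> (if k < N then 0 else c * (1/2) ^ k)" for k
    proof (cases "k < N")
      case False
      then have "norm z \<le> real k" using r[OF z] N by linarith
      from mix_term_bound[where m="\<lambda>k. if k < N then 0 else m k" and vs="[]" and i=1 and x=x and v=v, OF tm _ _ this]
      show ?thesis using False by (simp add: c)
    qed (simp add: mix_term_def)
    from norm_suminf_le[OF this sums_summable[OF half_tail_sums]]
    show ?thesis unfolding pole_mix_xpt[OF zd] sums_unique[OF half_tail_sums, symmetric] .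
  qed
  obtain N0 where N0: "r \<le> real N0" using real_arch_simple by blast
  have le: "norm (Lam x n t (pole_mix x (\<lambda>k. if k < N then 0 else m k))) \<le> C * (c * 2 * (1/2) ^ N)" if "N0 \<le> N" for N
  proof (rule b)
    show "pole_mix x (\<lambda>k. if k < N then 0 else m k) \<in> A01c" using m by (intro pole_mix_A01c x) simp
    have "r \<le> real N" using that N0 by linarith
    then show "\<forall>z\<in>K. norm (pole_mix x (\<lambda>k. if k < N then 0 else m k) (xpt 1 z) 1 x) \<le> c * 2 * (1/2) ^ N \<and>
      norm (pole_mix x (\<lambda>k. if k < N then 0 else m k) (xpt 1 z) 1 (perp x)) \<le> c * 2 * (1/2) ^ N"
      using tail by blast
  qed (use c0 in simp)
  have "(\<lambda>N. C * (c * 2 * (1/2) ^ N)) \<longlonglongrightarrow> C * (c * 2 * 0)"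
    by (intro tendsto_intros LIMSEQ_power_zero) simp
  then have "(\<lambda>N. C * (c * 2 * (1/2) ^ N)) \<longlonglongrightarrow> 0" by simp
  moreover have "\<forall>\<^sub>F N in sequentially. norm (Lam x n t (pole_mix x (\<lambda>k. if k < N then 0 else m k))) \<le> C * (c * 2 * (1/2) ^ N)"
    by (rule eventually_sequentiallyI[of N0]) (rule le)
  ultimately show ?thesis by (rule Lim_null_comparison[rotated])
qed

lemma Lam_scale:
  assumes "norm x = 1" "\<alpha> \<in> A01c" shows "Lam x n t (form_scale c \<alpha>) = c * Lam x n t \<alpha>"
proof -
  have "form_scale c \<alpha> = \<alpha> + form_scale (c - 1) \<alpha>" by (simp add: form_scale_def fun_eq_iff algebra_simps)
  then show ?thesis using Lam_add_scale[OF assms(1,2,2), of n t "c - 1"] by (simp add: algebra_simps)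
qed

text \<open>Splitting off one term at a time uses linearity alone; the vanishing of the tail in the
  limit turns this into a statement about the series.\<close>

lemma Lam_pole_mix:
  assumes x: "norm x = 1" and m: "\<And>k. norm (m k) \<le> 1"
  shows "(\<lambda>k. m k * of_real (weight x k) * Lam x n t (pole_at x k)) sums Lam x n t (pole_mix x m)"
proof -
  let ?T = "\<lambda>N k. if k < N then 0 else m k" and ?\<delta> = "\<lambda>N k. if k = N then 1 else 0 :: complex"
  have A: "pole_at x k \<in> A01c" for k using pole_at_Z01[OF x] by (simp add: Z01_iff)
  have T: "pole_mix x (?T N) \<in> A01c" "pole_mix x (?\<delta> N) \<in> A01c" for N using m by (intro pole_mix_A01c x; simp)+
  have single: "Lam x n t (pole_mix x (?\<delta> N)) = of_real (weight x N) * Lam x n t (pole_at x N)" for N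
    unfolding pole_mix_single by (rule Lam_scale[OF x A])
  have step: "Lam x n t (pole_mix x (?T N)) = Lam x n t (pole_mix x (?T (Suc N))) + m N * of_real (weight x N) * Lam x n t (pole_at x N)" for N
  proof -
    have "?T N = (\<lambda>k. ?T (Suc N) k + m N * ?\<delta> N k)" by (auto simp: fun_eq_iff less_Suc_eq)
    then have "pole_mix x (?T N) = pole_mix x (\<lambda>k. ?T (Suc N) k + m N * ?\<delta> N k)" by (rule arg_cong)
    also have "\<dots> = pole_mix x (?T (Suc N)) + form_scale (m N) (pole_mix x (?\<delta> N))"
      by (rule pole_mix_add_scale) (use m in auto)
    finally show ?thesis using Lam_add_scale[OF x T, of n t "Suc N" "m N" N] by (simp add: single mult.assoc)
  qed
  have sum: "Lam x n t (pole_mix x m) = (\<Sum>k<N. m k * of_real (weight x k) * Lam x n t (pole_at x k)) + Lam x n t (pole_mix x (?T N))" for N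
    by (induction N) (simp, subst (asm) step, simp)
  have "(\<lambda>N. Lam x n t (pole_mix x m) - Lam x n t (pole_mix x (?T N))) \<longlonglongrightarrow> Lam x n t (pole_mix x m) - 0"
    by (intro tendsto_intros Lam_pole_mix_tail x m)
  moreover have "Lam x n t (pole_mix x m) - Lam x n t (pole_mix x (?T N)) = (\<Sum>k<N. m k * of_real (weight x k) * Lam x n t (pole_at x k))" for N
    using sum[of N] by simp
  ultimately show ?thesis unfolding sums_def by simp
qed

lemma eta_less: "k < n \<Longrightarrow> eta n \<le> eta k / 4"
proof -
  assume "k < n"
  then obtain j where j: "n = Suc k + j" using less_iff_Suc_add by auto
  have "rho n = rho k / 2 * (1 / 2 ^ j)" by (simp add: j rho_def power_add)
  also have "\<dots> \<le> rho k / 2 * 1" using rho_pos[of k] by (intro mult_left_mono) (simp_all add: divide_simps)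
  finally have "(rho n)\<^sup>2 \<le> (rho k / 2)\<^sup>2" using rho_pos[of n] by (intro power_mono) auto
  then show "eta n \<le> eta k / 4" by (simp add: eta_def power_divide)
qed

text \<open>The poles with index at least \<open>n\<close> are inside of the bidisc on which \<open>Lam x n t\<close> is defined, and they
  contribute terms of size \<open>exp (- t eta k / 2)\<close>, which all point in the same half-plane.\<close>

lemma Lam_pole_mix_growth:
  assumes x: "norm x = 1" and m: "\<And>k. norm (m k) \<le> 1"
    and Re: "\<And>k. k \<ge> n \<Longrightarrow> Re (m k) \<ge> 0" "Re (m n) > 0"
  shows "\<not> (\<forall>t::nat. norm (Lam x n (real t) (pole_mix x m)) \<le> M * exp (- (real t * eta n)))"
proof
  assume M: "\<forall>t::nat. norm (Lam x n (real t) (pole_mix x m)) \<le> M * exp (- (real t * eta n))"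
  obtain C where C0: "C \<ge> 0" and C: "\<And>p t. 0 \<le> p \<Longrightarrow> p < 1 \<Longrightarrow> \<bar>p - (1 - eta n)\<bar> \<ge> eta n / 2 \<Longrightarrow>
    norm (Lam x n t (pole_form (1 - p) (of_real p *s x))
      - (if p > 1 - eta n then - 4 * pi\<^sup>2 * exp (- (t * (1 - p))) else 0)) \<le> C * exp (- (t * eta n))"
    using Lam_pole_form[OF x, of n] by blast
  have mono: "eta k \<le> eta n" if "n \<le> k" for k
    using eta_less[of n k] eta_pos[of n] that by (cases "n = k") auto
  \<comment> \<open>The real part that the n-th pole contributes, up to sign and the exponential
    factor.\<close>
  define A where "A = 4 * pi\<^sup>2 * Re (m n) * weight x n"
  have A: "A > 0" unfolding A_def using Re(2) weight_pos[of x n] by simp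
  have main: "norm (Lam x n t (pole_at x k) - of_real (if n \<le> k then - 4 * pi\<^sup>2 * exp (- (t * (eta k / 2))) else 0)) \<le> C * exp (- (t * eta n))" for t k
  proof -
    have iff: "1 - eta k / 2 > 1 - eta n \<longleftrightarrow> n \<le> k" and sep: "\<bar>(1 - eta k / 2) - (1 - eta n)\<bar> \<ge> eta n / 2"
      using mono[of k] eta_less[of k n] eta_pos[of n] eta_pos[of k] by (cases "n \<le> k"; simp)+
    have p: "0 \<le> 1 - eta k / 2" "1 - eta k / 2 < 1" and pd: "1 - (1 - eta k / 2) = eta k / 2"
      using eta_pos[of k] eta_le[of k] by simp_all
    from C[OF p sep, of t] show ?thesis unfolding iff pd pole_at_def[symmetric] .
  qed
  have bound: "A * exp (real t * (eta n / 2)) \<le> M + 2 * C" for t :: nat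
  proof -
    define E where "E = exp (- (real t * eta n))"
    have E: "E > 0" by (simp add: E_def)
    have S2: "(\<lambda>k. Re (- (m k * of_real (weight x k) * Lam x n t (pole_at x k)))) sums Re (- Lam x n t (pole_mix x m))"
      by (intro sums_Re sums_minus Lam_pole_mix x m)
    have S1: "(\<lambda>k. (if k = n then A * exp (- (real t * (eta k / 2))) else 0) - (C * E) * (1/2) ^ k) sums
        (A * exp (- (real t * (eta n / 2))) - (C * E) * (1 / (1 - 1/2)))"
      by (intro sums_diff sums_mult geometric_sums sums_single) simp
    \<comment> \<open>The residues are negative, so in the negated terms each pole with
      \<open>k \<ge> n\<close> contributes a nonnegative real part. All of these are discarded
      except the n-th one; the errors are summable because the weights are at most
      \<open>(1/2) ^ k\<close>.\<close>
    have le: "(if k = n then A * exp (- (real t * (eta k / 2))) else 0) - (C * E) * (1/2) ^ k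
        \<le> Re (- (m k * of_real (weight x k) * Lam x n t (pole_at x k)))" for k
    proof -
      define P where "P = (if n \<le> k then - 4 * pi\<^sup>2 * exp (- (real t * (eta k / 2))) else 0)"
      define R where "R = Lam x n t (pole_at x k) - of_real P"
      have R: "norm R \<le> C * E" unfolding R_def P_def E_def by (rule main)
      have "Re (m k * of_real (weight x k) * R) \<le> norm (m k) * (weight x k * norm R)"
        using complex_Re_le_cmod[of "m k * of_real (weight x k) * R"] weight_pos[of x k] by (simp add: norm_mult mult.assoc)
      also have "\<dots> \<le> 1 * ((1/2) ^ k * (C * E))"
        using m R weight_le[of x k] weight_pos[of x k] C0 E by (intro mult_mono mult_nonneg_nonneg) auto
      finally have r: "Re (m k * of_real (weight x k) * R) \<le> (C * E) * (1/2) ^ k" by (simp add: mult.commute)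
      have "(if k = n then A * exp (- (real t * (eta k / 2))) else 0) \<le> - (Re (m k) * weight x k * P)"
      proof (cases "n \<le> k")
        case True
        then have "Re (m k) * weight x k * (4 * pi\<^sup>2 * exp (- (real t * (eta k / 2)))) \<ge> 0"
          using Re(1)[OF True] weight_pos[of x k] by (intro mult_nonneg_nonneg) auto
        then show ?thesis using True by (auto simp: P_def A_def mult_ac)
      qed (auto simp: P_def)
      moreover have "Lam x n t (pole_at x k) = of_real P + R" by (simp add: R_def)
      then have "Re (- (m k * of_real (weight x k) * Lam x n t (pole_at x k))) =
          - (Re (m k) * weight x k * P) - Re (m k * of_real (weight x k) * R)"
        by (simp only:) (simp add: algebra_simps)
      ultimately show ?thesis using r by linarith
    qed
    have "A * exp (- (real t * (eta n / 2))) - (C * E) * (1 / (1 - 1/2)) \<le> Re (- Lam x n t (pole_mix x m))"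
      by (rule sums_le[OF le S1 S2])
    also have "\<dots> \<le> M * E" using complex_Re_le_cmod[of "- Lam x n t (pole_mix x m)"] M[rule_format, of t] by (simp add: E_def)
    finally have "A * exp (- (real t * (eta n / 2))) \<le> (M + 2 * C) * E" by (simp add: algebra_simps)
    \<comment> \<open>The n-th pole contributes at half of the decay rate \<open>eta n\<close>;
      after division by \<open>E\<close> a quantity that grows exponentially in \<open>t\<close>
      turns out to be bounded.\<close>
    moreover have "exp (- (real t * (eta n / 2))) = exp (real t * (eta n / 2)) * E"
      by (simp add: E_def exp_add[symmetric])
    ultimately show ?thesis using E by (simp add: mult.assoc[symmetric])
  qed
  obtain t :: nat where t: "(M + 2 * C) / (A * (eta n / 2)) < real t" using reals_Archimedean2 by blast
  then have "M + 2 * C < A * (real t * (eta n / 2))" using A eta_pos[of n] by (simp add: divide_less_eq mult_ac)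
  also have "\<dots> \<le> A * exp (real t * (eta n / 2))"
    using A exp_ge_add_one_self[of "real t * (eta n / 2)"] by (intro mult_left_mono) linarith+
  finally show False using bound[of t] by linarith
qed

section \<open>Codimension\<close>

lemma exact_near_0: "exact_near 0 c"
  unfolding exact_near_def
  by (intro exI[of _ 1] conjI exI[of _ "\<lambda>_. 0"] smooth_upto_const) (auto simp: dbar_at_const[OF has_cones_xdom])

lemma exact_near_add_scale:
  assumes "exact_near \<alpha> c" "exact_near \<beta> c" shows "exact_near (\<alpha> + form_scale k \<beta>) c"
proof -
  obtain r u where r: "r > 0" and u: "smooth_upto (xdom 1 \<inter> ball c r) u"
    and du: "\<And>z v. z \<in> xdom 1 \<inter> ball c r \<Longrightarrow> dbar_at (xdom 1) u z v = \<alpha> (xpt 1 z) 1 v"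
    using assms(1) unfolding exact_near_def by blast
  obtain s w where s: "s > 0" and w: "smooth_upto (xdom 1 \<inter> ball c s) w"
    and dw: "\<And>z v. z \<in> xdom 1 \<inter> ball c s \<Longrightarrow> dbar_at (xdom 1) w z v = \<beta> (xpt 1 z) 1 v"
    using assms(2) unfolding exact_near_def by blast
  let ?B = "xdom 1 \<inter> ball c (min r s)"
  show ?thesis unfolding exact_near_def
  proof (intro exI[of _ "min r s"] exI[of _ "\<lambda>z. u z + k * w z"] conjI ballI allI)
    show "smooth_upto ?B (\<lambda>z. u z + k * w z)"
      by (intro smooth_intros smooth_upto_subset[OF u] smooth_upto_subset[OF w]) auto
    fix z v assume z: "z \<in> ?B"
    have zu: "z \<in> xdom 1" "z \<in> xdom 1 \<inter> ball c r" "z \<in> xdom 1 \<inter> ball c s" using z by auto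
    have d: "(u has_derivative frechet_derivative u (at z within xdom 1)) (at z within xdom 1)"
        "(w has_derivative frechet_derivative w (at z within xdom 1)) (at z within xdom 1)"
      by (rule smooth_upto_has_derivative[OF has_cones_xdom u], use zu in auto)
        (rule smooth_upto_has_derivative[OF has_cones_xdom w], use zu in auto)
    have "dbar_at (xdom 1) (\<lambda>z. u z + k * w z) z v = dbar_at (xdom 1) u z v + dbar_at (xdom 1) (\<lambda>z. k * w z) z v"
      by (rule dbar_at_add[OF has_cones_xdom zu(1) d(1) has_derivative_mult_right[OF d(2)]])
    also have "dbar_at (xdom 1) (\<lambda>z. k * w z) z v = k * dbar_at (xdom 1) w z v"
      using dbar_at_mult[OF has_cones_xdom zu(1) has_derivative_const d(2), of k v]
      by (simp add: dbar_at_const[OF has_cones_xdom zu(1)])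
    finally show "dbar_at (xdom 1) (\<lambda>z. u z + k * w z) z v = (\<alpha> + form_scale k \<beta>) (xpt 1 z) 1 v"
      by (simp add: du[OF zu(2)] dw[OF zu(3)] form_scale_def)
  qed (use r s in auto)
qed

lemma exact_near_nearby:
  assumes "exact_near \<alpha> c" obtains r where "r > 0" "\<And>d. dist c d < r \<Longrightarrow> exact_near \<alpha> d"
proof -
  obtain r u where r: "r > 0" and u: "smooth_upto (xdom 1 \<inter> ball c r) u"
    and du: "\<And>z v. z \<in> xdom 1 \<inter> ball c r \<Longrightarrow> dbar_at (xdom 1) u z v = \<alpha> (xpt 1 z) 1 v"
    using assms(1) unfolding exact_near_def by blast
  show ?thesis
  proof (rule that[OF r])
    fix d assume d: "dist c d < r"
    have "ball d (r - dist c d) \<subseteq> ball c r"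
    proof
      fix y assume "y \<in> ball d (r - dist c d)"
      then show "y \<in> ball c r" using dist_triangle[of c y d] by simp
    qed
    then show "exact_near \<alpha> d" unfolding exact_near_def using d
      by (intro exI[of _ "r - dist c d"] exI[of _ u] conjI smooth_upto_subset[OF u]) (auto intro!: du)
  qed
qed

lemma subspace_Z01: "form_space.subspace Z01"
proof (rule form_space.subspaceI)
  have "pole_at (axis 1 1) 0 \<in> Z01" by (rule pole_at_Z01) (simp add: norm_axis_1)
  from Z01_form_scale[OF this, of 0] show "0 \<in> Z01" by simp
qed (auto intro: Z01_add Z01_form_scale)

lemma subspace_exact: "form_space.subspace {\<alpha> \<in> Z01. \<forall>c\<in>S. exact_near \<alpha> c}"
proof (rule form_space.subspaceI)
  let ?E = "{\<alpha> \<in> Z01. \<forall>c\<in>S. exact_near \<alpha> c}"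
  note Z = form_space.subspace_0[OF subspace_Z01]
  show "0 \<in> ?E" using Z exact_near_0 by blast
  fix \<alpha> \<beta> k assume \<alpha>: "\<alpha> \<in> ?E"
  show "form_scale k \<alpha> \<in> ?E" using \<alpha> exact_near_add_scale[OF exact_near_0, of \<alpha> _ k] Z01_form_scale by simp
  assume "\<beta> \<in> ?E"
  then show "\<alpha> + \<beta> \<in> ?E" using \<alpha> exact_near_add_scale[of \<alpha> _ \<beta> 1] Z01_add by simp
qed

lemma complex_affine_subspace: "form_space.subspace E \<Longrightarrow> complex_affine E"
  unfolding complex_affine_def
  by (auto intro: form_space.subspace_add form_space.subspace_scale dest: form_space.subspace_0)

text \<open>A family with more members than \<open>F\<close> in the span of \<open>F\<close> is
  dependent. Independence refers to sets, so a family with a repeated member is treated separately;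
  there the difference of the two equal members is the relation.\<close>

lemma span_relation:
  fixes \<gamma> :: "nat \<Rightarrow> complex form01"
  assumes F: "finite F" and \<gamma>: "\<And>j. \<gamma> j \<in> form_space.span F"
  obtains a i where "i \<le> card F" "a i \<noteq> (0::complex)" "(\<Sum>j\<le>card F. form_scale (a j) (\<gamma> j)) = 0"
proof (cases "inj_on \<gamma> {..card F}")
  case True
  have "\<not> form_space.independent (\<gamma> ` {..card F})"
  proof
    assume "form_space.independent (\<gamma> ` {..card F})"
    from form_space.independent_span_bound[OF F this] \<gamma> have "card (\<gamma> ` {..card F}) \<le> card F" by blast
    then show False using True by (simp add: card_image)
  qed
  then obtain u v where u: "v \<in> \<gamma> ` {..card F}" "u v \<noteq> 0" "(\<Sum>v\<in>\<gamma> ` {..card F}. form_scale (u v) v) = 0"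
    by (subst (asm) form_space.dependent_finite) auto
  then obtain i where "i \<le> card F" "v = \<gamma> i" by auto
  then show ?thesis using u that[of i "\<lambda>j. u (\<gamma> j)"] by (simp add: sum.reindex[OF True])
next
  case False
  then obtain i j where ij: "i \<le> card F" "j \<le> card F" "i \<noteq> j" "\<gamma> i = \<gamma> j" unfolding inj_on_def by auto
  define a where "a k = (if k = i then 1 else if k = j then -1 else 0 :: complex)" for k
  have "(\<Sum>k\<le>card F. form_scale (a k) (\<gamma> k)) = (\<Sum>k\<in>{i, j}. form_scale (a k) (\<gamma> k))"
    by (rule sum.mono_neutral_right) (use ij in \<open>auto simp: a_def\<close>)
  also have "\<dots> = 0" using ij by (simp add: a_def)
  finally show ?thesis using that[of i a] ij by (simp add: a_def)
qed

text \<open>Sequences with different orders of decay: in a finite combination the lowest exponent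
  with a nonzero coefficient dominates for large \<open>k\<close>.\<close>

definition power_weights :: "nat \<Rightarrow> nat \<Rightarrow> complex" where
  "power_weights j k = 1 / of_nat (Suc k) ^ j"

lemma norm_power_weights: "norm (power_weights j k) \<le> 1"
  unfolding power_weights_def norm_divide norm_power norm_of_nat norm_one
  by (simp add: divide_le_eq one_le_power del: of_nat_Suc)

lemma norm_combination_le: "(\<Sum>j\<in>J. norm (b j)) \<le> 1 \<Longrightarrow> norm (\<Sum>j\<in>J. b j * power_weights j k) \<le> 1"
proof -
  assume b: "(\<Sum>j\<in>J. norm (b j)) \<le> 1"
  have "norm (\<Sum>j\<in>J. b j * power_weights j k) \<le> (\<Sum>j\<in>J. norm (b j))"
    by (rule sum_norm_le) (simp add: norm_mult norm_power_weights mult_left_le)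
  then show ?thesis using b by linarith
qed

lemma pole_mix_combination:
  "(\<Sum>j<N. norm (b j)) \<le> 1 \<Longrightarrow>
    pole_mix x (\<lambda>k. \<Sum>j<N. b j * power_weights j k) = (\<Sum>j<N. form_scale (b j) (pole_mix x (power_weights j)))"
proof (induction N)
  case 0 show ?case by (simp add: pole_mix_def fun_eq_iff)
next
  case (Suc N)
  have "(\<Sum>j<N. norm (b j)) + norm (b N) \<le> 1" using Suc.prems by simp
  then have b: "(\<Sum>j<N. norm (b j)) \<le> 1" using norm_ge_zero[of "b N"] by linarith
  show ?case
    using pole_mix_add_scale[OF norm_combination_le[OF b] norm_power_weights, where c="b N" and x=x] Suc.IH[OF b] by simp
qed

text \<open>With \<open>q = 1 / (k + 1)\<close> the term of index \<open>i\<close> is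
  \<open>\<epsilon> * q ^ i\<close>, while the later ones sum to at most \<open>q ^ (i + 1)\<close>,
  because the norms of the coefficients sum to at most 1. The condition on \<open>k\<close> says
  that \<open>q < \<epsilon>\<close>.\<close>

lemma leading_coefficient_dominates:
  assumes b: "(\<Sum>j<N. norm (b j)) \<le> 1" and i: "i < N" "b i = of_real \<epsilon>" "\<epsilon> > 0" "\<And>j. j < i \<Longrightarrow> b j = 0"
    and k: "1 / \<epsilon> < Suc k"
  shows "Re (\<Sum>j<N. b j * power_weights j k) > 0"
proof -
  let ?q = "1 / real (Suc k)"
  have q: "0 < ?q" "?q \<le> 1" "?q < \<epsilon>" using k i(3) by (simp_all add: divide_less_eq mult.commute)
  have w: "power_weights j k = of_real (?q ^ j)" for j by (simp add: power_weights_def power_one_over)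
  have "Re (\<Sum>j\<in>{..<N} - {i}. b j * power_weights j k) \<ge> - (\<Sum>j\<in>{..<N} - {i}. norm (b j) * (?q ^ i * ?q))"
    unfolding Re_sum sum_negf[symmetric]
  proof (rule sum_mono)
    fix j assume j: "j \<in> {..<N} - {i}"
    show "- (norm (b j) * (?q ^ i * ?q)) \<le> Re (b j * power_weights j k)"
    proof (cases "j < i")
      case False
      then have "?q ^ j \<le> ?q ^ Suc i" using j q by (intro power_decreasing) auto
      then have "norm (b j) * ?q ^ j \<le> norm (b j) * (?q ^ i * ?q)" by (intro mult_left_mono) (simp_all add: mult.commute)
      moreover have "- Re (b j) * ?q ^ j \<le> norm (b j) * ?q ^ j"
        using complex_Re_le_cmod[of "- b j"] q by (intro mult_right_mono) auto
      ultimately show ?thesis unfolding w Re_complex_of_real times_complex.sel by simp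
    qed (simp add: i(4))
  qed
  moreover have "(\<Sum>j\<in>{..<N} - {i}. norm (b j) * (?q ^ i * ?q)) \<le> 1 * (?q ^ i * ?q)"
    unfolding sum_distrib_right[symmetric]
  proof (rule mult_right_mono)
    show "(\<Sum>j\<in>{..<N} - {i}. norm (b j)) \<le> 1"
      using b sum_mono2[of "{..<N}" "{..<N} - {i}" "\<lambda>j. norm (b j)"] by auto
  qed (use q in auto)
  moreover have "?q ^ i * ?q < ?q ^ i * \<epsilon>" using q by (intro mult_strict_left_mono) auto
  moreover have "(\<Sum>j<N. b j * power_weights j k) = b i * power_weights i k + (\<Sum>j\<in>{..<N} - {i}. b j * power_weights j k)"
    by (rule sum.remove) (use i in auto)
  moreover have "Re (b i * power_weights i k) = ?q ^ i * \<epsilon>" unfolding i(2) w by (simp add: mult.commute)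
  ultimately show ?thesis by simp
qed

text \<open>If finitely many forms spanned a complement, a nontrivial combination of the forms with
  power weights would lie in \<open>E\<close>. After normalisation it is a superposition whose
  coefficients eventually have positive real part, and its growth contradicts the decay on exact
  forms.\<close>

lemma infinite_codim_exact:
  assumes c: "norm c = 1" and E: "E \<subseteq> {\<alpha> \<in> Z01. exact_near \<alpha> c}" "form_space.subspace E"
  shows "infinite_codim_in Z01 E"
  unfolding infinite_codim_in_def
proof (intro notI, elim exE conjE)
  fix F assume F: "finite F" "F \<subseteq> Z01" and cov: "Z01 \<subseteq> {\<alpha> - \<beta> + \<gamma> | \<alpha> \<beta> \<gamma>. \<alpha> \<in> E \<and> \<beta> \<in> E \<and> \<gamma> \<in> form_space.span F}"
  define \<tau> where "\<tau> j = pole_mix c (power_weights j)" for j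
  have "\<exists>\<gamma>. \<gamma> \<in> form_space.span F \<and> \<tau> j - \<gamma> \<in> E" for j
  proof -
    have "\<tau> j \<in> Z01" unfolding \<tau>_def by (rule pole_mix_Z01[OF c norm_power_weights])
    then obtain \<alpha> \<beta> \<gamma> where "\<tau> j = \<alpha> - \<beta> + \<gamma>" "\<alpha> \<in> E" "\<beta> \<in> E" "\<gamma> \<in> form_space.span F" using cov by blast
    then show ?thesis using form_space.subspace_diff[OF E(2)] by (intro exI[of _ \<gamma>]) auto
  qed
  then obtain \<gamma> where \<gamma>: "\<And>j. \<gamma> j \<in> form_space.span F" "\<And>j. \<tau> j - \<gamma> j \<in> E" by metis
  obtain a i0 where a: "i0 \<le> card F" "a i0 \<noteq> 0" "(\<Sum>j\<le>card F. form_scale (a j) (\<gamma> j)) = 0"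
    by (rule span_relation[OF F(1) \<gamma>(1)])
  define N where "N = Suc (card F)"
  define i where "i = (LEAST j. a j \<noteq> 0)"
  have i: "a i \<noteq> 0" unfolding i_def by (rule LeastI[of "\<lambda>j. a j \<noteq> 0", OF a(2)])
  have i': "a j = 0" if "j < i" for j using not_less_Least[of j "\<lambda>j. a j \<noteq> 0"] that by (auto simp: i_def)
  have "i \<le> i0" unfolding i_def by (rule Least_le[of "\<lambda>j. a j \<noteq> 0", OF a(2)])
  then have iN: "i < N" using a(1) by (simp add: N_def)
  define A where "A = (\<Sum>j<N. norm (a j))"
  have "norm (a i) \<le> A" unfolding A_def by (rule member_le_sum) (use iN in auto)
  moreover have "norm (a i) > 0" using i by simp
  ultimately have A: "A > 0" by linarith
  \<comment> \<open>The factor rotates the leading coefficient to a positive real number and scales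
    the sum of the norms to 1, as convergence and \<open>leading_coefficient_dominates\<close>
    require.\<close>
  define s where "s = cnj (a i) / of_real (A * norm (a i))"
  define b where "b j = s * a j" for j
  have s: "norm s = 1 / A" using i A by (simp add: s_def norm_divide norm_mult)
  have bn: "(\<Sum>j<N. norm (b j)) \<le> 1"
  proof -
    have "(\<Sum>j<N. norm (b j)) = A / A" unfolding A_def sum_divide_distrib by (simp add: b_def norm_mult s A_def)
    then show ?thesis using A by simp
  qed
  define \<epsilon> where "\<epsilon> = norm (a i) / A"
  have bi: "b i = of_real \<epsilon>"
  proof -
    have "b i = of_real ((norm (a i))\<^sup>2) / of_real (A * norm (a i))"
      unfolding b_def s_def complex_norm_square by (simp add: mult.commute)
    also have "\<dots> = of_real \<epsilon>" using i A by (simp only: of_real_divide[symmetric]) (simp add: \<epsilon>_def power2_eq_square)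
    finally show ?thesis .
  qed
  have \<epsilon>: "\<epsilon> > 0" using i A by (simp add: \<epsilon>_def)
  define m where "m k = (\<Sum>j<N. b j * power_weights j k)" for k
  have m: "norm (m k) \<le> 1" for k unfolding m_def by (rule norm_combination_le[OF bn])
  have "pole_mix c m = (\<Sum>j<N. form_scale (b j) (\<tau> j))"
    unfolding m_def \<tau>_def by (rule pole_mix_combination[OF bn])
  also have "\<dots> = (\<Sum>j<N. form_scale (b j) (\<tau> j - \<gamma> j)) + form_scale s (\<Sum>j<N. form_scale (a j) (\<gamma> j))"
    by (simp add: form_space.scale_right_diff_distrib sum_subtractf form_space.scale_sum_right b_def)
  also have "(\<Sum>j<N. form_scale (a j) (\<gamma> j)) = 0" using a(3) by (simp add: N_def lessThan_Suc_atMost)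
  finally have "pole_mix c m = (\<Sum>j<N. form_scale (b j) (\<tau> j - \<gamma> j))"
    by (simp only: form_space.scale_zero_right add_0_right)
  also have "\<dots> \<in> E" by (intro form_space.subspace_sum form_space.subspace_scale E(2) \<gamma>(2))
  finally have "exact_near (pole_mix c m) c" using E(1) by blast
  from Lam_exact_near[OF c this] obtain n0 where
    n0: "\<And>n. n0 \<le> n \<Longrightarrow> \<exists>M. \<forall>t. norm (Lam c n t (pole_mix c m)) \<le> M * exp (- (t * eta n))" by blast
  obtain n1 :: nat where n1: "1 / \<epsilon> < real n1" using reals_Archimedean2 by blast
  \<comment> \<open>\<open>n0\<close> provides the decay on the n-th bidisc, \<open>n1\<close> the
    positivity of the real parts from index \<open>n\<close> on.\<close>
  define n where "n = max n0 n1"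
  have pos: "Re (m k) > 0" if "n \<le> k" for k
    unfolding m_def
    by (rule leading_coefficient_dominates[OF bn iN bi \<epsilon>]) (use i' n1 that in \<open>auto simp: b_def n_def\<close>)
  obtain M where "\<forall>t. norm (Lam c n t (pole_mix c m)) \<le> M * exp (- (t * eta n))" using n0[of n] by (auto simp: n_def)
  then show False using Lam_pole_mix_growth[where m=m and n=n and M=M, OF c m] pos by (auto intro: less_imp_le)
qed

section \<open>Category and density\<close>

lemma nowhere_dense_in_subset: "nowhere_dense_in T N \<Longrightarrow> M \<subseteq> N \<Longrightarrow> nowhere_dense_in T M"
  unfolding nowhere_dense_in_def using interior_of_mono[OF closure_of_mono, of M N T T] by blast

text \<open>The definition asks for a sequence of sets with union exactly \<open>S\<close>; hence
  the intersections with \<open>S\<close>, and the empty set as a default for the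
  enumeration.\<close>

lemma first_category_inI:
  assumes "countable \<N>" "\<And>N. N \<in> \<N> \<Longrightarrow> nowhere_dense_in T N" "S \<subseteq> \<Union>\<N>"
  shows "first_category_in T S"
  unfolding first_category_in_def
proof (intro exI[of _ "\<lambda>n. S \<inter> from_nat_into (insert {} \<N>) n"] conjI allI)
  fix n
  have "from_nat_into (insert {} \<N>) n \<in> insert {} \<N>" by (rule from_nat_into) simp
  moreover have "nowhere_dense_in T {}" by (simp add: nowhere_dense_in_def)
  ultimately have "nowhere_dense_in T (from_nat_into (insert {} \<N>) n)" using assms(2) by auto
  then show "nowhere_dense_in T (S \<inter> from_nat_into (insert {} \<N>) n)" by (rule nowhere_dense_in_subset) simp
next
  have "(\<Union>n. from_nat_into (insert {} \<N>) n) = \<Union>(insert {} \<N>)"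
    using range_from_nat_into[of "insert {} \<N>"] assms(1) by simp
  then show "S = (\<Union>n. S \<inter> from_nat_into (insert {} \<N>) n)" using assms(3) by auto
qed

lemma topspace_A01_topology: "topspace A01_topology = A01c"
proof -
  let ?B = "{cinf_nbhd i K vs v \<epsilon> \<alpha> | i K vs v \<epsilon> \<alpha>. compact K \<and> K \<subseteq> xdom i \<and> \<epsilon> > 0 \<and> \<alpha> \<in> A01c}"
  have "\<Union>?B \<subseteq> A01c" unfolding cinf_nbhd_def by blast
  moreover have "A01c \<subseteq> \<Union>?B"
  proof
    fix \<alpha> assume \<alpha>: "\<alpha> \<in> A01c"
    \<comment> \<open>For empty \<open>K\<close> the condition is void, so this neighbourhood is all
      of \<open>A01c\<close>.\<close>
    have "cinf_nbhd 1 {} [] 0 1 \<alpha> \<in> ?B"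
      by (intro CollectI exI[of _ 1] exI[of _ "{}"] exI[of _ "[]"] exI[of _ 0] exI[of _ \<alpha>] conjI refl) (use \<alpha> in simp_all)
    moreover have "\<alpha> \<in> cinf_nbhd 1 {} [] 0 1 \<alpha>" using \<alpha> by (simp add: cinf_nbhd_def)
    ultimately show "\<alpha> \<in> \<Union>?B" by (rule UnionI)
  qed
  ultimately show ?thesis unfolding A01_topology_def topology_generated_by_topspace by (rule equalityI)
qed

lemma openin_cinf_nbhd: "compact K \<Longrightarrow> K \<subseteq> xdom i \<Longrightarrow> e > 0 \<Longrightarrow> \<alpha> \<in> A01c \<Longrightarrow> openin A01_topology (cinf_nbhd i K vs v e \<alpha>)"
  unfolding A01_topology_def by (rule topology_generated_by_Basis) blast

lemma openin_Lam_greater: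
  assumes x: "norm x = 1" shows "openin A01_topology {\<alpha> \<in> A01c. norm (Lam x n t \<alpha>) > B}"
proof (subst openin_subopen, intro ballI)
  fix \<alpha> assume "\<alpha> \<in> {\<alpha> \<in> A01c. norm (Lam x n t \<alpha>) > B}"
  then have \<alpha>: "\<alpha> \<in> A01c" "norm (Lam x n t \<alpha>) > B" by auto
  obtain C K where C: "C \<ge> 0" and K: "compact K" "K \<subseteq> xdom 1" and
    b: "\<And>\<alpha> B. \<alpha> \<in> A01c \<Longrightarrow> 0 \<le> B \<Longrightarrow> \<forall>z\<in>K. norm (\<alpha> (xpt 1 z) 1 x) \<le> B \<and> norm (\<alpha> (xpt 1 z) 1 (perp x)) \<le> B \<Longrightarrow>
      norm (Lam x n t \<alpha>) \<le> C * B"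
    by (rule Lam_bound[OF x, of n t]) (rule that)
  \<comment> \<open>The denominator is \<open>C + 1\<close> because \<open>C\<close> may be 0;
    \<open>C * e\<close> stays below the excess over \<open>B\<close>.\<close>
  define e where "e = (norm (Lam x n t \<alpha>) - B) / (C + 1)"
  have e: "e > 0" "C * e < norm (Lam x n t \<alpha>) - B"
    using \<alpha>(2) C by (simp_all add: e_def field_simps)
  let ?W = "cinf_nbhd 1 K [] x e \<alpha> \<inter> cinf_nbhd 1 K [] (perp x) e \<alpha>"
  have "norm (Lam x n t \<beta>) > B" if \<beta>: "\<beta> \<in> ?W" for \<beta>
  proof -
    have A: "\<beta> \<in> A01c" "\<beta> + form_scale (-1) \<alpha> \<in> A01c"
      using \<beta> A01c_add[OF _ A01c_form_scale[OF \<alpha>(1)]] by (auto simp: cinf_nbhd_def simp del: form_space.scale_minus_left)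
    have "norm (Lam x n t (\<beta> + form_scale (-1) \<alpha>)) \<le> C * e"
      by (rule b[OF A(2)]) (use \<beta> e(1) in \<open>auto simp: cinf_nbhd_def form_scale_def intro: less_imp_le\<close>)
    moreover have "Lam x n t (\<beta> + form_scale (-1) \<alpha>) = Lam x n t \<beta> - Lam x n t \<alpha>"
      using Lam_add_scale[OF x A(1) \<alpha>(1), of n t "-1"] by simp
    ultimately have "norm (Lam x n t \<beta> - Lam x n t \<alpha>) \<le> C * e" by (simp only:)
    then show ?thesis using e(2) norm_triangle_ineq2[of "Lam x n t \<alpha>" "Lam x n t \<beta>"] norm_minus_commute[of "Lam x n t \<beta>" "Lam x n t \<alpha>"] by linarith
  qed
  moreover have "openin A01_topology ?W" by (intro openin_Int openin_cinf_nbhd K e \<alpha>)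
  moreover have "\<alpha> \<in> ?W" using \<alpha> e by (simp add: cinf_nbhd_def)
  ultimately show "\<exists>T. openin A01_topology T \<and> \<alpha> \<in> T \<and> T \<subseteq> {\<alpha> \<in> A01c. norm (Lam x n t \<alpha>) > B}"
    by (intro exI[of _ ?W]) (auto simp: cinf_nbhd_def)
qed

text \<open>The constant \<open>M\<close> is a natural number in order to keep the family of these
  sets countable; the growth of a superposition already shows along integers
  \<open>t\<close>.\<close>

definition Lam_small :: "complex^2 \<Rightarrow> nat \<Rightarrow> nat \<Rightarrow> complex form01 set" where
  "Lam_small x n M = {\<alpha>. \<forall>t::nat. norm (Lam x n (real t) \<alpha>) \<le> real M * exp (- (real t * eta n))}"

section \<open>Category, density and codimension in the space of operators\<close>

context trivialized_bundle
begin

abbreviation "cf \<equiv> connection_form L \<sigma>\<^sub>0"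

lemma openin_Delta_topology:
  "openin (Delta_topology L \<sigma>\<^sub>0) S \<longleftrightarrow> (\<exists>V. openin A01_topology V \<and> S = {\<delta> \<in> Delta L. cf \<delta> \<in> V})"
  unfolding Delta_topology_def openin_pullback_topology openin_subtopology
  using Delta_operator(1) by (auto simp: vimage_def)

lemma topspace_Delta_topology: "topspace (Delta_topology L \<sigma>\<^sub>0) = Delta L"
  unfolding Delta_topology_def topspace_pullback_topology topspace_subtopology topspace_A01_topology
  using Delta_operator(1) by (auto simp: Z01_iff)

text \<open>The set is closed, its complement being a union of open conditions. From an interior
  point \<open>\<delta>\<close> a small step in the direction of a superposition
  \<open>\<beta>\<close> would stay in the set, and the difference of the two points would force the
  functionals at \<open>\<beta>\<close> to decay at the rate that the growth of
  \<open>\<beta>\<close> excludes.\<close>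

lemma Lam_small_nowhere_dense:
  assumes x: "norm x = 1" shows "nowhere_dense_in (Delta_topology L \<sigma>\<^sub>0) {\<delta> \<in> Delta L. cf \<delta> \<in> Lam_small x n M}"
proof -
  let ?F = "{\<delta> \<in> Delta L. cf \<delta> \<in> Lam_small x n M}" and ?T = "Delta_topology L \<sigma>\<^sub>0"
  let ?G = "\<Union>t::nat. {\<alpha> \<in> A01c. norm (Lam x n (real t) \<alpha>) > real M * exp (- (real t * eta n))}"
  have "openin A01_topology ?G" by (intro openin_Union) (auto intro: openin_Lam_greater[OF x])
  moreover have "Delta L - ?F = {\<delta> \<in> Delta L. cf \<delta> \<in> ?G}"
    using Delta_operator(1) by (auto simp: Lam_small_def Z01_iff not_le dest: leD)
  ultimately have "openin ?T (Delta L - ?F)" unfolding openin_Delta_topology by (intro exI conjI)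
  then have "closedin ?T ?F" by (simp add: closedin_def topspace_Delta_topology)
  then have cl: "?T closure_of ?F = ?F" by (rule closure_of_closedin)
  have "?T interior_of ?F = {}"
  proof (rule ccontr)
    assume "?T interior_of ?F \<noteq> {}"
    then obtain V \<delta> where V: "openin A01_topology V" "{\<delta> \<in> Delta L. cf \<delta> \<in> V} \<subseteq> ?F" and \<delta>: "\<delta> \<in> Delta L" "cf \<delta> \<in> V"
      using interior_of_subset[of ?T ?F] openin_interior_of[of ?T ?F] unfolding openin_Delta_topology by blast
    \<comment> \<open>All coefficients are positive, so the same direction serves for every
      \<open>n\<close>.\<close>
    define \<beta> where "\<beta> = pole_mix x (\<lambda>k. 1)"
    have \<beta>: "\<beta> \<in> Z01" unfolding \<beta>_def by (rule pole_mix_Z01[OF x]) simp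
    have \<alpha>: "cf \<delta> \<in> Z01" by (rule Delta_operator(1)[OF \<delta>(1)])
    have A: "cf \<delta> \<in> A01c" "\<beta> \<in> A01c" using \<alpha> \<beta> by (simp_all add: Z01_iff)
    have "\<forall>\<^sub>F s::real in at_right 0. cf \<delta> + form_scale (of_real s) \<beta> \<in> V"
      by (rule cinf_tendsto_open[OF cinf_tendsto_line[OF A] V(1) \<delta>(2)])
    then have "\<forall>\<^sub>F s::real in at_right 0. s > 0 \<and> cf \<delta> + form_scale (of_real s) \<beta> \<in> V"
      by (intro eventually_conj eventually_at_right_less)
    then obtain s :: real where s: "s > 0" "cf \<delta> + form_scale (of_real s) \<beta> \<in> V"
      using eventually_happens'[OF trivial_limit_at_right_real] by blast
    have "cf \<delta> + form_scale (of_real s) \<beta> \<in> Z01" by (intro Z01_add Z01_form_scale \<alpha> \<beta>)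
    from operator_of_Delta[OF this] s(2) V(2)
    have 1: "cf \<delta> + form_scale (of_real s) \<beta> \<in> Lam_small x n M" by (metis (mono_tags, lifting) mem_Collect_eq subsetD)
    have 2: "cf \<delta> \<in> Lam_small x n M" using \<delta> V(2) by blast
    have "norm (Lam x n (real t) \<beta>) \<le> (2 * real M / s) * exp (- (real t * eta n))" for t :: nat
    proof -
      have "of_real s * Lam x n (real t) \<beta> = Lam x n (real t) (cf \<delta> + form_scale (of_real s) \<beta>) - Lam x n (real t) (cf \<delta>)"
        by (simp add: Lam_add_scale[OF x A])
      then have "s * norm (Lam x n (real t) \<beta>) = norm (Lam x n (real t) (cf \<delta> + form_scale (of_real s) \<beta>) - Lam x n (real t) (cf \<delta>))"
        using s(1) by (metis abs_of_pos norm_mult norm_of_real)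
      also have "\<dots> \<le> real M * exp (- (real t * eta n)) + real M * exp (- (real t * eta n))"
        using 1 2 unfolding Lam_small_def by (intro norm_triangle_le_diff add_mono) auto
      finally show ?thesis using s(1) by (simp add: field_simps)
    qed
    then show False using Lam_pole_mix_growth[OF x, of "\<lambda>k. 1" n "2 * real M / s"] by (simp add: \<beta>_def)
  qed
  then show ?thesis unfolding nowhere_dense_in_def cl by (auto simp: topspace_Delta_topology)
qed

text \<open>Formulated for arbitrary subsets, it covers the union, each \<open>Delta_at L x\<close>
  and \<open>Delta_si L\<close> at once.\<close>

lemma Delta_at_Union_first_category:
  assumes "S \<subseteq> (\<Union>x\<in>xbar_boundary. Delta_at L x)" shows "first_category_in (Delta_topology L \<sigma>\<^sub>0) S"
proof -
  obtain D :: "(complex^2) set" where D: "countable D" "D \<subseteq> sphere 0 1" "sphere 0 1 \<subseteq> closure D" by (rule separable)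
  define \<N> where "\<N> = (\<lambda>(x, n, M). {\<delta> \<in> Delta L. cf \<delta> \<in> Lam_small x n M}) ` (D \<times> UNIV \<times> UNIV)"
  show ?thesis
  proof (rule first_category_inI)
    show "countable \<N>" unfolding \<N>_def by (intro countable_image countable_SIGMA D) auto
    show "nowhere_dense_in (Delta_topology L \<sigma>\<^sub>0) N" if "N \<in> \<N>" for N
      using that D(2) Lam_small_nowhere_dense unfolding \<N>_def by auto
    show "S \<subseteq> \<Union>\<N>"
    proof
      fix \<delta> assume "\<delta> \<in> S"
      then obtain c where c: "c \<in> sphere 0 1" "\<delta> \<in> Delta_at L (xpt 1 c)"
        using assms unfolding xbar_boundary_eq by blast
      then have \<delta>: "\<delta> \<in> Delta L" "exact_near (cf \<delta>) c" by (simp_all add: Delta_at_eq)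
      obtain r where r: "r > 0" "\<And>d. dist c d < r \<Longrightarrow> exact_near (cf \<delta>) d" using exact_near_nearby[OF \<delta>(2)] by blast
      have "c \<in> closure D" using c D(3) by blast
      then obtain d where d: "d \<in> D" "dist d c < r" using r(1) unfolding closure_approachable by blast
      have "norm d = 1" using d D(2) by auto
      from Lam_exact_near[OF this r(2)] d(2) obtain n B where
        B: "\<forall>t. norm (Lam d n t (cf \<delta>)) \<le> B * exp (- (t * eta n))" by (auto simp: dist_commute)
      obtain M :: nat where M: "B \<le> real M" using real_arch_simple by blast
      have "cf \<delta> \<in> Lam_small d n M" unfolding Lam_small_def
      proof (intro CollectI allI)
        fix t :: nat
        have "norm (Lam d n (real t) (cf \<delta>)) \<le> B * exp (- (real t * eta n))" using B by blast
        also have "\<dots> \<le> real M * exp (- (real t * eta n))" using M by (intro mult_right_mono) auto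
        finally show "norm (Lam d n (real t) (cf \<delta>)) \<le> real M * exp (- (real t * eta n))" .
      qed
      then show "\<delta> \<in> \<Union>\<N>" unfolding \<N>_def using d(1) \<delta>(1) by auto
    qed
  qed
qed

lemma Delta_si_eq: "Delta_si L = {\<delta> \<in> Delta L. \<forall>c\<in>sphere 0 1. exact_near (cf \<delta>) c}"
proof -
  obtain c :: "complex^2" where "c \<in> sphere 0 1" using sphere_eq_empty[of "0::complex^2" 1] by fastforce
  then show ?thesis unfolding Delta_si_def xbar_boundary_eq by (auto simp: Delta_at_eq)
qed

lemma Delta_si_dense: "dense_in (Delta_topology L \<sigma>\<^sub>0) (Delta_si L)"
  unfolding dense_in_def
proof
  show "Delta_si L \<subseteq> topspace (Delta_topology L \<sigma>\<^sub>0)" unfolding topspace_Delta_topology Delta_si_eq by blast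
  have "Delta_si L \<inter> U \<noteq> {}" if U: "openin (Delta_topology L \<sigma>\<^sub>0) U" "U \<noteq> {}" for U
  proof -
    obtain V \<delta> where V: "openin A01_topology V" "U = {\<delta> \<in> Delta L. cf \<delta> \<in> V}" and \<delta>: "\<delta> \<in> Delta L" "cf \<delta> \<in> V"
      using U unfolding openin_Delta_topology by blast
    have \<alpha>: "cf \<delta> \<in> Z01" by (rule Delta_operator(1)[OF \<delta>(1)])
    then have "cf \<delta> \<in> A01c" by (simp add: Z01_iff)
    from cinf_tendsto_open[OF dilate_tendsto[OF this] V(1) \<delta>(2)]
    have "\<forall>\<^sub>F r in at_right 1. r > 1 \<and> dilate r (cf \<delta>) \<in> V" by (intro eventually_conj eventually_at_right_less)
    then obtain r where r: "r > 1" "dilate r (cf \<delta>) \<in> V"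
      using eventually_happens'[OF trivial_limit_at_right_real] by blast
    have Z: "dilate r (cf \<delta>) \<in> Z01" using dilate_Z01[OF \<alpha>] r(1) by simp
    have "operator_of (dilate r (cf \<delta>)) \<in> Delta_si L \<inter> U"
      using operator_of_Delta[OF Z] r(2) dilate_exact_near[OF \<alpha> r(1)] by (simp add: V(2) Delta_si_eq)
    then show ?thesis by blast
  qed
  then show "Delta_topology L \<sigma>\<^sub>0 closure_of Delta_si L = topspace (Delta_topology L \<sigma>\<^sub>0)"
    unfolding dense_intersects_open by blast
qed

text \<open>Applied to a single point and to the entire sphere. Exactness near one point of
  \<open>S\<close> already costs infinite codimension, and smaller subspaces inherit it.\<close>

lemma exact_subspace_properties:
  assumes S: "S \<subseteq> sphere 0 1" "S \<noteq> {}" and M: "M = {\<delta> \<in> Delta L. \<forall>c\<in>S. exact_near (cf \<delta>) c}"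
  shows "Delta_affine_subspace L \<sigma>\<^sub>0 M \<and> Delta_infinite_codim L \<sigma>\<^sub>0 M"
proof -
  let ?E = "{\<alpha> \<in> Z01. \<forall>c\<in>S. exact_near \<alpha> c}"
  have E: "cf ` M = ?E" unfolding M by (rule connection_form_image)
  obtain c where c: "c \<in> S" using S(2) by blast
  then have "norm c = 1" using S(1) by auto
  then have "infinite_codim_in Z01 ?E"
    by (rule infinite_codim_exact[OF _ _ subspace_exact]) (use c in auto)
  then show ?thesis unfolding Delta_affine_subspace_def Delta_infinite_codim_def E
    using complex_affine_subspace[OF subspace_exact, of S] by (auto simp: M)
qed

end

theorem proposition4p5:
  fixes L :: "'v::ab_group_add line_bundle" and \<sigma>\<^sub>0 :: "xbar \<Rightarrow> 'v"
  assumes "smooth_line_bundle L" and "trivializing_section L \<sigma>\<^sub>0"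
  shows
    "(first_category_in (Delta_topology L \<sigma>\<^sub>0) (\<Union>x\<in>xbar_boundary. Delta_at L x) \<and>
      (\<forall>x\<in>xbar_boundary. first_category_in (Delta_topology L \<sigma>\<^sub>0) (Delta_at L x)) \<and>
      first_category_in (Delta_topology L \<sigma>\<^sub>0) (Delta_si L)) \<and>
     (\<forall>x\<in>xbar_boundary.
        Delta_affine_subspace L \<sigma>\<^sub>0 (Delta_at L x) \<and>
        Delta_infinite_codim L \<sigma>\<^sub>0 (Delta_at L x)) \<and>
     (first_category_in (Delta_topology L \<sigma>\<^sub>0) (Delta_si L) \<and>
      Delta_affine_subspace L \<sigma>\<^sub>0 (Delta_si L) \<and>
      Delta_infinite_codim L \<sigma>\<^sub>0 (Delta_si L) \<and>
      dense_in (Delta_topology L \<sigma>\<^sub>0) (Delta_si L))"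
proof -
  interpret trivialized_bundle L \<sigma>\<^sub>0 by unfold_locales (rule assms)+
  have ne: "sphere (0::complex^2) 1 \<noteq> {}" by simp
  have "Delta_si L \<subseteq> (\<Union>x\<in>xbar_boundary. Delta_at L x)"
    using ne unfolding Delta_si_def xbar_boundary_eq by blast
  moreover have "Delta_affine_subspace L \<sigma>\<^sub>0 (Delta_at L x) \<and> Delta_infinite_codim L \<sigma>\<^sub>0 (Delta_at L x)"
    if x: "x \<in> xbar_boundary" for x
  proof -
    obtain c where c: "c \<in> sphere 0 1" "x = xpt 1 c" using x unfolding xbar_boundary_eq by blast
    then show ?thesis using exact_subspace_properties[of "{c}"] by (simp add: Delta_at_eq)
  qed
  moreover note exact_subspace_properties[OF order_refl ne Delta_si_eq] Delta_si_dense
  ultimately show ?thesis by (auto intro!: Delta_at_Union_first_category)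
qed

end
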